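(* Let $G$ be a locally compact groupoid, let $H$ be a closed wide subgroupoid of $G$, and let $\mu=\{\mu^u\}_{u\in G^0}$ be a full equivariant measure system on $G/H$. Then for every continuous unitary representation $\rho$ of $G$ and every continuous unitary representation $\pi$ of $H$, $$\rho\otimes(\operatorname{ind}_H^G(\pi),\mu)=(\operatorname{ind}_H^G(\rho_{|_H}\otimes\pi),\mu),$$ where equality of representations means unitary equivalence, $\otimes$ is the inner tensor product, and $\rho_{|_H}$ is the restriction of $\rho$ to $H$.
   Context: **Groupoids.** All groupoids are second countable, locally compact and Hausdorff topological groupoids. $G^0$ is the unit space, $r,d:G\to G^0$ are the range and domain maps, $x,y$ are composable iff $d(x)=r(y)$, and $G^u=r^{-1}(u)$. $G$ carries a (left) Haar system $\lambda=\{\lambda^u\}_{u\in G^0}$. A subgroupoid $H\subseteq G$ is wide if it contains $G^0$; the closed wide subgroupoid $H$ is assumed to carry a Haar system $\lambda_H$. **The quotient $G/H$.** $G/H$ is the quotient of $G$ by $l\sim g\iff r(l)=r(g)$ and $l^{-1}g\in H$, with quotient map $q_H:G\to G/H$, $x\mapsto xH$, and the quotient topology (locally compact Hausdorff). Put $r_{G^0}(xH)=r(x)$; $G$ acts on the left by $g\cdot xH=(gx)H$ when $d(g)=r(x)$. A full equivariant measure system $\mu=\{\mu^u\}_{u\in G^0}$ on $G/H$ is a family of positive Radon measures on $G/H$ with (i) $\operatorname{supp}\mu^u=r_{G^0}^{-1}(u)$; (ii) $u\mapsto\int f\,d\mu^u$ continuous for all $f\in C_c(G/H)$; (iii) $\int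 f(\gamma\cdot\omega)\,d\mu^{d(\gamma)}(\omega)=\int f(\omega)\,d\mu^{r(\gamma)}(\omega)$ for all $\gamma\in G$, $f\in C_c(G/H)$. **Representations.** A continuous Hilbert bundle over $G^0$ is a continuous field of Hilbert spaces $\{\mathcal H_u\}_{u\in G^0}$: it has a linear space $\Gamma\subseteq\prod_u\mathcal H_u$ of continuous sections which is fiberwise dense, has $u\mapsto\|\xi(u)\|$ continuous for $\xi\in\Gamma$, and is closed under locally uniform approximation; the total space $\mathcal H$ has the topology generated by the sets $\{h: p(h)\in V,\|h-\xi(p(h))\|<\varepsilon\}$ ($V\subseteq G^0$ open, $\xi\in\Gamma$, $\varepsilon>0$, $p$ the projection). $C_0(G^0,\mathcal H)$ denotes the continuous sections vanishing at infinity. A continuous unitary representation of $G$ is a pair $(\mathcal H^\pi,\pi)$ with $\mathcal H^\pi$ a continuous Hilbert bundle over $G^0$ and unitaries $\pi(x):\mathcal H^\pi_{d(x)}\to\mathcal H^\pi_{r(x)}$, $x\in G$, with $\pi(u)=\mathrm{id}$ for $u\in G^0$, $\pi(x)\pi(y)=\pi(xy)$ for composable $x,y$, $\pi(x)^{-1}=\pi(x^{-1})$, and $x\mapsto\langle\pi(x)\xi(d(x)),\eta(r(x))\rangle$ continuous for all $\xi,\eta\in C_0(G^0,\mathcal H^\pi)$. Likewise for $H$ (whose unit space is $G^0$). Two representations $\pi,\rho$ are unitarily equivalent if there are unitaries $T_u:\mathcal H^\pi_u\to\mathcal H^\rho_u$ ($u\in G^0$) such that a section $\xi$ is continuous iff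 $u\mapsto T_u\xi(u)$ is, and $T_{r(x)}\pi(x)=\rho(x)T_{d(x)}$ for all $x$. **Inner tensor product.** $\pi\otimes\rho$ is the representation on the Hilbert bundle with fibers $\mathcal H^\pi_u\otimes\mathcal H^\rho_u$ (Hilbert tensor products, with continuous structure generated by the sections $u\mapsto\xi(u)\otimes\eta(u)$ for continuous sections $\xi,\eta$) given by $(\pi\otimes\rho)(x)(v\otimes w)=\pi(x)v\otimes\rho(x)w$. **Induced representation.** For a continuous unitary representation $(\mathcal H^\sigma,\sigma)$ of $H$, let $\mathcal F_0^\sigma(G)$ be the set of continuous $f:G\to\mathcal H^\sigma$ with $f(x)\in\mathcal H^\sigma_{d(x)}$, $q_H(\operatorname{supp}f)$ compact, and $f(xh)=\sigma(h^{-1})f(x)$ for $h\in H$, $d(x)=r(h)$. Put $\langle f,g\rangle(u)=\int_{G/H}\langle f(x),g(x)\rangle\,d\mu^u(xH)$; $\mathcal F^\sigma(G,\mu)$ is the completion of $\mathcal F_0^\sigma(G)$ in the norm $\sup_u\langle f,f\rangle(u)^{1/2}$, a Hilbert $C_0(G^0)$-module. The corresponding continuous Hilbert bundle $\mathcal H^{\operatorname{ind}_H^G(\sigma)}$ has as fiber at $u$ the completion of $\{f|_{G^u}:f\in\mathcal F_0^\sigma(G)\}$ in the norm $\langle f,f\rangle(u)^{1/2}$, its continuous sections vanishing at infinity being given by the elements of $\mathcal F^\sigma(G,\mu)$. The induced representation $(\operatorname{ind}_H^G(\sigma),\mu)$ of $G$ on this bundle is $(L(x)f)(y)=f(x^{-1}y)$,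 from the fiber at $d(x)$ to the fiber at $r(x)$. *)

theory Defs
  imports "HOL-Analysis.Analysis" "HOL-Library.Poly_Mapping"
begin

section \<open>Complex Hilbert spaces with explicit carriers\<close>

text \<open>The fibers of a Hilbert bundle are different spaces, so each fiber is a value (a record with
  its own carrier and operations) and not a type.  Inner products are linear in the first
  argument.\<close>

record 'v hilb =
  hcarrier :: "'v set"
  hzero :: "'v"
  hadd :: "'v \<Rightarrow> 'v \<Rightarrow> 'v"
  hscale :: "complex \<Rightarrow> 'v \<Rightarrow> 'v"
  hinner :: "'v \<Rightarrow> 'v \<Rightarrow> complex"

definition hminus :: "'v hilb \<Rightarrow> 'v \<Rightarrow> 'v \<Rightarrow> 'v" where
  "hminus V v w = hadd V v (hscale V (-1) w)"

definition hnorm :: "'v hilb \<Rightarrow> 'v \<Rightarrow> real" where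
  "hnorm V v = sqrt (Re (hinner V v v))"

definition hcauchy :: "'v hilb \<Rightarrow> (nat \<Rightarrow> 'v) set" where
  "hcauchy V = {s. (\<forall>n. s n \<in> hcarrier V) \<and>
     (\<forall>\<epsilon>>0. \<exists>N. \<forall>m\<ge>N. \<forall>n\<ge>N. hnorm V (hminus V (s m) (s n)) < \<epsilon>)}"

locale complex_vector_space =
  fixes V :: "'v hilb"
  assumes zero_closed: "hzero V \<in> hcarrier V"
    and add_closed: "\<lbrakk>v \<in> hcarrier V; w \<in> hcarrier V\<rbrakk> \<Longrightarrow> hadd V v w \<in> hcarrier V"
    and scale_closed: "v \<in> hcarrier V \<Longrightarrow> hscale V a v \<in> hcarrier V"
    and add_assoc: "\<lbrakk>v \<in> hcarrier V; w \<in> hcarrier V; x \<in> hcarrier V\<rbrakk>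
      \<Longrightarrow> hadd V (hadd V v w) x = hadd V v (hadd V w x)"
    and add_commute: "\<lbrakk>v \<in> hcarrier V; w \<in> hcarrier V\<rbrakk> \<Longrightarrow> hadd V v w = hadd V w v"
    and add_zero: "v \<in> hcarrier V \<Longrightarrow> hadd V (hzero V) v = v"
    and add_uminus: "v \<in> hcarrier V \<Longrightarrow> hadd V v (hscale V (-1) v) = hzero V"
    and scale_add: "\<lbrakk>v \<in> hcarrier V; w \<in> hcarrier V\<rbrakk>
      \<Longrightarrow> hscale V a (hadd V v w) = hadd V (hscale V a v) (hscale V a w)"
    and add_scale: "v \<in> hcarrier V \<Longrightarrow> hscale V (a + b) v = hadd V (hscale V a v) (hscale V b v)"
    and scale_scale: "v \<in> hcarrier V \<Longrightarrow> hscale V a (hscale V b v) = hscale V (a * b) v"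
    and scale_one: "v \<in> hcarrier V \<Longrightarrow> hscale V 1 v = v"

locale hilbert_space = complex_vector_space V for V :: "'v hilb" +
  assumes inner_add: "\<lbrakk>v \<in> hcarrier V; w \<in> hcarrier V; x \<in> hcarrier V\<rbrakk>
      \<Longrightarrow> hinner V (hadd V v w) x = hinner V v x + hinner V w x"
    and inner_scale: "\<lbrakk>v \<in> hcarrier V; w \<in> hcarrier V\<rbrakk>
      \<Longrightarrow> hinner V (hscale V a v) w = a * hinner V v w"
    and inner_commute: "\<lbrakk>v \<in> hcarrier V; w \<in> hcarrier V\<rbrakk> \<Longrightarrow> hinner V v w = cnj (hinner V w v)"
    and inner_pos: "\<lbrakk>v \<in> hcarrier V; v \<noteq> hzero V\<rbrakk> \<Longrightarrow> 0 < Re (hinner V v v)"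
    and complete: "s \<in> hcauchy V
      \<Longrightarrow> \<exists>v\<in>hcarrier V. (\<lambda>n. hnorm V (hminus V (s n) v)) \<longlonglongrightarrow> 0"

definition unitary :: "'v hilb \<Rightarrow> 'w hilb \<Rightarrow> ('v \<Rightarrow> 'w) \<Rightarrow> bool" where
  "unitary V W T \<longleftrightarrow>
     bij_betw T (hcarrier V) (hcarrier W) \<and>
     (\<forall>v\<in>hcarrier V. \<forall>w\<in>hcarrier V. T (hadd V v w) = hadd W (T v) (T w)) \<and>
     (\<forall>a. \<forall>v\<in>hcarrier V. T (hscale V a v) = hscale W a (T v)) \<and>
     (\<forall>v\<in>hcarrier V. \<forall>w\<in>hcarrier V. hinner W (T v) (T w) = hinner V v w)"

subsection \<open>Completion\<close>

text \<open>The Hausdorff completion of a (semi-)inner product space: Cauchy sequences modulo null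
  sequences.\<close>

definition cauchy_class :: "'v hilb \<Rightarrow> (nat \<Rightarrow> 'v) \<Rightarrow> (nat \<Rightarrow> 'v) set" where
  "cauchy_class V s = {t \<in> hcauchy V. (\<lambda>n. hnorm V (hminus V (s n) (t n))) \<longlonglongrightarrow> 0}"

definition completion :: "'v hilb \<Rightarrow> (nat \<Rightarrow> 'v) set hilb" where
  "completion V =
    \<lparr> hcarrier = cauchy_class V ` hcauchy V,
      hzero = cauchy_class V (\<lambda>n. hzero V),
      hadd = (\<lambda>X Y. cauchy_class V (\<lambda>n. hadd V (some_elem X n) (some_elem Y n))),
      hscale = (\<lambda>a X. cauchy_class V (\<lambda>n. hscale V a (some_elem X n))),
      hinner = (\<lambda>X Y. lim (\<lambda>n. hinner V (some_elem X n) (some_elem Y n))) \<rparr>"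

definition completion_embed :: "'v hilb \<Rightarrow> 'v \<Rightarrow> (nat \<Rightarrow> 'v) set" where
  "completion_embed V v = cauchy_class V (\<lambda>n. v)"

definition completion_map :: "'w hilb \<Rightarrow> ('v \<Rightarrow> 'w) \<Rightarrow> (nat \<Rightarrow> 'v) set \<Rightarrow> (nat \<Rightarrow> 'w) set" where
  "completion_map W T X = cauchy_class W (\<lambda>n. T (some_elem X n))"

subsection \<open>Hilbert tensor product\<close>

text \<open>The free complex vector space on \<open>V \<times> W\<close> with the semi-inner product determined by
  \<open>\<langle>(v, w), (v', w')\<rangle> = \<langle>v, v'\<rangle> \<langle>w, w'\<rangle>\<close>.  For inner product spaces its null vectors are exactly the
  span of the bilinearity relations, so that its Hausdorff completion is the completion of the
  algebraic tensor product.\<close>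

definition pretensor :: "'v hilb \<Rightarrow> 'w hilb \<Rightarrow> (('v \<times> 'w) \<Rightarrow>\<^sub>0 complex) hilb" where
  "pretensor V W =
    \<lparr> hcarrier = {a. Poly_Mapping.keys a \<subseteq> hcarrier V \<times> hcarrier W},
      hzero = 0,
      hadd = (+),
      hscale = (\<lambda>c. Poly_Mapping.map (\<lambda>z. c * z)),
      hinner = (\<lambda>a b. \<Sum>(v, w)\<in>Poly_Mapping.keys a. \<Sum>(v', w')\<in>Poly_Mapping.keys b.
         Poly_Mapping.lookup a (v, w) * cnj (Poly_Mapping.lookup b (v', w')) *
         (hinner V v v' * hinner W w w')) \<rparr>"

definition tensor ::
  "'v hilb \<Rightarrow> 'w hilb \<Rightarrow> (nat \<Rightarrow> ('v \<times> 'w) \<Rightarrow>\<^sub>0 complex) set hilb" where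
  "tensor V W = completion (pretensor V W)"

definition tensor_vec ::
  "'v hilb \<Rightarrow> 'w hilb \<Rightarrow> 'v \<Rightarrow> 'w \<Rightarrow> (nat \<Rightarrow> ('v \<times> 'w) \<Rightarrow>\<^sub>0 complex) set" where
  "tensor_vec V W v w = completion_embed (pretensor V W) (Poly_Mapping.single (v, w) 1)"

text \<open>\<open>A \<otimes> B\<close> with values in the tensor product of \<open>V'\<close> and \<open>W'\<close>.\<close>

definition tensor_op ::
  "'v2 hilb \<Rightarrow> 'w2 hilb \<Rightarrow> ('v1 \<Rightarrow> 'v2) \<Rightarrow> ('w1 \<Rightarrow> 'w2) \<Rightarrow>
   (nat \<Rightarrow> ('v1 \<times> 'w1) \<Rightarrow>\<^sub>0 complex) set \<Rightarrow> (nat \<Rightarrow> ('v2 \<times> 'w2) \<Rightarrow>\<^sub>0 complex) set" where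
  "tensor_op V' W' A B = completion_map (pretensor V' W')
     (\<lambda>a. \<Sum>(v, w)\<in>Poly_Mapping.keys a.
        Poly_Mapping.single (A v, B w) (Poly_Mapping.lookup a (v, w)))"


section \<open>Topological groupoids\<close>

record 'g groupoid =
  gtop :: "'g topology"
  grng :: "'g \<Rightarrow> 'g"
  gdom :: "'g \<Rightarrow> 'g"
  gmul :: "'g \<Rightarrow> 'g \<Rightarrow> 'g"
  ginv :: "'g \<Rightarrow> 'g"

abbreviation gelems :: "'g groupoid \<Rightarrow> 'g set" where
  "gelems G \<equiv> topspace (gtop G)"

definition units :: "'g groupoid \<Rightarrow> 'g set" where
  "units G = grng G ` gelems G"

definition unit_space :: "'g groupoid \<Rightarrow> 'g topology" where
  "unit_space G = subtopology (gtop G) (units G)"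

definition composable :: "'g groupoid \<Rightarrow> ('g \<times> 'g) set" where
  "composable G = {(x, y). x \<in> gelems G \<and> y \<in> gelems G \<and> gdom G x = grng G y}"

definition range_fiber :: "'g groupoid \<Rightarrow> 'g \<Rightarrow> 'g set" where
  "range_fiber G u = {x \<in> gelems G. grng G x = u}"

text \<open>Continuity of \<open>grng\<close> and \<open>gdom\<close> follows from that of multiplication and inversion.\<close>

locale lc_groupoid =
  fixes G :: "'g groupoid"
  assumes rng_closed: "x \<in> gelems G \<Longrightarrow> grng G x \<in> gelems G"
    and dom_closed: "x \<in> gelems G \<Longrightarrow> gdom G x \<in> gelems G"
    and rng_rng: "x \<in> gelems G \<Longrightarrow> grng G (grng G x) = grng G x"
    and dom_rng: "x \<in> gelems G \<Longrightarrow> gdom G (grng G x) = grng G x"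
    and rng_dom: "x \<in> gelems G \<Longrightarrow> grng G (gdom G x) = gdom G x"
    and dom_dom: "x \<in> gelems G \<Longrightarrow> gdom G (gdom G x) = gdom G x"
    and mul_closed: "(x, y) \<in> composable G \<Longrightarrow> gmul G x y \<in> gelems G"
    and rng_mul: "(x, y) \<in> composable G \<Longrightarrow> grng G (gmul G x y) = grng G x"
    and dom_mul: "(x, y) \<in> composable G \<Longrightarrow> gdom G (gmul G x y) = gdom G y"
    and mul_assoc: "\<lbrakk>(x, y) \<in> composable G; (y, z) \<in> composable G\<rbrakk>
      \<Longrightarrow> gmul G (gmul G x y) z = gmul G x (gmul G y z)"
    and rng_mul_self: "x \<in> gelems G \<Longrightarrow> gmul G (grng G x) x = x"
    and mul_dom_self: "x \<in> gelems G \<Longrightarrow> gmul G x (gdom G x) = x"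
    and inv_closed: "x \<in> gelems G \<Longrightarrow> ginv G x \<in> gelems G"
    and rng_inv: "x \<in> gelems G \<Longrightarrow> grng G (ginv G x) = gdom G x"
    and dom_inv: "x \<in> gelems G \<Longrightarrow> gdom G (ginv G x) = grng G x"
    and inv_mul: "x \<in> gelems G \<Longrightarrow> gmul G (ginv G x) x = gdom G x"
    and mul_inv: "x \<in> gelems G \<Longrightarrow> gmul G x (ginv G x) = grng G x"
    and continuous_mul: "continuous_map
      (subtopology (prod_topology (gtop G) (gtop G)) (composable G)) (gtop G) (\<lambda>(x, y). gmul G x y)"
    and continuous_inv: "continuous_map (gtop G) (gtop G) (ginv G)"
    and second_countable: "second_countable (gtop G)"
    and locally_compact: "locally_compact_space (gtop G)"
    and Hausdorff: "Hausdorff_space (gtop G)"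

definition sub_groupoid :: "'g groupoid \<Rightarrow> 'g set \<Rightarrow> 'g groupoid" where
  "sub_groupoid G H = G\<lparr>gtop := subtopology (gtop G) H\<rparr>"

definition closed_wide_subgroupoid :: "'g groupoid \<Rightarrow> 'g set \<Rightarrow> bool" where
  "closed_wide_subgroupoid G H \<longleftrightarrow>
     closedin (gtop G) H \<and> units G \<subseteq> H \<and>
     (\<forall>x\<in>H. \<forall>y\<in>H. gdom G x = grng G y \<longrightarrow> gmul G x y \<in> H) \<and> (\<forall>x\<in>H. ginv G x \<in> H)"


section \<open>Equivariant systems of measures\<close>

definition radon_measure :: "'a topology \<Rightarrow> 'a measure \<Rightarrow> bool" where
  "radon_measure X M \<longleftrightarrow>
     sets M = sets (sigma (topspace X) {U. openin X U}) \<and>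
     (\<forall>K. compactin X K \<longrightarrow> emeasure M K < \<infinity>) \<and>
     (\<forall>A\<in>sets M. emeasure M A = (INF U\<in>{U. openin X U \<and> A \<subseteq> U}. emeasure M U)) \<and>
     (\<forall>U. openin X U \<longrightarrow> emeasure M U = (SUP K\<in>{K. compactin X K \<and> K \<subseteq> U}. emeasure M K))"

definition measure_support :: "'a topology \<Rightarrow> 'a measure \<Rightarrow> 'a set" where
  "measure_support X M = {x \<in> topspace X. \<forall>U. openin X U \<and> x \<in> U \<longrightarrow> 0 < emeasure M U}"

definition Cc :: "'a topology \<Rightarrow> ('a \<Rightarrow> complex) set" where
  "Cc X = {f. continuous_map X euclidean f \<and>
     compactin X (X closure_of {x \<in> topspace X. f x \<noteq> 0})}"

text \<open>\<open>X\<close> is a left \<open>G\<close>-space with anchor map \<open>p\<close> and action \<open>\<alpha>\<close>.  As \<open>\<alpha> \<gamma> \<omega>\<close> makes sense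
  only for \<open>p \<omega> = gdom G \<gamma>\<close>, the translated function is integrated over that fiber of \<open>p\<close>, which
  supports the measure.\<close>

definition full_equivariant_system ::
  "'g groupoid \<Rightarrow> 'a topology \<Rightarrow> ('a \<Rightarrow> 'g) \<Rightarrow> ('g \<Rightarrow> 'a \<Rightarrow> 'a) \<Rightarrow> ('g \<Rightarrow> 'a measure) \<Rightarrow> bool" where
  "full_equivariant_system G X p \<alpha> \<mu> \<longleftrightarrow>
     (\<forall>u\<in>units G. radon_measure X (\<mu> u) \<and>
        measure_support X (\<mu> u) = {\<omega> \<in> topspace X. p \<omega> = u}) \<and>
     (\<forall>f\<in>Cc X. continuous_map (unit_space G) euclidean (\<lambda>u. LINT \<omega>|\<mu> u. f \<omega>)) \<and>
     (\<forall>\<gamma>\<in>gelems G. \<forall>f\<in>Cc X.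
        (LINT \<omega>:{\<omega> \<in> topspace X. p \<omega> = gdom G \<gamma>}|\<mu> (gdom G \<gamma>). f (\<alpha> \<gamma> \<omega>)) =
        (LINT \<omega>|\<mu> (grng G \<gamma>). f \<omega>))"

definition haar_system :: "'g groupoid \<Rightarrow> ('g \<Rightarrow> 'g measure) \<Rightarrow> bool" where
  "haar_system G \<Lambda> \<longleftrightarrow> full_equivariant_system G (gtop G) (grng G) (gmul G) \<Lambda>"


section \<open>The quotient by a closed wide subgroupoid\<close>

definition quot_rel :: "'g groupoid \<Rightarrow> 'g set \<Rightarrow> ('g \<times> 'g) set" where
  "quot_rel G H = {(l, g). l \<in> gelems G \<and> g \<in> gelems G \<and>
     grng G l = grng G g \<and> gmul G (ginv G l) g \<in> H}"

definition quot_map :: "'g groupoid \<Rightarrow> 'g set \<Rightarrow> 'g \<Rightarrow> 'g set" where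
  "quot_map G H x = quot_rel G H `` {x}"

definition quot_space :: "'g groupoid \<Rightarrow> 'g set \<Rightarrow> 'g set topology" where
  "quot_space G H = topology (\<lambda>U. U \<subseteq> gelems G // quot_rel G H \<and>
     openin (gtop G) {x \<in> gelems G. quot_map G H x \<in> U})"

lemma openin_quot_space:
  "openin (quot_space G H) U \<longleftrightarrow> U \<subseteq> gelems G // quot_rel G H \<and>
     openin (gtop G) {x \<in> gelems G. quot_map G H x \<in> U}"
proof -
  have "istopology (\<lambda>U. U \<subseteq> gelems G // quot_rel G H \<and>
     openin (gtop G) {x \<in> gelems G. quot_map G H x \<in> U})" (is "istopology ?P")
    unfolding istopology_def
  proof (intro conjI allI impI)
    fix S T assume "?P S" "?P T"
    moreover have "{x \<in> gelems G. quot_map G H x \<in> S \<inter> T} =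
      {x \<in> gelems G. quot_map G H x \<in> S} \<inter> {x \<in> gelems G. quot_map G H x \<in> T}" by auto
    ultimately show "S \<inter> T \<subseteq> gelems G // quot_rel G H"
      "openin (gtop G) {x \<in> gelems G. quot_map G H x \<in> S \<inter> T}" by auto
  next
    fix K assume K: "\<forall>S\<in>K. ?P S"
    then show "\<Union>K \<subseteq> gelems G // quot_rel G H" by auto
    have "{x \<in> gelems G. quot_map G H x \<in> \<Union>K} =
      (\<Union>S\<in>K. {x \<in> gelems G. quot_map G H x \<in> S})" by auto
    then show "openin (gtop G) {x \<in> gelems G. quot_map G H x \<in> \<Union>K}" using K by auto
  qed
  then show ?thesis unfolding quot_space_def by simp
qed

lemma topspace_quot_space: "topspace (quot_space G H) = gelems G // quot_rel G H"
proof -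
  have "{x \<in> gelems G. quot_map G H x \<in> gelems G // quot_rel G H} = gelems G"
    by (auto simp: quot_map_def quotientI)
  then have "openin (quot_space G H) (gelems G // quot_rel G H)"
    by (simp add: openin_quot_space)
  then show ?thesis
    by (metis openin_quot_space openin_subset openin_topspace subset_antisym)
qed

lemma quotient_map_quot_map: "quotient_map (gtop G) (quot_space G H) (quot_map G H)"
  by (auto simp: quotient_map_def openin_quot_space topspace_quot_space quotient_def quot_map_def)

definition quot_rng :: "'g groupoid \<Rightarrow> 'g set \<Rightarrow> 'g" where
  "quot_rng G \<omega> = grng G (some_elem \<omega>)"

definition quot_act :: "'g groupoid \<Rightarrow> 'g set \<Rightarrow> 'g \<Rightarrow> 'g set \<Rightarrow> 'g set" where
  "quot_act G H \<gamma> \<omega> = quot_map G H (gmul G \<gamma> (some_elem \<omega>))"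

definition quot_measure_system ::
  "'g groupoid \<Rightarrow> 'g set \<Rightarrow> ('g \<Rightarrow> 'g set measure) \<Rightarrow> bool" where
  "quot_measure_system G H \<mu> \<longleftrightarrow>
     full_equivariant_system G (quot_space G H) (quot_rng G) (quot_act G H) \<mu>"


section \<open>Continuous Hilbert bundles\<close>

text \<open>Sections are functions on the whole type; only their values on the base matter.\<close>

record ('g, 'v) hbundle =
  fib :: "'g \<Rightarrow> 'v hilb"
  csect :: "('g \<Rightarrow> 'v) set"

definition locally_approximable ::
  "'g topology \<Rightarrow> ('g \<Rightarrow> 'v hilb) \<Rightarrow> ('g \<Rightarrow> 'v) set \<Rightarrow> ('g \<Rightarrow> 'v) \<Rightarrow> bool" where
  "locally_approximable B F S \<xi> \<longleftrightarrow>
     (\<forall>u\<in>topspace B. \<forall>\<epsilon>>0. \<exists>U. openin B U \<and> u \<in> U \<and>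
        (\<exists>\<eta>\<in>S. \<forall>v\<in>U. hnorm (F v) (hminus (F v) (\<xi> v) (\<eta> v)) < \<epsilon>))"

locale hilbert_bundle =
  fixes B :: "'g topology" and E :: "('g, 'v, 'z) hbundle_scheme"
  assumes hilbert: "u \<in> topspace B \<Longrightarrow> hilbert_space (fib E u)"
    and sect_in: "csect E \<subseteq> (\<Pi> u\<in>topspace B. hcarrier (fib E u))"
    and sect_zero: "(\<lambda>u. hzero (fib E u)) \<in> csect E"
    and sect_add: "\<lbrakk>\<xi> \<in> csect E; \<eta> \<in> csect E\<rbrakk> \<Longrightarrow> (\<lambda>u. hadd (fib E u) (\<xi> u) (\<eta> u)) \<in> csect E"
    and sect_scale: "\<xi> \<in> csect E \<Longrightarrow> (\<lambda>u. hscale (fib E u) a (\<xi> u)) \<in> csect E"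
    and sect_dense: "\<lbrakk>u \<in> topspace B; v \<in> hcarrier (fib E u); 0 < \<epsilon>\<rbrakk>
      \<Longrightarrow> \<exists>\<xi>\<in>csect E. hnorm (fib E u) (hminus (fib E u) (\<xi> u) v) < \<epsilon>"
    and sect_norm: "\<xi> \<in> csect E \<Longrightarrow> continuous_map B euclideanreal (\<lambda>u. hnorm (fib E u) (\<xi> u))"
    and sect_local: "\<lbrakk>\<xi> \<in> (\<Pi> u\<in>topspace B. hcarrier (fib E u));
      locally_approximable B (fib E) (csect E) \<xi>\<rbrakk> \<Longrightarrow> \<xi> \<in> csect E"

definition total_space :: "'g topology \<Rightarrow> ('g, 'v, 'z) hbundle_scheme \<Rightarrow> ('g \<times> 'v) topology" where
  "total_space B E = topology_generated_by
     {{(u, h). u \<in> V \<and> h \<in> hcarrier (fib E u) \<and> hnorm (fib E u) (hminus (fib E u) h (\<xi> u)) < \<epsilon>}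
      | V \<xi> \<epsilon>. openin B V \<and> \<xi> \<in> csect E \<and> 0 < \<epsilon>}"

definition C0_sections :: "'g topology \<Rightarrow> ('g, 'v, 'z) hbundle_scheme \<Rightarrow> ('g \<Rightarrow> 'v) set" where
  "C0_sections B E = {\<xi> \<in> csect E.
     \<forall>\<epsilon>>0. compactin B {u \<in> topspace B. \<epsilon> \<le> hnorm (fib E u) (\<xi> u)}}"

inductive_set section_span :: "('g \<Rightarrow> 'v hilb) \<Rightarrow> ('g \<Rightarrow> 'v) set \<Rightarrow> ('g \<Rightarrow> 'v) set"
  for F :: "'g \<Rightarrow> 'v hilb" and S :: "('g \<Rightarrow> 'v) set" where
  span_zero: "(\<lambda>u. hzero (F u)) \<in> section_span F S"
| span_base: "\<xi> \<in> S \<Longrightarrow> \<xi> \<in> section_span F S"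
| span_add: "\<xi> \<in> section_span F S \<Longrightarrow> \<eta> \<in> section_span F S
    \<Longrightarrow> (\<lambda>u. hadd (F u) (\<xi> u) (\<eta> u)) \<in> section_span F S"
| span_scale: "\<xi> \<in> section_span F S \<Longrightarrow> (\<lambda>u. hscale (F u) a (\<xi> u)) \<in> section_span F S"

definition generated_sections ::
  "'g topology \<Rightarrow> ('g \<Rightarrow> 'v hilb) \<Rightarrow> ('g \<Rightarrow> 'v) set \<Rightarrow> ('g \<Rightarrow> 'v) set" where
  "generated_sections B F S = {\<xi> \<in> (\<Pi> u\<in>topspace B. hcarrier (F u)).
     locally_approximable B F (section_span F S) \<xi>}"


section \<open>Continuous unitary representations\<close>

record ('g, 'v) grep = "('g, 'v) hbundle" +
  act :: "'g \<Rightarrow> 'v \<Rightarrow> 'v"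

definition unitary_rep :: "'g groupoid \<Rightarrow> ('g, 'v) grep \<Rightarrow> bool" where
  "unitary_rep G \<pi> \<longleftrightarrow>
     hilbert_bundle (unit_space G) \<pi> \<and>
     (\<forall>x\<in>gelems G. unitary (fib \<pi> (gdom G x)) (fib \<pi> (grng G x)) (act \<pi> x)) \<and>
     (\<forall>u\<in>units G. \<forall>v\<in>hcarrier (fib \<pi> u). act \<pi> u v = v) \<and>
     (\<forall>(x, y)\<in>composable G. \<forall>v\<in>hcarrier (fib \<pi> (gdom G y)).
        act \<pi> x (act \<pi> y v) = act \<pi> (gmul G x y) v) \<and>
     (\<forall>x\<in>gelems G. \<forall>w\<in>hcarrier (fib \<pi> (grng G x)).
        inv_into (hcarrier (fib \<pi> (gdom G x))) (act \<pi> x) w = act \<pi> (ginv G x) w) \<and>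
     (\<forall>\<xi>\<in>C0_sections (unit_space G) \<pi>. \<forall>\<eta>\<in>C0_sections (unit_space G) \<pi>.
        continuous_map (gtop G) euclidean
          (\<lambda>x. hinner (fib \<pi> (grng G x)) (act \<pi> x (\<xi> (gdom G x))) (\<eta> (grng G x))))"

definition unitarily_equivalent ::
  "'g groupoid \<Rightarrow> ('g, 'v) grep \<Rightarrow> ('g, 'w) grep \<Rightarrow> bool" where
  "unitarily_equivalent G \<pi> \<rho> \<longleftrightarrow> (\<exists>T.
     (\<forall>u\<in>units G. unitary (fib \<pi> u) (fib \<rho> u) (T u)) \<and>
     (\<forall>\<xi>\<in>(\<Pi> u\<in>units G. hcarrier (fib \<pi> u)). \<xi> \<in> csect \<pi> \<longleftrightarrow> (\<lambda>u. T u (\<xi> u)) \<in> csect \<rho>) \<and>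
     (\<forall>x\<in>gelems G. \<forall>v\<in>hcarrier (fib \<pi> (gdom G x)).
        T (grng G x) (act \<pi> x v) = act \<rho> x (T (gdom G x) v)))"

definition restrict_rep :: "('g, 'v) grep \<Rightarrow> 'g set \<Rightarrow> ('g, 'v) grep" where
  "restrict_rep \<rho> H = \<rho>\<lparr>act := restrict (act \<rho>) H\<rparr>"

definition tensor_rep ::
  "'g groupoid \<Rightarrow> ('g, 'v) grep \<Rightarrow> ('g, 'w) grep \<Rightarrow>
   ('g, (nat \<Rightarrow> ('v \<times> 'w) \<Rightarrow>\<^sub>0 complex) set) grep" where
  "tensor_rep G \<pi> \<rho> =
    \<lparr> fib = (\<lambda>u. tensor (fib \<pi> u) (fib \<rho> u)),
      csect = generated_sections (unit_space G) (\<lambda>u. tensor (fib \<pi> u) (fib \<rho> u))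
        {(\<lambda>u. tensor_vec (fib \<pi> u) (fib \<rho> u) (\<xi> u) (\<eta> u)) | \<xi> \<eta>. \<xi> \<in> csect \<pi> \<and> \<eta> \<in> csect \<rho>},
      act = (\<lambda>x. tensor_op (fib \<pi> (grng G x)) (fib \<rho> (grng G x)) (act \<pi> x) (act \<rho> x)) \<rparr>"


section \<open>Induced representations\<close>

text \<open>\<open>ind_functions G H \<sigma>\<close> is $\mathcal F_0^\sigma(G)$.\<close>

definition ind_functions :: "'g groupoid \<Rightarrow> 'g set \<Rightarrow> ('g, 'v) grep \<Rightarrow> ('g \<Rightarrow> 'v) set" where
  "ind_functions G H \<sigma> = {f.
     (\<forall>x\<in>gelems G. f x \<in> hcarrier (fib \<sigma> (gdom G x))) \<and>
     continuous_map (gtop G) (total_space (unit_space G) \<sigma>) (\<lambda>x. (gdom G x, f x)) \<and>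
     compactin (quot_space G H) (quot_map G H `
       (gtop G closure_of {x \<in> gelems G. f x \<noteq> hzero (fib \<sigma> (gdom G x))})) \<and>
     (\<forall>x\<in>gelems G. \<forall>h\<in>H. gdom G x = grng G h \<longrightarrow> f (gmul G x h) = act \<sigma> (ginv G h) (f x))}"

text \<open>For \<open>f, g\<close> in \<open>ind_functions G H \<sigma>\<close> the integrand depends only on the coset \<open>\<omega>\<close>, because
  \<open>\<sigma>\<close> is unitary.  The integral is taken over the fiber of \<open>quot_rng\<close> over \<open>u\<close>, which supports
  \<open>\<mu> u\<close>, so that it is also meaningful for functions given on \<open>range_fiber G u\<close> only.\<close>

definition ind_inner ::
  "'g groupoid \<Rightarrow> 'g set \<Rightarrow> ('g \<Rightarrow> 'g set measure) \<Rightarrow> ('g, 'v) grep \<Rightarrow>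
   'g \<Rightarrow> ('g \<Rightarrow> 'v) \<Rightarrow> ('g \<Rightarrow> 'v) \<Rightarrow> complex" where
  "ind_inner G H \<mu> \<sigma> u f g =
     (LINT \<omega>:{\<omega> \<in> topspace (quot_space G H). quot_rng G \<omega> = u}|\<mu> u.
        hinner (fib \<sigma> (gdom G (some_elem \<omega>))) (f (some_elem \<omega>)) (g (some_elem \<omega>)))"

definition ind_prefiber ::
  "'g groupoid \<Rightarrow> 'g set \<Rightarrow> ('g \<Rightarrow> 'g set measure) \<Rightarrow> ('g, 'v) grep \<Rightarrow> 'g \<Rightarrow> ('g \<Rightarrow> 'v) hilb" where
  "ind_prefiber G H \<mu> \<sigma> u =
    \<lparr> hcarrier = (\<lambda>f. restrict f (range_fiber G u)) ` ind_functions G H \<sigma>,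
      hzero = (\<lambda>x\<in>range_fiber G u. hzero (fib \<sigma> (gdom G x))),
      hadd = (\<lambda>f g. \<lambda>x\<in>range_fiber G u. hadd (fib \<sigma> (gdom G x)) (f x) (g x)),
      hscale = (\<lambda>a f. \<lambda>x\<in>range_fiber G u. hscale (fib \<sigma> (gdom G x)) a (f x)),
      hinner = ind_inner G H \<mu> \<sigma> u \<rparr>"

definition ind_fiber ::
  "'g groupoid \<Rightarrow> 'g set \<Rightarrow> ('g \<Rightarrow> 'g set measure) \<Rightarrow> ('g, 'v) grep \<Rightarrow>
   'g \<Rightarrow> (nat \<Rightarrow> 'g \<Rightarrow> 'v) set hilb" where
  "ind_fiber G H \<mu> \<sigma> u = completion (ind_prefiber G H \<mu> \<sigma> u)"

definition ind_section ::
  "'g groupoid \<Rightarrow> 'g set \<Rightarrow> ('g \<Rightarrow> 'g set measure) \<Rightarrow> ('g, 'v) grep \<Rightarrow>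
   ('g \<Rightarrow> 'v) \<Rightarrow> 'g \<Rightarrow> (nat \<Rightarrow> 'g \<Rightarrow> 'v) set" where
  "ind_section G H \<mu> \<sigma> f u =
     completion_embed (ind_prefiber G H \<mu> \<sigma> u) (restrict f (range_fiber G u))"

text \<open>$\mathcal F^\sigma(G,\mu)$, the completion of $\mathcal F_0^\sigma(G)$ in the supremum norm,
  realised as a closure in the space of bounded sections of the (complete) fibers.\<close>

definition ind_module ::
  "'g groupoid \<Rightarrow> 'g set \<Rightarrow> ('g \<Rightarrow> 'g set measure) \<Rightarrow> ('g, 'v) grep \<Rightarrow>
   ('g \<Rightarrow> (nat \<Rightarrow> 'g \<Rightarrow> 'v) set) set" where
  "ind_module G H \<mu> \<sigma> = {\<xi> \<in> (\<Pi> u\<in>units G. hcarrier (ind_fiber G H \<mu> \<sigma> u)).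
     \<forall>\<epsilon>>0. \<exists>f\<in>ind_functions G H \<sigma>. \<forall>u\<in>units G.
       hnorm (ind_fiber G H \<mu> \<sigma> u)
         (hminus (ind_fiber G H \<mu> \<sigma> u) (\<xi> u) (ind_section G H \<mu> \<sigma> f u)) \<le> \<epsilon>}"

text \<open>The continuous sections are the ones locally uniformly approximable by elements of
  \<open>ind_module\<close>; since \<open>ind_module\<close> is a sup-norm closed module over the continuous functions
  vanishing at infinity on the unit space, those vanishing at infinity are exactly its elements.
  \<open>(L(x)f)(y) = f(x\<^sup>-\<^sup>1 y)\<close> is extended from the dense subspaces to the completions.\<close>

definition ind_rep ::
  "'g groupoid \<Rightarrow> 'g set \<Rightarrow> ('g \<Rightarrow> 'g set measure) \<Rightarrow> ('g, 'v) grep \<Rightarrow>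
   ('g, (nat \<Rightarrow> 'g \<Rightarrow> 'v) set) grep" where
  "ind_rep G H \<mu> \<sigma> =
    \<lparr> fib = ind_fiber G H \<mu> \<sigma>,
      csect = generated_sections (unit_space G) (ind_fiber G H \<mu> \<sigma>) (ind_module G H \<mu> \<sigma>),
      act = (\<lambda>x. completion_map (ind_prefiber G H \<mu> \<sigma> (grng G x))
        (\<lambda>f. \<lambda>y\<in>range_fiber G (grng G x). f (gmul G (ginv G x) y))) \<rparr>"

end

theory Submission
  imports Defs
begin

abbreviation "hdist V v w \<equiv> hnorm V (hminus V v w)"
abbreviation "hnull V s t \<equiv> (\<lambda>n::nat. hdist V (s n) (t n)) \<longlonglongrightarrow> 0"

lemma null_bound:
  assumes "\<And>n. 0 \<le> a n" "\<And>n. a n < 1 / real (Suc n)"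
  shows "a \<longlonglongrightarrow> 0"
  by (rule Lim_null_comparison[OF always_eventually LIMSEQ_inverse_real_of_nat])
    (use assms in \<open>simp add: less_imp_le inverse_eq_divide\<close>)

section \<open>Semi-inner product spaces and their completions\<close>

locale semi_inner_space = complex_vector_space V for V :: "'v hilb" +
  assumes inner_add: "\<lbrakk>v \<in> hcarrier V; w \<in> hcarrier V; x \<in> hcarrier V\<rbrakk> \<Longrightarrow> hinner V (hadd V v w) x = hinner V v x + hinner V w x"
    and inner_scale: "\<lbrakk>v \<in> hcarrier V; w \<in> hcarrier V\<rbrakk> \<Longrightarrow> hinner V (hscale V a v) w = a * hinner V v w"
    and inner_commute: "\<lbrakk>v \<in> hcarrier V; w \<in> hcarrier V\<rbrakk> \<Longrightarrow> hinner V v w = cnj (hinner V w v)"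
    and inner_nonneg: "v \<in> hcarrier V \<Longrightarrow> 0 \<le> Re (hinner V v v)"
begin

abbreviation "\<C> \<equiv> completion V"

lemma minus_closed: "\<lbrakk>v \<in> hcarrier V; w \<in> hcarrier V\<rbrakk> \<Longrightarrow> hminus V v w \<in> hcarrier V"
  by (simp add: hminus_def add_closed scale_closed)

lemmas closed = zero_closed add_closed scale_closed minus_closed

lemma inner_add_right: "\<lbrakk>v \<in> hcarrier V; w \<in> hcarrier V; x \<in> hcarrier V\<rbrakk> \<Longrightarrow> hinner V x (hadd V v w) = hinner V x v + hinner V x w"
  by (metis add_closed complex_cnj_add inner_add inner_commute)

lemma inner_scale_right: "\<lbrakk>v \<in> hcarrier V; w \<in> hcarrier V\<rbrakk> \<Longrightarrow> hinner V w (hscale V a v) = cnj a * hinner V w v"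
  by (metis scale_closed complex_cnj_mult inner_scale inner_commute)

lemma inner_minus: "\<lbrakk>v \<in> hcarrier V; w \<in> hcarrier V; x \<in> hcarrier V\<rbrakk> \<Longrightarrow> hinner V (hminus V v w) x = hinner V v x - hinner V w x"
  by (simp add: hminus_def inner_add inner_scale scale_closed)

lemma inner_minus_right: "\<lbrakk>v \<in> hcarrier V; w \<in> hcarrier V; x \<in> hcarrier V\<rbrakk>
    \<Longrightarrow> hinner V x (hminus V v w) = hinner V x v - hinner V x w"
  by (simp add: hminus_def inner_add_right inner_scale_right scale_closed)

lemma zero_eq: "hzero V = hscale V 0 (hzero V)" by (metis add_uminus add_scale add_zero zero_closed scale_one add.right_inverse)

lemma inner_zero: "v \<in> hcarrier V \<Longrightarrow> hinner V (hzero V) v = 0" by (metis zero_eq inner_scale zero_closed mult_zero_left)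

lemma inner_zero_right: "v \<in> hcarrier V \<Longrightarrow> hinner V v (hzero V) = 0"
  by (metis inner_zero inner_commute zero_closed complex_cnj_zero)

lemmas inner_simps = inner_add inner_add_right inner_scale inner_scale_right inner_minus
  inner_minus_right inner_zero inner_zero_right

lemma inner_self: "v \<in> hcarrier V \<Longrightarrow> hinner V v v = complex_of_real ((hnorm V v)\<^sup>2)"
  using inner_nonneg[of v] inner_commute[of v v] by (auto simp: hnorm_def complex_eq_iff)

lemma norm_sq: "v \<in> hcarrier V \<Longrightarrow> (hnorm V v)\<^sup>2 = Re (hinner V v v)" by (simp add: hnorm_def inner_nonneg)

lemma norm_nonneg: "v \<in> hcarrier V \<Longrightarrow> 0 \<le> hnorm V v" by (simp add: hnorm_def inner_nonneg)

lemma norm_eqI: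
  assumes "Re (hinner V v v) = Re (hinner V w w)"
  shows "hnorm V v = hnorm V w"
  using assms by (simp add: hnorm_def)

lemma norm_zero: "hnorm V (hzero V) = 0" by (simp add: hnorm_def inner_zero zero_closed)

lemma norm_minus_self: "v \<in> hcarrier V \<Longrightarrow> hdist V v v = 0" by (simp add: hnorm_def inner_simps closed)

lemma norm_scale: "v \<in> hcarrier V \<Longrightarrow> hnorm V (hscale V a v) = cmod a * hnorm V v"
proof -
  assume v: "v \<in> hcarrier V"
  have "hinner V (hscale V a v) (hscale V a v) = a * cnj a * hinner V v v"
    using v by (simp add: inner_scale inner_scale_right closed)
  also have "\<dots> = of_real ((cmod a)\<^sup>2 * (hnorm V v)\<^sup>2)" using v by (simp only: inner_self complex_norm_square of_real_mult)
  finally have "hinner V (hscale V a v) (hscale V a v) = of_real ((cmod a)\<^sup>2 * (hnorm V v)\<^sup>2)" .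
  then have "Re (hinner V (hscale V a v) (hscale V a v)) = (cmod a * hnorm V v)\<^sup>2" by (simp add: power_mult_distrib)
  then show ?thesis using v by (simp add: hnorm_def inner_nonneg)
qed

lemma norm_minus_sq: "\<lbrakk>v \<in> hcarrier V; w \<in> hcarrier V\<rbrakk> \<Longrightarrow> (hdist V v w)\<^sup>2 = (hnorm V v)\<^sup>2 - 2 * Re (hinner V v w) + (hnorm V w)\<^sup>2"
  using inner_commute[of w v] by (simp add: norm_sq inner_simps closed)

lemma norm_add_sq: "\<lbrakk>v \<in> hcarrier V; w \<in> hcarrier V\<rbrakk>
    \<Longrightarrow> (hnorm V (hadd V v w))\<^sup>2 = (hnorm V v)\<^sup>2 + 2 * Re (hinner V v w) + (hnorm V w)\<^sup>2"
  using inner_commute[of w v] by (simp add: norm_sq inner_simps closed)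

lemma cauchy_schwarz:
  assumes v: "v \<in> hcarrier V" and w: "w \<in> hcarrier V"
  shows "cmod (hinner V v w) \<le> hnorm V v * hnorm V w"
proof -
  define c a b where "c = hinner V v w" and "a = (hnorm V v)\<^sup>2" and "b = (hnorm V w)\<^sup>2"
  have *: "0 \<le> a - 2 * t * (cmod c)\<^sup>2 + t\<^sup>2 * (cmod c)\<^sup>2 * b" for t :: real
  proof -
    have "(hdist V v (hscale V (of_real t * c) w))\<^sup>2 = a - 2 * Re (cnj (of_real t * c) * c) + (cmod (of_real t * c))\<^sup>2 * b"
      using v w by (simp add: norm_minus_sq closed inner_simps c_def a_def b_def norm_scale power_mult_distrib)
    also have "Re (cnj (of_real t * c) * c) = t * (cmod c)\<^sup>2"
      by (simp add: cmod_power2) (simp add: algebra_simps power2_eq_square)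
    also have "(cmod (of_real t * c))\<^sup>2 = t\<^sup>2 * (cmod c)\<^sup>2" by (simp add: norm_mult power_mult_distrib)
    finally show ?thesis by (metis (no_types, opaque_lifting) mult.assoc zero_le_power2)
  qed
  have "(cmod c)\<^sup>2 \<le> a * b"
  proof (cases "b = 0")
    case True
    have "c = 0"
    proof (rule ccontr)
      assume "c \<noteq> 0"
      then have "0 < (cmod c)\<^sup>2" by simp
      then show False using *[of "(a + 1) / (2 * (cmod c)\<^sup>2)"] True by simp
    qed
    then show ?thesis using True by simp
  next
    case False
    then have "b > 0" by (simp add: b_def)
    have "0 \<le> a - (cmod c)\<^sup>2 / b" using *[of "1 / b"] \<open>b > 0\<close> by (simp add: power2_eq_square field_simps)
    then show ?thesis using \<open>b > 0\<close> by (simp add: field_simps)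
  qed
  then have "(cmod c)\<^sup>2 \<le> (hnorm V v * hnorm V w)\<^sup>2" by (simp add: a_def b_def power_mult_distrib)
  then show ?thesis unfolding c_def using v w by (meson norm_nonneg mult_nonneg_nonneg power2_le_imp_le)
qed

lemma norm_add_le:
  assumes "v \<in> hcarrier V" "w \<in> hcarrier V"
  shows "hnorm V (hadd V v w) \<le> hnorm V v + hnorm V w"
proof -
  have "Re (hinner V v w) \<le> hnorm V v * hnorm V w" using cauchy_schwarz[OF assms] complex_Re_le_cmod order_trans by blast
  then have "(hnorm V (hadd V v w))\<^sup>2 \<le> (hnorm V v + hnorm V w)\<^sup>2" using assms by (simp add: norm_add_sq power2_sum)
  then show ?thesis using assms by (meson add_nonneg_nonneg norm_nonneg power2_le_imp_le)
qed

lemma norm_minus_commute: "\<lbrakk>v \<in> hcarrier V; w \<in> hcarrier V\<rbrakk> \<Longrightarrow> hdist V v w = hdist V w v"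
  by (rule norm_eqI) (simp add: inner_simps closed)

lemma norm_triangle:
  assumes "v \<in> hcarrier V" "w \<in> hcarrier V" "x \<in> hcarrier V"
  shows "hdist V v w \<le> hdist V v x + hdist V x w"
proof -
  have "hdist V v w = hnorm V (hadd V (hminus V v x) (hminus V x w))"
    by (rule norm_eqI) (use assms in \<open>simp add: inner_simps closed\<close>)
  then show ?thesis using norm_add_le assms by (simp add: closed)
qed

lemma norm_le_minus_add:
  assumes "v \<in> hcarrier V" "w \<in> hcarrier V"
  shows "hnorm V v \<le> hdist V v w + hnorm V w"
proof -
  have "hnorm V v = hnorm V (hadd V (hminus V v w) w)" by (rule norm_eqI) (use assms in \<open>simp add: inner_simps closed\<close>)
  then show ?thesis using norm_add_le assms by (simp add: closed)
qed

lemma norm_diff_le: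
  assumes "v \<in> hcarrier V" "w \<in> hcarrier V"
  shows "\<bar>hnorm V v - hnorm V w\<bar> \<le> hdist V v w"
  using norm_le_minus_add[of v w] norm_le_minus_add[of w v] norm_minus_commute[of v w] assms by simp

lemma norm_add_diff_le:
  assumes "v \<in> hcarrier V" "w \<in> hcarrier V" "v' \<in> hcarrier V" "w' \<in> hcarrier V"
  shows "hdist V (hadd V v w) (hadd V v' w') \<le> hdist V v v' + hdist V w w'"
proof -
  have "hdist V (hadd V v w) (hadd V v' w') = hnorm V (hadd V (hminus V v v') (hminus V w w'))"
    by (rule norm_eqI) (use assms in \<open>simp add: inner_simps closed\<close>)
  then show ?thesis using norm_add_le assms by (simp add: closed)
qed

lemma norm_scale_diff:
  assumes "v \<in> hcarrier V" "v' \<in> hcarrier V"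
  shows "hdist V (hscale V a v) (hscale V a v') = cmod a * hdist V v v'"
proof -
  have "hdist V (hscale V a v) (hscale V a v') = hnorm V (hscale V a (hminus V v v'))"
    by (rule norm_eqI) (use assms in \<open>simp add: inner_simps closed algebra_simps\<close>)
  then show ?thesis using assms by (simp add: norm_scale closed)
qed

lemma norm_scale_diff_left:
  assumes "v \<in> hcarrier V"
  shows "hdist V (hscale V a v) (hscale V b v) = cmod (a - b) * hnorm V v"
proof -
  have "hdist V (hscale V a v) (hscale V b v) = hnorm V (hscale V (a - b) v)"
    by (rule norm_eqI) (use assms in \<open>simp add: inner_simps closed algebra_simps\<close>)
  then show ?thesis using assms by (simp add: norm_scale closed)
qed

lemma inner_diff_le:
  assumes "v \<in> hcarrier V" "w \<in> hcarrier V" "v' \<in> hcarrier V" "w' \<in> hcarrier V"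
  shows "cmod (hinner V v w - hinner V v' w') \<le> hdist V v v' * hnorm V w + hnorm V v' * hdist V w w'"
proof -
  have "hinner V v w - hinner V v' w' = hinner V (hminus V v v') w + hinner V v' (hminus V w w')"
    using assms by (simp add: inner_simps closed)
  then show ?thesis using cauchy_schwarz[of "hminus V v v'" w] cauchy_schwarz[of v' "hminus V w w'"] assms
    by (smt (verit) closed norm_triangle_ineq)
qed

lemma hcauchyD: "\<lbrakk>s \<in> hcauchy V; 0 < e\<rbrakk> \<Longrightarrow> \<exists>N. \<forall>m\<ge>N. \<forall>n\<ge>N. hdist V (s m) (s n) < e" by (simp add: hcauchy_def)

lemma hcauchy_add:
  assumes "s \<in> hcauchy V" "t \<in> hcauchy V"
  shows "(\<lambda>n. hadd V (s n) (t n)) \<in> hcauchy V"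
  unfolding hcauchy_def
proof (safe)
  fix n show "hadd V (s n) (t n) \<in> hcarrier V" using assms by (simp add: hcauchy_def add_closed)
next
  fix e :: real assume "0 < e"
  then have "0 < e / 2" by simp
  then obtain M N where M: "\<forall>m\<ge>M. \<forall>n\<ge>M. hdist V (s m) (s n) < e / 2"
    and N: "\<forall>m\<ge>N. \<forall>n\<ge>N. hdist V (t m) (t n) < e / 2"
    using assms unfolding hcauchy_def by blast
  have "hdist V (hadd V (s m) (t m)) (hadd V (s n) (t n)) < e" if "m \<ge> max M N" "n \<ge> max M N" for m n
  proof -
    have "hdist V (s m) (s n) < e / 2" "hdist V (t m) (t n) < e / 2" using M N that by auto
    then show ?thesis using norm_add_diff_le[of "s m" "t m" "s n" "t n"] assms by (simp add: hcauchy_def)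
  qed
  then show "\<exists>N. \<forall>m\<ge>N. \<forall>n\<ge>N. hdist V (hadd V (s m) (t m)) (hadd V (s n) (t n)) < e" by blast
qed

lemma hcauchy_scale:
  assumes "s \<in> hcauchy V"
  shows "(\<lambda>n. hscale V a (s n)) \<in> hcauchy V"
  unfolding hcauchy_def
proof (safe)
  fix n show "hscale V a (s n) \<in> hcarrier V" using assms by (simp add: hcauchy_def scale_closed)
next
  fix e :: real assume "0 < e"
  then have "0 < e / (cmod a + 1)" by (smt (verit, best) divide_pos_pos norm_ge_zero)
  then obtain M where M: "\<forall>m\<ge>M. \<forall>n\<ge>M. hdist V (s m) (s n) < e / (cmod a + 1)" using assms unfolding hcauchy_def by blast
  have "hdist V (hscale V a (s m)) (hscale V a (s n)) < e" if "m \<ge> M" "n \<ge> M" for m n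
  proof -
    define h where "h = hdist V (s m) (s n)"
    have c: "s m \<in> hcarrier V" "s n \<in> hcarrier V" using assms by (auto simp: hcauchy_def)
    have h0: "0 \<le> h" using c by (simp add: h_def norm_nonneg minus_closed)
    have pos: "0 < cmod a + 1" by (smt (verit) norm_ge_zero)
    have "h < e / (cmod a + 1)" using M that by (auto simp: h_def)
    then have "h * (cmod a + 1) < e" using pos by (simp add: pos_less_divide_eq)
    then have "cmod a * h < e" using h0 by (simp add: algebra_simps)
    then show ?thesis using norm_scale_diff[of "s m" "s n" a] c by (simp add: h_def)
  qed
  then show "\<exists>N. \<forall>m\<ge>N. \<forall>n\<ge>N. hdist V (hscale V a (s m)) (hscale V a (s n)) < e" by blast
qed

lemma hcauchy_const: "v \<in> hcarrier V \<Longrightarrow> (\<lambda>n. v) \<in> hcauchy V" by (simp add: hcauchy_def norm_minus_self)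

lemma hcauchy_null:
  assumes t: "t \<in> hcauchy V" and s: "\<And>n. s n \<in> hcarrier V" and lim: "hnull V s t"
  shows "s \<in> hcauchy V"
  unfolding hcauchy_def
proof (safe)
  fix e :: real assume "0 < e"
  then obtain M where M: "\<forall>m\<ge>M. \<forall>n\<ge>M. hdist V (t m) (t n) < e / 3" using hcauchyD[OF t, of "e / 3"] by auto
  from LIMSEQ_D[OF lim, of "e / 3"] \<open>0 < e\<close> obtain N where N: "\<forall>n\<ge>N. norm (hdist V (s n) (t n) - 0) < e / 3" by auto
  have tc: "t n \<in> hcarrier V" for n using t by (simp add: hcauchy_def)
  have "hdist V (s m) (s n) < e" if "m \<ge> max M N" "n \<ge> max M N" for m n
  proof -
    have "hdist V (s m) (t m) < e / 3" "hdist V (s n) (t n) < e / 3" "hdist V (t m) (t n) < e / 3" using M N that by force+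
    then show ?thesis using norm_triangle[OF s s tc, of m n m] norm_triangle[OF tc s tc, of m n n]
        norm_minus_commute[OF s tc, of n n] by simp
  qed
  then show "\<exists>N. \<forall>m\<ge>N. \<forall>n\<ge>N. hdist V (s m) (s n) < e" by blast
qed (rule s)

lemmas hcauchyI = hcauchy_null[OF hcauchy_const]

lemma hcauchy_bounded:
  assumes "s \<in> hcauchy V"
  obtains B where "B > 0" "\<And>n. hnorm V (s n) \<le> B"
proof -
  have c: "s n \<in> hcarrier V" for n using assms by (simp add: hcauchy_def)
  have "Cauchy (\<lambda>n. hnorm V (s n))"
  proof (rule CauchyI)
    fix e :: real assume "0 < e"
    then obtain N where "\<forall>m\<ge>N. \<forall>n\<ge>N. hdist V (s m) (s n) < e" using assms unfolding hcauchy_def by blast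
    then show "\<exists>M. \<forall>m\<ge>M. \<forall>n\<ge>M. norm (hnorm V (s m) - hnorm V (s n)) < e"
      using norm_diff_le[OF c c] by (metis le_less_trans real_norm_def)
  qed
  then have "Bseq (\<lambda>n. hnorm V (s n))" by (rule Cauchy_Bseq)
  then obtain B where "B > 0" "\<forall>n. norm (hnorm V (s n)) \<le> B" by (meson BseqE)
  then show ?thesis using that c norm_nonneg by (metis real_norm_def abs_of_nonneg)
qed

lemma hcauchy_inner_Cauchy:
  assumes s: "s \<in> hcauchy V" and t: "t \<in> hcauchy V"
  shows "convergent (\<lambda>n. hinner V (s n) (t n))"
proof -
  have cs: "s n \<in> hcarrier V" and ct: "t n \<in> hcarrier V" for n using s t by (auto simp: hcauchy_def)
  obtain A where A: "A > 0" "\<And>n. hnorm V (s n) \<le> A" using hcauchy_bounded[OF s] by blast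
  obtain B where B: "B > 0" "\<And>n. hnorm V (t n) \<le> B" using hcauchy_bounded[OF t] by blast
  have "Cauchy (\<lambda>n. hinner V (s n) (t n))"
  proof (rule CauchyI)
    fix e :: real assume "0 < e"
    then have "0 < e / (2 * B)" "0 < e / (2 * A)" using A B by auto
    then obtain M N where M: "\<forall>m\<ge>M. \<forall>n\<ge>M. hdist V (s m) (s n) < e / (2 * B)"
      and N: "\<forall>m\<ge>N. \<forall>n\<ge>N. hdist V (t m) (t n) < e / (2 * A)"
      using s t unfolding hcauchy_def by blast
    have "cmod (hinner V (s m) (t m) - hinner V (s n) (t n)) < e" if "m \<ge> max M N" "n \<ge> max M N" for m n
    proof -
      have 1: "hdist V (s m) (s n) < e / (2 * B)" "hdist V (t m) (t n) < e / (2 * A)" using M N that by auto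
      have "cmod (hinner V (s m) (t m) - hinner V (s n) (t n))
        \<le> hdist V (s m) (s n) * hnorm V (t m) + hnorm V (s n) * hdist V (t m) (t n)"
        by (rule inner_diff_le) (use cs ct in auto)
      also have "\<dots> \<le> hdist V (s m) (s n) * B + A * hdist V (t m) (t n)"
        by (intro add_mono mult_mono) (use A B cs ct norm_nonneg minus_closed in auto)
      also have "\<dots> < e / (2 * B) * B + A * (e / (2 * A))"
        using 1 A B by (intro add_strict_mono mult_strict_left_mono mult_strict_right_mono) auto
      also have "\<dots> = e" using A B by (simp add: field_simps)
      finally show ?thesis .
    qed
    then show "\<exists>M. \<forall>m\<ge>M. \<forall>n\<ge>M. norm (hinner V (s m) (t m) - hinner V (s n) (t n)) < e" by blast
  qed
  then show ?thesis by (simp add: Cauchy_convergent_iff)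
qed

lemma inner_tendsto_cong:
  assumes s: "s \<in> hcauchy V" and t: "t \<in> hcauchy V" and s': "s' \<in> hcauchy V" and t': "t' \<in> hcauchy V"
    and 1: "hnull V s s'"
    and 2: "hnull V t t'"
  shows "lim (\<lambda>n. hinner V (s n) (t n)) = lim (\<lambda>n. hinner V (s' n) (t' n))"
proof -
  have c: "s n \<in> hcarrier V" "t n \<in> hcarrier V" "s' n \<in> hcarrier V" "t' n \<in> hcarrier V" for n
    using assms by (auto simp: hcauchy_def)
  obtain A where A: "A > 0" "\<And>n. hnorm V (s' n) \<le> A" using hcauchy_bounded[OF s'] by blast
  obtain B where B: "B > 0" "\<And>n. hnorm V (t n) \<le> B" using hcauchy_bounded[OF t] by blast
  have "(\<lambda>n. hinner V (s n) (t n) - hinner V (s' n) (t' n)) \<longlonglongrightarrow> 0"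
  proof (rule Lim_null_comparison)
    show "\<forall>\<^sub>F n in sequentially. norm (hinner V (s n) (t n) - hinner V (s' n) (t' n)) \<le>
        hdist V (s n) (s' n) * B + A * hdist V (t n) (t' n)"
    proof (rule always_eventually, rule allI)
      fix n
      have "norm (hinner V (s n) (t n) - hinner V (s' n) (t' n))
        \<le> hdist V (s n) (s' n) * hnorm V (t n) + hnorm V (s' n) * hdist V (t n) (t' n)"
        by (rule inner_diff_le) (use c in auto)
      also have "\<dots> \<le> hdist V (s n) (s' n) * B + A * hdist V (t n) (t' n)"
        by (intro add_mono mult_mono) (use A B c norm_nonneg minus_closed in auto)
      finally show "norm (hinner V (s n) (t n) - hinner V (s' n) (t' n)) \<le> hdist V (s n) (s' n) * B + A * hdist V (t n) (t' n)" .
    qed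
    have "(\<lambda>n. hdist V (s n) (s' n) * B + A * hdist V (t n) (t' n)) \<longlonglongrightarrow> 0 * B + A * 0" by (intro tendsto_intros 1 2)
    then show "(\<lambda>n. hdist V (s n) (s' n) * B + A * hdist V (t n) (t' n)) \<longlonglongrightarrow> 0" by simp
  qed
  moreover have "(\<lambda>n. hinner V (s' n) (t' n)) \<longlonglongrightarrow> lim (\<lambda>n. hinner V (s' n) (t' n))"
    using hcauchy_inner_Cauchy[OF s' t'] by (simp add: convergent_LIMSEQ_iff)
  ultimately have "(\<lambda>n. hinner V (s n) (t n)) \<longlonglongrightarrow> lim (\<lambda>n. hinner V (s' n) (t' n))" using tendsto_add by fastforce
  then show ?thesis by (rule limI)
qed

lemma cauchy_class_self: "s \<in> hcauchy V \<Longrightarrow> s \<in> cauchy_class V s" by (auto simp: cauchy_class_def hcauchy_def norm_minus_self)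

lemma null_trans:
  assumes "\<And>n. s n \<in> hcarrier V" "\<And>n. t n \<in> hcarrier V" "\<And>n. r n \<in> hcarrier V"
    and "hnull V s t"
    and "hnull V t r"
  shows "hnull V s r"
proof (rule Lim_null_comparison)
  show "\<forall>\<^sub>F n in sequentially. norm (hdist V (s n) (r n)) \<le> hdist V (s n) (t n) + hdist V (t n) (r n)"
    using assms(1-3) norm_triangle by (auto simp: norm_nonneg minus_closed)
  show "(\<lambda>n. hdist V (s n) (t n) + hdist V (t n) (r n)) \<longlonglongrightarrow> 0" using tendsto_add[OF assms(4,5)] by simp
qed

lemma null_sym:
  assumes "\<And>n. s n \<in> hcarrier V" "\<And>n. t n \<in> hcarrier V"
  shows "hnull V s t \<longleftrightarrow> hnull V t s"
  using norm_minus_commute[OF assms] by simp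

lemma cauchy_class_eq:
  assumes "\<And>n. s n \<in> hcarrier V" "\<And>n. t n \<in> hcarrier V"
    and "hnull V s t"
  shows "cauchy_class V s = cauchy_class V t"
proof -
  have "hnull V s r \<longleftrightarrow> hnull V t r" if "r \<in> hcauchy V" for r
  proof -
    have r: "\<And>n. r n \<in> hcarrier V" using that by (simp add: hcauchy_def)
    have 1: "hnull V t s" using null_sym[of s t] assms by simp
    show ?thesis using null_trans[of s t r] null_trans[of t s r] assms 1 r by auto
  qed
  then show ?thesis unfolding cauchy_class_def by blast
qed

text \<open>The operations of the completion are defined by a choice of representatives; this rule lets
  any representative take its place.\<close>

lemma some_elem_class:
  assumes "s \<in> hcauchy V"
  shows "some_elem (cauchy_class V s) \<in> hcauchy V"
    and "(\<lambda>n. hdist V (s n) (some_elem (cauchy_class V s) n)) \<longlonglongrightarrow> 0"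
proof -
  have "some_elem (cauchy_class V s) \<in> cauchy_class V s" by (rule some_elem_nonempty) (use cauchy_class_self[OF assms] in auto)
  then show "some_elem (cauchy_class V s) \<in> hcauchy V" "(\<lambda>n. hdist V (s n) (some_elem (cauchy_class V s) n)) \<longlonglongrightarrow> 0"
    by (auto simp: cauchy_class_def)
qed

lemma completion_carrier: "hcarrier \<C> = cauchy_class V ` hcauchy V" by (simp add: completion_def)

lemma completion_carrierE:
  assumes "X \<in> hcarrier \<C>"
  obtains s where "s \<in> hcauchy V" "X = cauchy_class V s"
  using assms by (auto simp: completion_def)

lemma completion_carrierI: "s \<in> hcauchy V \<Longrightarrow> cauchy_class V s \<in> hcarrier \<C>" by (auto simp: completion_def)

lemma completion_inner:
  assumes s: "s \<in> hcauchy V" and t: "t \<in> hcauchy V"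
  shows "hinner \<C> (cauchy_class V s) (cauchy_class V t) = lim (\<lambda>n. hinner V (s n) (t n))"
  unfolding completion_def using inner_tendsto_cong[OF s t some_elem_class(1)[OF s] some_elem_class(1)[OF t]
      some_elem_class(2)[OF s] some_elem_class(2)[OF t]] by simp

lemma completion_inner_LIMSEQ:
  assumes "s \<in> hcauchy V" and "t \<in> hcauchy V"
  shows "(\<lambda>n. hinner V (s n) (t n)) \<longlonglongrightarrow> hinner \<C> (cauchy_class V s) (cauchy_class V t)"
  using hcauchy_inner_Cauchy[OF assms] completion_inner[OF assms] by (simp add: convergent_LIMSEQ_iff)

lemma completion_add:
  assumes s: "s \<in> hcauchy V" and t: "t \<in> hcauchy V"
  shows "hadd \<C> (cauchy_class V s) (cauchy_class V t) = cauchy_class V (\<lambda>n. hadd V (s n) (t n))"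
proof -
  let ?s = "some_elem (cauchy_class V s)" and ?t = "some_elem (cauchy_class V t)"
  have c: "s n \<in> hcarrier V" "t n \<in> hcarrier V" "?s n \<in> hcarrier V" "?t n \<in> hcarrier V" for n
    using s t some_elem_class(1)[OF s] some_elem_class(1)[OF t] by (auto simp: hcauchy_def)
  have "(\<lambda>n. hdist V (hadd V (s n) (t n)) (hadd V (?s n) (?t n))) \<longlonglongrightarrow> 0"
  proof (rule Lim_null_comparison)
    show "\<forall>\<^sub>F n in sequentially. norm (hdist V (hadd V (s n) (t n)) (hadd V (?s n) (?t n))) \<le>
       hdist V (s n) (?s n) + hdist V (t n) (?t n)"
      using c norm_add_diff_le by (auto simp: norm_nonneg closed)
    show "(\<lambda>n. hdist V (s n) (?s n) + hdist V (t n) (?t n)) \<longlonglongrightarrow> 0"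
      using tendsto_add[OF some_elem_class(2)[OF s] some_elem_class(2)[OF t]] by simp
  qed
  then have "cauchy_class V (\<lambda>n. hadd V (s n) (t n)) = cauchy_class V (\<lambda>n. hadd V (?s n) (?t n))"
    using c by (intro cauchy_class_eq) (auto simp: closed)
  then show ?thesis by (simp add: completion_def)
qed

lemma completion_scale:
  assumes s: "s \<in> hcauchy V"
  shows "hscale \<C> a (cauchy_class V s) = cauchy_class V (\<lambda>n. hscale V a (s n))"
proof -
  let ?s = "some_elem (cauchy_class V s)"
  have c: "s n \<in> hcarrier V" "?s n \<in> hcarrier V" for n using s some_elem_class(1)[OF s] by (auto simp: hcauchy_def)
  have "(\<lambda>n. hdist V (hscale V a (s n)) (hscale V a (?s n))) \<longlonglongrightarrow> 0"
    using tendsto_mult_left[OF some_elem_class(2)[OF s], of "cmod a"] c by (simp add: norm_scale_diff)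
  then have "cauchy_class V (\<lambda>n. hscale V a (s n)) = cauchy_class V (\<lambda>n. hscale V a (?s n))"
    using c by (intro cauchy_class_eq) (auto simp: closed)
  then show ?thesis by (simp add: completion_def)
qed

lemma completion_zero: "hzero \<C> = cauchy_class V (\<lambda>n. hzero V)" by (simp add: completion_def)

lemma completion_minus:
  assumes "s \<in> hcauchy V" "t \<in> hcauchy V"
  shows "hminus \<C> (cauchy_class V s) (cauchy_class V t) = cauchy_class V (\<lambda>n. hminus V (s n) (t n))"
  unfolding hminus_def using assms by (simp add: completion_add completion_scale hcauchy_scale)

lemma hcauchy_in: "s \<in> hcauchy V \<Longrightarrow> s n \<in> hcarrier V" by (simp add: hcauchy_def)

lemma completion_norm_LIMSEQ:
  assumes "s \<in> hcauchy V"
  shows "(\<lambda>n. hnorm V (s n)) \<longlonglongrightarrow> hnorm \<C> (cauchy_class V s)"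
  unfolding hnorm_def by (intro tendsto_intros completion_inner_LIMSEQ assms)

lemma semi_inner_space_completion: "semi_inner_space \<C>"
proof -
  have comm: "hadd \<C> X Y = hadd \<C> Y X" if "X \<in> hcarrier \<C>" "Y \<in> hcarrier \<C>" for X Y
    using that by (elim completion_carrierE) (simp add: completion_add hcauchy_add hcauchy_in add_commute)
  interpret complex_vector_space \<C> by unfold_locales ((rule comm; assumption) |
      (auto elim!: completion_carrierE simp: completion_zero completion_add completion_scale
      completion_carrierI hcauchy_add hcauchy_scale hcauchy_const hcauchy_in closed
      add_assoc add_zero add_uminus scale_add add_scale scale_scale scale_one)[1])+
  show ?thesis
  proof
    fix X Y Z assume "X \<in> hcarrier \<C>" "Y \<in> hcarrier \<C>" "Z \<in> hcarrier \<C>"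
    then obtain s t r where c: "s \<in> hcauchy V" "t \<in> hcauchy V" "r \<in> hcauchy V"
      and X: "X = cauchy_class V s" "Y = cauchy_class V t" "Z = cauchy_class V r"
      by (auto simp: completion_carrier)
    have "(\<lambda>n. hinner V (s n) (r n) + hinner V (t n) (r n)) \<longlonglongrightarrow> hinner \<C> X Z + hinner \<C> Y Z"
      unfolding X by (intro tendsto_intros completion_inner_LIMSEQ c)
    moreover have "(\<lambda>n. hinner V (s n) (r n) + hinner V (t n) (r n)) \<longlonglongrightarrow> hinner \<C> (hadd \<C> X Y) Z"
      using completion_inner_LIMSEQ[OF hcauchy_add[OF c(1,2)] c(3)] c by (simp add: X completion_add hcauchy_in inner_add)
    ultimately show "hinner \<C> (hadd \<C> X Y) Z = hinner \<C> X Z + hinner \<C> Y Z" using LIMSEQ_unique by blast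
  next
    fix X Y a assume "X \<in> hcarrier \<C>" "Y \<in> hcarrier \<C>"
    then obtain s t where c: "s \<in> hcauchy V" "t \<in> hcauchy V"
      and X: "X = cauchy_class V s" "Y = cauchy_class V t"
      by (auto simp: completion_carrier)
    have "(\<lambda>n. a * hinner V (s n) (t n)) \<longlonglongrightarrow> a * hinner \<C> X Y" unfolding X by (intro tendsto_intros completion_inner_LIMSEQ c)
    moreover have "(\<lambda>n. a * hinner V (s n) (t n)) \<longlonglongrightarrow> hinner \<C> (hscale \<C> a X) Y"
      using completion_inner_LIMSEQ[OF hcauchy_scale[OF c(1)] c(2)] c by (simp add: X completion_scale hcauchy_in inner_scale)
    ultimately show "hinner \<C> (hscale \<C> a X) Y = a * hinner \<C> X Y" using LIMSEQ_unique by blast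
    have "(\<lambda>n. cnj (hinner V (t n) (s n))) \<longlonglongrightarrow> cnj (hinner \<C> Y X)" unfolding X by (intro tendsto_intros completion_inner_LIMSEQ c)
    moreover have "(\<lambda>n. cnj (hinner V (t n) (s n))) \<longlonglongrightarrow> hinner \<C> X Y"
      using completion_inner_LIMSEQ[OF c] inner_commute[OF hcauchy_in[OF c(1)] hcauchy_in[OF c(2)]] by (simp add: X)
    ultimately show "hinner \<C> X Y = cnj (hinner \<C> Y X)" using LIMSEQ_unique by blast
  next
    fix X assume "X \<in> hcarrier \<C>"
    then obtain s where c: "s \<in> hcauchy V" and X: "X = cauchy_class V s" by (auto simp: completion_carrier)
    show "0 \<le> Re (hinner \<C> X X)" unfolding X by (rule LIMSEQ_le_const[OF tendsto_Re[OF completion_inner_LIMSEQ[OF c c]]])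
        (use c in \<open>auto simp: inner_nonneg hcauchy_in\<close>)
  qed
qed

lemma embed_closed: "v \<in> hcarrier V \<Longrightarrow> completion_embed V v \<in> hcarrier \<C>"
  by (simp add: completion_embed_def completion_carrierI hcauchy_const)

lemma embed_inner: "\<lbrakk>v \<in> hcarrier V; w \<in> hcarrier V\<rbrakk> \<Longrightarrow> hinner \<C> (completion_embed V v) (completion_embed V w) = hinner V v w"
  by (simp add: completion_embed_def completion_inner hcauchy_const limI)

lemma embed_add: "\<lbrakk>v \<in> hcarrier V; w \<in> hcarrier V\<rbrakk>
    \<Longrightarrow> completion_embed V (hadd V v w) = hadd \<C> (completion_embed V v) (completion_embed V w)"
  by (simp add: completion_embed_def completion_add hcauchy_const)

lemma embed_scale: "v \<in> hcarrier V \<Longrightarrow> completion_embed V (hscale V a v) = hscale \<C> a (completion_embed V v)"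
  by (simp add: completion_embed_def completion_scale hcauchy_const)

lemma embed_zero: "completion_embed V (hzero V) = hzero \<C>" by (simp add: completion_embed_def completion_zero)

lemma embed_minus: "\<lbrakk>v \<in> hcarrier V; w \<in> hcarrier V\<rbrakk>
    \<Longrightarrow> completion_embed V (hminus V v w) = hminus \<C> (completion_embed V v) (completion_embed V w)"
  by (simp add: hminus_def embed_add embed_scale scale_closed)

lemma embed_norm: "v \<in> hcarrier V \<Longrightarrow> hnorm \<C> (completion_embed V v) = hnorm V v" by (simp add: hnorm_def embed_inner)

lemma embed_LIMSEQ:
  assumes s: "s \<in> hcauchy V"
  shows "(\<lambda>k. hdist \<C> (completion_embed V (s k)) (cauchy_class V s)) \<longlonglongrightarrow> 0"
proof (rule LIMSEQ_I)
  fix e :: real assume "0 < e"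
  then obtain N where N: "\<forall>m\<ge>N. \<forall>n\<ge>N. hdist V (s m) (s n) < e / 2" using hcauchyD[OF s half_gt_zero[OF \<open>0 < e\<close>]] by blast
  have "norm (hdist \<C> (completion_embed V (s k)) (cauchy_class V s) - 0) < e" if k: "k \<ge> N" for k
  proof -
    have sk: "(\<lambda>n. s k) \<in> hcauchy V" using s by (simp add: hcauchy_const hcauchy_in)
    have m: "(\<lambda>n. hminus V (s k) (s n)) \<in> hcauchy V" unfolding hminus_def by (intro hcauchy_add hcauchy_scale s sk)
    have "hdist \<C> (completion_embed V (s k)) (cauchy_class V s) \<le> e / 2" unfolding completion_embed_def completion_minus[OF sk s]
      by (rule LIMSEQ_le_const2[OF completion_norm_LIMSEQ[OF m]]) (use N k in \<open>auto intro!: exI[of _ N] less_imp_le\<close>)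
    moreover have "0 \<le> hdist \<C> (completion_embed V (s k)) (cauchy_class V s)"
      using semi_inner_space.norm_nonneg[OF semi_inner_space_completion]
        semi_inner_space.minus_closed[OF semi_inner_space_completion] s
      by (simp add: embed_closed hcauchy_in completion_carrierI)
    ultimately show ?thesis using \<open>0 < e\<close> by simp
  qed
  then show "\<exists>no. \<forall>n\<ge>no. norm (hdist \<C> (completion_embed V (s n)) (cauchy_class V s) - 0) < e" by blast
qed

lemma embed_dense:
  assumes "X \<in> hcarrier \<C>" "0 < e"
  obtains v where "v \<in> hcarrier V" "hdist \<C> X (completion_embed V v) < e"
proof -
  interpret C: semi_inner_space "completion V" by (rule semi_inner_space_completion)
  obtain s where s: "s \<in> hcauchy V" and X: "X = cauchy_class V s" using completion_carrierE[OF assms(1)] .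
  from LIMSEQ_D[OF embed_LIMSEQ[OF s] assms(2)] obtain k where
    "norm (hdist \<C> (completion_embed V (s k)) (cauchy_class V s) - 0) < e"
    by blast
  then have "hdist \<C> X (completion_embed V (s k)) < e" using C.norm_minus_commute[of X "completion_embed V (s k)"] assms(1) s
    by (simp add: X embed_closed hcauchy_in)
  then show ?thesis using that s hcauchy_in by blast
qed

lemma hilbert_space_completion: "hilbert_space \<C>"
proof -
  interpret C: semi_inner_space "completion V" by (rule semi_inner_space_completion)
  show ?thesis
  proof
    fix X assume "X \<in> hcarrier \<C>" and nz: "X \<noteq> hzero \<C>"
    then obtain s where s: "s \<in> hcauchy V" and X: "X = cauchy_class V s" by (auto simp: completion_carrier)
    show "0 < Re (hinner \<C> X X)"
    proof (rule ccontr)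
      assume "\<not> 0 < Re (hinner \<C> X X)"
      then have "hnorm \<C> X = 0" using C.inner_nonneg[of X] \<open>X \<in> hcarrier \<C>\<close> by (simp add: hnorm_def)
      then have "(\<lambda>n. hnorm V (s n)) \<longlonglongrightarrow> 0" using completion_norm_LIMSEQ[OF s] X by simp
      moreover have "hdist V (s n) (hzero V) = hnorm V (s n)" for n
        by (rule norm_eqI) (use s in \<open>simp add: inner_simps closed hcauchy_in\<close>)
      ultimately have "X = hzero \<C>"
        unfolding X completion_zero by (intro cauchy_class_eq) (use s in \<open>auto simp: hcauchy_in closed\<close>)
      with nz show False by simp
    qed
  next
    fix S assume S: "S \<in> hcauchy \<C>"
    have "\<exists>v. v \<in> hcarrier V \<and> hdist \<C> (S k) (completion_embed V v) < 1 / Suc k" for k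
      using embed_dense[of "S k" "1 / Suc k"] C.hcauchy_in[OF S] by (metis of_nat_0_less_iff zero_less_Suc zero_less_divide_1_iff)
    then obtain t where t: "\<And>k. t k \<in> hcarrier V"
      and close: "\<And>k. hdist \<C> (S k) (completion_embed V (t k)) < 1 / Suc k"
      by metis
    note cl = C.hcauchy_in[OF S] embed_closed[OF t] C.minus_closed
    have lim: "(\<lambda>k. hdist \<C> (S k) (completion_embed V (t k))) \<longlonglongrightarrow> 0" by (rule null_bound[OF _ close]) (use cl C.norm_nonneg in simp)
    have "(\<lambda>k. completion_embed V (t k)) \<in> hcauchy \<C>"
      by (rule C.hcauchy_null[OF S]) (use cl lim C.norm_minus_commute[OF cl(1,2)] in auto)
    then have tC: "t \<in> hcauchy V" using t unfolding hcauchy_def by (simp add: embed_norm closed flip: embed_minus)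
    have "(\<lambda>n. hdist \<C> (S n) (cauchy_class V t)) \<longlonglongrightarrow> 0"
      by (rule C.null_trans[OF _ _ _ lim embed_LIMSEQ[OF tC]]) (use cl completion_carrierI[OF tC] in auto)
    then show "\<exists>v\<in>hcarrier \<C>. (\<lambda>n. hdist \<C> (S n) v) \<longlonglongrightarrow> 0" using completion_carrierI[OF tC] by blast
  qed (rule C.inner_add C.inner_scale C.inner_commute; assumption)+
qed

end

sublocale hilbert_space \<subseteq> semi_inner_space
proof
  fix v assume "v \<in> hcarrier V"
  show "0 \<le> Re (hinner V v v)"
  proof (cases "v = hzero V")
    case True
    have "hzero V = hscale V 0 (hzero V)" by (metis add_uminus add_scale zero_closed scale_one add.right_inverse)
    then show ?thesis using inner_scale[OF zero_closed zero_closed, of 0] True by simp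
  next
    case False
    then show ?thesis using inner_pos \<open>v \<in> hcarrier V\<close> by force
  qed
qed (rule inner_add inner_scale inner_commute; assumption)+

section \<open>Spans, isometries and Gram matrices\<close>

inductive_set hspan :: "'v hilb \<Rightarrow> 'v set \<Rightarrow> 'v set" for V S where zero: "hzero V \<in> hspan V S"
| base: "s \<in> S \<Longrightarrow> s \<in> hspan V S"
| add: "\<lbrakk>v \<in> hspan V S; w \<in> hspan V S\<rbrakk> \<Longrightarrow> hadd V v w \<in> hspan V S"
| scale: "v \<in> hspan V S \<Longrightarrow> hscale V a v \<in> hspan V S"

definition total :: "'v hilb \<Rightarrow> 'v set \<Rightarrow> bool" where "total V S \<longleftrightarrow> (\<forall>v\<in>hcarrier V. \<forall>e>0. \<exists>s\<in>hspan V S. hdist V v s < e)"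

definition inner_preserving :: "'v hilb \<Rightarrow> 'w hilb \<Rightarrow> ('v \<Rightarrow> 'w) \<Rightarrow> bool" where
  "inner_preserving V W T \<longleftrightarrow> (\<forall>v\<in>hcarrier V. T v \<in> hcarrier W) \<and>
     (\<forall>v\<in>hcarrier V. \<forall>w\<in>hcarrier V. hinner W (T v) (T w) = hinner V v w)"

definition orthonormal :: "'v hilb \<Rightarrow> 'v set \<Rightarrow> bool" where
  "orthonormal V E \<longleftrightarrow> (\<forall>e\<in>E. \<forall>e'\<in>E. hinner V e e' = (if e = e' then 1 else 0))"

lemma hspan_mono: "S \<subseteq> S' \<Longrightarrow> hspan V S \<subseteq> hspan V S'"
proof
  fix x assume S: "S \<subseteq> S'" and "x \<in> hspan V S"
  from this(2) show "x \<in> hspan V S'" by induction (use S in \<open>auto intro: hspan.intros\<close>)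
qed

lemma hspan_minimal:
  assumes "S \<subseteq> hspan V S'"
  shows "hspan V S \<subseteq> hspan V S'"
proof
  fix x assume "x \<in> hspan V S"
  then show "x \<in> hspan V S'" by induction (use assms in \<open>auto intro: hspan.intros\<close>)
qed

context semi_inner_space
begin

lemma hspan_closed:
  assumes "S \<subseteq> hcarrier V" "x \<in> hspan V S"
  shows "x \<in> hcarrier V"
  using assms(2) by induction (use assms(1) in \<open>auto simp: closed\<close>)

lemma hspan_minus: "\<lbrakk>v \<in> hspan V S; w \<in> hspan V S\<rbrakk> \<Longrightarrow> hminus V v w \<in> hspan V S" by (simp add: hminus_def hspan.intros)

lemma hspan_orthogonal:
  assumes "S \<subseteq> hcarrier V" "d \<in> hcarrier V" "\<And>s. s \<in> S \<Longrightarrow> hinner V d s = 0" "x \<in> hspan V S"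
  shows "hinner V d x = 0"
  using assms(4) by induction (use assms(1-3) hspan_closed[OF assms(1)] in \<open>auto simp: inner_simps\<close>)

lemma inner_LIMSEQ:
  assumes a: "\<And>n. a n \<in> hcarrier V" "x \<in> hcarrier V" "(\<lambda>n. hdist V (a n) x) \<longlonglongrightarrow> 0"
    and b: "\<And>n. b n \<in> hcarrier V" "y \<in> hcarrier V" "(\<lambda>n. hdist V (b n) y) \<longlonglongrightarrow> 0"
  shows "(\<lambda>n. hinner V (a n) (b n)) \<longlonglongrightarrow> hinner V x y"
proof -
  have h: "a \<in> hcauchy V" "b \<in> hcauchy V" "(\<lambda>n. x) \<in> hcauchy V" "(\<lambda>n. y) \<in> hcauchy V"
    using a b by (auto intro: hcauchyI hcauchy_const)
  have "lim (\<lambda>n. hinner V (a n) (b n)) = lim (\<lambda>n. hinner V x y)" by (rule inner_tendsto_cong[OF h a(3) b(3)])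
  then show ?thesis using hcauchy_inner_Cauchy[OF h(1,2)] by (simp add: convergent_LIMSEQ_iff limI)
qed

lemma total_sequence:
  assumes "total V S" "v \<in> hcarrier V" "S \<subseteq> hcarrier V"
  obtains a where "\<And>n::nat. a n \<in> hspan V S" "(\<lambda>n. hdist V (a n) v) \<longlonglongrightarrow> 0"
proof -
  have "\<exists>s. s \<in> hspan V S \<and> hdist V v s < 1 / Suc n" for n
    using assms unfolding total_def by (meson of_nat_0_less_iff zero_less_Suc zero_less_divide_1_iff)
  then obtain a where a: "\<And>n. a n \<in> hspan V S" "\<And>n. hdist V v (a n) < 1 / Suc n" by metis
  have c: "a n \<in> hcarrier V" for n using hspan_closed[OF assms(3) a(1)] .
  have "(\<lambda>n. hdist V (a n) v) \<longlonglongrightarrow> 0"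
    by (rule null_bound) (use a(2) norm_minus_commute[OF assms(2) c] norm_nonneg[OF minus_closed[OF assms(2) c]] in auto)
  then show ?thesis using that a(1) by blast
qed

lemma total_trans:
  assumes "total V S" "S \<subseteq> hcarrier V" "S' \<subseteq> hcarrier V"
    and "\<And>s e. \<lbrakk>s \<in> S; 0 < e\<rbrakk> \<Longrightarrow> \<exists>t\<in>hspan V S'. hdist V s t < e"
  shows "total V S'"
proof -
  have sp: "\<exists>t\<in>hspan V S'. hdist V s t < e" if "s \<in> hspan V S" "0 < e" for s e using that
  proof (induction arbitrary: e)
    case zero
    then show ?case by (intro bexI[of _ "hzero V"]) (auto intro: hspan.intros simp: norm_minus_self closed)
  next
    case (add v w)
    from add.IH(1)[of "e / 2"] add.IH(2)[of "e / 2"] add.prems obtain v' w' where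
      t: "v' \<in> hspan V S'" "w' \<in> hspan V S'" "hdist V v v' < e / 2" "hdist V w w' < e / 2"
      by auto
    have "hdist V (hadd V v w) (hadd V v' w') < e"
      using norm_add_diff_le[of v w v' w'] t add.hyps hspan_closed[OF assms(2)] hspan_closed[OF assms(3)] by force
    then show ?case using t by (meson hspan.add)
  next
    case (scale v a)
    have "0 < e / (cmod a + 1)" using scale.prems by (smt (verit, best) divide_pos_pos norm_ge_zero)
    from scale.IH[OF this] obtain v' where t: "v' \<in> hspan V S'" "hdist V v v' < e / (cmod a + 1)" by blast
    have c: "v \<in> hcarrier V" "v' \<in> hcarrier V" using t scale.hyps hspan_closed[OF assms(2)] hspan_closed[OF assms(3)] by auto
    have "hdist V v v' * (cmod a + 1) < e" using t(2) by (smt (verit) norm_ge_zero pos_less_divide_eq)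
    then have "hdist V (hscale V a v) (hscale V a v') < e"
      using norm_nonneg[of "hminus V v v'"] c by (simp add: norm_scale_diff closed algebra_simps)
    then show ?case using t by (meson hspan.scale)
  qed (use assms in auto)
  show ?thesis unfolding total_def
  proof (intro ballI allI impI)
    fix v e assume v: "v \<in> hcarrier V" and "(0::real) < e"
    then have "0 < e / 2" by simp
    with assms(1) v obtain s where s: "s \<in> hspan V S" "hdist V v s < e / 2" unfolding total_def by blast
    from sp[OF s(1) \<open>0 < e / 2\<close>] obtain t where t: "t \<in> hspan V S'" "hdist V s t < e / 2" by blast
    have "hdist V v t < e" using norm_triangle[of v t s] s t v hspan_closed[OF assms(2)] hspan_closed[OF assms(3)] by force
    then show "\<exists>s\<in>hspan V S'. hdist V v s < e" using t by blast
  qed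
qed

end

lemma inner_preserving_norm:
  assumes "semi_inner_space V" "semi_inner_space W" "inner_preserving V W T" "v \<in> hcarrier V" "w \<in> hcarrier V"
  shows "hdist W (T v) (T w) = hdist V v w"
proof -
  interpret V: semi_inner_space V by fact
  interpret W: semi_inner_space W by fact
  have T: "T v \<in> hcarrier W" "T w \<in> hcarrier W" using assms by (auto simp: inner_preserving_def)
  have "hinner W (hminus W (T v) (T w)) (hminus W (T v) (T w)) = hinner V (hminus V v w) (hminus V v w)"
    using assms T by (simp add: V.inner_simps W.inner_simps V.closed W.closed) (simp add: inner_preserving_def)
  then show ?thesis by (simp add: hnorm_def)
qed

context hilbert_space
begin

lemma norm_eq_zero: "\<lbrakk>v \<in> hcarrier V; hnorm V v = 0\<rbrakk> \<Longrightarrow> v = hzero V" using inner_pos[of v] by (auto simp: hnorm_def)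

lemma eq_if_norm_minus:
  assumes "v \<in> hcarrier V" "w \<in> hcarrier V" "hdist V v w = 0"
  shows "v = w"
proof -
  have z: "hminus V v w = hzero V" using assms by (intro norm_eq_zero) (auto simp: closed)
  have "hadd V (hminus V v w) w = hadd V v (hadd V (hscale V (-1) w) w)"
    unfolding hminus_def using assms by (simp add: add_assoc closed)
  also have "hadd V (hscale V (-1) w) w = hzero V" using assms by (metis add_commute add_uminus scale_closed)
  also have "hadd V v (hzero V) = v" using assms by (metis add_commute add_zero zero_closed)
  finally show ?thesis using z assms by (simp add: add_zero)
qed

lemma eq_if_norm_small:
  assumes "v \<in> hcarrier V" "w \<in> hcarrier V" "\<And>e. 0 < e \<Longrightarrow> hdist V v w \<le> e"
  shows "v = w"
proof (rule eq_if_norm_minus[OF assms(1,2)])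
  have "hdist V v w \<le> 0" by (rule field_le_epsilon) (use assms(3) in simp)
  then show "hdist V v w = 0" using norm_nonneg[of "hminus V v w"] assms by (simp add: closed)
qed

lemma eq_if_inner_total:
  assumes "total V S" "S \<subseteq> hcarrier V" "v \<in> hcarrier V" "w \<in> hcarrier V"
    and "\<And>s. s \<in> S \<Longrightarrow> hinner V v s = hinner V w s"
  shows "v = w"
proof -
  let ?d = "hminus V v w"
  have d: "?d \<in> hcarrier V" using assms by (simp add: closed)
  obtain a where a: "\<And>n::nat. a n \<in> hspan V S" "(\<lambda>n. hdist V (a n) ?d) \<longlonglongrightarrow> 0" using total_sequence[OF assms(1) d assms(2)] by blast
  have ac: "a n \<in> hcarrier V" for n using hspan_closed[OF assms(2) a(1)] .
  have "hinner V ?d (a n) = 0" for n by (rule hspan_orthogonal[OF assms(2) d _ a(1)]) (use assms in \<open>auto simp: inner_simps\<close>)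
  moreover have "(\<lambda>n. hinner V ?d (a n)) \<longlonglongrightarrow> hinner V ?d ?d"
    by (rule inner_LIMSEQ[OF d d _ ac d a(2)]) (simp add: norm_minus_self d)
  ultimately have "hinner V ?d ?d = 0" by (simp add: LIMSEQ_const_iff)
  then have "hnorm V ?d = 0" by (simp add: hnorm_def)
  then show ?thesis using eq_if_norm_minus assms by blast
qed

text \<open>A functional that is uniformly approximable by inner products with vectors is itself an inner
  product with a vector: the approximating vectors form a Cauchy sequence.  This is used in place
  of the Riesz representation theorem to construct vectors from scalar data.\<close>

lemma weak_vector:
  assumes ap: "\<And>e. 0 < e \<Longrightarrow> \<exists>k\<in>hcarrier V. \<forall>w\<in>hcarrier V. cmod (hinner V k w - l w) \<le> e * hnorm V w"
  shows "\<exists>k\<in>hcarrier V. \<forall>w\<in>hcarrier V. hinner V k w = l w"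
proof -
  have "\<exists>k. k \<in> hcarrier V \<and> (\<forall>w\<in>hcarrier V. cmod (hinner V k w - l w) \<le> (1 / Suc n) * hnorm V w)" for n
    using ap[of "1 / Suc n"] by auto
  then obtain k where k: "\<And>n. k n \<in> hcarrier V"
    and kl: "\<And>n w. w \<in> hcarrier V \<Longrightarrow> cmod (hinner V (k n) w - l w) \<le> (1 / Suc n) * hnorm V w"
    by metis
  have bound: "hdist V (k m) (k n) \<le> 1 / Suc m + 1 / Suc n" for m n
  proof -
    let ?d = "hminus V (k m) (k n)"
    have d: "?d \<in> hcarrier V" using k by (simp add: closed)
    have "(hnorm V ?d)\<^sup>2 = cmod (hinner V ?d ?d)" using d by (simp add: inner_self norm_nonneg del: of_real_power)
    also have "\<dots> = cmod ((hinner V (k m) ?d - l ?d) - (hinner V (k n) ?d - l ?d))" using k d by (simp add: inner_minus)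
    also have "\<dots> \<le> (1 / Suc m) * hnorm V ?d + (1 / Suc n) * hnorm V ?d"
      using kl[OF d] by (meson add_mono norm_triangle_ineq4 order_trans)
    finally have "hnorm V ?d * hnorm V ?d \<le> (1 / Suc m + 1 / Suc n) * hnorm V ?d" by (simp add: power2_eq_square algebra_simps)
    then show ?thesis using norm_nonneg[OF d] by (cases "hnorm V ?d = 0") (auto simp: mult_le_cancel_right)
  qed
  have "k \<in> hcauchy V" unfolding hcauchy_def
  proof (safe)
    fix e :: real assume "0 < e"
    then obtain N where N: "1 / Suc N < e / 2" by (metis half_gt_zero_iff inverse_eq_divide reals_Archimedean)
    have "hdist V (k m) (k n) < e" if "m \<ge> N" "n \<ge> N" for m n
    proof -
      have "1 / real (Suc m) \<le> 1 / Suc N" "1 / real (Suc n) \<le> 1 / Suc N" using that by (auto simp: field_simps)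
      then show ?thesis using bound[of m n] N by linarith
    qed
    then show "\<exists>N. \<forall>m\<ge>N. \<forall>n\<ge>N. hdist V (k m) (k n) < e" by blast
  qed (rule k)
  from complete[OF this] obtain x where x: "x \<in> hcarrier V" "(\<lambda>n. hdist V (k n) x) \<longlonglongrightarrow> 0" by blast
  have "hinner V x w = l w" if w: "w \<in> hcarrier V" for w
  proof -
    have "(\<lambda>n. hinner V (k n) w) \<longlonglongrightarrow> hinner V x w" by (rule inner_LIMSEQ[OF k x w w]) (simp add: norm_minus_self w)
    moreover have "(\<lambda>n. hinner V (k n) w) \<longlonglongrightarrow> l w"
    proof (rule Lim_transform[OF tendsto_const])
      show "(\<lambda>n. hinner V (k n) w - l w) \<longlonglongrightarrow> 0"
      proof (rule Lim_null_comparison[OF always_eventually])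
        show "\<forall>n. norm (hinner V (k n) w - l w) \<le> inverse (Suc n) * hnorm V w" using kl[OF w] by (simp add: inverse_eq_divide)
        show "(\<lambda>n. inverse (Suc n) * hnorm V w) \<longlonglongrightarrow> 0" using tendsto_mult_left_zero[OF LIMSEQ_inverse_real_of_nat] by simp
      qed
    qed
    ultimately show ?thesis using LIMSEQ_unique by blast
  qed
  then show ?thesis using x by blast
qed

lemma norm_le_if_weak:
  assumes "k \<in> hcarrier V" "k' \<in> hcarrier V" "0 \<le> e"
    and "\<And>w. w \<in> hcarrier V \<Longrightarrow> cmod (hinner V k w - hinner V k' w) \<le> e * hnorm V w"
  shows "hdist V k k' \<le> e"
proof -
  let ?d = "hminus V k k'"
  have d: "?d \<in> hcarrier V" using assms by (simp add: closed)
  have "(hnorm V ?d)\<^sup>2 = cmod (hinner V ?d ?d)" using d by (simp add: inner_self norm_nonneg del: of_real_power)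
  also have "\<dots> = cmod (hinner V k ?d - hinner V k' ?d)" using assms d by (simp add: inner_minus)
  also have "\<dots> \<le> e * hnorm V ?d" using assms(4)[OF d] .
  finally show ?thesis using norm_nonneg[OF d] assms(3)
    by (cases "hnorm V ?d = 0") (auto simp: power2_eq_square mult_le_cancel_right)
qed

end

lemma inner_preserving_linear:
  assumes "semi_inner_space V" "hilbert_space W" "inner_preserving V W T"
  shows "\<And>v w. \<lbrakk>v \<in> hcarrier V; w \<in> hcarrier V\<rbrakk> \<Longrightarrow> T (hadd V v w) = hadd W (T v) (T w)"
    and "\<And>v a. v \<in> hcarrier V \<Longrightarrow> T (hscale V a v) = hscale W a (T v)"
    and "T (hzero V) = hzero W"
proof -
  interpret V: semi_inner_space V by fact
  interpret W: hilbert_space W by fact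
  have T: "T v \<in> hcarrier W" if "v \<in> hcarrier V" for v using assms that by (auto simp: inner_preserving_def)
  have I: "hinner W (T v) (T w) = hinner V v w" if "v \<in> hcarrier V" "w \<in> hcarrier V" for v w
    using assms that by (auto simp: inner_preserving_def)
  {
    fix v w assume c: "v \<in> hcarrier V" "w \<in> hcarrier V"
    show "T (hadd V v w) = hadd W (T v) (T w)"
    proof (rule W.eq_if_norm_minus)
      show "hdist W (T (hadd V v w)) (hadd W (T v) (T w)) = 0"
        unfolding hnorm_def using c by (simp add: W.inner_simps W.closed T V.closed I V.inner_simps)
    qed (use c in \<open>simp_all add: T V.closed W.closed\<close>)
  next
    fix v a assume c: "v \<in> hcarrier V"
    show "T (hscale V a v) = hscale W a (T v)"
    proof (rule W.eq_if_norm_minus)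
      show "hdist W (T (hscale V a v)) (hscale W a (T v)) = 0"
        unfolding hnorm_def using c by (simp add: W.inner_simps W.closed T V.closed I V.inner_simps)
    qed (use c in \<open>simp_all add: T V.closed W.closed\<close>)
  }
  show "T (hzero V) = hzero W" by (rule W.norm_eq_zero) (simp_all add: T V.closed hnorm_def I V.inner_simps)
qed

lemma hilbert_imp_semi_inner: "hilbert_space V \<Longrightarrow> semi_inner_space V"
proof -
  assume "hilbert_space V"
  then interpret hilbert_space V .
  show ?thesis by unfold_locales
qed

lemma unitary_inner_preserving: "unitary V W T \<Longrightarrow> inner_preserving V W T"
  by (auto simp: unitary_def inner_preserving_def bij_betw_def)

lemma inner_preserving_eq:
  assumes "semi_inner_space V" "hilbert_space W" "inner_preserving V W T" "inner_preserving V W T'"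
    and "total V S" "S \<subseteq> hcarrier V" "\<And>s. s \<in> S \<Longrightarrow> T s = T' s" and v: "v \<in> hcarrier V"
  shows "T v = T' v"
proof -
  interpret V: semi_inner_space V by fact
  interpret W: hilbert_space W by fact
  have Ws: "semi_inner_space W" by unfold_locales
  have T: "T v \<in> hcarrier W" "T' v \<in> hcarrier W" if "v \<in> hcarrier V" for v using assms that by (auto simp: inner_preserving_def)
  have sp: "T s = T' s" if "s \<in> hspan V S" for s using that
  proof induction
    case zero
    show ?case using inner_preserving_linear(3)[OF assms(1,2)] assms(3,4) by metis
  next
    case (add v w)
    then show ?case using inner_preserving_linear(1)[OF assms(1,2)] assms(3,4) V.hspan_closed[OF assms(6)] by metis
  next
    case (scale v a)
    then show ?case using inner_preserving_linear(2)[OF assms(1,2)] assms(3,4) V.hspan_closed[OF assms(6)] by metis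
  qed (rule assms)
  show ?thesis
  proof (rule W.eq_if_norm_small)
    fix e :: real assume "0 < e"
    then obtain s where s: "s \<in> hspan V S" "hdist V v s < e / 2" using assms(5) v unfolding total_def by (meson half_gt_zero)
    have sc: "s \<in> hcarrier V" using s V.hspan_closed[OF assms(6)] by blast
    have "hdist W (T v) (T' v) \<le> hdist W (T v) (T s) + hdist W (T s) (T' v)" by (rule W.norm_triangle) (use T v sc in auto)
    also have "hdist W (T s) (T' v) = hdist W (T' v) (T' s)"
      using W.norm_minus_commute[of "T s" "T' v"] sp[OF s(1)] T v sc by simp
    finally show "hdist W (T v) (T' v) \<le> e"
      using inner_preserving_norm[OF assms(1) Ws assms(3) v sc] inner_preserving_norm[OF assms(1) Ws assms(4) v sc] s by simp
  qed (use T v in auto)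
qed

inductive_set lin_graph :: "'v hilb \<Rightarrow> 'w hilb \<Rightarrow> ('v \<times> 'w) set \<Rightarrow> ('v \<times> 'w) set" for Y Z P where
  zero: "(hzero Y, hzero Z) \<in> lin_graph Y Z P"
| base: "p \<in> P \<Longrightarrow> p \<in> lin_graph Y Z P"
| add: "\<lbrakk>(a, b) \<in> lin_graph Y Z P; (a', b') \<in> lin_graph Y Z P\<rbrakk> \<Longrightarrow> (hadd Y a a', hadd Z b b') \<in> lin_graph Y Z P"
| scale: "(a, b) \<in> lin_graph Y Z P \<Longrightarrow> (hscale Y c a, hscale Z c b) \<in> lin_graph Y Z P"

text \<open>The closure of the linear relation spanned by the pairs of corresponding vectors is the
  graph of the unitary.  It is symmetric in the two spaces, so totality on one side gives
  existence of values and totality on the other side surjectivity.\<close>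

lemma isometry_of_gram:
  assumes Y: "hilbert_space Y" and Z: "hilbert_space Z"
    and y: "\<And>i. i \<in> I \<Longrightarrow> y i \<in> hcarrier Y" and z: "\<And>i. i \<in> I \<Longrightarrow> z i \<in> hcarrier Z"
    and gram: "\<And>i j. \<lbrakk>i \<in> I; j \<in> I\<rbrakk> \<Longrightarrow> hinner Y (y i) (y j) = hinner Z (z i) (z j)"
    and ty: "total Y (y ` I)"
  shows "\<exists>T. inner_preserving Y Z T \<and> (\<forall>i\<in>I. T (y i) = z i)"
proof -
  interpret Y: hilbert_space Y by fact
  interpret Z: hilbert_space Z by fact
  define \<Gamma> where "\<Gamma> = lin_graph Y Z ((\<lambda>i. (y i, z i)) ` I)"
  have \<Gamma>c: "fst p \<in> hcarrier Y \<and> snd p \<in> hcarrier Z" if "p \<in> \<Gamma>" for p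
    using that unfolding \<Gamma>_def by induction (auto simp: Y.closed Z.closed y z)
  have \<Gamma>1: "hinner Y (fst p) (y i) = hinner Z (snd p) (z i)" if "p \<in> \<Gamma>" "i \<in> I" for p i using that(1) unfolding \<Gamma>_def
  proof induction
    case (add a b a' b')
    then show ?case using \<Gamma>c[of "(a, b)"] \<Gamma>c[of "(a', b')"] that(2) by (simp add: \<Gamma>_def Y.inner_simps Z.inner_simps y z)
  next
    case (scale a b c)
    then show ?case using \<Gamma>c[of "(a, b)"] that(2) by (simp add: \<Gamma>_def Y.inner_simps Z.inner_simps y z)
  qed (use that(2) gram in \<open>auto simp: Y.inner_simps Z.inner_simps y z\<close>)
  have \<Gamma>2: "hinner Y (fst p) (fst q) = hinner Z (snd p) (snd q)" if "p \<in> \<Gamma>" "q \<in> \<Gamma>" for p q using that(2) unfolding \<Gamma>_def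
  proof induction
    case (add a b a' b')
    then show ?case using \<Gamma>c[of "(a, b)"] \<Gamma>c[of "(a', b')"] \<Gamma>c[OF that(1)] by (simp add: \<Gamma>_def Y.inner_simps Z.inner_simps)
  next
    case (scale a b c)
    then show ?case using \<Gamma>c[of "(a, b)"] \<Gamma>c[OF that(1)] by (simp add: \<Gamma>_def Y.inner_simps Z.inner_simps)
  qed (use \<Gamma>1[OF that(1)] \<Gamma>c[OF that(1)] in \<open>auto simp: Y.inner_simps Z.inner_simps\<close>)
  have left: "\<exists>b. (a, b) \<in> \<Gamma>" if "a \<in> hspan Y (y ` I)" for a
    using that unfolding \<Gamma>_def by induction (blast intro: lin_graph.intros)+
  have dist: "hdist Y (fst p) (fst q) = hdist Z (snd p) (snd q)" if "p \<in> \<Gamma>" "q \<in> \<Gamma>" for p q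
    unfolding hnorm_def using \<Gamma>c that \<Gamma>2 by (simp add: Y.inner_simps Z.inner_simps Y.closed Z.closed)
  define R where "R a b \<longleftrightarrow> a \<in> hcarrier Y \<and> b \<in> hcarrier Z \<and> (\<exists>g. (\<forall>n. g n \<in> \<Gamma>) \<and>
     (\<lambda>n::nat. hdist Y (fst (g n)) a) \<longlonglongrightarrow> 0 \<and> (\<lambda>n. hdist Z (snd (g n)) b) \<longlonglongrightarrow> 0)" for a b
  have Rinner: "hinner Y a a' = hinner Z b b'" if "R a b" "R a' b'" for a b a' b'
  proof -
    from that obtain g g' where c: "a \<in> hcarrier Y" "a' \<in> hcarrier Y" "b \<in> hcarrier Z" "b' \<in> hcarrier Z"
      and g: "\<And>n::nat. g n \<in> \<Gamma>" "\<And>n::nat. g' n \<in> \<Gamma>" "(\<lambda>n. hdist Y (fst (g n)) a) \<longlonglongrightarrow> 0"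
        "(\<lambda>n. hdist Z (snd (g n)) b) \<longlonglongrightarrow> 0" "(\<lambda>n. hdist Y (fst (g' n)) a') \<longlonglongrightarrow> 0"
        "(\<lambda>n. hdist Z (snd (g' n)) b') \<longlonglongrightarrow> 0"
      unfolding R_def by blast
    have "(\<lambda>n. hinner Y (fst (g n)) (fst (g' n))) \<longlonglongrightarrow> hinner Y a a'" by (rule Y.inner_LIMSEQ) (use \<Gamma>c g c in auto)
    moreover have "(\<lambda>n. hinner Z (snd (g n)) (snd (g' n))) \<longlonglongrightarrow> hinner Z b b'" by (rule Z.inner_LIMSEQ) (use \<Gamma>c g c in auto)
    moreover have "hinner Y (fst (g n)) (fst (g' n)) = hinner Z (snd (g n)) (snd (g' n))" for n using \<Gamma>2 g by blast
    ultimately show ?thesis using LIMSEQ_unique by simp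
  qed
  have Rleft: "\<exists>b. R a b" if a: "a \<in> hcarrier Y" for a
  proof -
    obtain s where s: "\<And>n::nat. s n \<in> hspan Y (y ` I)" "(\<lambda>n. hdist Y (s n) a) \<longlonglongrightarrow> 0"
      by (rule Y.total_sequence[OF ty a]) (use y in auto)
    from left[OF s(1)] obtain t where g: "\<And>n. (s n, t n) \<in> \<Gamma>" by metis
    have "s \<in> hcauchy Y" by (rule Y.hcauchyI[OF a _ s(2)]) (use \<Gamma>c[OF g] in simp)
    then have "t \<in> hcauchy Z" using \<Gamma>c[OF g] dist[OF g g] unfolding hcauchy_def by simp
    then obtain b where "b \<in> hcarrier Z" "(\<lambda>n. hdist Z (t n) b) \<longlonglongrightarrow> 0" using Z.complete by blast
    then have "R a b" unfolding R_def using a s(2) g by (intro conjI exI[of _ "\<lambda>n. (s n, t n)"]) auto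
    then show ?thesis ..
  qed
  have Rc: "a \<in> hcarrier Y" "b \<in> hcarrier Z" if "R a b" for a b using that by (auto simp: R_def)
  have Rfun: "b = b'" if "R a b" "R a b'" for a b b'
  proof (rule Z.eq_if_norm_minus)
    show "hdist Z b b' = 0"
      unfolding hnorm_def using Rc that Rinner[OF that] Rinner[OF that(1) that(1)] Rinner[OF that(2) that(2)]
        Rinner[OF that(2) that(1)]
      by (simp add: Z.inner_simps Z.closed)
  qed (use Rc that in auto)
  define T where "T a = (SOME b. R a b)" for a
  have RT: "R a (T a)" if "a \<in> hcarrier Y" for a unfolding T_def using someI_ex[OF Rleft[OF that]] .
  have ip: "inner_preserving Y Z T" unfolding inner_preserving_def using RT Rc Rinner by metis
  have "T (y i) = z i" if i: "i \<in> I" for i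
  proof (rule Rfun)
    show "R (y i) (T (y i))" using RT y i by blast
    show "R (y i) (z i)" unfolding R_def using y z i by (intro conjI exI[of _ "\<lambda>n. (y i, z i)"])
        (auto simp: \<Gamma>_def Y.norm_minus_self Z.norm_minus_self intro: lin_graph.base)
  qed
  with ip show ?thesis by blast
qed

lemma unitaryI:
  assumes "hilbert_space V" "hilbert_space W" "inner_preserving V W T"
    and surj: "\<And>w. w \<in> hcarrier W \<Longrightarrow> \<exists>v\<in>hcarrier V. T v = w"
  shows "unitary V W T"
proof -
  interpret V: hilbert_space V by fact
  interpret W: hilbert_space W by fact
  note Vs = hilbert_imp_semi_inner[OF assms(1)] and Ws = hilbert_imp_semi_inner[OF assms(2)]
  have "inj_on T (hcarrier V)"
  proof (rule inj_onI)
    fix v w assume v: "v \<in> hcarrier V" and w: "w \<in> hcarrier V" and eq: "T v = T w"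
    have "T w \<in> hcarrier W" using assms(3) w by (simp add: inner_preserving_def)
    then have "hdist V v w = 0" using inner_preserving_norm[OF Vs Ws assms(3) v w] eq W.norm_minus_self by simp
    then show "v = w" by (rule V.eq_if_norm_minus[OF v w])
  qed
  moreover have "T ` hcarrier V = hcarrier W" using surj assms(3) by (auto simp: inner_preserving_def)
  ultimately show ?thesis unfolding unitary_def bij_betw_def
    using inner_preserving_linear[OF Vs assms(2,3)] assms(3) by (auto simp: inner_preserving_def)
qed

lemma unitary_of_gram:
  assumes Y: "hilbert_space Y" and Z: "hilbert_space Z"
    and y: "\<And>i. i \<in> I \<Longrightarrow> y i \<in> hcarrier Y" and z: "\<And>i. i \<in> I \<Longrightarrow> z i \<in> hcarrier Z"
    and gram: "\<And>i j. \<lbrakk>i \<in> I; j \<in> I\<rbrakk> \<Longrightarrow> hinner Y (y i) (y j) = hinner Z (z i) (z j)"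
    and ty: "total Y (y ` I)" and tz: "total Z (z ` I)"
  obtains T where "unitary Y Z T" "\<And>i. i \<in> I \<Longrightarrow> T (y i) = z i"
proof -
  obtain T where T: "inner_preserving Y Z T" "\<forall>i\<in>I. T (y i) = z i" using isometry_of_gram[OF Y Z y z gram ty] by blast
  obtain S where S: "inner_preserving Z Y S" "\<forall>i\<in>I. S (z i) = y i" using isometry_of_gram[OF Z Y z y gram[symmetric] tz] by blast
  have "unitary Y Z T"
  proof (rule unitaryI[OF Y Z T(1)])
    fix w assume w: "w \<in> hcarrier Z"
    have "T (S w) = w" by (rule inner_preserving_eq[OF hilbert_imp_semi_inner[OF Z] Z _ _ tz _ _ w, of "\<lambda>w. T (S w)" "\<lambda>w. w"])
        (use T S z in \<open>auto simp: inner_preserving_def\<close>)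
    then show "\<exists>v\<in>hcarrier Y. T v = w" using S(1) w by (auto simp: inner_preserving_def)
  qed
  then show ?thesis using that T(2) by blast
qed

section \<open>Extension of isometries to completions\<close>

text \<open>\<open>L\<close> may take values in a larger space \<open>W'\<close>, of which \<open>W\<close> is a subspace; all that matters is
  that its values can be approximated from \<open>W\<close>.\<close>

lemma completion_map_isometry:
  assumes "semi_inner_space V" "semi_inner_space W'" "semi_inner_space W"
    and W: "W = W'\<lparr>hcarrier := P\<rparr>" "P \<subseteq> hcarrier W'"
    and L: "inner_preserving V W' L"
    and dense: "\<And>v e. \<lbrakk>v \<in> hcarrier V; 0 < e\<rbrakk> \<Longrightarrow> \<exists>p\<in>P. hdist W' (L v) p < e"
  shows "inner_preserving (completion V) (completion W) (completion_map W L)"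
    and "\<And>v w. \<lbrakk>v \<in> hcarrier V; w \<in> P\<rbrakk> \<Longrightarrow>
      hinner (completion W) (completion_map W L (completion_embed V v)) (completion_embed W w) = hinner W' (L v) w"
    and "\<And>v. \<lbrakk>v \<in> hcarrier V; L v \<in> P\<rbrakk> \<Longrightarrow> completion_map W L (completion_embed V v) = completion_embed W (L v)"
proof -
  interpret V: semi_inner_space V by fact
  interpret W': semi_inner_space W' by fact
  interpret W: semi_inner_space W by fact
  have [simp]: "hnorm W = hnorm W'" "hminus W = hminus W'" "hinner W = hinner W'" "hcarrier W = P"
    by (auto simp: W fun_eq_iff hnorm_def hminus_def)
  have Lc: "L v \<in> hcarrier W'" if "v \<in> hcarrier V" for v using L that by (auto simp: inner_preserving_def)
  have Li: "hinner W' (L v) (L w) = hinner V v w" if "v \<in> hcarrier V" "w \<in> hcarrier V" for v w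
    using L that by (auto simp: inner_preserving_def)
  have sub: "hcauchy W \<subseteq> hcauchy W'" using W(2) unfolding hcauchy_def by auto
  have Lcauchy: "(\<lambda>n. L (s n)) \<in> hcauchy W'" if "s \<in> hcauchy V" for s
    using that inner_preserving_norm[OF assms(1,2) L] Lc unfolding hcauchy_def by simp
  have cl: "cauchy_class W t = cauchy_class W t'" if "\<And>n. t n \<in> hcarrier W'" "\<And>n. t' n \<in> hcarrier W'" "hnull W' t t'" for t t'
  proof -
    have "cauchy_class W t = cauchy_class W' t \<inter> hcauchy W" for t using sub by (auto simp: cauchy_class_def)
    then show ?thesis using W'.cauchy_class_eq[OF that] by simp
  qed
  have rep: "\<exists>p\<in>hcauchy W. (\<lambda>n. hdist W' (L (s n)) (p n)) \<longlonglongrightarrow> 0" if s: "s \<in> hcauchy V" for s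
  proof -
    have sc: "s n \<in> hcarrier V" for n using s by (rule V.hcauchy_in)
    have "\<exists>p. p \<in> P \<and> hdist W' (L (s n)) p < 1 / Suc n" for n using dense[OF sc, of "1 / Suc n"] by auto
    then obtain p where p: "\<And>n. p n \<in> P" "\<And>n. hdist W' (L (s n)) (p n) < 1 / Suc n" by metis
    have pc: "p n \<in> hcarrier W'" for n using p W by auto
    have lim: "(\<lambda>n. hdist W' (L (s n)) (p n)) \<longlonglongrightarrow> 0"
      by (rule null_bound[OF _ p(2)]) (use Lc[OF sc] pc W'.norm_nonneg W'.minus_closed in simp)
    have "p \<in> hcauchy W'" by (rule W'.hcauchy_null[OF Lcauchy[OF s] pc]) (use W'.norm_minus_commute[OF pc Lc[OF sc]] lim in simp)
    then have "p \<in> hcauchy W" using p(1) by (simp add: hcauchy_def)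
    then show ?thesis using lim by blast
  qed
  have img: "\<exists>p\<in>hcauchy W. completion_map W L (cauchy_class V s) = cauchy_class W p \<and>
     (\<lambda>n. hdist W' (L (s n)) (p n)) \<longlonglongrightarrow> 0" if s: "s \<in> hcauchy V" for s
  proof -
    let ?s = "some_elem (cauchy_class V s)"
    have sc: "s n \<in> hcarrier V" "?s n \<in> hcarrier V" for n using s V.some_elem_class(1)[OF s] by (auto simp: V.hcauchy_in)
    obtain p where p: "p \<in> hcauchy W" "(\<lambda>n. hdist W' (L (s n)) (p n)) \<longlonglongrightarrow> 0" using rep[OF s] by blast
    have pc: "p n \<in> hcarrier W'" for n using p(1) sub W'.hcauchy_in by blast
    have "(\<lambda>n. hdist W' (L (s n)) (L (?s n))) \<longlonglongrightarrow> 0"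
      using V.some_elem_class(2)[OF s] inner_preserving_norm[OF assms(1,2) L sc(1) sc(2)] by simp
    then have a: "(\<lambda>n. hdist W' (L (?s n)) (L (s n))) \<longlonglongrightarrow> 0" using W'.null_sym[of "\<lambda>n. L (?s n)" "\<lambda>n. L (s n)"] Lc sc by auto
    have "cauchy_class W (\<lambda>n. L (?s n)) = cauchy_class W (\<lambda>n. L (s n))" using Lc sc by (intro cl a) auto
    also have "\<dots> = cauchy_class W p" using Lc sc pc by (intro cl p(2)) auto
    finally show ?thesis unfolding completion_map_def using p by blast
  qed
  show "inner_preserving (completion V) (completion W) (completion_map W L)" unfolding inner_preserving_def
  proof (intro conjI ballI)
    fix X assume "X \<in> hcarrier (completion V)"
    then obtain s where "s \<in> hcauchy V" "X = cauchy_class V s" by (auto simp: V.completion_carrier)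
    then show "completion_map W L X \<in> hcarrier (completion W)" using img W.completion_carrierI by metis
  next
    fix X Y assume "X \<in> hcarrier (completion V)" "Y \<in> hcarrier (completion V)"
    then obtain s t where s: "s \<in> hcauchy V" "t \<in> hcauchy V" and X: "X = cauchy_class V s" "Y = cauchy_class V t"
      by (auto simp: V.completion_carrier)
    obtain p where p: "p \<in> hcauchy W" "completion_map W L X = cauchy_class W p"
      "(\<lambda>n. hdist W' (L (s n)) (p n)) \<longlonglongrightarrow> 0" using img[OF s(1)] X by blast
    obtain q where q: "q \<in> hcauchy W" "completion_map W L Y = cauchy_class W q"
      "(\<lambda>n. hdist W' (L (t n)) (q n)) \<longlonglongrightarrow> 0" using img[OF s(2)] X by blast
    have "hinner (completion W) (completion_map W L X) (completion_map W L Y) = lim (\<lambda>n. hinner W' (p n) (q n))"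
      using W.completion_inner[OF p(1) q(1)] p q by simp
    also have "\<dots> = lim (\<lambda>n. hinner W' (L (s n)) (L (t n)))"
      by (rule W'.inner_tendsto_cong[symmetric]) (use Lcauchy s p q sub in auto)
    also have "\<dots> = hinner (completion V) X Y"
      using V.completion_inner[OF s] X Li V.hcauchy_in[OF s(1)] V.hcauchy_in[OF s(2)] by simp
    finally show "hinner (completion W) (completion_map W L X) (completion_map W L Y) = hinner (completion V) X Y" .
  qed
  {
    fix v w assume v: "v \<in> hcarrier V" and w: "w \<in> P"
    have wc: "w \<in> hcarrier W'" using w W by auto
    obtain p where p: "p \<in> hcauchy W" "completion_map W L (completion_embed V v) = cauchy_class W p"
      "(\<lambda>n. hdist W' (L v) (p n)) \<longlonglongrightarrow> 0"
      using img[OF V.hcauchy_const[OF v]] unfolding completion_embed_def by blast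
    have "hinner (completion W) (completion_map W L (completion_embed V v)) (completion_embed W w) = lim (\<lambda>n. hinner W' (p n) w)"
      unfolding completion_embed_def p(2)[unfolded completion_embed_def]
      using W.completion_inner[OF p(1) W.hcauchy_const] w by simp
    also have "\<dots> = lim (\<lambda>n. hinner W' (L v) w)" by (rule W'.inner_tendsto_cong[symmetric])
        (use p sub Lc v W'.hcauchy_const wc in \<open>auto simp: W'.norm_minus_self\<close>)
    finally show "hinner (completion W) (completion_map W L (completion_embed V v)) (completion_embed W w) = hinner W' (L v) w"
      by (simp add: limI)
  next
    fix v assume v: "v \<in> hcarrier V" and Lv: "L v \<in> P"
    obtain p where p: "p \<in> hcauchy W" "completion_map W L (completion_embed V v) = cauchy_class W p"
      "(\<lambda>n. hdist W' (L v) (p n)) \<longlonglongrightarrow> 0"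
      using img[OF V.hcauchy_const[OF v]] unfolding completion_embed_def by blast
    have pc: "p n \<in> hcarrier W'" for n using p(1) sub W'.hcauchy_in by blast
    show "completion_map W L (completion_embed V v) = completion_embed W (L v)"
      unfolding p(2) unfolding completion_embed_def by (rule cl[symmetric]) (use pc Lc v p in auto)
  }
qed

section \<open>Orthonormal sets\<close>

context hilbert_space
begin

lemma orthonormal_projection:
  assumes "finite E" "E \<subseteq> hcarrier V" "orthonormal V E" "v \<in> hcarrier V"
  shows "\<exists>p\<in>hspan V E. \<forall>e\<in>E. hinner V (hminus V v p) e = 0"
  using assms(1-3)
proof (induction E)
  case empty
  then show ?case by (auto intro: hspan.zero)
next
  case (insert b E)
  then obtain p where p: "p \<in> hspan V E" "\<forall>e\<in>E. hinner V (hminus V v p) e = 0" by (auto simp: orthonormal_def)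
  have pc: "p \<in> hcarrier V" using hspan_closed[of E p] insert.prems p by auto
  have b: "b \<in> hcarrier V" and bb: "hinner V b b = 1" and be: "\<And>e. e \<in> E \<Longrightarrow> hinner V b e = 0"
    using insert.prems insert.hyps by (auto simp: orthonormal_def)
  let ?p = "hadd V p (hscale V (hinner V (hminus V v p) b) b)"
  have "?p \<in> hspan V (insert b E)" using p(1) hspan_mono[of E "insert b E" V] by (intro hspan.add hspan.scale[OF hspan.base]) auto
  moreover have "hinner V (hminus V v ?p) e = 0" if "e \<in> insert b E" for e
  proof (cases "e = b")
    case True
    then show ?thesis using b pc assms(4) bb by (simp add: inner_simps closed)
  next
    case False
    then have "e \<in> E" "e \<in> hcarrier V" using that insert.prems by auto
    moreover from this have "hinner V v e = hinner V p e" using bspec[OF p(2) \<open>e \<in> E\<close>] pc assms(4) by (simp add: inner_minus)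
    ultimately show ?thesis using b pc assms(4) be by (simp add: inner_simps closed)
  qed
  ultimately show ?case by blast
qed

lemma gram_schmidt:
  assumes "finite A" "A \<subseteq> S" and S: "S \<subseteq> hcarrier V"
    and sub: "hzero V \<in> S" "\<And>v w. \<lbrakk>v \<in> S; w \<in> S\<rbrakk> \<Longrightarrow> hadd V v w \<in> S" "\<And>v a. v \<in> S \<Longrightarrow> hscale V a v \<in> S"
  shows "\<exists>E. finite E \<and> E \<subseteq> S \<and> orthonormal V E \<and> A \<subseteq> hspan V E"
  using assms(1,2)
proof (induction A)
  case empty
  then show ?case by (intro exI[of _ "{}"]) (auto simp: orthonormal_def)
next
  case (insert b A)
  then obtain E where E: "finite E" "E \<subseteq> S" "orthonormal V E" "A \<subseteq> hspan V E" by auto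
  have spS: "x \<in> S" if "x \<in> hspan V E" for x using that by induction (use E sub in auto)
  have b: "b \<in> S" "b \<in> hcarrier V" using insert.prems S by auto
  from orthonormal_projection[OF E(1) _ E(3) b(2)] E(2) S obtain p where
    p: "p \<in> hspan V E" "\<forall>e\<in>E. hinner V (hminus V b p) e = 0" by blast
  let ?d = "hminus V b p"
  have pc: "p \<in> S" "p \<in> hcarrier V" using spS[OF p(1)] S by auto
  have d: "?d \<in> hcarrier V" "?d \<in> S" using b pc sub by (auto simp: hminus_def closed)
  show ?case
  proof (cases "hnorm V ?d = 0")
    case True
    then have "b = p" using eq_if_norm_minus b pc by blast
    then show ?thesis using E p by (intro exI[of _ E]) auto
  next
    case False
    define n where "n = hnorm V ?d"
    define e where "e = hscale V (of_real (1 / n)) ?d"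
    have n0: "n \<noteq> 0" using False by (simp add: n_def)
    have e: "e \<in> S" "e \<in> hcarrier V" using d sub by (auto simp: e_def closed)
    have ee: "hinner V e e = 1" using d n0 inner_self[OF d(1)] by (simp add: e_def inner_simps closed n_def power2_eq_square)
    have ex: "hinner V e x = 0" "hinner V x e = 0" if x: "x \<in> E" for x
    proof -
      have xc: "x \<in> hcarrier V" using E S x by auto
      show "hinner V e x = 0" using p(2) x d xc by (simp add: e_def inner_scale)
      then show "hinner V x e = 0" using inner_commute[OF xc e(2)] by simp
    qed
    have "b = hadd V (hscale V (of_real n) e) p"
    proof (rule eq_if_norm_minus)
      show "hdist V b (hadd V (hscale V (of_real n) e) p) = 0"
        unfolding hnorm_def using b pc d n0 by (simp add: inner_simps closed e_def field_simps)
    qed (use b pc e in \<open>auto simp: closed\<close>)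
    moreover have "hadd V (hscale V (of_real n) e) p \<in> hspan V (insert e E)"
      using p(1) hspan_mono[of E "insert e E" V] by (intro hspan.add hspan.scale[OF hspan.base]) auto
    moreover have "A \<subseteq> hspan V (insert e E)" using E(4) hspan_mono[of E "insert e E"] by auto
    moreover have "orthonormal V (insert e E)" using E(3) ee ex unfolding orthonormal_def by auto
    ultimately show ?thesis using E e by (intro exI[of _ "insert e E"]) auto
  qed
qed

lemma parseval:
  assumes "finite E" "E \<subseteq> hcarrier V" "orthonormal V E" "v \<in> hspan V E" "w \<in> hspan V E"
  shows "hinner V v w = (\<Sum>e\<in>E. hinner V v e * cnj (hinner V w e))"
proof -
  note c = hspan_closed[OF assms(2)]
  have 1: "hinner V v w = (\<Sum>e\<in>E. hinner V v e * cnj (hinner V w e))" if w: "w \<in> E" for w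
  proof -
    have "(\<Sum>e\<in>E. hinner V v e * cnj (hinner V w e)) = (\<Sum>e\<in>E. if e = w then hinner V v e else 0)"
      using assms(3) w by (intro sum.cong) (auto simp: orthonormal_def)
    then show ?thesis using assms(1) w by simp
  qed
  have v: "v \<in> hcarrier V" using c assms by blast
  show ?thesis using assms(5)
  proof induction
    case zero
    have "hinner V (hzero V) e = 0" if "e \<in> E" for e using that assms(2) by (auto simp: inner_zero)
    then show ?case using v by (simp add: inner_zero_right)
  next
    case (base s) then show ?case by (rule 1)
  next
    case (add x y)
    have "hinner V (hadd V x y) e = hinner V x e + hinner V y e" if "e \<in> E" for e
      using that assms(2) c add by (auto simp: inner_add)
    then show ?case using add c v by (simp add: inner_add_right sum.distrib algebra_simps)
  next
    case (scale x a)
    have "hinner V (hscale V a x) e = a * hinner V x e" if "e \<in> E" for e using that assms(2) c scale by (auto simp: inner_scale)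
    then show ?case using scale c v by (simp add: inner_scale_right sum_distrib_left algebra_simps)
  qed
qed

end

section \<open>Hilbert tensor products\<close>

abbreviation "keys \<equiv> Poly_Mapping.keys"
abbreviation "lookup \<equiv> Poly_Mapping.lookup"
abbreviation "single \<equiv> Poly_Mapping.single"

lemma pretensor_simps: "hcarrier (pretensor V W) = {a. keys a \<subseteq> hcarrier V \<times> hcarrier W}"
  "hzero (pretensor V W) = 0" "hadd (pretensor V W) = (+)"
  "hscale (pretensor V W) = (\<lambda>c. Poly_Mapping.map (\<lambda>z. c * z))"
  by (simp_all add: pretensor_def)

lemma lookup_map_mult: "lookup (Poly_Mapping.map (\<lambda>z. c * z) a) k = c * lookup a (k :: 'k) "
  for c :: complex
  by (simp add: map.rep_eq when_def)

lemma pretensor_inner: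
  assumes "finite A" "keys a \<subseteq> A" "finite B" "keys b \<subseteq> B"
  shows "hinner (pretensor V W) a b = (\<Sum>p\<in>A. \<Sum>q\<in>B. lookup a p *
    cnj (lookup b q) * (hinner V (fst p) (fst q) * hinner W (snd p) (snd q)))"
proof -
  have "hinner (pretensor V W) a b = (\<Sum>p\<in>keys a. \<Sum>q\<in>keys b. lookup a p *
    cnj (lookup b q) * (hinner V (fst p) (fst q) * hinner W (snd p) (snd q)))"
    by (simp add: pretensor_def case_prod_beta)
  also have "\<dots> = (\<Sum>p\<in>keys a. \<Sum>q\<in>B. lookup a p * cnj (lookup b q) * (hinner V (fst p) (fst q) * hinner W (snd p) (snd q)))"
    by (intro sum.cong sum.mono_neutral_left refl) (use assms in \<open>auto simp: in_keys_iff\<close>)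
  also have "\<dots> = (\<Sum>p\<in>A. \<Sum>q\<in>B. lookup a p * cnj (lookup b q) * (hinner V (fst p) (fst q) * hinner W (snd p) (snd q)))"
    by (intro sum.mono_neutral_left) (use assms in \<open>auto simp: in_keys_iff\<close>)
  finally show ?thesis .
qed

lemma (in semi_inner_space) gram_nonneg:
  assumes "finite A" "\<And>p. p \<in> A \<Longrightarrow> w p \<in> hcarrier V"
  shows "0 \<le> Re (\<Sum>p\<in>A. \<Sum>q\<in>A. c p * cnj (c q) * hinner V (w p) (w q))"
proof -
  have "\<exists>s\<in>hcarrier V. \<forall>x\<in>hcarrier V. hinner V s x = (\<Sum>p\<in>A. c p * hinner V (w p) x)" using assms
  proof (induction A)
    case empty
    then show ?case by (intro bexI[of _ "hzero V"]) (auto simp: inner_simps closed)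
  next
    case (insert b A)
    then obtain s where s: "s \<in> hcarrier V" "\<forall>x\<in>hcarrier V. hinner V s x = (\<Sum>p\<in>A. c p * hinner V (w p) x)" by auto
    then show ?case using insert by (intro bexI[of _ "hadd V (hscale V (c b) (w b)) s"]) (auto simp: inner_simps closed)
  qed
  then obtain s where s: "s \<in> hcarrier V" "\<And>x. x \<in> hcarrier V \<Longrightarrow> hinner V s x = (\<Sum>p\<in>A. c p * hinner V (w p) x)" by blast
  have "(\<Sum>p\<in>A. \<Sum>q\<in>A. c p * cnj (c q) * hinner V (w p) (w q)) = (\<Sum>p\<in>A. c p * cnj (\<Sum>q\<in>A. c q * hinner V (w q) (w p)))"
  proof (rule sum.cong[OF refl])
    fix p assume p: "p \<in> A"
    have "(\<Sum>q\<in>A. c p * cnj (c q) * hinner V (w p) (w q)) = (\<Sum>q\<in>A. c p * (cnj (c q) * cnj (hinner V (w q) (w p))))"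
      by (intro sum.cong refl) (metis p assms(2) inner_commute mult.assoc)
    then show "(\<Sum>q\<in>A. c p * cnj (c q) * hinner V (w p) (w q)) = c p * cnj (\<Sum>q\<in>A. c q * hinner V (w q) (w p))"
      by (simp add: sum_distrib_left)
  qed
  also have "\<dots> = (\<Sum>p\<in>A. c p * cnj (hinner V s (w p)))" using s assms by simp
  also have "\<dots> = (\<Sum>p\<in>A. c p * hinner V (w p) s)" by (intro sum.cong refl) (metis s(1) assms(2) inner_commute)
  also have "\<dots> = hinner V s s" using s by simp
  finally show ?thesis using inner_nonneg s(1) by simp
qed

text \<open>Positivity is the Schur product theorem: after an orthonormalization of the finitely many left
  factors, the form is a sum of Gram forms of the right factors.\<close>

lemma semi_inner_space_pretensor:
  assumes "hilbert_space V" "hilbert_space W"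
  shows "semi_inner_space (pretensor V W)"
proof -
  interpret V: hilbert_space V by fact
  interpret W: hilbert_space W by fact
  let ?P = "pretensor V W"
  have kadd: "keys (a + b) \<subseteq> keys a \<union> keys b" for a b :: "('a \<times> 'b) \<Rightarrow>\<^sub>0 complex" by (rule keys_add)
  have kscale: "keys (Poly_Mapping.map (\<lambda>z. c * z) a) \<subseteq> keys a" for c and a :: "('a \<times> 'b) \<Rightarrow>\<^sub>0 complex"
    by (auto simp: in_keys_iff lookup_map_mult)
  interpret complex_vector_space ?P
    by unfold_locales (auto simp: pretensor_simps poly_mapping_eq_iff fun_eq_iff lookup_add lookup_map_mult
      algebra_simps dest!: subsetD[OF kadd] subsetD[OF kscale])
  show ?thesis
  proof
    fix a b x :: "('a \<times> 'b) \<Rightarrow>\<^sub>0 complex"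
    let ?A = "keys a \<union> keys b" and ?X = "keys x"
    have "hinner ?P (a + b) x = hinner ?P a x + hinner ?P b x"
      using pretensor_inner[of ?A "a + b" ?X x] pretensor_inner[of ?A a ?X x] pretensor_inner[of ?A b ?X x] kadd[of a b]
      by (simp add: lookup_add sum.distrib[symmetric] algebra_simps)
    then show "hinner ?P (hadd ?P a b) x = hinner ?P a x + hinner ?P b x" by (simp add: pretensor_simps)
  next
    fix a x :: "('a \<times> 'b) \<Rightarrow>\<^sub>0 complex" and c
    let ?A = "keys a" and ?X = "keys x"
    show "hinner ?P (hscale ?P c a) x = c * hinner ?P a x"
      using pretensor_inner[of ?A "hscale ?P c a" ?X x] pretensor_inner[of ?A a ?X x] kscale[of c a]
      by (simp add: pretensor_simps lookup_map_mult sum_distrib_left algebra_simps)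
  next
    fix a b assume a: "a \<in> hcarrier ?P" and b: "b \<in> hcarrier ?P"
    have *: "hinner V (fst p) (fst q) * hinner W (snd p) (snd q) = cnj (hinner V (fst q) (fst p) * hinner W (snd q) (snd p))"
      if "p \<in> keys a" "q \<in> keys b" for p q
    proof -
      have "fst p \<in> hcarrier V" "snd p \<in> hcarrier W" "fst q \<in> hcarrier V" "snd q \<in> hcarrier W"
        using a b that by (auto simp: pretensor_simps)
      then show ?thesis using V.inner_commute[of "fst p" "fst q"] W.inner_commute[of "snd p" "snd q"] by simp
    qed
    have "hinner ?P a b = (\<Sum>p\<in>keys a. \<Sum>q\<in>keys b. lookup a p *
      cnj (lookup b q) * cnj (hinner V (fst q) (fst p) * hinner W (snd q) (snd p)))"
      unfolding pretensor_inner[OF finite_keys subset_refl finite_keys subset_refl] by (intro sum.cong refl) (simp only: *)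
    also have "\<dots> = (\<Sum>q\<in>keys b. \<Sum>p\<in>keys a. lookup a p *
      cnj (lookup b q) * cnj (hinner V (fst q) (fst p) * hinner W (snd q) (snd p)))"
      by (rule sum.swap)
    also have "\<dots> = cnj (hinner ?P b a)" unfolding pretensor_inner[OF finite_keys subset_refl finite_keys subset_refl] cnj_sum
      by (intro sum.cong refl) (simp add: mult.commute)
    finally show "hinner ?P a b = cnj (hinner ?P b a)" .
  next
    fix a assume a: "a \<in> hcarrier ?P"
    let ?K = "keys a"
    have K: "fst p \<in> hcarrier V" "snd p \<in> hcarrier W" if "p \<in> ?K" for p using a that by (auto simp: pretensor_simps)
    have KV: "fst ` ?K \<subseteq> hcarrier V" using K by blast
    obtain E where E: "finite E" "E \<subseteq> hcarrier V" "orthonormal V E" "fst ` ?K \<subseteq> hspan V E"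
      using V.gram_schmidt[OF _ KV subset_refl V.zero_closed V.add_closed V.scale_closed] by auto
    have "hinner ?P a a = (\<Sum>p\<in>?K. \<Sum>q\<in>?K. \<Sum>e\<in>E. (lookup a p * hinner V (fst p) e) *
      cnj (lookup a q * hinner V (fst q) e) * hinner W (snd p) (snd q))"
      unfolding pretensor_inner[OF finite_keys subset_refl finite_keys subset_refl]
    proof (intro sum.cong refl)
      fix p q assume "p \<in> ?K" "q \<in> ?K"
      then have "hinner V (fst p) (fst q) = (\<Sum>e\<in>E. hinner V (fst p) e * cnj (hinner V (fst q) e))"
        using E by (intro V.parseval) auto
      then show "lookup a p * cnj (lookup a q) * (hinner V (fst p) (fst q) * hinner W (snd p) (snd q)) =
        (\<Sum>e\<in>E. (lookup a p * hinner V (fst p) e) * cnj (lookup a q * hinner V (fst q) e) * hinner W (snd p) (snd q))"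
        by (simp add: sum_distrib_left sum_distrib_right algebra_simps)
    qed
    also have "\<dots> = (\<Sum>p\<in>?K. \<Sum>e\<in>E. \<Sum>q\<in>?K. (lookup a p * hinner V (fst p) e) *
      cnj (lookup a q * hinner V (fst q) e) * hinner W (snd p) (snd q))"
      by (intro sum.cong refl sum.swap)
    also have "\<dots> = (\<Sum>e\<in>E. \<Sum>p\<in>?K. \<Sum>q\<in>?K. (lookup a p * hinner V (fst p) e) *
      cnj (lookup a q * hinner V (fst q) e) * hinner W (snd p) (snd q))"
      by (rule sum.swap)
    finally have eq: "hinner ?P a a = \<dots>" .
    show "0 \<le> Re (hinner ?P a a)" by (subst eq, subst Re_sum, rule sum_nonneg, rule W.gram_nonneg) (use K in auto)
  qed
qed

locale hilbert_pair = V: hilbert_space V + W: hilbert_space W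
  for V :: "'v hilb" and W :: "'w hilb"
begin

abbreviation "VW \<equiv> tensor V W"
abbreviation "\<P> \<equiv> pretensor V W"

sublocale P: semi_inner_space "pretensor V W" by (rule semi_inner_space_pretensor) unfold_locales

lemma single_closed: "\<lbrakk>v \<in> hcarrier V; w \<in> hcarrier W\<rbrakk> \<Longrightarrow> single (v, w) c \<in> hcarrier \<P>" by (auto simp: pretensor_simps)

lemma single_inner: "hinner \<P> (single (v, w) c) (single (v', w') d) = c * cnj d * (hinner V v v' * hinner W w w')"
  using pretensor_inner[of "{(v, w)}" "single (v, w) c" "{(v', w')}" "single (v', w') d" V W] by simp

lemma hilbert_space_tensor: "hilbert_space VW" unfolding tensor_def by (rule P.hilbert_space_completion)

sublocale T: hilbert_space "tensor V W" by (rule hilbert_space_tensor)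

lemma tensor_vec_closed: "\<lbrakk>v \<in> hcarrier V; w \<in> hcarrier W\<rbrakk> \<Longrightarrow> tensor_vec V W v w \<in> hcarrier VW"
  by (simp add: tensor_vec_def tensor_def P.embed_closed single_closed)

lemma tensor_inner: "\<lbrakk>v \<in> hcarrier V; w \<in> hcarrier W; v' \<in> hcarrier V; w' \<in> hcarrier W\<rbrakk> \<Longrightarrow>
    hinner VW (tensor_vec V W v w) (tensor_vec V W v' w') = hinner V v v' * hinner W w w'"
  by (simp add: tensor_vec_def tensor_def P.embed_inner single_closed single_inner)

lemma tensor_norm:
  assumes "v \<in> hcarrier V" "w \<in> hcarrier W"
  shows "hnorm VW (tensor_vec V W v w) = hnorm V v * hnorm W w"
proof -
  have "Re (hinner VW (tensor_vec V W v w) (tensor_vec V W v w)) = (hnorm V v * hnorm W w)\<^sup>2"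
    using assms by (simp add: tensor_inner V.inner_self W.inner_self power_mult_distrib flip: of_real_mult)
  then show ?thesis using assms by (simp add: hnorm_def V.inner_nonneg W.inner_nonneg)
qed

lemma tensor_norm_diff:
  assumes "v \<in> hcarrier V" "w \<in> hcarrier W" "v' \<in> hcarrier V" "w' \<in> hcarrier W"
  shows "hdist VW (tensor_vec V W v w) (tensor_vec V W v' w') \<le> hdist V v v' * hnorm W w + hnorm V v' * hdist W w w'"
proof -
  have 1: "hdist VW (tensor_vec V W v w) (tensor_vec V W v' w) = hnorm VW (tensor_vec V W (hminus V v v') w)" by (rule T.norm_eqI)
      (use assms in \<open>simp add: T.inner_simps tensor_vec_closed tensor_inner V.inner_simps V.closed T.closed algebra_simps\<close>)
  have 2: "hdist VW (tensor_vec V W v' w) (tensor_vec V W v' w') = hnorm VW (tensor_vec V W v' (hminus W w w'))"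
    by (rule T.norm_eqI)
      (use assms in \<open>simp add: T.inner_simps tensor_vec_closed tensor_inner W.inner_simps W.closed T.closed algebra_simps\<close>)
  show ?thesis using T.norm_triangle[of "tensor_vec V W v w" "tensor_vec V W v' w'" "tensor_vec V W v' w"] assms 1 2
    by (simp add: tensor_vec_closed tensor_norm V.closed W.closed)
qed

lemma tensor_total: "total VW {tensor_vec V W v w | v w. v \<in> hcarrier V \<and> w \<in> hcarrier W}" (is "total _ ?S") unfolding total_def
proof (intro ballI allI impI)
  have sum: "(\<Sum>p\<in>K. single p (lookup a p)) \<in> {b \<in> hcarrier \<P>. completion_embed \<P> b \<in> hspan VW ?S}"
    if "finite K" "K \<subseteq> hcarrier V \<times> hcarrier W" for K and a :: "('v \<times> 'w) \<Rightarrow>\<^sub>0 complex"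
    using that
  proof (induction K)
    case empty
    then show ?case using P.embed_zero P.zero_closed hspan.zero[of "tensor V W" ?S] by (simp add: pretensor_simps tensor_def)
  next
    case (insert p K)
    obtain v w where p: "p = (v, w)" "v \<in> hcarrier V" "w \<in> hcarrier W" using insert.prems by auto
    define s where "s = (\<Sum>p\<in>K. single p (lookup a p))"
    have s: "s \<in> hcarrier \<P>" "completion_embed \<P> s \<in> hspan VW ?S" using insert unfolding s_def by auto
    have sc: "single p (lookup a p) = hscale \<P> (lookup a p) (single (v, w) 1)"
      by (rule poly_mapping_eqI) (simp add: pretensor_simps lookup_map_mult lookup_single p(1) when_def)
    have "completion_embed \<P> (single p (lookup a p)) \<in> hspan VW ?S"
      unfolding sc P.embed_scale[OF single_closed[OF p(2,3)]] tensor_vec_def[symmetric] tensor_def[symmetric]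
      by (rule hspan.scale[OF hspan.base]) (use p in blast)
    moreover have "single p (lookup a p) \<in> hcarrier \<P>" using p single_closed by blast
    ultimately show ?case using s insert.hyps P.embed_add[of "single p (lookup a p)" s] P.add_closed
      by (auto simp: s_def[symmetric] pretensor_simps(3) tensor_def[symmetric] intro: hspan.add)
  qed
  fix X and e :: real assume "X \<in> hcarrier VW" "0 < e"
  then obtain a where a: "a \<in> hcarrier \<P>" "hdist VW X (completion_embed \<P> a) < e" unfolding tensor_def by (rule P.embed_dense)
  have "a = (\<Sum>p\<in>keys a. single p (lookup a p))"
  proof (rule poly_mapping_eqI)
    fix k
    have "(\<Sum>p\<in>keys a. lookup a p when p = k) = (\<Sum>p\<in>keys a. if k = p then lookup a k else 0)"
      by (intro sum.cong) (auto simp: when_def)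
    then show "lookup a k = lookup (\<Sum>p\<in>keys a. single p (lookup a p)) k" by (simp add: lookup_sum lookup_single in_keys_iff)
  qed
  then have "completion_embed \<P> a \<in> hspan VW ?S" using sum[OF finite_keys, of a a] a(1) by (simp add: pretensor_simps)
  with a(2) show "\<exists>s\<in>hspan VW ?S. hdist VW X s < e" by blast
qed

lemma tensor_approx:
  assumes A: "A \<subseteq> hcarrier V" "\<And>v e. \<lbrakk>v \<in> hcarrier V; 0 < e\<rbrakk> \<Longrightarrow> \<exists>a\<in>A. hdist V v a < e"
    and B: "B \<subseteq> hcarrier W" "\<And>w e. \<lbrakk>w \<in> hcarrier W; 0 < e\<rbrakk> \<Longrightarrow> \<exists>b\<in>B. hdist W w b < e"
    and v: "v \<in> hcarrier V" and w: "w \<in> hcarrier W" and e: "0 < e"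
  shows "\<exists>a\<in>A. \<exists>b\<in>B. hdist V v a * hnorm W w + hnorm V a * hdist W w b < e"
proof -
  have w0: "0 < hnorm W w + 1" using W.norm_nonneg[OF w] by simp
  then have "0 < e / (2 * (hnorm W w + 1))" using e by simp
  from A(2)[OF v this] obtain a where a: "a \<in> A" "hdist V v a < e / (2 * (hnorm W w + 1))" by blast
  have ac: "a \<in> hcarrier V" using a A by blast
  have a0: "0 < hnorm V a + 1" using V.norm_nonneg[OF ac] by simp
  then have "0 < e / (2 * (hnorm V a + 1))" using e by simp
  from B(2)[OF w this] obtain b where b: "b \<in> B" "hdist W w b < e / (2 * (hnorm V a + 1))" by blast
  have "hdist V v a * hnorm W w \<le> hdist V v a * (hnorm W w + 1)"
    using V.norm_nonneg V.minus_closed v ac by (intro mult_left_mono) auto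
  also have "\<dots> < e / 2" using a(2) w0 by (simp add: field_simps)
  finally have 1: "hdist V v a * hnorm W w < e / 2" .
  have "hnorm V a * hdist W w b \<le> (hnorm V a + 1) * hdist W w b"
    using W.norm_nonneg W.minus_closed w b(1) B(1) by (intro mult_right_mono) auto
  also have "\<dots> < e / 2" using b(2) a0 by (simp add: field_simps)
  finally show ?thesis using 1 a(1) b(1) by (intro bexI[of _ a] bexI[of _ b]) auto
qed

lemma tensor_total_dense:
  assumes A: "A \<subseteq> hcarrier V" "\<And>v e. \<lbrakk>v \<in> hcarrier V; 0 < e\<rbrakk> \<Longrightarrow> \<exists>a\<in>A. hdist V v a < e"
    and B: "B \<subseteq> hcarrier W" "\<And>w e. \<lbrakk>w \<in> hcarrier W; 0 < e\<rbrakk> \<Longrightarrow> \<exists>b\<in>B. hdist W w b < e"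
  shows "total VW {tensor_vec V W v w | v w. v \<in> A \<and> w \<in> B}"
proof (rule T.total_trans[OF tensor_total])
  fix s and e :: real assume "s \<in> {tensor_vec V W v w |v w. v \<in> hcarrier V \<and> w \<in> hcarrier W}" and e: "0 < e"
  then obtain v w where s: "s = tensor_vec V W v w" "v \<in> hcarrier V" "w \<in> hcarrier W" by blast
  obtain a b where ab: "a \<in> A" "b \<in> B" "hdist V v a * hnorm W w + hnorm V a * hdist W w b < e"
    using tensor_approx[OF A B s(2,3) e] by blast
  then have "hdist VW s (tensor_vec V W a b) < e" using tensor_norm_diff[OF s(2,3), of a b] A(1) B(1) s(1) by force
  then show "\<exists>t\<in>hspan VW {tensor_vec V W v w |v w. v \<in> A \<and> w \<in> B}. hdist VW s t < e"
    using ab by (auto intro!: bexI[of _ "tensor_vec V W a b"] hspan.base)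
qed (use A B in \<open>auto intro!: tensor_vec_closed\<close>)

end

lemma tensor_op_isometry:
  fixes A :: "'a \<Rightarrow> 'c" and B :: "'b \<Rightarrow> 'd"
  assumes "hilbert_space V1" "hilbert_space W1" "hilbert_space V2" "hilbert_space W2"
    and A: "inner_preserving V1 V2 A" and B: "inner_preserving W1 W2 B"
  shows "inner_preserving (tensor V1 W1) (tensor V2 W2) (tensor_op V2 W2 A B)"
    and "\<And>v w. \<lbrakk>v \<in> hcarrier V1; w \<in> hcarrier W1\<rbrakk> \<Longrightarrow> tensor_op V2 W2 A B (tensor_vec V1 W1 v w) = tensor_vec V2 W2 (A v) (B w)"
proof -
  interpret X: hilbert_pair V1 W1 using assms by (simp add: hilbert_pair_def)
  interpret Y: hilbert_pair V2 W2 using assms by (simp add: hilbert_pair_def)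
  define L where "L a = (\<Sum>(v, w)\<in>keys a. single (A v, B w) (lookup a (v, w)))"
    for a :: "('a \<times> 'b) \<Rightarrow>\<^sub>0 complex"
  have AB: "A v \<in> hcarrier V2" if "v \<in> hcarrier V1" for v using A that by (auto simp: inner_preserving_def)
  have BC: "B v \<in> hcarrier W2" if "v \<in> hcarrier W1" for v using B that by (auto simp: inner_preserving_def)
  let ?Q = "pretensor V2 W2"
  have sumQ: "(\<Sum>p\<in>K. f p) \<in> hcarrier ?Q \<and> (\<forall>x\<in>hcarrier ?Q. hinner ?Q (\<Sum>p\<in>K. f p) x = (\<Sum>p\<in>K. hinner ?Q (f p) x))
     \<and> (\<forall>x\<in>hcarrier ?Q. hinner ?Q x (\<Sum>p\<in>K. f p) = (\<Sum>p\<in>K. hinner ?Q x (f p)))"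
    if "finite K" "\<And>p. p \<in> K \<Longrightarrow> f p \<in> hcarrier ?Q" for K :: "('a \<times> 'b) set" and f
    using that
  proof (induction K)
    case empty
    then show ?case using Y.P.zero_closed Y.P.inner_zero Y.P.inner_zero_right by (simp add: pretensor_simps(2))
  next
    case (insert p K)
    then show ?case using Y.P.add_closed[of "f p" "\<Sum>p\<in>K. f p"] Y.P.inner_add[of "f p" "\<Sum>p\<in>K. f p"]
        Y.P.inner_add_right[of "f p" "\<Sum>p\<in>K. f p"]
      by (simp add: pretensor_simps(3))
  qed
  have f: "single (A (fst p), B (snd p)) (lookup a p) \<in> hcarrier ?Q" if "a \<in> hcarrier (pretensor V1 W1)" "p \<in> keys a" for a p
    using that AB BC by (intro Y.single_closed) (auto simp: pretensor_simps)
  have L': "L a = (\<Sum>p\<in>keys a. single (A (fst p), B (snd p)) (lookup a p))" for a by (simp add: L_def case_prod_beta)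
  have Lc: "L a \<in> hcarrier ?Q" if "a \<in> hcarrier (pretensor V1 W1)" for a
    using sumQ[OF finite_keys[of a] f[OF that]] by (simp add: L')
  have Li: "hinner ?Q (L a) (L b) = hinner (pretensor V1 W1) a b"
    if a: "a \<in> hcarrier (pretensor V1 W1)" and b: "b \<in> hcarrier (pretensor V1 W1)" for a b
  proof -
    have "hinner ?Q (L a) (L b) = (\<Sum>p\<in>keys a. hinner ?Q (single (A (fst p), B (snd p)) (lookup a p)) (L b))"
      using sumQ[OF finite_keys[of a] f[OF a]] Lc[OF b] by (simp add: L'[of a])
    also have "\<dots> = (\<Sum>p\<in>keys a. \<Sum>q\<in>keys b. hinner ?Q (single (A (fst p), B (snd p)) (lookup a p))
          (single (A (fst q), B (snd q)) (lookup b q)))"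
      using sumQ[OF finite_keys[of b] f[OF b]] f[OF a] by (intro sum.cong refl) (simp add: L'[of b])
    also have "\<dots> = (\<Sum>p\<in>keys a. \<Sum>q\<in>keys b. lookup a p *
       cnj (lookup b q) * (hinner V1 (fst p) (fst q) * hinner W1 (snd p) (snd q)))"
    proof (intro sum.cong refl)
      fix p q assume "p \<in> keys a" "q \<in> keys b"
      then have "fst p \<in> hcarrier V1" "snd p \<in> hcarrier W1" "fst q \<in> hcarrier V1" "snd q \<in> hcarrier W1"
        using a b by (auto simp: pretensor_simps)
      then show "hinner ?Q (single (A (fst p), B (snd p)) (lookup a p))
          (single (A (fst q), B (snd q)) (lookup b q)) = lookup a p *
       cnj (lookup b q) * (hinner V1 (fst p) (fst q) * hinner W1 (snd p) (snd q))"
        using A B by (simp add: Y.single_inner inner_preserving_def)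
    qed
    finally show ?thesis using pretensor_inner[of "keys a" a "keys b" b V1 W1] by simp
  qed
  have ip: "inner_preserving (pretensor V1 W1) ?Q L" using Lc Li by (simp add: inner_preserving_def)
  have dense: "\<exists>p\<in>hcarrier ?Q. hdist ?Q (L a) p < e" if "a \<in> hcarrier (pretensor V1 W1)" "0 < e" for a e
    using that Lc Y.P.norm_minus_self by (intro bexI[of _ "L a"]) auto
  have op: "tensor_op V2 W2 A B = completion_map ?Q L" by (simp add: tensor_op_def L_def[abs_def])
  have upd: "?Q = ?Q\<lparr>hcarrier := hcarrier ?Q\<rparr>" by simp
  note * = completion_map_isometry[OF X.P.semi_inner_space_axioms Y.P.semi_inner_space_axioms
      Y.P.semi_inner_space_axioms upd subset_refl ip]
  show "inner_preserving (tensor V1 W1) (tensor V2 W2) (tensor_op V2 W2 A B)" unfolding op tensor_def by (rule *(1)) (rule dense)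
  fix v w assume v: "v \<in> hcarrier V1" and w: "w \<in> hcarrier W1"
  have "L (single (v, w) 1) = single (A v, B w) 1" by (simp add: L_def)
  moreover have "completion_map ?Q L (completion_embed (pretensor V1 W1) (single (v, w) 1))
      = completion_embed ?Q (L (single (v, w) 1))"
    by (rule *(3)) (use dense Lc[OF X.single_closed[OF v w]] X.single_closed[OF v w] in auto)
  ultimately show "tensor_op V2 W2 A B (tensor_vec V1 W1 v w) = tensor_vec V2 W2 (A v) (B w)" unfolding op tensor_vec_def by simp
qed

section \<open>Continuous functions and bump functions\<close>

lemma continuous_map_euclidean_iff_tendsto: "continuous_map X euclidean f \<longleftrightarrow> (\<forall>x\<in>topspace X. (f \<longlongrightarrow> f x) (atin X x))"
  by (simp add: continuous_map_atin)

lemma continuous_map_euclidean_iff_eps: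
  fixes f :: "'x \<Rightarrow> 'b::metric_space"
  shows "continuous_map X euclidean f \<longleftrightarrow> (\<forall>x\<in>topspace X. \<forall>e>0. \<exists>U. openin X U \<and> x \<in> U \<and> (\<forall>y\<in>U. dist (f y) (f x) < e))"
proof
  assume f: "continuous_map X euclidean f"
  show "\<forall>x\<in>topspace X. \<forall>e>0. \<exists>U. openin X U \<and> x \<in> U \<and> (\<forall>y\<in>U. dist (f y) (f x) < e)"
  proof (intro ballI allI impI)
    fix x and e :: real assume x: "x \<in> topspace X" and e: "0 < e"
    have "openin X {y \<in> topspace X. f y \<in> ball (f x) e}" by (rule openin_continuous_map_preimage[OF f]) simp
    moreover have "x \<in> {y \<in> topspace X. f y \<in> ball (f x) e}" using x e by simp
    moreover have "\<forall>y\<in>{y \<in> topspace X. f y \<in> ball (f x) e}. dist (f y) (f x) < e"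
      by (metis (no_types, lifting) dist_commute mem_Collect_eq mem_ball)
    ultimately show "\<exists>U. openin X U \<and> x \<in> U \<and> (\<forall>y\<in>U. dist (f y) (f x) < e)" by blast
  qed
next
  assume f: "\<forall>x\<in>topspace X. \<forall>e>0. \<exists>U. openin X U \<and> x \<in> U \<and> (\<forall>y\<in>U. dist (f y) (f x) < e)"
  show "continuous_map X euclidean f" unfolding continuous_map_euclidean_iff_tendsto tendsto_iff eventually_atin
    using f by (metis (no_types, lifting) DiffD1)
qed

lemma continuous_map_epsE:
  fixes f :: "'x \<Rightarrow> 'b::metric_space"
  assumes "continuous_map X euclidean f" "x \<in> topspace X" "0 < e"
  obtains U where "openin X U" "x \<in> U" "\<And>y. y \<in> U \<Longrightarrow> dist (f y) (f x) < e"
  using assms(1)[unfolded continuous_map_euclidean_iff_eps, rule_format, OF assms(2,3)] by auto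

lemma continuous_map_mult:
  fixes f g :: "'x \<Rightarrow> complex"
  assumes "continuous_map X euclidean f" "continuous_map X euclidean g"
  shows "continuous_map X euclidean (\<lambda>x. f x * g x)"
  using assms by (simp add: continuous_map_euclidean_iff_tendsto tendsto_mult)

lemma continuous_map_of_real: "continuous_map X euclideanreal f \<Longrightarrow> continuous_map X euclidean (\<lambda>x. complex_of_real (f x))"
  by (simp add: continuous_map_euclidean_iff_tendsto tendsto_of_real)

lemma continuous_map_Re: "continuous_map X euclidean f \<Longrightarrow> continuous_map X euclideanreal (\<lambda>x. Re (f x))"
  by (simp add: continuous_map_euclidean_iff_tendsto tendsto_Re)

lemma continuous_map_locally:
  fixes f :: "'x \<Rightarrow> 'b::metric_space"
  assumes "\<And>x. x \<in> topspace X \<Longrightarrow> \<exists>U g. openin X U \<and> x \<in> U \<and> continuous_map X euclidean g \<and> (\<forall>y\<in>U. g y = f y)"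
  shows "continuous_map X euclidean f"
  unfolding continuous_map_euclidean_iff_eps
proof (intro ballI allI impI)
  fix x and e :: real assume x: "x \<in> topspace X" and e: "0 < e"
  then obtain U g where U: "openin X U" "x \<in> U" "continuous_map X euclidean g" "\<forall>y\<in>U. g y = f y" using assms by blast
  obtain V where V: "openin X V" "x \<in> V" "\<And>y. y \<in> V \<Longrightarrow> dist (g y) (g x) < e" using continuous_map_epsE[OF U(3) x e] by metis
  show "\<exists>U. openin X U \<and> x \<in> U \<and> (\<forall>y\<in>U. dist (f y) (f x) < e)"
  proof (intro exI[of _ "U \<inter> V"] conjI ballI)
    fix y assume "y \<in> U \<inter> V"
    then show "dist (f y) (f x) < e" using V(3)[of y] U by auto
  qed (use U V in auto)
qed

lemma bump_function:
  assumes X: "locally_compact_space X" "Hausdorff_space X" and U: "openin X U" "x \<in> U"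
  obtains f :: "'a \<Rightarrow> real" and V K where "continuous_map X euclideanreal f" "\<And>y. 0 \<le> f y" "\<And>y. f y \<le> 1"
    "openin X V" "x \<in> V" "\<And>y. y \<in> V \<Longrightarrow> f y = 1" "compactin X K" "closedin X K" "K \<subseteq> U"
    "\<And>y. y \<in> topspace X \<Longrightarrow> f y \<noteq> 0 \<Longrightarrow> y \<in> K"
proof -
  have "neighbourhood_base_of (\<lambda>C. compactin X C \<and> closedin X C) X"
    using X locally_compact_space_neighbourhood_base_closedin by blast
  from this[unfolded neighbourhood_base_of, rule_format, of U x] U
  obtain W K where W: "openin X W" "x \<in> W" "W \<subseteq> K" "K \<subseteq> U" "compactin X K" "closedin X K" by auto
  have "completely_regular_space X"
    using X locally_compact_regular_imp_completely_regular_space locally_compact_Hausdorff_imp_regular_space by blast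
  moreover have "closedin X (topspace X - W)" "x \<in> topspace X - (topspace X - W)" using W openin_subset[OF U(1)] U(2) by auto
  ultimately obtain g :: "'a \<Rightarrow> real" where g: "continuous_map X (top_of_set {0..1}) g" "g x = 0" "g ` (topspace X - W) \<subseteq> {1}"
    unfolding completely_regular_space_def by blast
  have gc: "continuous_map X euclideanreal g" using g(1) by (simp add: continuous_map_in_subtopology)
  define f where "f y = max 0 (min 1 (2 * (1 - g y)))" for y
  have "continuous_map X euclideanreal f" unfolding f_def using gc by (intro continuous_intros) (auto simp: continuous_map_const)
  moreover define V where "V = {y \<in> topspace X. g y \<in> {..<1/2}}"
  have "openin X V" unfolding V_def by (rule openin_continuous_map_preimage[OF gc]) simp
  moreover have "x \<in> V" using g(2) U(2) openin_subset[OF U(1)] by (auto simp: V_def)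
  moreover have "f y = 1" if "y \<in> V" for y using that by (auto simp: f_def V_def)
  moreover have "y \<in> K" if "y \<in> topspace X" "f y \<noteq> 0" for y
  proof (rule ccontr)
    assume "y \<notin> K"
    then have "g y = 1" using g(3) W that by blast
    then show False using that by (simp add: f_def)
  qed
  moreover have "0 \<le> f y" "f y \<le> 1" for y by (auto simp: f_def)
  ultimately show ?thesis using that[of f V K] W by blast
qed

section \<open>Local approximation of sections\<close>

lemma total_mono: "\<lbrakk>total V S; S \<subseteq> S'\<rbrakk> \<Longrightarrow> total V S'" unfolding total_def using hspan_mono by blast

locale hilbert_family =
  fixes B :: "'g topology" and F :: "'g \<Rightarrow> 'v hilb"
  assumes family: "u \<in> topspace B \<Longrightarrow> hilbert_space (F u)"
begin

abbreviation "sections \<equiv> (\<Pi> u\<in>topspace B. hcarrier (F u))"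

lemma semi: "u \<in> topspace B \<Longrightarrow> semi_inner_space (F u)" by (simp add: family hilbert_imp_semi_inner)

lemmas fam_closed = semi_inner_space.closed[OF semi]
lemmas fam_inner = semi_inner_space.inner_simps[OF semi]
lemmas fam_norm = semi_inner_space.norm_minus_self[OF semi] semi_inner_space.norm_nonneg[OF semi]

lemma la_self:
  assumes "\<xi> \<in> S" "\<xi> \<in> sections"
  shows "locally_approximable B F S \<xi>"
  unfolding locally_approximable_def
proof (intro ballI allI impI)
  fix u and e :: real assume "u \<in> topspace B" "0 < e"
  then show "\<exists>U. openin B U \<and> u \<in> U \<and> (\<exists>\<eta>\<in>S. \<forall>v\<in>U. hdist (F v) (\<xi> v) (\<eta> v) < e)" using assms openin_subset
    by (intro exI[of _ "topspace B"] conjI bexI[of _ \<xi>]) (auto simp: Pi_iff fam_norm)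
qed

lemma la_trans:
  assumes \<xi>: "\<xi> \<in> sections" "locally_approximable B F T \<xi>"
    and S: "S \<subseteq> sections"
    and T: "\<And>t. t \<in> T \<Longrightarrow> t \<in> sections \<and> locally_approximable B F S t"
  shows "locally_approximable B F S \<xi>"
  unfolding locally_approximable_def
proof (intro ballI allI impI)
  fix u and e :: real assume u: "u \<in> topspace B" and "0 < e"
  then have e2: "0 < e / 2" by simp
  then obtain U t where U: "openin B U" "u \<in> U" "t \<in> T"
    and 1: "\<And>v. v \<in> U \<Longrightarrow> hdist (F v) (\<xi> v) (t v) < e / 2"
    using \<xi>(2) u unfolding locally_approximable_def by meson
  obtain U' s where U': "openin B U'" "u \<in> U'" "s \<in> S"
    and 2: "\<And>v. v \<in> U' \<Longrightarrow> hdist (F v) (t v) (s v) < e / 2"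
    using T[OF U(3)] u e2 unfolding locally_approximable_def by meson
  have "hdist (F v) (\<xi> v) (s v) < e" if v: "v \<in> U \<inter> U'" for v
  proof -
    have vB: "v \<in> topspace B" using v U openin_subset by blast
    interpret semi_inner_space "F v" by (rule semi[OF vB])
    have "\<xi> v \<in> hcarrier (F v)" "t v \<in> hcarrier (F v)" "s v \<in> hcarrier (F v)"
      using \<xi>(1) S T[OF U(3)] U'(3) vB by (auto simp: Pi_iff)
    then show ?thesis using norm_triangle[of "\<xi> v" "s v" "t v"] 1[of v] 2[of v] v by simp
  qed
  then show "\<exists>U. openin B U \<and> u \<in> U \<and> (\<exists>\<eta>\<in>S. \<forall>v\<in>U. hdist (F v) (\<xi> v) (\<eta> v) < e)" using U U' by (intro exI[of _ "U \<inter> U'"]) auto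
qed

lemma la_add:
  assumes S: "S \<subseteq> sections" "\<And>s t. \<lbrakk>s \<in> S; t \<in> S\<rbrakk> \<Longrightarrow> (\<lambda>u. hadd (F u) (s u) (t u)) \<in> S"
    and \<xi>: "\<xi> \<in> sections" "locally_approximable B F S \<xi>"
    and \<eta>: "\<eta> \<in> sections" "locally_approximable B F S \<eta>"
  shows "locally_approximable B F S (\<lambda>u. hadd (F u) (\<xi> u) (\<eta> u))"
  unfolding locally_approximable_def
proof (intro ballI allI impI)
  fix u and e :: real assume u: "u \<in> topspace B" and "0 < e"
  then have e2: "0 < e / 2" by simp
  then obtain U t where U: "openin B U" "u \<in> U" "t \<in> S"
    and 1: "\<And>v. v \<in> U \<Longrightarrow> hdist (F v) (\<xi> v) (t v) < e / 2"
    using \<xi>(2) u unfolding locally_approximable_def by meson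
  obtain U' s where U': "openin B U'" "u \<in> U'" "s \<in> S"
    and 2: "\<And>v. v \<in> U' \<Longrightarrow> hdist (F v) (\<eta> v) (s v) < e / 2"
    using \<eta>(2) u e2 unfolding locally_approximable_def by meson
  have "hdist (F v) (hadd (F v) (\<xi> v) (\<eta> v)) (hadd (F v) (t v) (s v)) < e" if v: "v \<in> U \<inter> U'" for v
  proof -
    have vB: "v \<in> topspace B" using v U openin_subset by blast
    interpret semi_inner_space "F v" by (rule semi[OF vB])
    have "\<xi> v \<in> hcarrier (F v)" "\<eta> v \<in> hcarrier (F v)" "t v \<in> hcarrier (F v)" "s v \<in> hcarrier (F v)"
      using \<xi>(1) \<eta>(1) S(1) U(3) U'(3) vB by (auto simp: Pi_iff)
    then show ?thesis using norm_add_diff_le[of "\<xi> v" "\<eta> v" "t v" "s v"] 1[of v] 2[of v] v by simp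
  qed
  then show "\<exists>U. openin B U \<and> u \<in> U \<and> (\<exists>\<zeta>\<in>S. \<forall>v\<in>U. hdist (F v) (hadd (F v) (\<xi> v) (\<eta> v)) (\<zeta> v) < e)"
    using U U' S(2) by (intro exI[of _ "U \<inter> U'"] conjI bexI[of _ "\<lambda>v. hadd (F v) (t v) (s v)"]) auto
qed

lemma la_scale:
  assumes S: "S \<subseteq> sections" "\<And>s. s \<in> S \<Longrightarrow> (\<lambda>u. hscale (F u) a (s u)) \<in> S"
    and \<xi>: "\<xi> \<in> sections" "locally_approximable B F S \<xi>"
  shows "locally_approximable B F S (\<lambda>u. hscale (F u) a (\<xi> u))"
  unfolding locally_approximable_def
proof (intro ballI allI impI)
  fix u and e :: real assume u: "u \<in> topspace B" and "0 < e"
  have a: "0 < cmod a + 1" by (smt (verit) norm_ge_zero)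
  then have "0 < e / (cmod a + 1)" using \<open>0 < e\<close> by simp
  then obtain U t where U: "openin B U" "u \<in> U" "t \<in> S"
    and 1: "\<And>v. v \<in> U \<Longrightarrow> hdist (F v) (\<xi> v) (t v) < e / (cmod a + 1)"
    using \<xi>(2) u unfolding locally_approximable_def by meson
  have "hdist (F v) (hscale (F v) a (\<xi> v)) (hscale (F v) a (t v)) < e" if v: "v \<in> U" for v
  proof -
    have vB: "v \<in> topspace B" using v U openin_subset by blast
    interpret semi_inner_space "F v" by (rule semi[OF vB])
    have c: "\<xi> v \<in> hcarrier (F v)" "t v \<in> hcarrier (F v)" using \<xi>(1) S(1) U(3) vB by (auto simp: Pi_iff)
    have "hdist (F v) (\<xi> v) (t v) * (cmod a + 1) < e" using 1[OF v] a by (simp add: pos_less_divide_eq)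
    moreover have "0 \<le> hdist (F v) (\<xi> v) (t v)" using c by (simp add: norm_nonneg closed)
    ultimately show ?thesis using norm_scale_diff[of "\<xi> v" "t v" a] c by (simp add: algebra_simps)
  qed
  then show "\<exists>U. openin B U \<and> u \<in> U \<and> (\<exists>\<zeta>\<in>S. \<forall>v\<in>U. hdist (F v) (hscale (F v) a (\<xi> v)) (\<zeta> v) < e)"
    using U S(2) by (intro exI[of _ U] conjI bexI[of _ "\<lambda>v. hscale (F v) a (t v)"]) auto
qed

text \<open>Sections that are locally uniformly approximable from a linear space of sections with continuous
  norms and dense values form a continuous Hilbert bundle.\<close>

lemma hilbert_bundle_generated:
  assumes E: "fib E = F" "csect E = {\<xi> \<in> sections. locally_approximable B F S \<xi>}"
    and S: "S \<subseteq> sections" "(\<lambda>u. hzero (F u)) \<in> S"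
    "\<And>s t. \<lbrakk>s \<in> S; t \<in> S\<rbrakk> \<Longrightarrow> (\<lambda>u. hadd (F u) (s u) (t u)) \<in> S"
    "\<And>s a. s \<in> S \<Longrightarrow> (\<lambda>u. hscale (F u) a (s u)) \<in> S"
    and dense: "\<And>u v e. \<lbrakk>u \<in> topspace B; v \<in> hcarrier (F u); 0 < e\<rbrakk> \<Longrightarrow> \<exists>s\<in>S. hdist (F u) (s u) v < e"
    and norm: "\<And>s. s \<in> S \<Longrightarrow> continuous_map B euclideanreal (\<lambda>u. hnorm (F u) (s u))"
  shows "hilbert_bundle B E"
proof (rule hilbert_bundle.intro)
  fix u assume "u \<in> topspace B" then show "hilbert_space (fib E u)" using E family by simp
next
  show "csect E \<subseteq> (\<Pi> u\<in>topspace B. hcarrier (fib E u))" using E by auto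
next
  show "(\<lambda>u. hzero (fib E u)) \<in> csect E" unfolding E using S(1,2) la_self by auto
next
  fix \<xi> \<eta> assume "\<xi> \<in> csect E" "\<eta> \<in> csect E"
  then have c: "\<xi> \<in> sections" "locally_approximable B F S \<xi>" "\<eta> \<in> sections" "locally_approximable B F S \<eta>" by (auto simp: E)
  have "locally_approximable B F S (\<lambda>u. hadd (F u) (\<xi> u) (\<eta> u))" by (rule la_add[OF S(1) _ c]) (rule S(3))
  moreover have "(\<lambda>u. hadd (F u) (\<xi> u) (\<eta> u)) \<in> sections" using c(1,3) by (simp add: Pi_iff fam_closed)
  ultimately show "(\<lambda>u. hadd (fib E u) (\<xi> u) (\<eta> u)) \<in> csect E" by (simp add: E)
next
  fix \<xi> a assume "\<xi> \<in> csect E"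
  then have c: "\<xi> \<in> sections" "locally_approximable B F S \<xi>" by (auto simp: E)
  have "locally_approximable B F S (\<lambda>u. hscale (F u) a (\<xi> u))" by (rule la_scale[OF S(1) _ c]) (rule S(4))
  moreover have "(\<lambda>u. hscale (F u) a (\<xi> u)) \<in> sections" using c(1) by (simp add: Pi_iff fam_closed)
  ultimately show "(\<lambda>u. hscale (fib E u) a (\<xi> u)) \<in> csect E" by (simp add: E)
next
  fix u v and e :: real assume "u \<in> topspace B" "v \<in> hcarrier (fib E u)" "0 < e"
  then obtain s where s: "s \<in> S" "hdist (F u) (s u) v < e" unfolding E using dense[of u v e] by blast
  moreover have "s \<in> csect E" using s(1) S(1) la_self[OF s(1)] by (auto simp: E)
  ultimately show "\<exists>\<xi>\<in>csect E. hdist (fib E u) (\<xi> u) v < e" by (auto simp: E)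
next
  fix \<xi> assume "\<xi> \<in> csect E"
  then have \<xi>: "\<xi> \<in> sections" "locally_approximable B F S \<xi>" by (auto simp: E)
  show "continuous_map B euclideanreal (\<lambda>u. hnorm (fib E u) (\<xi> u))" unfolding E continuous_map_euclidean_iff_eps
  proof (intro ballI allI impI)
    fix u and e :: real assume u: "u \<in> topspace B" and "0 < e"
    then have e3: "0 < e / 3" by simp
    then obtain U s where U: "openin B U" "u \<in> U" "s \<in> S"
      and 1: "\<And>v. v \<in> U \<Longrightarrow> hdist (F v) (\<xi> v) (s v) < e / 3"
      using \<xi>(2) u unfolding locally_approximable_def by meson
    obtain U' where U': "openin B U'" "u \<in> U'" "\<And>v. v \<in> U' \<Longrightarrow> dist (hnorm (F v) (s v)) (hnorm (F u) (s u)) < e / 3"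
      using continuous_map_epsE[OF norm[OF U(3)] u e3] by metis
    have 3: "\<bar>hnorm (F v) (\<xi> v) - hnorm (F v) (s v)\<bar> < e / 3" if "v \<in> U" for v
    proof -
      have vB: "v \<in> topspace B" using that U openin_subset by blast
      interpret semi_inner_space "F v" by (rule semi[OF vB])
      have "\<xi> v \<in> hcarrier (F v)" "s v \<in> hcarrier (F v)" using \<xi>(1) S(1) U(3) vB by (auto simp: Pi_iff)
      then show ?thesis using norm_diff_le 1[OF that] by (meson le_less_trans)
    qed
    have "dist (hnorm (F v) (\<xi> v)) (hnorm (F u) (\<xi> u)) < e" if "v \<in> U \<inter> U'" for v
    proof -
      have "dist (hnorm (F v) (s v)) (hnorm (F u) (s u)) < e / 3" using U' that by blast
      moreover have "v \<in> U" using that by blast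
      ultimately show ?thesis using 3[of v] 3[OF U(2)] unfolding dist_real_def by linarith
    qed
    then show "\<exists>U. openin B U \<and> u \<in> U \<and> (\<forall>v\<in>U. dist (hnorm (F v) (\<xi> v)) (hnorm (F u) (\<xi> u)) < e)"
      using U U' by (intro exI[of _ "U \<inter> U'"]) auto
  qed
next
  fix \<xi> assume "\<xi> \<in> (\<Pi> u\<in>topspace B. hcarrier (fib E u))" "locally_approximable B (fib E) (csect E) \<xi>"
  then show "\<xi> \<in> csect E" unfolding E using la_trans[of \<xi> _ S] S(1) by auto
qed

lemma section_span_closed:
  assumes "S \<subseteq> sections"
  shows "section_span F S \<subseteq> sections"
proof
  fix \<xi> assume "\<xi> \<in> section_span F S"
  then show "\<xi> \<in> sections" by induction (use assms in \<open>auto simp: Pi_iff fam_closed\<close>)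
qed

lemma section_span_inner_continuous:
  assumes S: "S \<subseteq> sections"
    and ic: "\<And>s t. \<lbrakk>s \<in> S; t \<in> S\<rbrakk> \<Longrightarrow> continuous_map B euclidean (\<lambda>u. hinner (F u) (s u) (t u))"
    and \<xi>: "\<xi> \<in> section_span F S" and \<eta>: "\<eta> \<in> section_span F S"
  shows "continuous_map B euclidean (\<lambda>u. hinner (F u) (\<xi> u) (\<eta> u))"
proof -
  have c: "\<xi> u \<in> hcarrier (F u)" if "\<xi> \<in> section_span F S" "u \<in> topspace B" for \<xi> u
    using section_span_closed[OF S] that by (auto simp: Pi_iff)
  have *: "continuous_map B euclidean (\<lambda>u. hinner (F u) (\<xi> u) (t u))" if t: "t \<in> S" for t using \<xi>
  proof induction
    case span_zero
    show ?case by (rule continuous_map_eq[of B euclidean "\<lambda>u. 0"])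
        (use c[OF section_span.span_base[OF t]] in \<open>auto simp: fam_inner\<close>)
  next
    case (span_add x y)
    show ?case by (rule continuous_map_eq[OF continuous_map_add[OF span_add.IH]])
        (use c[OF span_add.hyps(1)] c[OF span_add.hyps(2)] c[OF section_span.span_base[OF t]] in \<open>auto simp: fam_inner\<close>)
  next
    case (span_scale x a)
    show ?case by (rule continuous_map_eq[OF continuous_map_mult[of _ "\<lambda>u. a", OF _ span_scale.IH]])
        (use c[OF span_scale.hyps] c[OF section_span.span_base[OF t]] in \<open>auto simp: fam_inner\<close>)
  qed (use t ic in auto)
  show ?thesis using \<eta>
  proof induction
    case span_zero
    show ?case by (rule continuous_map_eq[of B euclidean "\<lambda>u. 0"]) (use c[OF \<xi>] in \<open>auto simp: fam_inner\<close>)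
  next
    case (span_add x y)
    show ?case by (rule continuous_map_eq[OF continuous_map_add[OF span_add.IH]])
        (use c[OF span_add.hyps(1)] c[OF span_add.hyps(2)] c[OF \<xi>] in \<open>auto simp: fam_inner\<close>)
  next
    case (span_scale x a)
    show ?case by (rule continuous_map_eq[OF continuous_map_mult[of _ "\<lambda>u. cnj a", OF _ span_scale.IH]])
        (use c[OF span_scale.hyps] c[OF \<xi>] in \<open>auto simp: fam_inner\<close>)
  qed (rule *)
qed

lemma section_span_hspan:
  assumes "x \<in> hspan (F u) {s u | s. s \<in> S}"
  shows "\<exists>\<xi>\<in>section_span F S. \<xi> u = x"
  using assms
proof induction
  case zero
  show ?case by (rule bexI[OF _ section_span.span_zero]) simp
next
  case (base s)
  then show ?case using section_span.span_base by blast
next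
  case (add v w)
  then obtain \<xi> \<eta> where "\<xi> \<in> section_span F S" "\<xi> u = v" "\<eta> \<in> section_span F S" "\<eta> u = w" by blast
  then show ?case by (intro bexI[OF _ section_span.span_add[of \<xi> F S \<eta>]]) auto
next
  case (scale v a)
  then obtain \<xi> where "\<xi> \<in> section_span F S" "\<xi> u = v" by blast
  then show ?case by (intro bexI[OF _ section_span.span_scale[of \<xi> F S a]]) auto
qed

lemma hilbert_bundle_generated_sections:
  assumes E: "fib E = F" "csect E = generated_sections B F S"
    and S: "S \<subseteq> sections"
    and tot: "\<And>u. u \<in> topspace B \<Longrightarrow> total (F u) {s u | s. s \<in> S}"
    and ic: "\<And>s t. \<lbrakk>s \<in> S; t \<in> S\<rbrakk> \<Longrightarrow> continuous_map B euclidean (\<lambda>u. hinner (F u) (s u) (t u))"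
  shows "hilbert_bundle B E"
proof (rule hilbert_bundle_generated[of E "section_span F S"])
  show "fib E = F" by fact
  show "csect E = {\<xi> \<in> sections. locally_approximable B F (section_span F S) \<xi>}" by (simp add: E generated_sections_def)
  show "section_span F S \<subseteq> sections" by (rule section_span_closed[OF S])
next
  fix u v and e :: real assume u: "u \<in> topspace B" and v: "v \<in> hcarrier (F u)" and e: "0 < e"
  interpret semi_inner_space "F u" by (rule semi[OF u])
  from tot[OF u] v e obtain x where x: "x \<in> hspan (F u) {s u | s. s \<in> S}" "hdist (F u) v x < e" unfolding total_def by blast
  obtain \<xi> where "\<xi> \<in> section_span F S" "\<xi> u = x" using section_span_hspan[OF x(1)] by blast
  moreover have "x \<in> hcarrier (F u)" by (rule hspan_closed[OF _ x(1)]) (use S u in auto)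
  ultimately show "\<exists>s\<in>section_span F S. hdist (F u) (s u) v < e" using x(2) norm_minus_commute[OF v, of x] by auto
next
  fix s assume s: "s \<in> section_span F S"
  show "continuous_map B euclideanreal (\<lambda>u. hnorm (F u) (s u))" unfolding hnorm_def
    by (rule continuous_map_sqrt) (rule continuous_map_Re[OF section_span_inner_continuous[OF S ic s s]])
qed (auto intro: section_span.intros)

end

section \<open>Continuous Hilbert bundles\<close>

context hilbert_bundle
begin

sublocale hilbert_family B "fib E" by (rule hilbert_family.intro) (rule hilbert)

lemma sect_closed: "\<lbrakk>\<xi> \<in> csect E; u \<in> topspace B\<rbrakk> \<Longrightarrow> \<xi> u \<in> hcarrier (fib E u)" using sect_in by (auto simp: Pi_iff)

lemma values_dense:
  assumes u: "u \<in> topspace B" and v: "v \<in> hcarrier (fib E u)" and e: "0 < e"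
  shows "\<exists>a\<in>(\<lambda>\<xi>. \<xi> u) ` csect E. hdist (fib E u) v a < e"
  using sect_dense[OF u v e] semi_inner_space.norm_minus_commute[OF semi[OF u] v sect_closed[OF _ u]] by auto

lemma sect_minus: "\<lbrakk>\<xi> \<in> csect E; \<eta> \<in> csect E\<rbrakk> \<Longrightarrow> (\<lambda>u. hminus (fib E u) (\<xi> u) (\<eta> u)) \<in> csect E"
  unfolding hminus_def by (rule sect_add[OF _ sect_scale])

lemma sect_cong:
  assumes "\<xi> \<in> csect E" "\<And>u. u \<in> topspace B \<Longrightarrow> \<xi> u = \<eta> u"
  shows "\<eta> \<in> csect E"
proof (rule sect_local)
  show "\<eta> \<in> sections" using assms(2) sect_closed[OF assms(1)] by (metis Pi_I)
  have "locally_approximable B (fib E) (csect E) \<xi>" by (rule la_self) (use assms sect_in in auto)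
  then show "locally_approximable B (fib E) (csect E) \<eta>" unfolding locally_approximable_def
  proof (intro ballI allI impI)
    fix u and e :: real assume u: "u \<in> topspace B" and e: "0 < e"
    assume "\<forall>u\<in>topspace B. \<forall>\<epsilon>>0. \<exists>U. openin B U \<and> u \<in> U \<and> (\<exists>\<zeta>\<in>csect E. \<forall>v\<in>U. hdist (fib E v) (\<xi> v) (\<zeta> v) < \<epsilon>)"
    from this[rule_format, OF u e] obtain U \<zeta> where U: "openin B U" "u \<in> U" "\<zeta> \<in> csect E"
      "\<And>v. v \<in> U \<Longrightarrow> hdist (fib E v) (\<xi> v) (\<zeta> v) < e" by auto
    show "\<exists>U. openin B U \<and> u \<in> U \<and> (\<exists>\<zeta>\<in>csect E. \<forall>v\<in>U. hdist (fib E v) (\<eta> v) (\<zeta> v) < e)"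
    proof (intro exI[of _ U] conjI bexI[of _ \<zeta>] ballI)
      fix v assume "v \<in> U"
      then show "hdist (fib E v) (\<eta> v) (\<zeta> v) < e" using U(4)[of v] assms(2)[of v] openin_subset[OF U(1)] by auto
    qed (use U in auto)
  qed
qed

lemma Re_inner_continuous:
  assumes "\<xi> \<in> csect E" "\<eta> \<in> csect E"
  shows "continuous_map B euclideanreal (\<lambda>u. Re (hinner (fib E u) (\<xi> u) (\<eta> u)))"
proof (rule continuous_map_eq)
  show "continuous_map B euclideanreal (\<lambda>u. (1/2) * ((hnorm (fib E u) (hadd (fib E u) (\<xi> u) (\<eta> u)))\<^sup>2
     - (hnorm (fib E u) (\<xi> u))\<^sup>2 - (hnorm (fib E u) (\<eta> u))\<^sup>2))"
    by (intro continuous_intros sect_norm sect_norm[OF sect_add] assms) simp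
  fix u assume u: "u \<in> topspace B"
  then interpret semi_inner_space "fib E u" by (rule semi)
  show "(1/2) * ((hnorm (fib E u) (hadd (fib E u) (\<xi> u) (\<eta> u)))\<^sup>2
     - (hnorm (fib E u) (\<xi> u))\<^sup>2 - (hnorm (fib E u) (\<eta> u))\<^sup>2) = Re (hinner (fib E u) (\<xi> u) (\<eta> u))"
    using norm_add_sq[of "\<xi> u" "\<eta> u"] sect_closed[OF _ u] assms by simp
qed

lemma inner_continuous:
  assumes "\<xi> \<in> csect E" "\<eta> \<in> csect E"
  shows "continuous_map B euclidean (\<lambda>u. hinner (fib E u) (\<xi> u) (\<eta> u))"
proof (rule continuous_map_eq)
  show "continuous_map B euclidean (\<lambda>u. complex_of_real (Re (hinner (fib E u) (\<xi> u) (\<eta> u)))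
    + \<i> * complex_of_real (Re (hinner (fib E u) (\<xi> u) (hscale (fib E u) \<i> (\<eta> u)))))"
    by (intro continuous_intros continuous_map_mult continuous_map_of_real Re_inner_continuous
        Re_inner_continuous[OF _ sect_scale] assms) simp
  fix u assume u: "u \<in> topspace B"
  then interpret semi_inner_space "fib E u" by (rule semi)
  show "complex_of_real (Re (hinner (fib E u) (\<xi> u) (\<eta> u)))
    + \<i> * complex_of_real (Re (hinner (fib E u) (\<xi> u) (hscale (fib E u) \<i> (\<eta> u)))) = hinner (fib E u) (\<xi> u) (\<eta> u)"
    using sect_closed[OF _ u] assms by (simp add: inner_simps complex_eq_iff)
qed

lemma sect_mult:
  assumes c: "continuous_map B euclidean c" and \<xi>: "\<xi> \<in> csect E"
  shows "(\<lambda>u. hscale (fib E u) (c u) (\<xi> u)) \<in> csect E"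
proof (rule sect_local)
  show "(\<lambda>u. hscale (fib E u) (c u) (\<xi> u)) \<in> sections" using sect_closed[OF \<xi>] by (auto simp: fam_closed)
  show "locally_approximable B (fib E) (csect E) (\<lambda>u. hscale (fib E u) (c u) (\<xi> u))" unfolding locally_approximable_def
  proof (intro ballI allI impI)
    fix u and e :: real assume u: "u \<in> topspace B" and e: "0 < e"
    have "continuous_map B euclideanreal (\<lambda>v. cmod (c v - c u) * hnorm (fib E v) (\<xi> v))"
      by (intro continuous_intros sect_norm \<xi> c) simp
    from continuous_map_epsE[OF this u e] obtain U where U: "openin B U" "u \<in> U" and
      1: "\<And>v. v \<in> U \<Longrightarrow> dist (cmod (c v - c u) * hnorm (fib E v) (\<xi> v)) (cmod (c u - c u) * hnorm (fib E u) (\<xi> u)) < e"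
      by metis
    have "hdist (fib E v) (hscale (fib E v) (c v) (\<xi> v)) (hscale (fib E v) (c u) (\<xi> v)) < e" if "v \<in> U" for v
    proof -
      have vB: "v \<in> topspace B" using that U openin_subset by blast
      interpret semi_inner_space "fib E v" by (rule semi[OF vB])
      show ?thesis using 1[OF that] norm_scale_diff_left[OF sect_closed[OF \<xi> vB]] by simp
    qed
    then show "\<exists>U. openin B U \<and> u \<in> U \<and> (\<exists>\<eta>\<in>csect E. \<forall>v\<in>U. hdist (fib E v) (hscale (fib E v) (c v) (\<xi> v)) (\<eta> v) < e)"
      using U sect_scale[OF \<xi>, of "c u"] by (intro exI[of _ U] conjI bexI[of _ "\<lambda>v. hscale (fib E v) (c u) (\<xi> v)"]) auto
  qed
qed

lemma C0_section_local:
  assumes X: "locally_compact_space B" "Hausdorff_space B" and \<xi>: "\<xi> \<in> csect E" and u: "u \<in> topspace B"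
  obtains \<eta> U where "\<eta> \<in> C0_sections B E" "openin B U" "u \<in> U" "\<And>v. v \<in> U \<Longrightarrow> \<eta> v = \<xi> v"
proof -
  obtain f :: "_ \<Rightarrow> real" and V K where f: "continuous_map B euclideanreal f" "openin B V" "u \<in> V"
    "\<And>y. y \<in> V \<Longrightarrow> f y = 1" "compactin B K" "\<And>y. y \<in> topspace B \<Longrightarrow> f y \<noteq> 0 \<Longrightarrow> y \<in> K"
    by (rule bump_function[OF X openin_topspace u]) auto
  define \<eta> where "\<eta> v = hscale (fib E v) (of_real (f v)) (\<xi> v)" for v
  have \<eta>: "\<eta> \<in> csect E" unfolding \<eta>_def by (intro sect_mult continuous_map_of_real f \<xi>)
  have "compactin B {v \<in> topspace B. e \<le> hnorm (fib E v) (\<eta> v)}" if e: "0 < e" for e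
  proof (rule closed_compactin[OF f(5)])
    show "{v \<in> topspace B. e \<le> hnorm (fib E v) (\<eta> v)} \<subseteq> K"
    proof safe
      fix v assume v: "v \<in> topspace B" "e \<le> hnorm (fib E v) (\<eta> v)"
      interpret semi_inner_space "fib E v" by (rule semi[OF v(1)])
      have "f v \<noteq> 0" using v e norm_scale[OF sect_closed[OF \<xi> v(1)]] by (auto simp: \<eta>_def)
      then show "v \<in> K" using f v by blast
    qed
    have "closedin B {v \<in> topspace B. hnorm (fib E v) (\<eta> v) \<in> {e..}}"
      by (rule closedin_continuous_map_preimage[OF sect_norm[OF \<eta>]]) simp
    then show "closedin B {v \<in> topspace B. e \<le> hnorm (fib E v) (\<eta> v)}" by simp
  qed
  then have "\<eta> \<in> C0_sections B E" using \<eta> by (simp add: C0_sections_def)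
  moreover have "\<eta> v = \<xi> v" if "v \<in> V" for v
  proof -
    have vB: "v \<in> topspace B" using that f openin_subset by blast
    interpret semi_inner_space "fib E v" by (rule semi[OF vB])
    show ?thesis using f(4)[OF that] scale_one sect_closed[OF \<xi> vB] by (simp add: \<eta>_def)
  qed
  ultimately show ?thesis using that f by blast
qed

text \<open>Continuous sections can be constructed weakly, through their inner products, as long as these are
  locally uniformly approximable by inner products with continuous sections.\<close>

lemma weak_section:
  assumes ap: "\<And>u e. \<lbrakk>u \<in> topspace B; 0 < e\<rbrakk> \<Longrightarrow> \<exists>U. openin B U \<and> u \<in> U \<and>
     (\<exists>k\<in>csect E. \<forall>v\<in>U. \<forall>w\<in>hcarrier (fib E v). cmod (hinner (fib E v) (k v) w - l v w) \<le> e * hnorm (fib E v) w)"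
  obtains f where "f \<in> csect E" "\<And>u w. \<lbrakk>u \<in> topspace B; w \<in> hcarrier (fib E u)\<rbrakk> \<Longrightarrow> hinner (fib E u) (f u) w = l u w"
proof -
  have "\<exists>k\<in>hcarrier (fib E u). \<forall>w\<in>hcarrier (fib E u). hinner (fib E u) k w = l u w" if u: "u \<in> topspace B" for u
  proof -
    interpret hilbert_space "fib E u" by (rule hilbert[OF u])
    show ?thesis
    proof (rule weak_vector)
      fix e :: real assume "0 < e"
      from ap[OF u this] show "\<exists>k\<in>hcarrier (fib E u). \<forall>w\<in>hcarrier (fib E u).
          cmod (hinner (fib E u) k w - l u w) \<le> e * hnorm (fib E u) w"
        using sect_closed[OF _ u] by blast
    qed
  qed
  then obtain f where f: "\<And>u. u \<in> topspace B \<Longrightarrow> f u \<in> hcarrier (fib E u)"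
    "\<And>u w. \<lbrakk>u \<in> topspace B; w \<in> hcarrier (fib E u)\<rbrakk> \<Longrightarrow> hinner (fib E u) (f u) w = l u w"
    by metis
  have "f \<in> csect E"
  proof (rule sect_local)
    show "locally_approximable B (fib E) (csect E) f" unfolding locally_approximable_def
    proof (intro ballI allI impI)
      fix u and e :: real assume u: "u \<in> topspace B" and e: "0 < e"
      from ap[OF u half_gt_zero[OF e]] obtain U k where U: "openin B U" "u \<in> U" "k \<in> csect E"
        "\<And>v w. \<lbrakk>v \<in> U; w \<in> hcarrier (fib E v)\<rbrakk> \<Longrightarrow> cmod (hinner (fib E v) (k v) w - l v w) \<le> e / 2 * hnorm (fib E v) w"
        by blast
      have "hdist (fib E v) (f v) (k v) < e" if v: "v \<in> U" for v
      proof -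
        have vB: "v \<in> topspace B" using v U openin_subset by blast
        interpret hilbert_space "fib E v" by (rule hilbert[OF vB])
        have "hdist (fib E v) (k v) (f v) \<le> e / 2" by (rule norm_le_if_weak) (use U v e f vB sect_closed in auto)
        then show ?thesis using norm_minus_commute[of "f v" "k v"] f(1)[OF vB] sect_closed[OF U(3) vB] e by simp
      qed
      then show "\<exists>U. openin B U \<and> u \<in> U \<and> (\<exists>\<eta>\<in>csect E. \<forall>v\<in>U. hdist (fib E v) (f v) (\<eta> v) < e)" using U by blast
    qed
  qed (use f in auto)
  then show ?thesis using that f by blast
qed

end

section \<open>Pullback bundles\<close>

definition pullback :: "'x topology \<Rightarrow> ('x \<Rightarrow> 'g) \<Rightarrow> ('g, 'v, 'z) hbundle_scheme \<Rightarrow> ('x, 'v) hbundle" where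
  "pullback X p E = \<lparr>fib = (\<lambda>x. fib E (p x)), csect = {f \<in> (\<Pi> x\<in>topspace X. hcarrier (fib E (p x))).
     locally_approximable X (\<lambda>x. fib E (p x)) ((\<lambda>\<xi> x. \<xi> (p x)) ` csect E) f}\<rparr>"

lemma fib_pullback [simp]: "fib (pullback X p E) x = fib E (p x)" by (simp add: pullback_def)

lemma fib_pullback': "fib (pullback X p E) = (\<lambda>x. fib E (p x))" by (simp add: pullback_def)

context hilbert_bundle
begin

lemma hilbert_bundle_pullback:
  assumes p: "continuous_map X B p"
  shows "hilbert_bundle X (pullback X p E)"
proof -
  have pB: "p x \<in> topspace B" if "x \<in> topspace X" for x using p that by (auto simp: continuous_map_def)
  interpret P: hilbert_family X "\<lambda>x. fib E (p x)" by (rule hilbert_family.intro) (use pB hilbert in auto)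
  show ?thesis
  proof (rule P.hilbert_bundle_generated[of _ "(\<lambda>\<xi> x. \<xi> (p x)) ` csect E"])
    show "fib (pullback X p E) = (\<lambda>x. fib E (p x))" by (simp add: pullback_def)
    show "csect (pullback X p E) = {\<xi> \<in> (\<Pi> x\<in>topspace X. hcarrier (fib E (p x))).
       locally_approximable X (\<lambda>x. fib E (p x)) ((\<lambda>\<xi> x. \<xi> (p x)) ` csect E) \<xi>}" by (simp add: pullback_def)
    show "(\<lambda>\<xi> x. \<xi> (p x)) ` csect E \<subseteq> (\<Pi> u\<in>topspace X. hcarrier (fib E (p u)))" using pB sect_closed by auto
    show "(\<lambda>u. hzero (fib E (p u))) \<in> (\<lambda>\<xi> x. \<xi> (p x)) ` csect E"
      using sect_zero by (intro image_eqI[where x = "\<lambda>u. hzero (fib E u)"]) auto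
  next
    fix s t assume "s \<in> (\<lambda>\<xi> x. \<xi> (p x)) ` csect E" "t \<in> (\<lambda>\<xi> x. \<xi> (p x)) ` csect E"
    then obtain \<xi> \<eta> where "\<xi> \<in> csect E" "\<eta> \<in> csect E" "s = (\<lambda>x. \<xi> (p x))" "t = (\<lambda>x. \<eta> (p x))" by blast
    then show "(\<lambda>u. hadd (fib E (p u)) (s u) (t u)) \<in> (\<lambda>\<xi> x. \<xi> (p x)) ` csect E"
      using sect_add[of \<xi> \<eta>] by (intro image_eqI[where x = "\<lambda>u. hadd (fib E u) (\<xi> u) (\<eta> u)"]) auto
  next
    fix s a assume "s \<in> (\<lambda>\<xi> x. \<xi> (p x)) ` csect E"
    then obtain \<xi> where "\<xi> \<in> csect E" "s = (\<lambda>x. \<xi> (p x))" by blast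
    then show "(\<lambda>u. hscale (fib E (p u)) a (s u)) \<in> (\<lambda>\<xi> x. \<xi> (p x)) ` csect E"
      using sect_scale[of \<xi> a] by (intro image_eqI[where x = "\<lambda>u. hscale (fib E u) a (\<xi> u)"]) auto
  next
    fix x v and e :: real assume "x \<in> topspace X" "v \<in> hcarrier (fib E (p x))" "0 < e"
    then obtain \<xi> where "\<xi> \<in> csect E" "hdist (fib E (p x)) (\<xi> (p x)) v < e" using sect_dense[OF pB] by metis
    then show "\<exists>s\<in>(\<lambda>\<xi> x. \<xi> (p x)) ` csect E. hdist (fib E (p x)) (s x) v < e" by (intro bexI[of _ "\<lambda>x. \<xi> (p x)"]) auto
  next
    fix s assume "s \<in> (\<lambda>\<xi> x. \<xi> (p x)) ` csect E"
    then obtain \<xi> where "\<xi> \<in> csect E" "s = (\<lambda>x. \<xi> (p x))" by blast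
    then show "continuous_map X euclideanreal (\<lambda>u. hnorm (fib E (p u)) (s u))"
      using continuous_map_compose[OF p sect_norm] by (simp add: o_def)
  qed
qed

lemma pullback_sect:
  assumes p: "continuous_map X B p" and \<xi>: "\<xi> \<in> csect E"
  shows "(\<lambda>x. \<xi> (p x)) \<in> csect (pullback X p E)"
proof -
  have pB: "p x \<in> topspace B" if "x \<in> topspace X" for x using p that by (auto simp: continuous_map_def)
  interpret P: hilbert_family X "\<lambda>x. fib E (p x)" by (rule hilbert_family.intro) (use pB hilbert in auto)
  show ?thesis unfolding pullback_def using sect_closed[OF \<xi> pB] \<xi> by (auto intro: P.la_self)
qed

lemma pullback_comp:
  assumes p: "continuous_map Y B p" and q: "continuous_map X Y q" and f: "f \<in> csect (pullback Y p E)"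
  shows "(\<lambda>x. f (q x)) \<in> csect (pullback X (\<lambda>x. p (q x)) E)"
proof -
  have qY: "q x \<in> topspace Y" if "x \<in> topspace X" for x using q that by (auto simp: continuous_map_def)
  have fc: "f y \<in> hcarrier (fib E (p y))" if "y \<in> topspace Y" for y using f that by (auto simp: pullback_def Pi_iff)
  have "locally_approximable X (\<lambda>x. fib E (p (q x))) ((\<lambda>\<xi> x. \<xi> (p (q x))) ` csect E) (\<lambda>x. f (q x))"
    unfolding locally_approximable_def
  proof (intro ballI allI impI)
    fix x and e :: real assume x: "x \<in> topspace X" and e: "0 < e"
    from f qY[OF x] e obtain U \<xi> where U: "openin Y U" "q x \<in> U" "\<xi> \<in> csect E"
      "\<And>y. y \<in> U \<Longrightarrow> hdist (fib E (p y)) (f y) (\<xi> (p y)) < e"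
      unfolding pullback_def locally_approximable_def by force
    have "openin X {x \<in> topspace X. q x \<in> U}" using openin_continuous_map_preimage[OF q U(1)] .
    then show "\<exists>U. openin X U \<and> x \<in> U \<and> (\<exists>\<eta>\<in>(\<lambda>\<xi> x. \<xi> (p (q x))) ` csect E. \<forall>v\<in>U. hdist (fib E (p (q v))) (f (q v)) (\<eta> v) < e)"
      using U x by (intro exI[of _ "{x \<in> topspace X. q x \<in> U}"]) auto
  qed
  then show ?thesis unfolding pullback_def using fc qY by auto
qed

lemma topspace_total_space: "topspace (total_space B E) = {(u, h). u \<in> topspace B \<and> h \<in> hcarrier (fib E u)}"
proof -
  have "(u, h) \<in> topspace (total_space B E)" if u: "u \<in> topspace B" and h: "h \<in> hcarrier (fib E u)" for u h
  proof -
    interpret semi_inner_space "fib E u" by (rule semi[OF u])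
    define e where "e = hdist (fib E u) h (hzero (fib E u)) + 1"
    have "0 < e" using norm_nonneg[OF minus_closed[OF h zero_closed]] by (simp add: e_def)
    show ?thesis unfolding total_space_def topology_generated_by_topspace
    proof (rule UnionI)
      show "{(u, h). u \<in> topspace B \<and> h \<in> hcarrier (fib E u) \<and> hdist (fib E u) h (hzero (fib E u)) < e}
        \<in> {{(u, h). u \<in> V \<and> h \<in> hcarrier (fib E u) \<and> hdist (fib E u) h (\<xi> u) < \<epsilon>} | V \<xi> \<epsilon>. openin B V \<and> \<xi> \<in> csect E \<and> 0 < \<epsilon>}"
        by (intro CollectI exI[of _ "topspace B"] exI[of _ "\<lambda>u. hzero (fib E u)"] exI[of _ e] conjI refl)
          (use \<open>0 < e\<close> sect_zero in auto)
    qed (use u h in \<open>auto simp: e_def\<close>)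
  qed
  moreover have "u \<in> topspace B \<and> h \<in> hcarrier (fib E u)" if "(u, h) \<in> topspace (total_space B E)" for u h
    using that openin_subset[of B] unfolding total_space_def topology_generated_by_topspace by fastforce
  ultimately show ?thesis by auto
qed

lemma continuous_map_total_space:
  assumes p: "continuous_map X B p"
  shows "continuous_map X (total_space B E) (\<lambda>x. (p x, f x)) \<longleftrightarrow> f \<in> csect (pullback X p E)" (is "?L \<longleftrightarrow> ?R")
proof
  have pB: "p x \<in> topspace B" if "x \<in> topspace X" for x using p that by (auto simp: continuous_map_def)
  interpret P: hilbert_bundle X "pullback X p E" by (rule hilbert_bundle_pullback[OF p])
  {
    assume L: ?L
    have fc: "f x \<in> hcarrier (fib E (p x))" if "x \<in> topspace X" for x
      using continuous_map_image_subset_topspace[OF L] topspace_total_space that by auto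
    have "locally_approximable X (\<lambda>x. fib E (p x)) ((\<lambda>\<xi> x. \<xi> (p x)) ` csect E) f" unfolding locally_approximable_def
    proof (intro ballI allI impI)
      fix x and e :: real assume x: "x \<in> topspace X" and e: "0 < e"
      interpret Fx: semi_inner_space "fib E (p x)" by (rule semi[OF pB[OF x]])
      obtain \<xi> where \<xi>: "\<xi> \<in> csect E" "hdist (fib E (p x)) (\<xi> (p x)) (f x) < e" using sect_dense[OF pB[OF x] fc[OF x] e] by blast
      then have \<xi>': "hdist (fib E (p x)) (f x) (\<xi> (p x)) < e"
        using Fx.norm_minus_commute[OF fc[OF x] sect_closed[OF \<xi>(1) pB[OF x]]] by simp
      define W where "W = {(u, h). u \<in> topspace B \<and> h \<in> hcarrier (fib E u) \<and> hdist (fib E u) h (\<xi> u) < e}"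
      have "openin (total_space B E) W" unfolding total_space_def W_def by (rule topology_generated_by_Basis) (use \<xi> e in blast)
      then have "openin X {x \<in> topspace X. (p x, f x) \<in> W}" by (rule openin_continuous_map_preimage[OF L])
      then show "\<exists>U. openin X U \<and> x \<in> U \<and> (\<exists>\<eta>\<in>(\<lambda>\<xi> x. \<xi> (p x)) ` csect E. \<forall>v\<in>U. hdist (fib E (p v)) (f v) (\<eta> v) < e)"
        using \<xi> \<xi>' x pB fc by (intro exI[of _ "{x \<in> topspace X. (p x, f x) \<in> W}"]) (auto simp: W_def)
    qed
    then show ?R unfolding pullback_def using fc by auto
  next
    assume R: ?R
    have fc: "f x \<in> hcarrier (fib E (p x))" if "x \<in> topspace X" for x using P.sect_closed[OF R that] by simp
    have ne: "(p x, f x) \<in> \<Union>{{(u, h). u \<in> V \<and> h \<in> hcarrier (fib E u) \<and> hdist (fib E u) h (\<xi> u) < \<epsilon>}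
      | V \<xi> \<epsilon>. openin B V \<and> \<xi> \<in> csect E \<and> 0 < \<epsilon>}" if "x \<in> topspace X" for x
      using topspace_total_space pB[OF that] fc[OF that] unfolding total_space_def topology_generated_by_topspace by blast
    have op: "openin X ((\<lambda>x. (p x, f x)) -` {(u, h). u \<in> V \<and> h \<in> hcarrier (fib E u) \<and> hdist (fib E u) h (\<xi> u) < e} \<inter> topspace X)"
      if V: "openin B V" and \<xi>: "\<xi> \<in> csect E" for V \<xi> and e :: real
    proof -
      have "continuous_map X euclideanreal (\<lambda>x. hdist (fib E (p x)) (f x) (\<xi> (p x)))"
        using P.sect_norm[OF P.sect_minus[OF R pullback_sect[OF p \<xi>]]] by simp
      then have "openin X {x \<in> topspace X. hdist (fib E (p x)) (f x) (\<xi> (p x)) \<in> {..<e}}"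
        by (rule openin_continuous_map_preimage) simp
      moreover have "openin X {x \<in> topspace X. p x \<in> V}" by (rule openin_continuous_map_preimage[OF p V])
      ultimately have "openin X ({x \<in> topspace X. hdist (fib E (p x)) (f x) (\<xi> (p x)) \<in> {..<e}} \<inter> {x \<in> topspace X. p x \<in> V})"
        by (rule openin_Int)
      also have "\<dots> = (\<lambda>x. (p x, f x)) -` {(u, h). u \<in> V \<and> h \<in> hcarrier (fib E u) \<and> hdist (fib E u) h (\<xi> u) < e} \<inter> topspace X"
        using fc by auto
      finally show ?thesis .
    qed
    show ?L unfolding total_space_def continuous_on_generated_topo_iff
    proof (intro conjI allI impI)
      fix U assume "U \<in> {{(u, h). u \<in> V \<and> h \<in> hcarrier (fib E u) \<and> hdist (fib E u) h (\<xi> u) < \<epsilon>}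
        | V \<xi> \<epsilon>. openin B V \<and> \<xi> \<in> csect E \<and> 0 < \<epsilon>}"
      then show "openin X ((\<lambda>x. (p x, f x)) -` U \<inter> topspace X)" using op by blast
    qed (use ne in blast)
  }
qed

end

section \<open>Tensor product bundles\<close>

locale tensor_bundle = E1: hilbert_bundle B E1 + E2: hilbert_bundle B E2
  for B :: "'g topology" and E1 :: "('g, 'v, 'y) hbundle_scheme" and E2 :: "('g, 'w, 'z) hbundle_scheme" +
  fixes T :: "('g, (nat \<Rightarrow> ('v \<times> 'w) \<Rightarrow>\<^sub>0 complex) set, 'x) hbundle_scheme"
  assumes fib_T: "fib T = (\<lambda>u. tensor (fib E1 u) (fib E2 u))"
    and csect_T: "csect T = generated_sections B (\<lambda>u. tensor (fib E1 u) (fib E2 u))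
        {(\<lambda>u. tensor_vec (fib E1 u) (fib E2 u) (\<xi> u) (\<eta> u)) | \<xi> \<eta>. \<xi> \<in> csect E1 \<and> \<eta> \<in> csect E2}"
begin

abbreviation "TT u \<equiv> tensor (fib E1 u) (fib E2 u)"
abbreviation "tv u \<equiv> tensor_vec (fib E1 u) (fib E2 u)"

abbreviation "elementary \<equiv> {(\<lambda>u. tv u (\<xi> u) (\<eta> u)) | \<xi> \<eta>. \<xi> \<in> csect E1 \<and> \<eta> \<in> csect E2}"

lemma pair: "u \<in> topspace B \<Longrightarrow> hilbert_pair (fib E1 u) (fib E2 u)" by (simp add: hilbert_pair_def E1.hilbert E2.hilbert)

lemma tensor_family: "hilbert_family B TT" by (rule hilbert_family.intro) (rule hilbert_pair.hilbert_space_tensor[OF pair])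

lemma elementary_closed: "elementary \<subseteq> (\<Pi> u\<in>topspace B. hcarrier (TT u))"
  using hilbert_pair.tensor_vec_closed[OF pair] E1.sect_closed E2.sect_closed by fastforce

lemma total_sections:
  assumes u: "u \<in> topspace B"
  shows "total (TT u) {s u | s. s \<in> elementary}"
proof -
  interpret hilbert_pair "fib E1 u" "fib E2 u" by (rule pair[OF u])
  have dense: "total (TT u) {tv u v w | v w. v \<in> (\<lambda>\<xi>. \<xi> u) ` csect E1 \<and> w \<in> (\<lambda>\<eta>. \<eta> u) ` csect E2}"
    by (rule tensor_total_dense[OF _ E1.values_dense[OF u] _ E2.values_dense[OF u]])
      (use E1.sect_closed[OF _ u] E2.sect_closed[OF _ u] in auto)
  have "tv u (\<xi> u) (\<eta> u) \<in> {s u | s. s \<in> elementary}" if "\<xi> \<in> csect E1" "\<eta> \<in> csect E2" for \<xi> \<eta>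
    using that by (intro CollectI exI[of _ "\<lambda>u. tv u (\<xi> u) (\<eta> u)"]) blast
  then show ?thesis by (intro total_mono[OF dense]) auto
qed

lemma hilbert_bundle_tensor: "hilbert_bundle B T"
proof (rule hilbert_family.hilbert_bundle_generated_sections[OF tensor_family fib_T csect_T elementary_closed total_sections])
  fix s t assume "s \<in> elementary" "t \<in> elementary"
  then obtain \<xi> \<eta> \<xi>' \<eta>' where c: "\<xi> \<in> csect E1" "\<eta> \<in> csect E2" "\<xi>' \<in> csect E1" "\<eta>' \<in> csect E2"
    and s: "s = (\<lambda>u. tv u (\<xi> u) (\<eta> u))"
    and t: "t = (\<lambda>u. tv u (\<xi>' u) (\<eta>' u))" by blast
  show "continuous_map B euclidean (\<lambda>u. hinner (TT u) (s u) (t u))"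
    by (rule continuous_map_eq[OF continuous_map_mult[OF E1.inner_continuous[OF c(1,3)] E2.inner_continuous[OF c(2,4)]]])
      (use c hilbert_pair.tensor_inner[OF pair] E1.sect_closed E2.sect_closed in \<open>simp add: s t\<close>)
qed

sublocale T: hilbert_bundle B T by (rule hilbert_bundle_tensor)

lemma tensor_sect:
  assumes "\<xi> \<in> csect E1" "\<eta> \<in> csect E2"
  shows "(\<lambda>u. tv u (\<xi> u) (\<eta> u)) \<in> csect T"
proof -
  have s: "(\<lambda>u. tv u (\<xi> u) (\<eta> u)) \<in> elementary" using assms by blast
  show ?thesis unfolding csect_T generated_sections_def
    using hilbert_family.la_self[OF tensor_family section_span.span_base[OF s]] elementary_closed s by blast
qed

lemma section_span_csect: "s \<in> section_span (fib T) elementary \<Longrightarrow> s \<in> csect T"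
proof (induction rule: section_span.induct)
  case (span_base \<xi>)
  then show ?case using tensor_sect by blast
qed (auto intro: T.sect_zero T.sect_add T.sect_scale)

end

text \<open>Tensor products and contractions of continuous sections of pullbacks.  The contraction of
  \<open>K x\<close> by \<open>a x\<close> is adjoint to tensoring by \<open>a x\<close>.\<close>

context tensor_bundle
begin

lemma pullback_tensor:
  assumes p: "continuous_map X B p" and f: "f \<in> csect (pullback X p E1)" and g: "g \<in> csect (pullback X p E2)"
  shows "(\<lambda>x. tv (p x) (f x) (g x)) \<in> csect (pullback X p T)"
proof -
  let ?V = "\<lambda>x. fib E1 (p x)" and ?W = "\<lambda>x. fib E2 (p x)" and ?T = "\<lambda>x. fib T (p x)" and ?v = "\<lambda>x. tv (p x)"
  interpret P1: hilbert_bundle X "pullback X p E1" by (rule E1.hilbert_bundle_pullback[OF p])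
  interpret P2: hilbert_bundle X "pullback X p E2" by (rule E2.hilbert_bundle_pullback[OF p])
  interpret P: hilbert_bundle X "pullback X p T" by (rule T.hilbert_bundle_pullback[OF p])
  have pB: "p x \<in> topspace B" if "x \<in> topspace X" for x using p that by (auto simp: continuous_map_def)
  show ?thesis
  proof (rule P.sect_local)
    show "(\<lambda>x. ?v x (f x) (g x)) \<in> (\<Pi> u\<in>topspace X. hcarrier (fib (pullback X p T) u))"
      using hilbert_pair.tensor_vec_closed[OF pair[OF pB]] P1.sect_closed[OF f] P2.sect_closed[OF g] by (auto simp: fib_T)
    show "locally_approximable X (fib (pullback X p T)) (csect (pullback X p T)) (\<lambda>x. ?v x (f x) (g x))"
      unfolding locally_approximable_def
    proof (intro ballI allI impI)
      fix x and e :: real assume x: "x \<in> topspace X" and e: "0 < e"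
      have fc: "f y \<in> hcarrier (?V y)" and gc: "g y \<in> hcarrier (?W y)" if "y \<in> topspace X" for y
        using P1.sect_closed[OF f that] P2.sect_closed[OF g that] by auto
      \<comment> \<open>the bound for the distance of the two tensors is continuous, so it is enough to make it small at \<open>x\<close>\<close>
      obtain a b where ab: "a \<in> (\<lambda>\<xi>. \<xi> (p x)) ` csect E1" "b \<in> (\<lambda>\<eta>. \<eta> (p x)) ` csect E2"
        "hdist (?V x) (f x) a * hnorm (?W x) (g x) + hnorm (?V x) a * hdist (?W x) (g x) b < e"
        using hilbert_pair.tensor_approx[OF pair[OF pB[OF x]] _ E1.values_dense[OF pB[OF x]] _ E2.values_dense[OF pB[OF x]] fc[OF x] gc[OF x] e]
          E1.sect_closed[OF _ pB[OF x]] E2.sect_closed[OF _ pB[OF x]] by blast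
      then obtain \<xi> \<eta> where \<xi>: "\<xi> \<in> csect E1" and \<eta>: "\<eta> \<in> csect E2"
        and Mx: "hdist (?V x) (f x) (\<xi> (p x)) * hnorm (?W x) (g x) + hnorm (?V x) (\<xi> (p x)) * hdist (?W x) (g x) (\<eta> (p x)) < e"
        by blast
      note s = E1.pullback_sect[OF p \<xi>] E2.pullback_sect[OF p \<eta>]
      define M where "M y = hdist (?V y) (f y) (\<xi> (p y)) * hnorm (?W y) (g y) + hnorm (?V y) (\<xi> (p y)) * hdist (?W y) (g y) (\<eta> (p y))" for y
      have "continuous_map X euclideanreal M"
        unfolding M_def using P1.sect_norm[OF P1.sect_minus[OF f s(1)]] P2.sect_norm[OF g] P1.sect_norm[OF s(1)]
          P2.sect_norm[OF P2.sect_minus[OF g s(2)]] by (intro continuous_map_add continuous_map_real_mult) simp_all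
      then have o: "openin X {y \<in> topspace X. M y \<in> {..<e}}" by (rule openin_continuous_map_preimage) simp
      have "M x < e" using Mx by (simp add: M_def)
      moreover have "hdist (?T y) (?v y (f y) (g y)) (?v y (\<xi> (p y)) (\<eta> (p y))) \<le> M y" if y: "y \<in> topspace X" for y
        using hilbert_pair.tensor_norm_diff[OF pair[OF pB[OF y]] fc[OF y] gc[OF y] E1.sect_closed[OF \<xi> pB[OF y]]
            E2.sect_closed[OF \<eta> pB[OF y]]] by (simp add: M_def fib_T)
      moreover have "(\<lambda>y. ?v y (\<xi> (p y)) (\<eta> (p y))) \<in> csect (pullback X p T)" using T.pullback_sect[OF p tensor_sect[OF \<xi> \<eta>]] .
      ultimately show "\<exists>U. openin X U \<and> x \<in> U \<and> (\<exists>\<eta>\<in>csect (pullback X p T). \<forall>v\<in>U.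
          hdist (fib (pullback X p T) v) (?v v (f v) (g v)) (\<eta> v) < e)"
        using o x by (intro exI[of _ "{y \<in> topspace X. M y \<in> {..<e}}"] conjI bexI[of _ "\<lambda>y. ?v y (\<xi> (p y)) (\<eta> (p y))"])
          (auto intro: le_less_trans)
    qed
  qed
qed

lemma pullback_contraction:
  assumes p: "continuous_map X B p" and K: "K \<in> csect (pullback X p T)" and a: "a \<in> csect (pullback X p E1)"
  obtains f where "f \<in> csect (pullback X p E2)" "\<And>x w. \<lbrakk>x \<in> topspace X; w \<in> hcarrier (fib E2 (p x))\<rbrakk> \<Longrightarrow>
      hinner (fib E2 (p x)) (f x) w = hinner (fib T (p x)) (K x) (tv (p x) (a x) w)"
proof -
  let ?V = "\<lambda>x. fib E1 (p x)" and ?W = "\<lambda>x. fib E2 (p x)" and ?T = "\<lambda>x. fib T (p x)" and ?v = "\<lambda>x. tv (p x)"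
  interpret P1: hilbert_bundle X "pullback X p E1" by (rule E1.hilbert_bundle_pullback[OF p])
  interpret P2: hilbert_bundle X "pullback X p E2" by (rule E2.hilbert_bundle_pullback[OF p])
  interpret P: hilbert_bundle X "pullback X p T" by (rule T.hilbert_bundle_pullback[OF p])
  have pB: "p x \<in> topspace B" if "x \<in> topspace X" for x using p that by (auto simp: continuous_map_def)
  let ?l = "\<lambda>x w. hinner (?T x) (K x) (?v x (a x) w)"
  have ac: "a x \<in> hcarrier (?V x)" if "x \<in> topspace X" for x using P1.sect_closed[OF a that] by simp
  have tc: "?v x (a x) w \<in> hcarrier (?T x)" if "x \<in> topspace X" "w \<in> hcarrier (?W x)" for x w
    using hilbert_pair.tensor_vec_closed[OF pair[OF pB[OF that(1)]] ac[OF that(1)] that(2)] by (simp add: fib_T)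
  have sc: "s (p x) \<in> hcarrier (?T x)" if "s \<in> section_span (fib T) elementary" "x \<in> topspace X" for s x
    using T.sect_closed[OF section_span_csect pB] that by auto
  let ?adj = "\<lambda>s k. \<forall>x\<in>topspace X. \<forall>w\<in>hcarrier (?W x). hinner (?W x) (k x) w = hinner (?T x) (s (p x)) (?v x (a x) w)"
  have span: "\<exists>k\<in>csect (pullback X p E2). ?adj s k" if "s \<in> section_span (fib T) elementary" for s using that
  proof induction
    case span_zero
    show ?case by (intro bexI[OF _ P2.sect_zero]) (simp add: tc pB E2.fam_inner T.fam_inner)
  next
    case (span_base s)
    then obtain \<xi> \<eta> where c: "\<xi> \<in> csect E1" "\<eta> \<in> csect E2" and s: "s = (\<lambda>u. tv u (\<xi> u) (\<eta> u))" by blast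
    have 1: "continuous_map X euclidean (\<lambda>x. hinner (?V x) (\<xi> (p x)) (a x))"
      using P1.inner_continuous[OF E1.pullback_sect[OF p c(1)] a] by simp
    show ?case
    proof (intro bexI[OF _ P2.sect_mult[OF 1 E2.pullback_sect[OF p c(2)]]] ballI)
      fix x w assume x: "x \<in> topspace X" and w: "w \<in> hcarrier (?W x)"
      interpret hilbert_pair "fib E1 (p x)" "fib E2 (p x)" by (rule pair[OF pB[OF x]])
      show "hinner (?W x) (hscale (fib (pullback X p E2) x) (hinner (?V x) (\<xi> (p x)) (a x)) (\<eta> (p x))) w
         = hinner (?T x) (s (p x)) (?v x (a x) w)"
        using w ac[OF x] E1.sect_closed[OF c(1) pB[OF x]] E2.sect_closed[OF c(2) pB[OF x]]
        by (simp add: s fib_T tensor_inner W.inner_scale)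
    qed
  next
    case (span_add s t)
    then obtain k l where k: "k \<in> csect (pullback X p E2)" "l \<in> csect (pullback X p E2)" "?adj s k" "?adj t l" by auto
    show ?case by (intro bexI[OF _ P2.sect_add[OF k(1,2)]] ballI) (use k(3,4) P2.sect_closed[OF k(1)] P2.sect_closed[OF k(2)] in
          \<open>simp add: E2.fam_inner T.fam_inner pB tc sc[OF span_add.hyps(1)] sc[OF span_add.hyps(2)]\<close>)
  next
    case (span_scale s c)
    then obtain k where k: "k \<in> csect (pullback X p E2)" "?adj s k" by auto
    show ?case by (intro bexI[OF _ P2.sect_scale[OF k(1), of c]] ballI)
        (use k(2) P2.sect_closed[OF k(1)] in \<open>simp add: E2.fam_inner T.fam_inner pB tc sc[OF span_scale.hyps]\<close>)
  qed
  show ?thesis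
  proof (rule P2.weak_section[of ?l, unfolded fib_pullback])
    fix x and e :: real assume x: "x \<in> topspace X" and e: "0 < e"
    interpret Tx: hilbert_space "?T x" by (rule T.hilbert[OF pB[OF x]])
    have n: "0 < hnorm (?V x) (a x) + 1" using P1.fam_norm(2)[OF x] ac[OF x] by (simp add: add_nonneg_pos)
    then have en: "0 < e / (hnorm (?V x) (a x) + 1)" using e by simp
    obtain t where t: "t \<in> hspan (?T x) {s (p x) | s. s \<in> elementary}" "hdist (?T x) (K x) t < e / (hnorm (?V x) (a x) + 1)"
      using total_sections[OF pB[OF x]] P.sect_closed[OF K x] en unfolding total_def fib_pullback fib_T by blast
    obtain s where s: "s \<in> section_span (fib T) elementary" "s (p x) = t" using T.section_span_hspan[OF t(1)] by blast
    note sT = T.pullback_sect[OF p section_span_csect[OF s(1)]]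
    obtain k where k: "k \<in> csect (pullback X p E2)" "\<And>x w. \<lbrakk>x\<in>topspace X; w\<in>hcarrier (?W x)\<rbrakk> \<Longrightarrow>
       hinner (?W x) (k x) w = hinner (?T x) (s (p x)) (?v x (a x) w)"
      using span[OF s(1)] by metis
    define M where "M y = hdist (?T y) (K y) (s (p y)) * hnorm (?V y) (a y)" for y
    have "continuous_map X euclideanreal M"
      unfolding M_def using P.sect_norm[OF P.sect_minus[OF K sT]] P1.sect_norm[OF a] by (intro continuous_map_real_mult) simp_all
    then have o: "openin X {y \<in> topspace X. M y \<in> {..<e}}" by (rule openin_continuous_map_preimage) simp
    have "0 \<le> hdist (?T x) (K x) (s (p x))" using P.fam_norm(2)[OF x P.sect_closed[OF P.sect_minus[OF K sT] x]] by simp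
    then have "M x \<le> hdist (?T x) (K x) (s (p x)) * (hnorm (?V x) (a x) + 1)" unfolding M_def by (intro mult_left_mono) auto
    also have "\<dots> < e" using t(2) s(2) n by (simp add: pos_less_divide_eq)
    finally have Mx: "M x < e" .
    have "cmod (hinner (?W y) (k y) w - ?l y w) \<le> e * hnorm (?W y) w"
      if y: "y \<in> topspace X" "M y < e" and w: "w \<in> hcarrier (?W y)" for y w
    proof -
      interpret hilbert_pair "fib E1 (p y)" "fib E2 (p y)" by (rule pair[OF pB[OF y(1)]])
      interpret Ty: hilbert_space "?T y" by (rule T.hilbert[OF pB[OF y(1)]])
      let ?t = "?v y (a y) w"
      have c: "K y \<in> hcarrier (?T y)" "s (p y) \<in> hcarrier (?T y)" "?t \<in> hcarrier (?T y)"
        using P.sect_closed[OF K y(1)] P.sect_closed[OF sT y(1)] tensor_vec_closed[OF ac[OF y(1)] w] by (simp_all add: fib_T)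
      have "hinner (?W y) (k y) w - ?l y w = hinner (?T y) (hminus (?T y) (s (p y)) (K y)) ?t"
        using k(2)[OF y(1) w] c by (simp add: Ty.inner_minus)
      then have "cmod (hinner (?W y) (k y) w - ?l y w) \<le> hdist (?T y) (K y) (s (p y)) * hnorm (?T y) ?t"
        using Ty.cauchy_schwarz[of "hminus (?T y) (s (p y)) (K y)" ?t] c Ty.norm_minus_commute[OF c(1,2)] by (simp add: Ty.closed)
      also have "\<dots> = M y * hnorm (?W y) w" using tensor_norm[OF ac[OF y(1)] w] by (simp add: M_def fib_T)
      also have "\<dots> \<le> e * hnorm (?W y) w" using y(2) by (intro mult_right_mono W.norm_nonneg[OF w]) simp
      finally show ?thesis .
    qed
    then show "\<exists>U. openin X U \<and> x \<in> U \<and> (\<exists>k\<in>csect (pullback X p E2). \<forall>y\<in>U. \<forall>w\<in>hcarrier (?W y).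
        cmod (hinner (?W y) (k y) w - ?l y w) \<le> e * hnorm (?W y) w)"
      using o x Mx k(1) by (intro exI[of _ "{y \<in> topspace X. M y \<in> {..<e}}"] conjI bexI[of _ k]) auto
  next
    fix f assume "f \<in> csect (pullback X p E2)" "\<And>x w. \<lbrakk>x \<in> topspace X; w \<in> hcarrier (?W x)\<rbrakk> \<Longrightarrow> hinner (?W x) (f x) w = ?l x w"
    then show ?thesis by (rule that)
  qed
qed

end

section \<open>Radon measures on topological spaces\<close>

locale radon =
  fixes X :: "'a topology" and M :: "'a measure"
  assumes radon: "radon_measure X M"
begin

lemma sets_M: "sets M = sigma_sets (topspace X) {U. openin X U}"
  using radon openin_subset by (auto simp: radon_measure_def intro!: sets_measure_of)

lemma space_M: "space M = topspace X"
proof -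
  have "space M = space (sigma (topspace X) {U. openin X U})"
    using radon by (intro sets_eq_imp_space_eq) (simp add: radon_measure_def)
  then show ?thesis using openin_subset by (subst (asm) space_measure_of) auto
qed

lemma open_measurable: "openin X U \<Longrightarrow> U \<in> sets M" by (simp add: sets_M)

lemma closed_measurable: "closedin X C \<Longrightarrow> C \<in> sets M"
  using open_measurable[of "topspace X - C"] sets.compl_sets[of "topspace X - C" M]
  by (simp add: closedin_def space_M double_diff)

lemma compact_finite: "compactin X K \<Longrightarrow> emeasure M K < \<infinity>" using radon by (simp add: radon_measure_def)

lemma openin_off_support: "openin X (topspace X - measure_support X M)"
proof (subst openin_subopen, intro ballI)
  fix x assume "x \<in> topspace X - measure_support X M"
  then obtain U where U: "openin X U" "x \<in> U" "emeasure M U = 0" by (auto simp: measure_support_def)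
  then have "U \<subseteq> topspace X - measure_support X M" using openin_subset[OF U(1)] by (auto simp: measure_support_def)
  then show "\<exists>T. openin X T \<and> x \<in> T \<and> T \<subseteq> topspace X - measure_support X M" using U by blast
qed

lemma off_support_null: "emeasure M (topspace X - measure_support X M) = 0"
proof -
  let ?N = "topspace X - measure_support X M"
  have "emeasure M K = 0" if K: "compactin X K" "K \<subseteq> ?N" for K
  proof -
    have "\<forall>U\<in>{U. openin X U \<and> emeasure M U = 0}. openin X U" by simp
    moreover have "K \<subseteq> \<Union>{U. openin X U \<and> emeasure M U = 0}"
    proof
      fix x assume "x \<in> K"
      then have "x \<in> ?N" using K(2) by blast
      then show "x \<in> \<Union>{U. openin X U \<and> emeasure M U = 0}" by (auto simp: measure_support_def)
    qed
    ultimately obtain F where F: "finite F" "F \<subseteq> {U. openin X U \<and> emeasure M U = 0}" "K \<subseteq> \<Union>F"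
      using K(1) unfolding compactin_def by meson
    have Fs: "F \<subseteq> sets M" using F(2) open_measurable by auto
    have "emeasure M (\<Union>F) \<le> (\<Sum>U\<in>F. emeasure M U)" using emeasure_subadditive_finite[OF F(1), of "\<lambda>U. U" M] Fs by simp
    also have "\<dots> = 0" using F(2) by (intro sum.neutral) auto
    finally have "emeasure M (\<Union>F) = 0" by simp
    moreover have "\<Union>F \<in> sets M" using Fs F(1) by (intro sets.finite_Union) auto
    ultimately show ?thesis using emeasure_mono[OF F(3)] by (metis le_zero_eq)
  qed
  then have "(SUP K\<in>{K. compactin X K \<and> K \<subseteq> ?N}. emeasure M K) \<le> 0" by (intro SUP_least) auto
  moreover have "emeasure M ?N = (SUP K\<in>{K. compactin X K \<and> K \<subseteq> ?N}. emeasure M K)"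
    using radon openin_off_support unfolding radon_measure_def by blast
  ultimately have "emeasure M ?N \<le> 0" by simp
  then show ?thesis by simp
qed

lemma AE_support: "AE x in M. x \<in> measure_support X M" by (rule AE_I[of _ _ "topspace X - measure_support X M"])
    (auto simp: space_M off_support_null openin_off_support open_measurable)

lemma closedin_support: "closedin X (measure_support X M)"
proof -
  have "measure_support X M \<subseteq> topspace X" by (auto simp: measure_support_def)
  then show ?thesis using openin_off_support by (simp add: closedin_def)
qed

lemma continuous_measurable_on:
  fixes g :: "'a \<Rightarrow> 'b::real_normed_vector"
  assumes C: "closedin X C" and g: "continuous_map (subtopology X C) euclidean g"
  shows "(\<lambda>x. indicator C x *\<^sub>R g x) \<in> borel_measurable M"
proof (rule borel_measurableI)
  fix S :: "'b set" assume S: "open S"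
  have CX: "C \<subseteq> topspace X" using closedin_subset[OF C] .
  have "openin (subtopology X C) {x \<in> topspace (subtopology X C). g x \<in> S}"
    by (rule openin_continuous_map_preimage[OF g]) (simp add: S)
  then have "openin (subtopology X C) {x \<in> C. g x \<in> S}" using CX by (simp add: inf.absorb2)
  then obtain U where "openin X U" "{x \<in> C. g x \<in> S} = U \<inter> C" by (auto simp: openin_subtopology)
  then have 1: "{x \<in> C. g x \<in> S} \<in> sets M" using open_measurable closed_measurable[OF C] by auto
  have 2: "topspace X - C \<in> sets M" using C open_measurable by (simp add: closedin_def)
  show "(\<lambda>x. indicator C x *\<^sub>R g x) -` S \<inter> space M \<in> sets M"
  proof (cases "0 \<in> S")
    case True
    then have "(\<lambda>x. indicator C x *\<^sub>R g x) -` S \<inter> space M = {x \<in> C. g x \<in> S} \<union> (topspace X - C)"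
      using CX by (auto simp: space_M indicator_def split: if_splits)
    then show ?thesis using 1 2 by auto
  next
    case False
    then have "(\<lambda>x. indicator C x *\<^sub>R g x) -` S \<inter> space M = {x \<in> C. g x \<in> S}"
      using CX by (auto simp: space_M indicator_def of_bool_def split: if_splits)
    then show ?thesis using 1 by auto
  qed
qed

lemma set_integrable_continuous:
  fixes g :: "'a \<Rightarrow> complex"
  assumes C: "closedin X C" and g: "continuous_map (subtopology X C) euclidean g"
    and K: "compactin X K" "closedin X K" "\<And>x. \<lbrakk>x \<in> C; g x \<noteq> 0\<rbrakk> \<Longrightarrow> x \<in> K"
  shows "set_integrable M C g"
proof -
  have "compactin X (C \<inter> K)" by (rule closed_Int_compactin[OF C K(1)])
  then have "compactin (subtopology X C) (C \<inter> K)" by (simp add: compactin_subtopology)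
  then have "compactin euclidean (g ` (C \<inter> K))" using image_compactin g by blast
  then have "bounded (g ` (C \<inter> K))" by (simp add: compact_imp_bounded)
  then obtain B where B: "\<And>x. x \<in> C \<inter> K \<Longrightarrow> norm (g x) \<le> B" by (auto simp: bounded_iff)
  show ?thesis unfolding set_integrable_def
  proof (rule integrableI_bounded_set[of K M _ "max B 0"])
    show "K \<in> sets M" by (rule closed_measurable[OF K(2)])
    show "(\<lambda>x. indicator C x *\<^sub>R g x) \<in> borel_measurable M" by (rule continuous_measurable_on[OF C g])
    show "emeasure M K < \<infinity>" by (rule compact_finite[OF K(1)])
    show "AE x in M. x \<in> K \<longrightarrow> norm (indicator C x *\<^sub>R g x) \<le> max B 0"
      using B by (intro AE_I2) (auto simp: indicator_def le_max_iff_disj)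
    show "AE x in M. x \<notin> K \<longrightarrow> indicator C x *\<^sub>R g x = 0" using K(3) by (intro AE_I2) (auto simp: indicator_def)
  qed
qed

lemma LINT_support:
  fixes g :: "'a \<Rightarrow> complex"
  assumes g: "continuous_map X euclidean g"
  shows "(LINT x|M. g x) = (LINT x:measure_support X M|M. g x)"
  unfolding set_lebesgue_integral_def
proof (rule integral_cong_AE)
  show "g \<in> borel_measurable M" using continuous_measurable_on[of "topspace X" g] g
    by (subst measurable_cong[where g = "\<lambda>x. indicator (topspace X) x *\<^sub>R g x"]) (auto simp: space_M)
  show "(\<lambda>x. indicator (measure_support X M) x *\<^sub>R g x) \<in> borel_measurable M"
    by (rule continuous_measurable_on[OF closedin_support continuous_map_from_subtopology[OF g]])
  show "AE x in M. g x = indicator (measure_support X M) x *\<^sub>R g x" using AE_support by eventually_elim simp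
qed

text \<open>A nonnegative continuous function that vanishes in the mean vanishes on the support.\<close>

lemma pos_integral:
  assumes f: "continuous_map X euclideanreal f" "\<And>x. 0 \<le> f x"
    and K: "compactin X K" "closedin X K" "\<And>x. \<lbrakk>x \<in> topspace X; f x \<noteq> 0\<rbrakk> \<Longrightarrow> x \<in> K"
    and V: "openin X V" "x \<in> V" "\<And>y. y \<in> V \<Longrightarrow> f y = 1" and x: "x \<in> measure_support X M"
  shows "0 < (LINT x|M. f x)" "integrable M f"
proof -
  have "set_integrable M (topspace X) (\<lambda>x. complex_of_real (f x))"
    using K by (intro set_integrable_continuous[of "topspace X" _ K] continuous_map_of_real) (auto simp: f)
  moreover have "integrable M (\<lambda>x. indicator (topspace X) x *\<^sub>R complex_of_real (f x)) = integrable M (\<lambda>x. complex_of_real (f x))"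
    by (rule Bochner_Integration.integrable_cong[OF refl]) (simp add: space_M)
  ultimately have "integrable M (\<lambda>x. complex_of_real (f x))" by (simp add: set_integrable_def)
  then show int: "integrable M f" by (simp add: complex_of_real_integrable_eq)
  have VK: "V \<subseteq> K" using V(3) K(3) openin_subset[OF V(1)] by force
  have Vs: "V \<in> sets M" using open_measurable V by blast
  have VKm: "emeasure M V \<le> emeasure M K" by (rule emeasure_mono[OF VK closed_measurable[OF K(2)]])
  have Vfin: "emeasure M V < \<infinity>" by (rule le_less_trans[OF VKm compact_finite[OF K(1)]])
  have "0 < emeasure M V" using x V by (auto simp: measure_support_def)
  then have "0 < measure M V" using Vfin by (simp add: measure_def enn2real_positive_iff)
  also have "measure M V = (LINT x|M. indicator V x)" using Vs by simp
  also have "\<dots> \<le> (LINT x|M. f x)" by (rule integral_mono[OF integrable_real_indicator[OF Vs Vfin] int])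
      (use V(3) f(2) in \<open>auto simp: indicator_def\<close>)
  finally show "0 < (LINT x|M. f x)" .
qed

end

section \<open>Openness of the anchor map\<close>

text \<open>The integral of a bump function at a point is positive on the fiber of that point, hence on
  the neighbouring fibers, which therefore meet the support of the bump.\<close>

lemma full_system_open:
  assumes sys: "full_equivariant_system G X p \<alpha> \<mu>" and X: "locally_compact_space X" "Hausdorff_space X"
    and U: "openin X U" "x \<in> U" and p: "p x \<in> units G" "units G \<subseteq> gelems G"
  obtains V where "openin (unit_space G) V" "p x \<in> V" "\<And>v. v \<in> V \<Longrightarrow> \<exists>y\<in>U. p y = v"
proof -
  obtain f :: "_ \<Rightarrow> real" and V K where f: "continuous_map X euclideanreal f" "\<And>y. 0 \<le> f y"
    "openin X V" "x \<in> V" "\<And>y. y \<in> V \<Longrightarrow> f y = 1" "compactin X K" "closedin X K" "K \<subseteq> U"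
    "\<And>y. y \<in> topspace X \<Longrightarrow> f y \<noteq> 0 \<Longrightarrow> y \<in> K"
    by (rule bump_function[OF X U]) auto
  let ?f = "\<lambda>y. complex_of_real (f y)"
  have rad: "radon X (\<mu> u)" and supp: "measure_support X (\<mu> u) = {\<omega> \<in> topspace X. p \<omega> = u}" if "u \<in> units G" for u
    using sys that by (auto simp: full_equivariant_system_def radon_def)
  have fc: "continuous_map X euclidean ?f" by (rule continuous_map_of_real[OF f(1)])
  have "{y \<in> topspace X. ?f y \<noteq> 0} \<subseteq> K" using f(9) by auto
  then have sub: "X closure_of {y \<in> topspace X. ?f y \<noteq> 0} \<subseteq> K" by (rule closure_of_minimal[OF _ f(7)])
  have "?f \<in> Cc X" unfolding Cc_def using fc closed_compactin[OF f(6) sub closedin_closure_of] by simp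
  then have cont: "continuous_map (unit_space G) euclidean (\<lambda>u. LINT \<omega>|\<mu> u. ?f \<omega>)"
    by (rule sys[unfolded full_equivariant_system_def, THEN conjunct2, THEN conjunct1, rule_format])
  define u where "u = p x"
  have xX: "x \<in> topspace X" using U openin_subset by blast
  interpret radon X "\<mu> u" using rad p by (simp add: u_def)
  have "0 < (LINT \<omega>|\<mu> u. f \<omega>)" by (rule pos_integral(1)[OF f(1,2,6,7,9,3,4,5)]) (use supp[of u] p xX in \<open>auto simp: u_def\<close>)
  then have nz: "(LINT \<omega>|\<mu> u. ?f \<omega>) \<noteq> 0" by simp
  have tu: "topspace (unit_space G) = units G" using p(2) by (auto simp: unit_space_def)
  define W where "W = {v \<in> topspace (unit_space G). (LINT \<omega>|\<mu> v. ?f \<omega>) \<in> - {0}}"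
  have "openin (unit_space G) W" unfolding W_def by (rule openin_continuous_map_preimage[OF cont]) (simp add: open_Compl)
  moreover have "p x \<in> W" using nz p by (simp add: W_def tu u_def)
  moreover have "\<exists>y\<in>U. p y = v" if v: "v \<in> W" for v
  proof (rule ccontr)
    assume no: "\<not> (\<exists>y\<in>U. p y = v)"
    have vu: "v \<in> units G" using v by (simp add: W_def tu)
    interpret v: radon X "\<mu> v" by (rule rad[OF vu])
    have "(LINT \<omega>|\<mu> v. ?f \<omega>) = (LINT \<omega>:measure_support X (\<mu> v)|\<mu> v. ?f \<omega>)" by (rule v.LINT_support[OF fc])
    also have "\<dots> = (LINT \<omega>|\<mu> v. 0)" unfolding set_lebesgue_integral_def
    proof (rule Bochner_Integration.integral_cong[OF refl])
      fix y
      have "f y = 0" if "y \<in> measure_support X (\<mu> v)" using that supp[OF vu] no f(8,9) by blast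
      then show "indicator (measure_support X (\<mu> v)) y *\<^sub>R ?f y = 0" by (auto simp: indicator_def)
    qed
    finally show False using v by (simp add: W_def)
  qed
  ultimately show ?thesis using that by blast
qed

section \<open>Groupoids\<close>

context lc_groupoid
begin

abbreviation "rng \<equiv> grng G"
abbreviation "src \<equiv> gdom G"
abbreviation "mul \<equiv> gmul G"
abbreviation inv where "inv \<equiv> ginv G"

abbreviation "ldiv x y \<equiv> mul (inv x) y"
abbreviation "res u f \<equiv> restrict f (range_fiber G u)"

lemma units_iff: "u \<in> units G \<longleftrightarrow> u \<in> gelems G \<and> rng u = u" using rng_closed rng_rng by (force simp: units_def)

lemma units_subset: "units G \<subseteq> gelems G" using units_iff by blast

lemma rng_unit: "x \<in> gelems G \<Longrightarrow> rng x \<in> units G" by (simp add: units_iff rng_closed rng_rng)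

lemma dom_unit: "x \<in> gelems G \<Longrightarrow> src x \<in> units G" by (simp add: units_iff dom_closed rng_dom)

lemma topspace_unit_space: "topspace (unit_space G) = units G" using units_subset by (auto simp: unit_space_def)

lemma composable_iff: "(x, y) \<in> composable G \<longleftrightarrow> x \<in> gelems G \<and> y \<in> gelems G \<and> src x = rng y" by (simp add: composable_def)

lemma inv_mul_cancel: "\<lbrakk>x \<in> gelems G; y \<in> gelems G; src x = rng y\<rbrakk> \<Longrightarrow> mul (inv x) (mul x y) = y"
  using mul_assoc[of "inv x" x y] by (simp add: composable_iff inv_closed dom_inv inv_mul rng_mul_self)

lemma mul_inv_cancel: "\<lbrakk>x \<in> gelems G; y \<in> gelems G; rng x = rng y\<rbrakk> \<Longrightarrow> mul x (ldiv x y) = y"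
  using mul_assoc[of x "inv x" y] by (simp add: composable_iff inv_closed dom_inv rng_inv mul_inv rng_mul_self)

lemma inv_inv: "x \<in> gelems G \<Longrightarrow> inv (inv x) = x" using inv_mul_cancel[of "inv x" x] mul_dom_self[of "inv (inv x)"]
  by (simp add: inv_closed dom_inv rng_inv inv_mul)

lemma inv_unique:
  assumes "x \<in> gelems G" "y \<in> gelems G" "src x = rng y" "mul x y = rng x"
  shows "y = inv x"
  using inv_mul_cancel[OF assms(1-3)] mul_dom_self[of "inv x"] assms by (simp add: inv_closed dom_inv)

lemma inv_mul_distrib:
  assumes "x \<in> gelems G" "y \<in> gelems G" "src x = rng y"
  shows "inv (mul x y) = mul (inv y) (inv x)"
proof -
  have c: "(x, y) \<in> composable G" "(inv y, inv x) \<in> composable G" "(y, inv y) \<in> composable G"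
    "(y, mul (inv y) (inv x)) \<in> composable G"
    using assms by (auto simp: composable_iff inv_closed rng_inv dom_inv mul_closed rng_mul)
  have "mul (mul x y) (mul (inv y) (inv x)) = mul x (mul y (mul (inv y) (inv x)))" using mul_assoc[OF c(1,4)] .
  also have "mul y (mul (inv y) (inv x)) = inv x" using assms by (intro mul_inv_cancel) (auto simp: inv_closed rng_inv)
  also have "mul x (inv x) = rng (mul x y)" using assms c by (simp add: mul_inv rng_mul)
  finally show ?thesis using inv_unique[of "mul x y" "mul (inv y) (inv x)"] c assms
    by (simp add: mul_closed rng_mul dom_mul rng_inv inv_closed)
qed

lemma continuous_mul_comp:
  assumes f: "continuous_map X (gtop G) f" and g: "continuous_map X (gtop G) g"
    and fg: "\<And>x. x \<in> topspace X \<Longrightarrow> src (f x) = rng (g x)"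
  shows "continuous_map X (gtop G) (\<lambda>x. mul (f x) (g x))"
proof -
  have "f x \<in> gelems G \<and> g x \<in> gelems G" if "x \<in> topspace X" for x using f g that by (auto simp: continuous_map_def)
  then have "continuous_map X (subtopology (prod_topology (gtop G) (gtop G)) (composable G)) (\<lambda>x. (f x, g x))"
    using fg continuous_map_pairedI[OF f g] by (auto simp: continuous_map_in_subtopology composable_iff)
  from continuous_map_compose[OF this continuous_mul] show ?thesis by (simp add: o_def)
qed

lemma continuous_id: "continuous_map (gtop G) (gtop G) (\<lambda>x. x)" using continuous_map_id[of "gtop G"] by (simp add: id_def)

lemma continuous_inv': "continuous_map (gtop G) (gtop G) (\<lambda>x. inv x)" using continuous_inv by simp

lemma continuous_rng: "continuous_map (gtop G) (gtop G) (\<lambda>x. rng x)"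
  by (rule continuous_map_eq[OF continuous_mul_comp[OF continuous_id continuous_inv']]) (auto simp: rng_inv mul_inv)

lemma continuous_dom: "continuous_map (gtop G) (gtop G) (\<lambda>x. src x)"
  by (rule continuous_map_eq[OF continuous_mul_comp[OF continuous_inv' continuous_id]]) (auto simp: dom_inv inv_mul)

lemma continuous_rng_units: "continuous_map (gtop G) (unit_space G) (\<lambda>x. rng x)"
  unfolding unit_space_def continuous_map_in_subtopology using continuous_rng rng_unit by auto

lemma continuous_dom_units: "continuous_map (gtop G) (unit_space G) (\<lambda>x. src x)"
  unfolding unit_space_def continuous_map_in_subtopology using continuous_dom dom_unit by auto

lemma closedin_equal:
  assumes "continuous_map X (gtop G) f" "continuous_map X (gtop G) g"
  shows "closedin X {x \<in> topspace X. f x = g x}"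
  by (rule closedin_continuous_maps_eq[OF Hausdorff assms])

lemma closedin_units: "closedin (gtop G) (units G)"
proof -
  have "units G = {x \<in> gelems G. rng x = x}" using units_iff by blast
  then show ?thesis using closedin_equal[OF continuous_rng continuous_id] by simp
qed

lemma unit_space_lc: "locally_compact_space (unit_space G)" "Hausdorff_space (unit_space G)" unfolding unit_space_def
  by (intro locally_compact_space_closed_subset closedin_units locally_compact disjI1 Hausdorff Hausdorff_space_subtopology)+

lemma closedin_range_fiber: "u \<in> units G \<Longrightarrow> closedin (gtop G) (range_fiber G u)"
  using closedin_equal[OF continuous_rng, of "\<lambda>x. u"] units_subset by (auto simp: range_fiber_def)

end

section \<open>The homogeneous space of a closed wide subgroupoid\<close>

locale homogeneous_space = lc_groupoid G for G :: "'g groupoid" +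
  fixes H :: "'g set" and \<Lambda> \<Lambda>\<^sub>H :: "'g \<Rightarrow> 'g measure" and \<mu> :: "'g \<Rightarrow> 'g set measure"
  assumes haar: "haar_system G \<Lambda>" and wide: "closed_wide_subgroupoid G H"
    and haar_H: "haar_system (sub_groupoid G H) \<Lambda>\<^sub>H" and system: "quot_measure_system G H \<mu>"
begin

abbreviation "q \<equiv> quot_map G H"
abbreviation "Q \<equiv> quot_space G H"

lemma H_closed: "closedin (gtop G) H" using wide by (simp add: closed_wide_subgroupoid_def)
lemma H_subset: "H \<subseteq> gelems G" using closedin_subset[OF H_closed] .
lemma H_elem: "h \<in> H \<Longrightarrow> h \<in> gelems G" using H_subset by blast
lemma H_units: "units G \<subseteq> H" using wide by (simp add: closed_wide_subgroupoid_def)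
lemma H_mul: "\<lbrakk>x \<in> H; y \<in> H; src x = rng y\<rbrakk> \<Longrightarrow> mul x y \<in> H" using wide by (simp add: closed_wide_subgroupoid_def)
lemma H_inv: "x \<in> H \<Longrightarrow> inv x \<in> H" using wide by (simp add: closed_wide_subgroupoid_def)

lemma sub_simps: "gtop (sub_groupoid G H) = subtopology (gtop G) H" "grng (sub_groupoid G H) = rng"
  "gdom (sub_groupoid G H) = src" "gmul (sub_groupoid G H) = mul" "ginv (sub_groupoid G H) = inv"
  "gelems (sub_groupoid G H) = H"
  using H_subset by (auto simp: sub_groupoid_def)

lemma units_sub: "units (sub_groupoid G H) = units G"
proof -
  have "units G \<subseteq> rng ` H"
  proof
    fix u assume "u \<in> units G"
    then show "u \<in> rng ` H" using H_units units_iff by (intro image_eqI[of _ _ u]) auto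
  qed
  then show ?thesis unfolding units_def[of "sub_groupoid G H"] sub_simps(6) sub_simps(2) using rng_unit H_subset by auto
qed

lemma unit_space_sub: "unit_space (sub_groupoid G H) = unit_space G"
  using H_units by (simp add: unit_space_def units_sub sub_simps subtopology_subtopology inf.absorb2)

lemma H_rng_open:
  assumes "openin (gtop G) U" "h \<in> U" "h \<in> H"
  obtains V where "openin (unit_space G) V" "rng h \<in> V" "\<And>v. v \<in> V \<Longrightarrow> \<exists>k\<in>U \<inter> H. rng k = v"
proof -
  have 1: "full_equivariant_system (sub_groupoid G H) (subtopology (gtop G) H) (rng) (mul) \<Lambda>\<^sub>H"
    using haar_H by (simp add: haar_system_def sub_simps)
  have 2: "locally_compact_space (subtopology (gtop G) H)" "Hausdorff_space (subtopology (gtop G) H)"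
    using locally_compact_space_closed_subset[OF locally_compact H_closed] Hausdorff Hausdorff_space_subtopology by blast+
  have 3: "openin (subtopology (gtop G) H) (U \<inter> H)" using assms by (auto simp: openin_subtopology)
  show ?thesis
    by (rule full_system_open[OF 1 2 3, of h]) (use assms that H_elem rng_unit units_sub H_units in \<open>auto simp: unit_space_sub sub_simps\<close>)
qed

lemma rel_iff: "(x, y) \<in> quot_rel G H \<longleftrightarrow> x \<in> gelems G \<and> (\<exists>h\<in>H. src x = rng h \<and> y = mul x h)"
proof
  assume "(x, y) \<in> quot_rel G H"
  then have c: "x \<in> gelems G" "y \<in> gelems G" "rng x = rng y" "ldiv x y \<in> H" by (auto simp: quot_rel_def)
  moreover have "rng (ldiv x y) = src x" using c rng_mul[of "inv x" y] by (simp add: composable_iff inv_closed dom_inv rng_inv)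
  moreover have "y = mul x (ldiv x y)" using mul_inv_cancel[of x y] c by simp
  ultimately show "x \<in> gelems G \<and> (\<exists>h\<in>H. src x = rng h \<and> y = mul x h)" by metis
next
  assume "x \<in> gelems G \<and> (\<exists>h\<in>H. src x = rng h \<and> y = mul x h)"
  then obtain h where c: "x \<in> gelems G" "h \<in> H" "src x = rng h" "y = mul x h" by blast
  then have "(x, h) \<in> composable G" using H_elem by (simp add: composable_iff)
  then show "(x, y) \<in> quot_rel G H" using c mul_closed rng_mul inv_mul_cancel[of x h] H_elem by (simp add: quot_rel_def)
qed

lemma rel_refl: "x \<in> gelems G \<Longrightarrow> (x, x) \<in> quot_rel G H" using inv_mul dom_unit H_units by (auto simp: quot_rel_def)

lemma rel_sym: "(x, y) \<in> quot_rel G H \<Longrightarrow> (y, x) \<in> quot_rel G H"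
proof -
  assume a: "(x, y) \<in> quot_rel G H"
  then have c: "x \<in> gelems G" "y \<in> gelems G" "rng x = rng y" "ldiv x y \<in> H" by (auto simp: quot_rel_def)
  then have "inv (ldiv x y) = ldiv y x" using inv_mul_distrib[of "inv x" y] by (simp add: inv_closed dom_inv inv_inv)
  then show ?thesis using c H_inv[OF c(4)] by (simp add: quot_rel_def)
qed

lemma rel_trans: "\<lbrakk>(x, y) \<in> quot_rel G H; (y, z) \<in> quot_rel G H\<rbrakk> \<Longrightarrow> (x, z) \<in> quot_rel G H"
proof -
  assume "(x, y) \<in> quot_rel G H" "(y, z) \<in> quot_rel G H"
  then obtain h k where c: "x \<in> gelems G" "h \<in> H" "src x = rng h" "y = mul x h"
    "k \<in> H" "src y = rng k" "z = mul y k" by (auto simp: rel_iff)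
  have hk: "(x, h) \<in> composable G" "src h = rng k" using c H_elem dom_mul[of x h] by (auto simp: composable_iff)
  have "z = mul x (mul h k)" using mul_assoc[OF hk(1), of k] hk c H_elem by (simp add: composable_iff)
  moreover have "rng (mul h k) = rng h" using rng_mul[of h k] hk c H_elem by (simp add: composable_iff)
  ultimately show ?thesis unfolding rel_iff using c hk H_mul[of h k] by (intro conjI bexI[of _ "mul h k"]) auto
qed

lemma q_eq_iff: "x \<in> gelems G \<Longrightarrow> q x = q y \<longleftrightarrow> (x, y) \<in> quot_rel G H"
  using rel_refl rel_sym rel_trans unfolding quot_map_def by blast

lemma q_mul: "\<lbrakk>x \<in> gelems G; h \<in> H; src x = rng h\<rbrakk> \<Longrightarrow> q (mul x h) = q x" using q_eq_iff[of x "mul x h"] rel_iff by metis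

lemma q_closed: "x \<in> gelems G \<Longrightarrow> q x \<in> topspace Q" by (simp add: topspace_quot_space quot_map_def quotientI)

lemma q_rng: "\<lbrakk>x \<in> gelems G; q x = q y\<rbrakk> \<Longrightarrow> rng x = rng y \<and> y \<in> gelems G" using q_eq_iff by (auto simp: quot_rel_def)

lemma some_elem_q:
  assumes "x \<in> gelems G"
  shows "some_elem (q x) \<in> gelems G" "q (some_elem (q x)) = q x" "rng (some_elem (q x)) = rng x"
proof -
  have "x \<in> q x" using rel_refl[OF assms] by (simp add: quot_map_def)
  then have "some_elem (q x) \<in> q x" by (intro some_elem_nonempty) auto
  then have r: "(x, some_elem (q x)) \<in> quot_rel G H" by (simp add: quot_map_def)
  then show 1: "some_elem (q x) \<in> gelems G" by (auto simp: quot_rel_def)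
  show "q (some_elem (q x)) = q x" using q_eq_iff[OF assms] r by metis
  show "rng (some_elem (q x)) = rng x" using r by (auto simp: quot_rel_def)
qed

lemma Q_elem:
  assumes "\<omega> \<in> topspace Q"
  shows "some_elem \<omega> \<in> gelems G" "q (some_elem \<omega>) = \<omega>"
proof -
  obtain x where "x \<in> gelems G" "\<omega> = q x" using assms by (auto simp: topspace_quot_space quotient_def quot_map_def)
  then show "some_elem \<omega> \<in> gelems G" "q (some_elem \<omega>) = \<omega>" using some_elem_q by auto
qed

lemma quot_rng_q: "x \<in> gelems G \<Longrightarrow> quot_rng G (q x) = rng x" by (simp add: quot_rng_def some_elem_q)

lemma quot_act_q:
  assumes "\<gamma> \<in> gelems G" "x \<in> gelems G" "src \<gamma> = rng x"
  shows "quot_act G H \<gamma> (q x) = q (mul \<gamma> x)"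
proof -
  let ?y = "some_elem (q x)"
  have y: "?y \<in> gelems G" "q ?y = q x" "rng ?y = rng x" using some_elem_q[OF assms(2)] by auto
  obtain h where h: "h \<in> H" "src x = rng h" "?y = mul x h" using q_eq_iff[OF assms(2), of ?y] y rel_iff by metis
  have c: "(\<gamma>, x) \<in> composable G" "(x, h) \<in> composable G" using assms h H_elem by (auto simp: composable_iff)
  have "mul \<gamma> ?y = mul (mul \<gamma> x) h" using mul_assoc[OF c] h by simp
  then show ?thesis unfolding quot_act_def using q_mul[of "mul \<gamma> x" h] c h mul_closed dom_mul by simp
qed

lemma continuous_q: "continuous_map (gtop G) Q q" by (rule quotient_imp_continuous_map[OF quotient_map_quot_map])

lemma q_open:
  assumes U: "openin (gtop G) U"
  shows "openin Q (q ` U)"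
proof -
  have UG: "U \<subseteq> gelems G" using openin_subset[OF U] .
  have "openin (gtop G) {x \<in> gelems G. q x \<in> q ` U}"
  proof (subst openin_subopen, intro ballI)
    fix x assume "x \<in> {x \<in> gelems G. q x \<in> q ` U}"
    then obtain u where x: "x \<in> gelems G" "u \<in> U" "q x = q u" by auto
    then obtain h where h: "h \<in> H" "src x = rng h" "u = mul x h" using q_eq_iff[OF x(1), of u] rel_iff by metis
    let ?C = "subtopology (prod_topology (gtop G) (gtop G)) (composable G)"
    have tC: "topspace ?C = composable G" by (auto simp: composable_def)
    have "openin ?C {p \<in> topspace ?C. (\<lambda>(x, y). mul x y) p \<in> U}" by (rule openin_continuous_map_preimage[OF continuous_mul U])
    then obtain W where W: "openin (prod_topology (gtop G) (gtop G)) W"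
      "{p \<in> composable G. (\<lambda>(x, y). mul x y) p \<in> U} = W \<inter> composable G"
      unfolding tC by (auto simp: openin_subtopology)
    have "(x, h) \<in> W" using W(2) x h H_elem by (auto simp: composable_iff)
    from W(1)[unfolded openin_prod_topology_alt, rule_format, OF this] obtain A B where AB: "openin (gtop G) A" "openin (gtop G) B" "x \<in> A" "h \<in> B" "A \<times> B \<subseteq> W"
      by auto
    obtain V where V: "openin (unit_space G) V" "rng h \<in> V" "\<And>v. v \<in> V \<Longrightarrow> \<exists>k\<in>B \<inter> H. rng k = v"
      using H_rng_open[OF AB(2,4) h(1)] by metis
    have "openin (gtop G) {y \<in> gelems G. src y \<in> V}" by (rule openin_continuous_map_preimage[OF continuous_dom_units V(1)])
    then have "openin (gtop G) (A \<inter> {y \<in> gelems G. src y \<in> V})" using AB by auto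
    moreover have "x \<in> A \<inter> {y \<in> gelems G. src y \<in> V}" using AB x V h by auto
    moreover have "A \<inter> {y \<in> gelems G. src y \<in> V} \<subseteq> {x \<in> gelems G. q x \<in> q ` U}"
    proof
      fix y assume y: "y \<in> A \<inter> {y \<in> gelems G. src y \<in> V}"
      then obtain k where k: "k \<in> B" "k \<in> H" "rng k = src y" using V(3) by blast
      then have "(y, k) \<in> W \<inter> composable G" using AB y H_elem by (auto simp: composable_iff)
      then have "(y, k) \<in> {p \<in> composable G. (\<lambda>(x, y). mul x y) p \<in> U}" by (simp only: W(2))
      then have "mul y k \<in> U" by simp
      moreover have "q (mul y k) = q y" using q_mul k y by auto
      ultimately show "y \<in> {x \<in> gelems G. q x \<in> q ` U}" using y by (metis (no_types, lifting) IntD2 image_eqI mem_Collect_eq)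
    qed
    ultimately show "\<exists>T. openin (gtop G) T \<and> x \<in> T \<and> T \<subseteq> {x \<in> gelems G. q x \<in> q ` U}" by blast
  qed
  moreover have "q ` U \<subseteq> gelems G // quot_rel G H" using UG q_closed by (auto simp: topspace_quot_space)
  ultimately show ?thesis by (simp add: openin_quot_space)
qed

lemma saturation_closed:
  assumes A: "compactin (gtop G) A"
  shows "closedin (gtop G) {x \<in> gelems G. q x \<in> q ` A}"
proof -
  have AG: "A \<subseteq> gelems G" using compactin_subset_topspace[OF A] .
  let ?A = "subtopology (gtop G) A"
  let ?P = "prod_topology ?A (gtop G)"
  have tA: "topspace ?A = A" using AG by auto
  have c1: "continuous_map ?P (gtop G) (\<lambda>p. fst p)" using continuous_map_fst[of ?A "gtop G"]
    by (auto simp: continuous_map_in_subtopology)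
  have c2: "continuous_map ?P (gtop G) (\<lambda>p. snd p)" using continuous_map_snd by blast
  define C where "C = {p \<in> topspace ?P. rng (fst p) = rng (snd p)}"
  have C: "closedin ?P C"
    unfolding C_def using continuous_map_compose[OF c1 continuous_rng] continuous_map_compose[OF c2 continuous_rng]
    by (intro closedin_equal) (auto simp: o_def)
  have "C \<subseteq> topspace ?P" by (auto simp: C_def)
  then have tC: "topspace (subtopology ?P C) = C" by (simp add: topspace_subtopology inf.absorb2)
  have "continuous_map (subtopology ?P C) (gtop G) (\<lambda>p. mul (inv (fst p)) (snd p))"
  proof (rule continuous_mul_comp)
    show "continuous_map (subtopology ?P C) (gtop G) (\<lambda>p. inv (fst p))"
      using continuous_map_compose[OF continuous_map_from_subtopology[OF c1] continuous_inv'] by (simp add: o_def)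
    show "continuous_map (subtopology ?P C) (gtop G) (\<lambda>p. snd p)" by (rule continuous_map_from_subtopology[OF c2])
    show "\<And>x. x \<in> topspace (subtopology ?P C) \<Longrightarrow> src (inv (fst x)) = rng (snd x)" using AG by (auto simp: C_def dom_inv)
  qed
  from closedin_continuous_map_preimage[OF this H_closed]
  have "closedin (subtopology ?P C) {p \<in> C. mul (inv (fst p)) (snd p) \<in> H}" by (simp only: tC)
  then have T: "closedin ?P {p \<in> C. mul (inv (fst p)) (snd p) \<in> H}" using C closedin_closed_subtopology by blast
  have "compact_space ?A" using A by (simp add: compact_space_subtopology)
  from closed_map_snd[OF this, of "gtop G"] T
  have "closedin (gtop G) (snd ` {p \<in> C. mul (inv (fst p)) (snd p) \<in> H})" by (simp add: closed_map_def)
  moreover have "snd ` {p \<in> C. mul (inv (fst p)) (snd p) \<in> H} = {x \<in> gelems G. q x \<in> q ` A}"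
  proof safe
    fix a x assume ax: "(a, x) \<in> C" "mul (inv (fst (a, x))) (snd (a, x)) \<in> H"
    then have a: "a \<in> A" "x \<in> gelems G" "(a, x) \<in> quot_rel G H" using AG by (auto simp: C_def quot_rel_def)
    then show "snd (a, x) \<in> gelems G" by simp
    have "q a = q x" using a AG q_eq_iff by blast
    then show "q (snd (a, x)) \<in> q ` A" using a by auto
  next
    fix x a assume a: "x \<in> gelems G" "q x = q a" "a \<in> A"
    then have "(a, x) \<in> quot_rel G H" using AG q_eq_iff by (metis subsetD)
    then show "x \<in> snd ` {p \<in> C. mul (inv (fst p)) (snd p) \<in> H}"
      using a AG by (intro image_eqI[of _ _ "(a, x)"]) (auto simp: C_def quot_rel_def)
  qed
  ultimately show ?thesis by simp
qed

lemma q_compact: "compactin (gtop G) A \<Longrightarrow> compactin Q (q ` A)" using image_compactin continuous_q by blast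

lemma closedin_Q_iff: "C \<subseteq> topspace Q \<Longrightarrow> closedin Q C \<longleftrightarrow> closedin (gtop G) {x \<in> gelems G. q x \<in> C}"
  using quotient_map_quot_map[of G H] by (simp add: quotient_map_closedin)

lemma q_compact_closed:
  assumes "compactin (gtop G) A"
  shows "closedin Q (q ` A)"
  using saturation_closed[OF assms] compactin_subset_topspace[OF assms] q_closed by (subst closedin_Q_iff) auto

lemma compact_lift:
  assumes K: "compactin Q K"
  obtains A where "compactin (gtop G) A" "K \<subseteq> q ` A"
proof -
  let ?U = "{q ` U | U. openin (gtop G) U \<and> (\<exists>A. compactin (gtop G) A \<and> U \<subseteq> A)}"
  have 1: "\<forall>V\<in>?U. openin Q V" using q_open by blast
  have 2: "K \<subseteq> \<Union>?U"
  proof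
    fix \<omega> assume "\<omega> \<in> K"
    then have w: "\<omega> \<in> topspace Q" using compactin_subset_topspace[OF K] by blast
    obtain U A where "openin (gtop G) U" "compactin (gtop G) A" "some_elem \<omega> \<in> U" "U \<subseteq> A"
      using locally_compact Q_elem(1)[OF w] unfolding locally_compact_space_def by blast
    then show "\<omega> \<in> \<Union>?U" using Q_elem(2)[OF w] by (intro UnionI[of "q ` U"]) auto
  qed
  from K 1 2 obtain F where F: "finite F" "F \<subseteq> ?U" "K \<subseteq> \<Union>F" unfolding compactin_def by meson
  have "\<forall>V\<in>F. \<exists>A. compactin (gtop G) A \<and> V \<subseteq> q ` A"
  proof
    fix V assume "V \<in> F"
    then have "V \<in> ?U" using F(2) by blast
    then obtain U A where "V = q ` U" "compactin (gtop G) A" "U \<subseteq> A" by auto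
    then show "\<exists>A. compactin (gtop G) A \<and> V \<subseteq> q ` A" by blast
  qed
  from bchoice[OF this] obtain A where A: "\<forall>V\<in>F. compactin (gtop G) (A V) \<and> V \<subseteq> q ` A V" ..
  have "compactin (gtop G) (\<Union>(A ` F))" by (rule compactin_Union) (use F(1) A in auto)
  moreover have "K \<subseteq> q ` (\<Union>(A ` F))" using F(3) A by blast
  ultimately show ?thesis using that by blast
qed

end

section \<open>Equivariant sections\<close>

lemma (in hilbert_bundle) pullback_cong:
  assumes "\<And>x. x \<in> topspace X \<Longrightarrow> p x = p' x"
  shows "csect (pullback X p E) = csect (pullback X p' E)"
proof -
  have *: "csect (pullback X p E) \<subseteq> csect (pullback X p' E)" if eq: "\<And>x. x \<in> topspace X \<Longrightarrow> p x = p' x" for p p'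
  proof
    fix f assume f: "f \<in> csect (pullback X p E)"
    have "locally_approximable X (\<lambda>x. fib E (p' x)) ((\<lambda>\<xi> x. \<xi> (p' x)) ` csect E) f" unfolding locally_approximable_def
    proof (intro ballI allI impI)
      fix x and e :: real assume x: "x \<in> topspace X" and e: "0 < e"
      have "locally_approximable X (\<lambda>x. fib E (p x)) ((\<lambda>\<xi> x. \<xi> (p x)) ` csect E) f" using f by (simp add: pullback_def)
      from this[unfolded locally_approximable_def, rule_format, OF x e] obtain U \<xi> where U: "openin X U" "x \<in> U" "\<xi> \<in> csect E"
        "\<And>y. y \<in> U \<Longrightarrow> hdist (fib E (p y)) (f y) (\<xi> (p y)) < e" by auto
      have "hdist (fib E (p' y)) (f y) (\<xi> (p' y)) < e" if "y \<in> U" for y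
        using U(4)[OF that] eq[of y] that openin_subset[OF U(1)] by auto
      then show "\<exists>U. openin X U \<and> x \<in> U \<and> (\<exists>\<eta>\<in>(\<lambda>\<xi> x. \<xi> (p' x)) ` csect E. \<forall>v\<in>U. hdist (fib E (p' v)) (f v) (\<eta> v) < e)"
        using U by (intro exI[of _ U] conjI bexI[of _ "\<lambda>x. \<xi> (p' x)"]) auto
    qed
    moreover have "f \<in> (\<Pi> x\<in>topspace X. hcarrier (fib E (p' x)))" using f eq by (simp add: pullback_def Pi_iff)
    ultimately show "f \<in> csect (pullback X p' E)" by (simp add: pullback_def)
  qed
  show ?thesis using *[of p p'] *[of p' p] assms by auto
qed

lemma (in hilbert_bundle) pullback_const:
  assumes v: "v \<in> topspace B" and w: "w \<in> hcarrier (fib E v)"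
  shows "(\<lambda>x. w) \<in> csect (pullback X (\<lambda>x. v) E)"
proof -
  interpret V: hilbert_space "fib E v" by (rule hilbert[OF v])
  have "locally_approximable X (\<lambda>x. fib E v) ((\<lambda>\<xi> x. \<xi> v) ` csect E) (\<lambda>x. w)" unfolding locally_approximable_def
  proof (intro ballI allI impI)
    fix x and e :: real assume x: "x \<in> topspace X" and e: "0 < e"
    obtain \<xi> where \<xi>: "\<xi> \<in> csect E" "hdist (fib E v) (\<xi> v) w < e" using sect_dense[OF v w e] by blast
    then have "hdist (fib E v) w (\<xi> v) < e" using V.norm_minus_commute[OF w sect_closed[OF \<xi>(1) v]] by simp
    then show "\<exists>U. openin X U \<and> x \<in> U \<and> (\<exists>\<eta>\<in>(\<lambda>\<xi> x. \<xi> v) ` csect E. \<forall>y\<in>U. hdist (fib E v) w (\<eta> y) < e)"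
      using x \<xi> by (intro exI[of _ "topspace X"] conjI bexI[of _ "\<lambda>x. \<xi> v"]) auto
  qed
  then show ?thesis using w by (simp add: pullback_def)
qed

locale induced = homogeneous_space G H \<Lambda> \<Lambda>\<^sub>H \<mu> for G :: "'g groupoid" and H \<Lambda> \<Lambda>\<^sub>H \<mu> +
  fixes \<sigma> :: "('g, 'v) grep"
  assumes hbundle: "hilbert_bundle (unit_space G) \<sigma>"
    and unitary_act: "h \<in> H \<Longrightarrow> unitary (fib \<sigma> (gdom G h)) (fib \<sigma> (grng G h)) (act \<sigma> h)"
begin

sublocale S: hilbert_bundle "unit_space G" \<sigma> by (rule hbundle)

abbreviation "E x \<equiv> fib \<sigma> (src x)"
abbreviation "\<F> \<equiv> ind_functions G H \<sigma>"
abbreviation "prefiber \<equiv> ind_prefiber G H \<mu> \<sigma>"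
abbreviation "ip \<equiv> ind_inner G H \<mu> \<sigma>"
abbreviation "bundle_on D \<equiv> pullback (subtopology (gtop G) D) src \<sigma>"

lemma E_hilbert: "x \<in> gelems G \<Longrightarrow> hilbert_space (E x)" by (rule S.hilbert) (simp add: topspace_unit_space dom_unit)

lemmas E_semi = hilbert_imp_semi_inner[OF E_hilbert]
lemmas E_closed = semi_inner_space.closed[OF E_semi]
lemmas E_inner = semi_inner_space.inner_simps[OF E_semi]

definition equivariant_on :: "'g set \<Rightarrow> ('g \<Rightarrow> 'v) \<Rightarrow> bool" where "equivariant_on D f \<longleftrightarrow> f \<in> csect (bundle_on D) \<and>
     (\<exists>A. compactin (gtop G) A \<and> (\<forall>x\<in>D. f x \<noteq> hzero (E x) \<longrightarrow> q x \<in> q ` A)) \<and>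
     (\<forall>x\<in>D. \<forall>h\<in>H. src x = rng h \<longrightarrow> f (mul x h) = act \<sigma> (inv h) (f x))"

definition invariant :: "'g set \<Rightarrow> bool" where "invariant D \<longleftrightarrow> closedin (gtop G) D \<and> (\<forall>x\<in>D. \<forall>h\<in>H. src x = rng h \<longrightarrow> mul x h \<in> D)"

lemma invariant_gelems: "invariant (gelems G)" unfolding invariant_def using mul_closed H_elem by (auto simp: composable_iff)

lemma range_fiber_iff: "x \<in> range_fiber G u \<longleftrightarrow> x \<in> gelems G \<and> rng x = u" by (simp add: range_fiber_def)

lemma invariant_range_fiber: "u \<in> units G \<Longrightarrow> invariant (range_fiber G u)"
  unfolding invariant_def using closedin_range_fiber mul_closed rng_mul H_elem by (auto simp: composable_iff range_fiber_iff)

lemma invariant_subset: "invariant D \<Longrightarrow> D \<subseteq> gelems G" by (simp add: invariant_def closedin_subset)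

lemma invariant_q:
  assumes D: "invariant D" and "x \<in> D" "q x = q y"
  shows "y \<in> D"
proof -
  have x: "x \<in> gelems G" using invariant_subset[OF D] assms by blast
  then obtain h where "h \<in> H" "src x = rng h" "y = mul x h" using q_eq_iff[OF x] assms(3) rel_iff by metis
  then show ?thesis using D assms(2) by (auto simp: invariant_def)
qed

lemma dom_restricted: "continuous_map (subtopology (gtop G) D) (unit_space G) src"
  using continuous_map_from_subtopology[OF continuous_dom_units] by simp

lemma hilbert_bundle_on: "hilbert_bundle (subtopology (gtop G) D) (bundle_on D)"
  by (rule S.hilbert_bundle_pullback[OF dom_restricted])

lemma topspace_on: "invariant D \<Longrightarrow> topspace (subtopology (gtop G) D) = D" using invariant_subset by auto

lemma equivariant_closed: "\<lbrakk>equivariant_on D f; invariant D; x \<in> D\<rbrakk> \<Longrightarrow> f x \<in> hcarrier (E x)"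
  using hilbert_bundle.sect_closed[OF hilbert_bundle_on, of f D x] topspace_on by (auto simp: equivariant_on_def)

lemma act_inv:
  assumes "h \<in> H"
  shows "unitary (fib \<sigma> (rng h)) (E h) (act \<sigma> (inv h))"
  using unitary_act[OF H_inv[OF assms]] H_elem[OF assms] by (simp add: dom_inv rng_inv)

lemma act_inv_preserving: "h \<in> H \<Longrightarrow> inner_preserving (fib \<sigma> (rng h)) (E h) (act \<sigma> (inv h))"
  by (rule unitary_inner_preserving[OF act_inv])

lemma fib_semi: "u \<in> units G \<Longrightarrow> semi_inner_space (fib \<sigma> u)" "u \<in> units G \<Longrightarrow> hilbert_space (fib \<sigma> u)"
  using S.hilbert hilbert_imp_semi_inner by (auto simp: topspace_unit_space)

lemma act_inv_linear:
  assumes "h \<in> H"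
  shows "\<And>v w. \<lbrakk>v \<in> hcarrier (fib \<sigma> (rng h)); w \<in> hcarrier (fib \<sigma> (rng h))\<rbrakk> \<Longrightarrow>
      act \<sigma> (inv h) (hadd (fib \<sigma> (rng h)) v w) = hadd (E h) (act \<sigma> (inv h) v) (act \<sigma> (inv h) w)"
    and "\<And>v a. v \<in> hcarrier (fib \<sigma> (rng h)) \<Longrightarrow> act \<sigma> (inv h) (hscale (fib \<sigma> (rng h)) a v) = hscale (E h) a (act \<sigma> (inv h) v)"
    and "act \<sigma> (inv h) (hzero (fib \<sigma> (rng h))) = hzero (E h)"
  using inner_preserving_linear[OF fib_semi(1) fib_semi(2) act_inv_preserving[OF assms]] H_elem[OF assms]
  by (simp_all add: rng_unit dom_unit)

lemma dom_mul_H: "\<lbrakk>x \<in> gelems G; h \<in> H; src x = rng h\<rbrakk> \<Longrightarrow> src (mul x h) = src h" using dom_mul H_elem by (simp add: composable_iff)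

lemma equivariant_zero:
  assumes D: "invariant D"
  shows "equivariant_on D (\<lambda>x. hzero (E x))"
  unfolding equivariant_on_def
proof (intro conjI ballI impI)
  show "(\<lambda>x. hzero (E x)) \<in> csect (bundle_on D)" using hilbert_bundle.sect_zero[OF hilbert_bundle_on] by simp
  show "\<exists>A. compactin (gtop G) A \<and> (\<forall>x\<in>D. hzero (E x) \<noteq> hzero (E x) \<longrightarrow> q x \<in> q ` A)" by (intro exI[of _ "{}"]) simp
  fix x h assume x: "x \<in> D" and h: "h \<in> H" "src x = rng h"
  then show "hzero (E (mul x h)) = act \<sigma> (inv h) (hzero (E x))"
    using act_inv_linear(3)[OF h(1)] dom_mul_H invariant_subset[OF D] by auto
qed

lemma equivariant_add:
  assumes D: "invariant D" and f: "equivariant_on D f" and g: "equivariant_on D g"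
  shows "equivariant_on D (\<lambda>x. hadd (E x) (f x) (g x))"
  unfolding equivariant_on_def
proof (intro conjI ballI impI)
  show "(\<lambda>x. hadd (E x) (f x) (g x)) \<in> csect (bundle_on D)"
    using hilbert_bundle.sect_add[OF hilbert_bundle_on, of f D g] f g by (simp add: equivariant_on_def)
  obtain A B where A: "compactin (gtop G) A" "\<forall>x\<in>D. f x \<noteq> hzero (E x) \<longrightarrow> q x \<in> q ` A"
    and B: "compactin (gtop G) B" "\<forall>x\<in>D. g x \<noteq> hzero (E x) \<longrightarrow> q x \<in> q ` B"
    using f g unfolding equivariant_on_def by blast
  have "q x \<in> q ` (A \<union> B)" if x: "x \<in> D" "hadd (E x) (f x) (g x) \<noteq> hzero (E x)" for x
  proof (rule ccontr)
    assume "q x \<notin> q ` (A \<union> B)"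
    then have z: "f x = hzero (E x)" "g x = hzero (E x)" using A B x by blast+
    interpret hilbert_space "E x" by (rule E_hilbert) (use x invariant_subset[OF D] in blast)
    show False using z x add_zero zero_closed by simp
  qed
  then show "\<exists>A. compactin (gtop G) A \<and> (\<forall>x\<in>D. hadd (E x) (f x) (g x) \<noteq> hzero (E x) \<longrightarrow> q x \<in> q ` A)"
    using compactin_Un[OF A(1) B(1)] by blast
  fix x h assume x: "x \<in> D" and h: "h \<in> H" "src x = rng h"
  have "f x \<in> hcarrier (E x)" "g x \<in> hcarrier (E x)" using equivariant_closed D f g x by auto
  then show "hadd (E (mul x h)) (f (mul x h)) (g (mul x h)) = act \<sigma> (inv h) (hadd (E x) (f x) (g x))"
    using act_inv_linear(1)[OF h(1)] dom_mul_H[of x h] invariant_subset[OF D] x h f g by (auto simp: equivariant_on_def)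
qed

lemma equivariant_mult:
  assumes D: "invariant D" and f: "equivariant_on D f"
    and c: "continuous_map (subtopology (gtop G) D) euclidean c"
    and inv: "\<And>x h. \<lbrakk>x \<in> D; h \<in> H; src x = rng h\<rbrakk> \<Longrightarrow> c (mul x h) = c x"
  shows "equivariant_on D (\<lambda>x. hscale (E x) (c x) (f x))"
  unfolding equivariant_on_def
proof (intro conjI ballI impI)
  show "(\<lambda>x. hscale (E x) (c x) (f x)) \<in> csect (bundle_on D)"
    using hilbert_bundle.sect_mult[OF hilbert_bundle_on c, of f] f by (simp add: equivariant_on_def)
  obtain A where A: "compactin (gtop G) A" "\<forall>x\<in>D. f x \<noteq> hzero (E x) \<longrightarrow> q x \<in> q ` A" using f unfolding equivariant_on_def by blast
  have "f x \<noteq> hzero (E x)" if x: "x \<in> D" "hscale (E x) (c x) (f x) \<noteq> hzero (E x)" for x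
  proof
    assume z: "f x = hzero (E x)"
    interpret hilbert_space "E x" by (rule E_hilbert) (use x invariant_subset[OF D] in blast)
    have "hscale (E x) (c x) (hzero (E x)) = hzero (E x)" by (rule norm_eq_zero) (simp_all add: closed norm_scale norm_zero)
    then show False using x z by simp
  qed
  then show "\<exists>A. compactin (gtop G) A \<and> (\<forall>x\<in>D. hscale (E x) (c x) (f x) \<noteq> hzero (E x) \<longrightarrow> q x \<in> q ` A)" using A by blast
  fix x h assume x: "x \<in> D" and h: "h \<in> H" "src x = rng h"
  have "f x \<in> hcarrier (E x)" using equivariant_closed D f x by auto
  then show "hscale (E (mul x h)) (c (mul x h)) (f (mul x h)) = act \<sigma> (inv h) (hscale (E x) (c x) (f x))"
    using act_inv_linear(2)[OF h(1)] dom_mul_H[of x h] invariant_subset[OF D] x h f inv by (auto simp: equivariant_on_def)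
qed

lemma equivariant_scale: "\<lbrakk>invariant D; equivariant_on D f\<rbrakk> \<Longrightarrow> equivariant_on D (\<lambda>x. hscale (E x) a (f x))"
  by (rule equivariant_mult) auto

lemma equivariant_cong:
  assumes D: "invariant D" and f: "equivariant_on D f" and eq: "\<And>x. x \<in> D \<Longrightarrow> f x = g x"
  shows "equivariant_on D g"
  unfolding equivariant_on_def
proof (intro conjI ballI impI)
  have "f \<in> csect (bundle_on D)" using f by (simp add: equivariant_on_def)
  then show "g \<in> csect (bundle_on D)" by (rule hilbert_bundle.sect_cong[OF hilbert_bundle_on]) (use eq topspace_on[OF D] in simp)
  show "\<exists>A. compactin (gtop G) A \<and> (\<forall>x\<in>D. g x \<noteq> hzero (E x) \<longrightarrow> q x \<in> q ` A)" using f eq unfolding equivariant_on_def by metis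
  fix x h assume "x \<in> D" and "h \<in> H" "src x = rng h"
  then show "g (mul x h) = act \<sigma> (inv h) (g x)" using f eq D unfolding equivariant_on_def invariant_def by metis
qed

lemma equivariant_subset:
  assumes D: "invariant D" "invariant D'" "D' \<subseteq> D" and f: "equivariant_on D f"
  shows "equivariant_on D' f"
proof -
  have "continuous_map (subtopology (gtop G) D') (subtopology (gtop G) D) (\<lambda>x. x)"
    using D invariant_subset continuous_map_from_subtopology[OF continuous_id] by (auto simp: continuous_map_in_subtopology)
  from S.pullback_comp[OF dom_restricted this] have "f \<in> csect (pullback (subtopology (gtop G) D') src \<sigma>)"
    using f by (simp add: equivariant_on_def)
  then show ?thesis using f D(3) unfolding equivariant_on_def by (meson subsetD)
qed

lemma ind_functions_iff: "f \<in> \<F> \<longleftrightarrow> equivariant_on (gelems G) f"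
proof
  assume f: "f \<in> \<F>"
  have "f \<in> csect (pullback (gtop G) src \<sigma>)"
    using f S.continuous_map_total_space[OF continuous_dom_units] by (simp add: ind_functions_def)
  moreover have "compactin Q (q ` (gtop G closure_of {x \<in> gelems G. f x \<noteq> hzero (E x)}))" using f by (simp add: ind_functions_def)
  then obtain A where A: "compactin (gtop G) A" "q ` (gtop G closure_of {x \<in> gelems G. f x \<noteq> hzero (E x)}) \<subseteq> q ` A"
    using compact_lift by blast
  moreover have "q x \<in> q ` A" if "x \<in> gelems G" "f x \<noteq> hzero (E x)" for x
  proof -
    have "x \<in> gtop G closure_of {x \<in> gelems G. f x \<noteq> hzero (E x)}" by (rule subsetD[OF closure_of_subset]) (use that in auto)
    then show ?thesis using A(2) by blast
  qed
  ultimately show "equivariant_on (gelems G) f"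
    using f unfolding equivariant_on_def subtopology_topspace ind_functions_def by blast
next
  assume f: "equivariant_on (gelems G) f"
  then have cs: "f \<in> csect (pullback (gtop G) src \<sigma>)" by (simp add: equivariant_on_def subtopology_topspace)
  obtain A where A: "compactin (gtop G) A" "\<And>x. x\<in>gelems G \<Longrightarrow> f x \<noteq> hzero (E x) \<Longrightarrow> q x \<in> q ` A"
    using f unfolding equivariant_on_def by blast
  let ?N = "{x \<in> gelems G. f x \<noteq> hzero (E x)}"
  let ?C = "gtop G closure_of ?N"
  have CG: "?C \<subseteq> gelems G" by (rule closure_of_subset_topspace)
  have sub: "?C \<subseteq> {x \<in> gelems G. q x \<in> q ` A}" by (rule closure_of_minimal[OF _ saturation_closed[OF A(1)]]) (use A(2) in auto)
  have Ninv: "mul x h \<in> ?N" if x: "x \<in> ?N" and h: "h \<in> H" "src x = rng h" for x h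
  proof -
    have c: "mul x h \<in> gelems G" "E (mul x h) = E h" using x h mul_closed H_elem dom_mul_H[of x h] by (auto simp: composable_iff)
    have fx: "f x \<in> hcarrier (E x)" using equivariant_closed[OF f invariant_gelems] x by blast
    have eq: "f (mul x h) = act \<sigma> (inv h) (f x)" using f x h by (auto simp: equivariant_on_def)
    have "f x = hzero (E x)" if "act \<sigma> (inv h) (f x) = hzero (E h)"
    proof -
      have "inj_on (act \<sigma> (inv h)) (hcarrier (E x))" using act_inv[OF h(1)] h by (simp add: unitary_def bij_betw_def)
      then show ?thesis using that act_inv_linear(3)[OF h(1)] fx E_closed(1)[of x] x h by (auto simp: inj_on_def)
    qed
    then show ?thesis using c eq x by auto
  qed
  \<comment> \<open>closures of invariant sets are invariant, because the quotient map is open\<close>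
  have "closedin Q (q ` ?C)"
  proof -
    have "{x \<in> gelems G. q x \<in> q ` ?C} = ?C"
    proof (intro equalityI subsetI)
      fix x assume "x \<in> {x \<in> gelems G. q x \<in> q ` ?C}"
      then obtain y where x: "x \<in> gelems G" and y: "y \<in> ?C" "q x = q y" by blast
      show "x \<in> ?C" unfolding in_closure_of
      proof (intro conjI allI impI)
        fix T assume T: "x \<in> T \<and> openin (gtop G) T"
        have "openin (gtop G) {z \<in> gelems G. q z \<in> q ` T}" using q_open[of T] T openin_quot_space by blast
        moreover have "y \<in> {z \<in> gelems G. q z \<in> q ` T}" using y x T CG by auto
        ultimately have "\<exists>z. z \<in> ?N \<and> z \<in> {z \<in> gelems G. q z \<in> q ` T}"
          by (intro y(1)[unfolded in_closure_of, THEN conjunct2, rule_format]) (rule conjI)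
        then obtain z where z: "z \<in> ?N" "q z \<in> q ` T" by auto
        then obtain t where t: "t \<in> T" "q z = q t" by blast
        then obtain h where "h \<in> H" "src z = rng h" "t = mul z h" using q_eq_iff[of z t] rel_iff z by auto
        then have "t \<in> ?N" using Ninv z by blast
        then show "\<exists>y. y \<in> ?N \<and> y \<in> T" using t by blast
      qed (rule x)
    qed (use CG in auto)
    moreover have "q ` ?C \<subseteq> topspace Q" using CG q_closed by blast
    ultimately show ?thesis using closedin_Q_iff by simp
  qed
  moreover have "q ` ?C \<subseteq> q ` A" using sub by auto
  ultimately have "compactin Q (q ` ?C)" using closed_compactin[OF q_compact[OF A(1)]] by blast
  then show "f \<in> \<F>" unfolding ind_functions_def
    using S.continuous_map_total_space[OF continuous_dom_units] cs f equivariant_closed[OF f invariant_gelems]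
    by (auto simp: equivariant_on_def)
qed

section \<open>The inner products on the fibers of the induced bundle\<close>

definition pairing :: "('g \<Rightarrow> 'v) \<Rightarrow> ('g \<Rightarrow> 'v) \<Rightarrow> 'g set \<Rightarrow> complex" where
  "pairing f g \<omega> = hinner (E (some_elem \<omega>)) (f (some_elem \<omega>)) (g (some_elem \<omega>))"

abbreviation "fiber u \<equiv> {\<omega> \<in> topspace Q. quot_rng G \<omega> = u}"

lemma fiber_q: "fiber u = q ` range_fiber G u"
proof safe
  fix \<omega> assume "\<omega> \<in> topspace Q" "u = quot_rng G \<omega>"
  then show "\<omega> \<in> q ` range_fiber G (quot_rng G \<omega>)"
    using Q_elem[of \<omega>] by (intro image_eqI[of _ _ "some_elem \<omega>"]) (auto simp: range_fiber_iff quot_rng_def)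
qed (auto simp: range_fiber_iff q_closed quot_rng_q)

lemma ind_inner_pairing: "ip u f g = (LINT \<omega>:fiber u|\<mu> u. pairing f g \<omega>)" by (simp add: ind_inner_def pairing_def)

lemma pairing_q:
  assumes D: "invariant D" and f: "equivariant_on D f" and g: "equivariant_on D g" and x: "x \<in> D"
  shows "pairing f g (q x) = hinner (E x) (f x) (g x)"
proof -
  have xG: "x \<in> gelems G" using x invariant_subset[OF D] by blast
  obtain h where h: "h \<in> H" "src x = rng h" "some_elem (q x) = mul x h"
    using q_eq_iff[OF xG, of "some_elem (q x)"] some_elem_q(2)[OF xG] rel_iff by metis
  have "f (mul x h) = act \<sigma> (inv h) (f x)" "g (mul x h) = act \<sigma> (inv h) (g x)" using f g x h by (auto simp: equivariant_on_def)
  moreover have "f x \<in> hcarrier (fib \<sigma> (rng h))" "g x \<in> hcarrier (fib \<sigma> (rng h))" using equivariant_closed D f g x h by metis+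
  ultimately show ?thesis using act_inv_preserving[OF h(1)] h xG dom_mul_H[of x h] by (simp add: pairing_def inner_preserving_def)
qed

lemma closedin_qD:
  assumes D: "invariant D"
  shows "closedin Q (q ` D)" "{x \<in> gelems G. q x \<in> q ` D} = D"
proof -
  show 1: "{x \<in> gelems G. q x \<in> q ` D} = D" using invariant_q[OF D] invariant_subset[OF D] by (auto; blast)
  have "q ` D \<subseteq> topspace Q" using invariant_subset[OF D] q_closed by blast
  then show "closedin Q (q ` D)" using closedin_Q_iff 1 D by (simp add: invariant_def)
qed

lemma pairing_continuous:
  assumes D: "invariant D" and f: "equivariant_on D f" and g: "equivariant_on D g"
  shows "continuous_map (subtopology Q (q ` D)) euclidean (pairing f g)"
proof -
  have "quotient_map (subtopology (gtop G) D) (subtopology Q (q ` D)) q"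
    by (rule quotient_map_restriction[OF quotient_map_quot_map]) (use closedin_qD[OF D] in auto)
  moreover have "continuous_map (subtopology (gtop G) D) euclidean (pairing f g \<circ> q)"
  proof (rule continuous_map_eq)
    show "continuous_map (subtopology (gtop G) D) euclidean (\<lambda>x. hinner (E x) (f x) (g x))"
      using hilbert_bundle.inner_continuous[OF hilbert_bundle_on, of f D g] f g by (simp add: equivariant_on_def)
  qed (use pairing_q[OF D f g] topspace_on[OF D] in simp)
  ultimately show ?thesis using continuous_compose_quotient_map_eq by blast
qed

lemma pairing_support:
  assumes D: "invariant D" and f: "equivariant_on D f" and g: "equivariant_on D g"
  shows "\<exists>A. compactin (gtop G) A \<and> (\<forall>\<omega>\<in>q ` D. pairing f g \<omega> \<noteq> 0 \<longrightarrow> \<omega> \<in> q ` A)"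
proof -
  obtain A where A: "compactin (gtop G) A" "\<forall>x\<in>D. f x \<noteq> hzero (E x) \<longrightarrow> q x \<in> q ` A" using f unfolding equivariant_on_def by blast
  have "q x \<in> q ` A" if x: "x \<in> D" "pairing f g (q x) \<noteq> 0" for x
  proof (rule ccontr)
    assume "q x \<notin> q ` A"
    then have "f x = hzero (E x)" using A x by blast
    then show False using x pairing_q[OF D f g x(1)] equivariant_closed[OF g D x(1)] invariant_subset[OF D]
      by (simp add: E_inner subsetD)
  qed
  then show ?thesis using A(1) by blast
qed

lemma mu_radon: "u \<in> units G \<Longrightarrow> radon Q (\<mu> u)"
  and mu_support: "u \<in> units G \<Longrightarrow> measure_support Q (\<mu> u) = fiber u"
  using system by (auto simp: quot_measure_system_def full_equivariant_system_def radon_def)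

lemma fiber_closed: "u \<in> units G \<Longrightarrow> closedin Q (fiber u)" using closedin_qD(1)[OF invariant_range_fiber] by (simp add: fiber_q)

lemma fiber_measurable: "u \<in> units G \<Longrightarrow> fiber u \<in> sets (\<mu> u)" using radon.closed_measurable[OF mu_radon fiber_closed] .

lemma pairing_integrable:
  assumes u: "u \<in> units G" and f: "equivariant_on (range_fiber G u) f" and g: "equivariant_on (range_fiber G u) g"
  shows "set_integrable (\<mu> u) (fiber u) (pairing f g)"
proof -
  note D = invariant_range_fiber[OF u]
  obtain A where A: "compactin (gtop G) A" "\<forall>\<omega>\<in>q ` range_fiber G u. pairing f g \<omega> \<noteq> 0 \<longrightarrow> \<omega> \<in> q ` A"
    using pairing_support[OF D f g] by blast
  show ?thesis unfolding fiber_q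
    by (rule radon.set_integrable_continuous[OF mu_radon[OF u] closedin_qD(1)[OF D] pairing_continuous[OF D f g]
          q_compact[OF A(1)] q_compact_closed[OF A(1)]]) (use A(2) in auto)
qed

definition fiber_functions :: "'g \<Rightarrow> ('g \<Rightarrow> 'v) set" where
  "fiber_functions u = {f \<in> extensional (range_fiber G u). equivariant_on (range_fiber G u) f}"

text \<open>The functions on \<open>G\<^sup>u\<close> that look like restrictions of equivariant functions, whether or not
  they extend to \<open>G\<close>.\<close>

definition big_prefiber :: "'g \<Rightarrow> ('g \<Rightarrow> 'v) hilb" where "big_prefiber u = (prefiber u)\<lparr>hcarrier := fiber_functions u\<rparr>"

lemma prefiber_simps: "hcarrier (prefiber u) = (\<lambda>f. res u f) ` \<F>" "hzero (prefiber u) = (\<lambda>x\<in>range_fiber G u. hzero (E x))"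
  "hadd (prefiber u) = (\<lambda>f g. \<lambda>x\<in>range_fiber G u. hadd (E x) (f x) (g x))"
  "hscale (prefiber u) = (\<lambda>a f. \<lambda>x\<in>range_fiber G u. hscale (E x) a (f x))"
  "hinner (prefiber u) = ip u"
  "hcarrier (big_prefiber u) = fiber_functions u"
  "hzero (big_prefiber u) = (\<lambda>x\<in>range_fiber G u. hzero (E x))"
  "hadd (big_prefiber u) = (\<lambda>f g. \<lambda>x\<in>range_fiber G u. hadd (E x) (f x) (g x))"
  "hscale (big_prefiber u) = (\<lambda>a f. \<lambda>x\<in>range_fiber G u. hscale (E x) a (f x))"
  "hinner (big_prefiber u) = ip u"
  by (simp_all add: ind_prefiber_def big_prefiber_def)

lemma fiber_functionsI:
  assumes u: "u \<in> units G" and f: "equivariant_on (range_fiber G u) f"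
  shows "res u f \<in> fiber_functions u"
  unfolding fiber_functions_def using equivariant_cong[OF invariant_range_fiber[OF u] f, of "res u f"] by simp

lemma ind_restrict:
  assumes u: "u \<in> units G" and f: "f \<in> \<F>"
  shows "res u f \<in> fiber_functions u"
  by (intro fiber_functionsI[OF u] equivariant_subset[OF invariant_gelems invariant_range_fiber[OF u]])
    (use f in \<open>auto simp: ind_functions_iff range_fiber_iff\<close>)

lemma ind_inner_cong:
  assumes u: "u \<in> units G" and "\<And>x. x \<in> range_fiber G u \<Longrightarrow> hinner (E x) (f x) (g x) = hinner (E x) (f' x) (g' x)"
  shows "ip u f g = ip u f' g'"
  unfolding ind_inner_pairing
proof (rule set_lebesgue_integral_cong[OF fiber_measurable[OF u]], intro allI impI)
  fix \<omega> assume w: "\<omega> \<in> fiber u"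
  then have "some_elem \<omega> \<in> range_fiber G u" using Q_elem[of \<omega>] by (auto simp: range_fiber_iff quot_rng_def)
  then show "pairing f g \<omega> = pairing f' g' \<omega>" using assms(2) by (simp add: pairing_def)
qed

lemma semi_inner_space_big_prefiber:
  assumes u: "u \<in> units G"
  shows "semi_inner_space (big_prefiber u)"
proof -
  let ?R = "range_fiber G u"
  note D = invariant_range_fiber[OF u]
  have ff: "equivariant_on ?R f" "f \<in> extensional ?R" if "f \<in> fiber_functions u" for f
    using that by (auto simp: fiber_functions_def)
  have fc: "f x \<in> hcarrier (E x)" if "f \<in> fiber_functions u" "x \<in> ?R" for f x
    using equivariant_closed[OF ff(1)[OF that(1)] D that(2)] .
  have RG: "x \<in> gelems G" if "x \<in> ?R" for x using that by (simp add: range_fiber_iff)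
  have vs: "complex_vector_space (E x)" if "x \<in> ?R" for x using E_semi[OF RG[OF that]] by (simp add: semi_inner_space_def)
  have some: "some_elem \<omega> \<in> ?R" if "\<omega> \<in> fiber u" for \<omega> using that Q_elem[of \<omega>] by (auto simp: range_fiber_iff quot_rng_def)
  have add: "(\<lambda>x\<in>?R. hadd (E x) (f x) (g x)) \<in> fiber_functions u" if "f \<in> fiber_functions u" "g \<in> fiber_functions u" for f g
    by (rule fiber_functionsI[OF u equivariant_add[OF D ff(1)[OF that(1)] ff(1)[OF that(2)]]])
  have scale: "(\<lambda>x\<in>?R. hscale (E x) a (f x)) \<in> fiber_functions u" if "f \<in> fiber_functions u" for f a
    by (rule fiber_functionsI[OF u equivariant_scale[OF D ff(1)[OF that]]])
  note cv = complex_vector_space.add_assoc[OF vs] complex_vector_space.add_zero[OF vs]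
    complex_vector_space.add_uminus[OF vs] complex_vector_space.scale_add[OF vs] complex_vector_space.add_scale[OF vs]
    complex_vector_space.scale_scale[OF vs] complex_vector_space.scale_one[OF vs]
  have comm: "hadd (big_prefiber u) f g = hadd (big_prefiber u) g f"
    if "f \<in> hcarrier (big_prefiber u)" "g \<in> hcarrier (big_prefiber u)" for f g
    using that unfolding prefiber_simps by (intro restrict_ext) (rule complex_vector_space.add_commute[OF vs]; simp add: fc)
  interpret complex_vector_space "big_prefiber u" by unfold_locales ((rule comm; assumption) |
      (simp add: prefiber_simps add scale fiber_functionsI[OF u equivariant_zero[OF D]]; fail)[1] |
      (simp add: prefiber_simps fun_eq_iff restrict_def cv fc extensional_arb[OF ff(2)]; fail)[1])+
  show ?thesis
  proof
    fix f g k assume a: "f \<in> hcarrier (big_prefiber u)" "g \<in> hcarrier (big_prefiber u)" "k \<in> hcarrier (big_prefiber u)"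
    then have c: "f \<in> fiber_functions u" "g \<in> fiber_functions u" "k \<in> fiber_functions u" by (simp_all add: prefiber_simps)
    have "(LINT \<omega>:fiber u|\<mu> u. pairing (\<lambda>x\<in>?R. hadd (E x) (f x) (g x)) k \<omega>) = (LINT \<omega>:fiber u|\<mu> u. pairing f k \<omega> + pairing g k \<omega>)"
      by (rule set_lebesgue_integral_cong[OF fiber_measurable[OF u]]) (use some fc c RG in \<open>auto simp: pairing_def E_inner\<close>)
    also have "\<dots> = (LINT \<omega>:fiber u|\<mu> u. pairing f k \<omega>) + (LINT \<omega>:fiber u|\<mu> u. pairing g k \<omega>)"
      by (rule set_integral_add) (use pairing_integrable[OF u ff(1) ff(1)] c in auto)
    finally show "hinner (big_prefiber u) (hadd (big_prefiber u) f g) k = hinner (big_prefiber u) f k + hinner (big_prefiber u) g k"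
      by (simp add: prefiber_simps ind_inner_pairing)
  next
    fix f g a assume "f \<in> hcarrier (big_prefiber u)" "g \<in> hcarrier (big_prefiber u)"
    then have c: "f \<in> fiber_functions u" "g \<in> fiber_functions u" by (simp_all add: prefiber_simps)
    have "(LINT \<omega>:fiber u|\<mu> u. pairing (\<lambda>x\<in>?R. hscale (E x) a (f x)) g \<omega>) = (LINT \<omega>:fiber u|\<mu> u. a * pairing f g \<omega>)"
      by (rule set_lebesgue_integral_cong[OF fiber_measurable[OF u]]) (use some fc c RG in \<open>auto simp: pairing_def E_inner\<close>)
    then show "hinner (big_prefiber u) (hscale (big_prefiber u) a f) g = a * hinner (big_prefiber u) f g"
      by (simp add: prefiber_simps ind_inner_pairing)
  next
    fix f g assume "f \<in> hcarrier (big_prefiber u)" "g \<in> hcarrier (big_prefiber u)"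
    then have c: "f \<in> fiber_functions u" "g \<in> fiber_functions u" by (simp_all add: prefiber_simps)
    have "pairing f g \<omega> = cnj (pairing g f \<omega>)" if "\<omega> \<in> fiber u" for \<omega> unfolding pairing_def
      by (rule semi_inner_space.inner_commute[OF E_semi]) (use some[OF that] fc c RG in auto)
    then have "(LINT \<omega>:fiber u|\<mu> u. pairing f g \<omega>) = (LINT \<omega>:fiber u|\<mu> u. cnj (pairing g f \<omega>))"
      by (intro set_lebesgue_integral_cong[OF fiber_measurable[OF u]]) auto
    also have "\<dots> = cnj (LINT \<omega>:fiber u|\<mu> u. pairing g f \<omega>)"
      unfolding set_lebesgue_integral_def complex_cnj_scaleR[symmetric] by (rule Bochner_Integration.integral_cnj)
    finally show "hinner (big_prefiber u) f g = cnj (hinner (big_prefiber u) g f)" by (simp add: prefiber_simps ind_inner_pairing)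
  next
    fix f assume "f \<in> hcarrier (big_prefiber u)"
    then have c: "f \<in> fiber_functions u" by (simp add: prefiber_simps)
    have nn: "0 \<le> Re (pairing f f \<omega>)" if "\<omega> \<in> fiber u" for \<omega> unfolding pairing_def
      by (rule semi_inner_space.inner_nonneg[OF E_semi]) (use some[OF that] fc c RG in auto)
    have "Re (LINT \<omega>:fiber u|\<mu> u. pairing f f \<omega>) = (LINT \<omega>|\<mu> u. Re (indicator (fiber u) \<omega> *\<^sub>R pairing f f \<omega>))"
      unfolding set_lebesgue_integral_def
      by (rule integral_Re[symmetric]) (use pairing_integrable[OF u ff(1)[OF c] ff(1)[OF c]] in \<open>simp add: set_integrable_def\<close>)
    also have "0 \<le> \<dots>" by (rule integral_nonneg_AE) (use nn in \<open>auto simp: indicator_def\<close>)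
    finally show "0 \<le> Re (hinner (big_prefiber u) f f)" by (simp add: prefiber_simps ind_inner_pairing)
  qed
qed

lemma ind_zero: "(\<lambda>x. hzero (E x)) \<in> \<F>"
  and ind_add: "\<lbrakk>f \<in> \<F>; g \<in> \<F>\<rbrakk> \<Longrightarrow> (\<lambda>x. hadd (E x) (f x) (g x)) \<in> \<F>"
  and ind_scale: "f \<in> \<F> \<Longrightarrow> (\<lambda>x. hscale (E x) a (f x)) \<in> \<F>"
  by (simp_all add: ind_functions_iff equivariant_zero[OF invariant_gelems] equivariant_add[OF invariant_gelems]
      equivariant_scale[OF invariant_gelems])

lemma ind_minus: "\<lbrakk>f \<in> \<F>; g \<in> \<F>\<rbrakk> \<Longrightarrow> (\<lambda>x. hminus (E x) (f x) (g x)) \<in> \<F>" unfolding hminus_def by (rule ind_add[OF _ ind_scale])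

lemma restrict_ops: "restrict (\<lambda>x. hzero (E x)) (range_fiber G u) = hzero (prefiber u)"
  "restrict (\<lambda>x. hadd (E x) (f x) (g x)) (range_fiber G u) = hadd (prefiber u) (res u f) (res u g)"
  "restrict (\<lambda>x. hscale (E x) a (f x)) (range_fiber G u) = hscale (prefiber u) a (res u f)"
  "restrict (\<lambda>x. hminus (E x) (f x) (g x)) (range_fiber G u) = hminus (prefiber u) (res u f) (res u g)"
  by (auto simp: prefiber_simps hminus_def fun_eq_iff)

lemma prefiber_eq: "prefiber u = (big_prefiber u)\<lparr>hcarrier := hcarrier (prefiber u)\<rparr>" by (simp add: big_prefiber_def)

lemma prefiber_subset: "u \<in> units G \<Longrightarrow> hcarrier (prefiber u) \<subseteq> hcarrier (big_prefiber u)"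
  using ind_restrict by (auto simp: prefiber_simps)

lemma semi_inner_space_prefiber:
  assumes u: "u \<in> units G"
  shows "semi_inner_space (prefiber u)"
proof -
  let ?P = "prefiber u"
  interpret big: semi_inner_space "big_prefiber u" by (rule semi_inner_space_big_prefiber[OF u])
  have ops: "hzero ?P = hzero (big_prefiber u)" "hadd ?P = hadd (big_prefiber u)" "hscale ?P = hscale (big_prefiber u)"
    "hinner ?P = hinner (big_prefiber u)"
    by (simp_all add: prefiber_simps)
  have sub: "f \<in> hcarrier (big_prefiber u)" if "f \<in> hcarrier ?P" for f using prefiber_subset[OF u] that by blast
  have 1: "hzero ?P \<in> hcarrier ?P" using ind_zero restrict_ops(1)[of u] by (metis (no_types, lifting) image_eqI prefiber_simps(1))
  have 2: "hadd ?P f g \<in> hcarrier ?P" if "f \<in> hcarrier ?P" "g \<in> hcarrier ?P" for f g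
  proof -
    obtain f' g' where fg: "f' \<in> \<F>" "g' \<in> \<F>"
      "f = restrict f' (range_fiber G u)" "g = restrict g' (range_fiber G u)" using \<open>f \<in> _\<close> \<open>g \<in> _\<close> by (auto simp: prefiber_simps(1))
    show ?thesis unfolding fg(3,4) restrict_ops(2)[symmetric] prefiber_simps(1) by (rule imageI[OF ind_add[OF fg(1,2)]])
  qed
  have 3: "hscale ?P a f \<in> hcarrier ?P" if "f \<in> hcarrier ?P" for f a
  proof -
    obtain f' where fg: "f' \<in> \<F>" "f = restrict f' (range_fiber G u)" using \<open>f \<in> _\<close> by (auto simp: prefiber_simps(1))
    show ?thesis unfolding fg(2) restrict_ops(3)[symmetric] prefiber_simps(1) by (rule imageI[OF ind_scale[OF fg(1)]])
  qed
  show ?thesis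
    by unfold_locales (rule 1 | erule (1) 2 | erule 3 | (simp only: ops, (rule big.add_assoc big.add_commute big.add_zero
      big.add_uminus big.scale_add big.add_scale big.scale_scale big.scale_one big.inner_add big.inner_scale
      big.inner_commute big.inner_nonneg; erule sub)))+
qed

lemma ind_inner_continuous:
  assumes f: "f \<in> \<F>" and g: "g \<in> \<F>"
  shows "continuous_map (unit_space G) euclidean (\<lambda>u. ip u f g)"
    and "pairing f g \<in> Cc Q"
    and "\<And>u. u \<in> units G \<Longrightarrow> (LINT \<omega>|\<mu> u. pairing f g \<omega>) = ip u f g"
proof -
  have e: "equivariant_on (gelems G) f" "equivariant_on (gelems G) g" using f g by (simp_all add: ind_functions_iff)
  have qG: "q ` gelems G = topspace Q"
    using q_closed Q_elem by (metis (no_types, lifting) image_eqI image_subsetI subsetI subset_antisym)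
  have c: "continuous_map Q euclidean (pairing f g)" using pairing_continuous[OF invariant_gelems e] by (simp add: qG)
  obtain A where A: "compactin (gtop G) A" "\<forall>\<omega>\<in>q ` gelems G. pairing f g \<omega> \<noteq> 0 \<longrightarrow> \<omega> \<in> q ` A"
    using pairing_support[OF invariant_gelems e] by blast
  have "Q closure_of {\<omega> \<in> topspace Q. pairing f g \<omega> \<noteq> 0} \<subseteq> q ` A"
    by (rule closure_of_minimal[OF _ q_compact_closed[OF A(1)]]) (use A(2) qG in auto)
  then show Cc: "pairing f g \<in> Cc Q"
    unfolding Cc_def using c closed_compactin[OF q_compact[OF A(1)] _ closedin_closure_of] by simp
  show eq: "(LINT \<omega>|\<mu> u. pairing f g \<omega>) = ip u f g" if u: "u \<in> units G" for u
    using radon.LINT_support[OF mu_radon[OF u] c] by (simp add: mu_support[OF u] ind_inner_pairing)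
  have "continuous_map (unit_space G) euclidean (\<lambda>u. LINT \<omega>|\<mu> u. pairing f g \<omega>)"
    using system[unfolded quot_measure_system_def full_equivariant_system_def, THEN conjunct2, THEN conjunct1, rule_format, OF Cc] .
  then show "continuous_map (unit_space G) euclidean (\<lambda>u. ip u f g)"
    by (rule continuous_map_eq) (simp add: topspace_unit_space eq)
qed

end

section \<open>Translation of equivariant functions\<close>

context induced
begin

abbreviation "dom_sections \<equiv> csect (pullback (gtop G) src \<sigma>)"
abbreviation "fiber_top u \<equiv> subtopology (gtop G) (range_fiber G u)"
abbreviation "pairs \<equiv> subtopology (prod_topology (gtop G) (gtop G)) {p. rng (fst p) = rng (snd p)}"

definition translate :: "'g \<Rightarrow> ('g \<Rightarrow> 'v) \<Rightarrow> 'g \<Rightarrow> 'v" where "translate x f = (\<lambda>y\<in>range_fiber G (rng x). f (ldiv x y))"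

lemma inv_mul_in:
  assumes "x \<in> gelems G" "y \<in> gelems G" "rng x = rng y"
  shows "ldiv x y \<in> gelems G" "rng (ldiv x y) = src x" "src (ldiv x y) = src y"
proof -
  have "(inv x, y) \<in> composable G" using assms by (simp add: composable_iff inv_closed dom_inv)
  then show "ldiv x y \<in> gelems G" "rng (ldiv x y) = src x" "src (ldiv x y) = src y"
    using assms by (simp_all add: mul_closed rng_mul dom_mul rng_inv)
qed

lemma inv_mul_assoc_H:
  assumes "x \<in> gelems G" "y \<in> gelems G" "rng x = rng y" "h \<in> H" "src y = rng h"
  shows "mul (inv x) (mul y h) = mul (ldiv x y) h"
  using assms H_elem by (intro mul_assoc[symmetric]) (auto simp: composable_iff inv_closed dom_inv)

lemma q_inv_mul:
  assumes "x \<in> gelems G" "y \<in> gelems G" "rng x = rng y" "a \<in> gelems G" "q (ldiv x y) = q a"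
  shows "src x = rng a" "q y = q (mul x a)"
proof -
  note i = inv_mul_in[OF assms(1-3)]
  show r: "src x = rng a" using q_rng[OF i(1) assms(5)] i by simp
  have "q y = q (mul x (ldiv x y))" using mul_inv_cancel assms by simp
  also have "\<dots> = quot_act G H x (q (ldiv x y))" using quot_act_q[OF assms(1) i(1)] i by simp
  also have "\<dots> = q (mul x a)" using quot_act_q[OF assms(1,4) r] assms by simp
  finally show "q y = q (mul x a)" .
qed

lemma translate_fiber_function:
  assumes x: "x \<in> gelems G" and f: "f \<in> fiber_functions (src x)"
  shows "translate x f \<in> fiber_functions (rng x)"
  unfolding translate_def
proof (rule fiber_functionsI[OF rng_unit[OF x]])
  let ?R = "range_fiber G (rng x)" and ?D = "range_fiber G (src x)"
  have fe: "equivariant_on ?D f" using f by (simp add: fiber_functions_def)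
  have i: "ldiv x y \<in> ?D" "src (ldiv x y) = src y" if "y \<in> ?R" for y
    using that inv_mul_in[OF x, of y] by (auto simp: range_fiber_iff)
  have tR: "topspace (subtopology (gtop G) ?R) = ?R" by (auto simp: range_fiber_iff)
  have "continuous_map (subtopology (gtop G) ?R) (gtop G) (\<lambda>y. ldiv x y)" by (rule continuous_mul_comp)
      (use x inv_closed dom_inv continuous_map_from_subtopology[OF continuous_id] in \<open>auto simp: range_fiber_iff\<close>)
  then have "continuous_map (subtopology (gtop G) ?R) (subtopology (gtop G) ?D) (\<lambda>y. ldiv x y)"
    using i tR by (auto simp: continuous_map_in_subtopology)
  from S.pullback_comp[OF dom_restricted this, of f]
  have "(\<lambda>y. f (ldiv x y)) \<in> csect (pullback (subtopology (gtop G) ?R) (\<lambda>y. src (ldiv x y)) \<sigma>)"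
    using fe by (simp add: equivariant_on_def)
  then have cs: "(\<lambda>y. f (ldiv x y)) \<in> csect (pullback (subtopology (gtop G) ?R) src \<sigma>)"
    using S.pullback_cong[of "subtopology (gtop G) ?R" "\<lambda>y. src (ldiv x y)" "src"] i tR by simp
  obtain A where A: "compactin (gtop G) A" "\<forall>y\<in>?D. f y \<noteq> hzero (E y) \<longrightarrow> q y \<in> q ` A" using fe unfolding equivariant_on_def by blast
  have AG: "A \<subseteq> gelems G" by (rule compactin_subset_topspace[OF A(1)])
  have "compactin (gtop G) (?D \<inter> A)" by (rule closed_Int_compactin[OF closedin_range_fiber[OF dom_unit[OF x]] A(1)])
  then have "compactin (subtopology (gtop G) ?D) (?D \<inter> A)" by (simp add: compactin_subtopology)
  moreover have "continuous_map (subtopology (gtop G) ?D) (gtop G) (\<lambda>y. mul x y)" by (rule continuous_mul_comp)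
      (use x continuous_map_from_subtopology[OF continuous_id] in \<open>auto simp: range_fiber_iff\<close>)
  ultimately have cA: "compactin (gtop G) ((\<lambda>y. mul x y) ` (?D \<inter> A))" using image_compactin by blast
  have "q y \<in> q ` (\<lambda>y. mul x y) ` (?D \<inter> A)" if y: "y \<in> ?R" "f (ldiv x y) \<noteq> hzero (E y)" for y
  proof -
    have "q (ldiv x y) \<in> q ` A" using A(2) i[OF y(1)] y(2) by simp
    then obtain a where a: "a \<in> A" "q (ldiv x y) = q a" by blast
    have "src x = rng a" "q y = q (mul x a)" using q_inv_mul[OF x, of y a] y a AG by (auto simp: range_fiber_iff)
    then show ?thesis using a AG by (auto simp: range_fiber_iff)
  qed
  moreover have "f (mul (inv x) (mul y h)) = act \<sigma> (inv h) (f (ldiv x y))" if y: "y \<in> ?R" and h: "h \<in> H" "src y = rng h" for y h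
    using inv_mul_assoc_H[OF x, of y h] i[OF y] fe h y by (auto simp: equivariant_on_def range_fiber_iff)
  ultimately show "equivariant_on ?R (\<lambda>y. f (ldiv x y))" unfolding equivariant_on_def using cs cA by blast
qed

lemma translate_isometry:
  assumes x: "x \<in> gelems G" and f: "f \<in> \<F>" and g: "g \<in> \<F>"
  shows "ip (rng x) (translate x (res (src x) f)) (translate x (res (src x) g)) = ip (src x) (res (src x) f) (res (src x) g)"
proof -
  let ?\<gamma> = "inv x"
  have e: "equivariant_on (gelems G) f" "equivariant_on (gelems G) g" using f g by (simp_all add: ind_functions_iff)
  have \<gamma>: "?\<gamma> \<in> gelems G" "src ?\<gamma> = rng x" "rng ?\<gamma> = src x" using x by (auto simp: inv_closed dom_inv rng_inv)
  have "(LINT \<omega>:fiber (src ?\<gamma>)|\<mu> (src ?\<gamma>). pairing f g (quot_act G H ?\<gamma> \<omega>)) = (LINT \<omega>|\<mu> (rng ?\<gamma>). pairing f g \<omega>)"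
    using system[unfolded quot_measure_system_def full_equivariant_system_def, THEN conjunct2, THEN conjunct2, rule_format, OF \<gamma>(1) ind_inner_continuous(2)[OF f g]] .
  then have 1: "(LINT \<omega>:fiber (rng x)|\<mu> (rng x). pairing f g (quot_act G H ?\<gamma> \<omega>)) = ip (src x) f g"
    using ind_inner_continuous(3)[OF f g dom_unit[OF x]] \<gamma> by simp
  have "ip (rng x) (translate x (res (src x) f)) (translate x (res (src x) g))
     = (LINT \<omega>:fiber (rng x)|\<mu> (rng x). pairing f g (quot_act G H ?\<gamma> \<omega>))"
    unfolding ind_inner_pairing
  proof (rule set_lebesgue_integral_cong[OF fiber_measurable[OF rng_unit[OF x]]], intro allI impI)
    fix \<omega> assume w: "\<omega> \<in> fiber (rng x)"
    define y where "y = some_elem \<omega>"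
    have y: "y \<in> gelems G" "rng y = rng x" "\<omega> = q y" "y = some_elem \<omega>" using Q_elem[of \<omega>] w by (auto simp: quot_rng_def y_def)
    note i = inv_mul_in[OF x y(1) y(2)[symmetric]]
    have "pairing f g (quot_act G H ?\<gamma> \<omega>) = pairing f g (q (mul ?\<gamma> y))"
      using quot_act_q[OF \<gamma>(1) y(1)] \<gamma>(2) y(2) by (simp add: y(3))
    also have "\<dots> = hinner (E y) (f (mul ?\<gamma> y)) (g (mul ?\<gamma> y))" using pairing_q[OF invariant_gelems e i(1)] i by simp
    finally show "pairing (translate x (res (src x) f)) (translate x (res (src x) g)) \<omega> = pairing f g (quot_act G H ?\<gamma> \<omega>)"
      using y(1,2) i by (simp add: pairing_def translate_def range_fiber_iff y_def[symmetric])
  qed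
  also have "\<dots> = ip (src x) f g" by (rule 1)
  also have "\<dots> = ip (src x) (res (src x) f) (res (src x) g)" by (rule ind_inner_cong[OF dom_unit[OF x]]) simp
  finally show ?thesis .
qed

section \<open>Integration of translates against bump functions\<close>

definition bump :: "('g \<Rightarrow> real) \<Rightarrow> bool" where "bump \<phi> \<longleftrightarrow> continuous_map (gtop G) euclideanreal \<phi> \<and> (\<forall>z. 0 \<le> \<phi> z) \<and>
     (\<exists>K. compactin (gtop G) K \<and> (\<forall>z\<in>gelems G. \<phi> z \<noteq> 0 \<longrightarrow> z \<in> K))"

definition mass :: "('g \<Rightarrow> real) \<Rightarrow> 'g \<Rightarrow> real" where "mass \<phi> u = (LINT z|\<Lambda> u. \<phi> z)"

definition wint :: "('g \<Rightarrow> real) \<Rightarrow> 'g \<Rightarrow> ('g \<Rightarrow> complex) \<Rightarrow> complex" where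
  "wint \<phi> u g = (LINT z:range_fiber G u|\<Lambda> u. complex_of_real (\<phi> z) * g z)"

lemma haar_radon: "u \<in> units G \<Longrightarrow> radon (gtop G) (\<Lambda> u)"
  and haar_support: "u \<in> units G \<Longrightarrow> measure_support (gtop G) (\<Lambda> u) = range_fiber G u"
  using haar by (auto simp: haar_system_def full_equivariant_system_def radon_def range_fiber_def)

lemma bump_compact:
  assumes "bump \<phi>"
  shows "\<exists>K. compactin (gtop G) K \<and> closedin (gtop G) K \<and> (\<forall>z\<in>gelems G. \<phi> z \<noteq> 0 \<longrightarrow> z \<in> K)"
  using assms compactin_imp_closedin[OF Hausdorff] unfolding bump_def by blast

lemma bump_continuous: "bump \<phi> \<Longrightarrow> continuous_map (gtop G) euclidean (\<lambda>z. complex_of_real (\<phi> z))"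
  by (rule continuous_map_of_real) (simp add: bump_def)

lemma bump_nonneg: "bump \<phi> \<Longrightarrow> 0 \<le> \<phi> z" by (simp add: bump_def)

lemma wint_integrable:
  assumes \<phi>: "bump \<phi>" and u: "u \<in> units G"
    and g: "continuous_map (fiber_top u) euclidean g"
  shows "set_integrable (\<Lambda> u) (range_fiber G u) (\<lambda>z. complex_of_real (\<phi> z) * g z)"
proof -
  obtain K where K: "compactin (gtop G) K" "closedin (gtop G) K" "\<forall>z\<in>gelems G. \<phi> z \<noteq> 0 \<longrightarrow> z \<in> K" using bump_compact[OF \<phi>] by blast
  show ?thesis by (rule radon.set_integrable_continuous[OF haar_radon[OF u] closedin_range_fiber[OF u] _ K(1,2)])
      (use K(3) in \<open>auto simp: range_fiber_iff intro!: continuous_map_mult g continuous_map_from_subtopology[OF bump_continuous[OF \<phi>]]\<close>)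
qed

lemma bump_integrable:
  assumes \<phi>: "bump \<phi>" and u: "u \<in> units G"
  shows "integrable (\<Lambda> u) \<phi>"
proof -
  obtain K where K: "compactin (gtop G) K" "closedin (gtop G) K" "\<forall>z\<in>gelems G. \<phi> z \<noteq> 0 \<longrightarrow> z \<in> K" using bump_compact[OF \<phi>] by blast
  have "set_integrable (\<Lambda> u) (gelems G) (\<lambda>z. complex_of_real (\<phi> z))"
    by (rule radon.set_integrable_continuous[OF haar_radon[OF u] closedin_topspace _ K(1,2)])
      (use K(3) bump_continuous[OF \<phi>] in auto)
  moreover have "integrable (\<Lambda> u) (\<lambda>x. indicator (gelems G) x *\<^sub>R complex_of_real (\<phi> x)) = integrable (\<Lambda> u) (\<lambda>x. complex_of_real (\<phi> x))"
    by (rule Bochner_Integration.integrable_cong[OF refl]) (simp add: radon.space_M[OF haar_radon[OF u]])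
  ultimately show ?thesis by (simp add: set_integrable_def complex_of_real_integrable_eq)
qed

lemma mass_nonneg: "bump \<phi> \<Longrightarrow> 0 \<le> mass \<phi> u" unfolding mass_def by (rule integral_nonneg_AE) (simp add: bump_nonneg)

lemma wint_const:
  assumes \<phi>: "bump \<phi>" and u: "u \<in> units G"
  shows "wint \<phi> u (\<lambda>z. c) = complex_of_real (mass \<phi> u) * c"
proof -
  have "wint \<phi> u (\<lambda>z. c) = (LINT z:range_fiber G u|\<Lambda> u. complex_of_real (\<phi> z)) * c" unfolding wint_def by simp
  also have "(LINT z:range_fiber G u|\<Lambda> u. complex_of_real (\<phi> z)) = (LINT z|\<Lambda> u. complex_of_real (\<phi> z))"
    using radon.LINT_support[OF haar_radon[OF u] bump_continuous[OF \<phi>]] haar_support[OF u] by simp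
  finally show ?thesis by (simp add: mass_def)
qed

lemma mass_continuous:
  assumes \<phi>: "bump \<phi>"
  shows "continuous_map (unit_space G) euclidean (\<lambda>u. complex_of_real (mass \<phi> u))"
proof -
  obtain K where K: "compactin (gtop G) K" "closedin (gtop G) K" "\<forall>z\<in>gelems G. \<phi> z \<noteq> 0 \<longrightarrow> z \<in> K" using bump_compact[OF \<phi>] by blast
  have "gtop G closure_of {z \<in> gelems G. complex_of_real (\<phi> z) \<noteq> 0} \<subseteq> K"
    by (rule closure_of_minimal[OF _ K(2)]) (use K(3) in auto)
  then have "(\<lambda>z. complex_of_real (\<phi> z)) \<in> Cc (gtop G)"
    unfolding Cc_def using bump_continuous[OF \<phi>] closed_compactin[OF K(1) _ closedin_closure_of] by simp
  from haar[unfolded haar_system_def full_equivariant_system_def, THEN conjunct2, THEN conjunct1, rule_format, OF this]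
  show ?thesis by (simp add: mass_def)
qed

lemma wint_bound:
  assumes \<phi>: "bump \<phi>" and u: "u \<in> units G"
    and g: "continuous_map (fiber_top u) euclidean g"
    and C: "0 \<le> C" "\<And>z. \<lbrakk>z \<in> range_fiber G u; \<phi> z \<noteq> 0\<rbrakk> \<Longrightarrow> cmod (g z) \<le> C"
  shows "cmod (wint \<phi> u g) \<le> C * mass \<phi> u"
proof -
  have "cmod (wint \<phi> u g) \<le> (LINT z|\<Lambda> u. C * \<phi> z)" unfolding wint_def set_lebesgue_integral_def
  proof (rule order_trans[OF integral_norm_bound Bochner_Integration.integral_mono])
    show "integrable (\<Lambda> u) (\<lambda>z. norm (indicator (range_fiber G u) z *\<^sub>R (complex_of_real (\<phi> z) * g z)))"
      using wint_integrable[OF \<phi> u g] unfolding set_integrable_def by (rule integrable_norm)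
    show "integrable (\<Lambda> u) (\<lambda>z. C * \<phi> z)" using bump_integrable[OF \<phi> u] by simp
    fix z
    have "\<phi> z * cmod (g z) \<le> C * \<phi> z" if "z \<in> range_fiber G u"
      using C(2)[OF that] bump_nonneg[OF \<phi>, of z] by (cases "\<phi> z = 0") (auto simp: mult.commute mult_left_mono)
    then show "norm (indicator (range_fiber G u) z *\<^sub>R (complex_of_real (\<phi> z) * g z)) \<le> C * \<phi> z"
      using bump_nonneg[OF \<phi>, of z] C(1) by (auto simp: indicator_def norm_mult)
  qed
  also have "\<dots> = C * mass \<phi> u" by (simp add: mass_def)
  finally show ?thesis .
qed

lemma wint_diff:
  assumes "bump \<phi>" "u \<in> units G" "continuous_map (fiber_top u) euclidean g" "continuous_map (fiber_top u) euclidean g'"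
  shows "wint \<phi> u g - wint \<phi> u g' = wint \<phi> u (\<lambda>z. g z - g' z)"
  using set_integral_diff(2)[OF wint_integrable[OF assms(1-3)] wint_integrable[OF assms(1,2,4)]]
  by (simp add: wint_def algebra_simps)

lemma wint_add_bump:
  assumes "bump \<phi>" "bump \<psi>" "u \<in> units G" "continuous_map (fiber_top u) euclidean g"
  shows "wint (\<lambda>z. \<phi> z + \<psi> z) u g = wint \<phi> u g + wint \<psi> u g"
  using set_integral_add(2)[OF wint_integrable[OF assms(1,3,4)] wint_integrable[OF assms(2,3,4)]]
  by (simp add: wint_def algebra_simps)

lemma mass_add: "\<lbrakk>bump \<phi>; bump \<psi>; u \<in> units G\<rbrakk> \<Longrightarrow> mass (\<lambda>z. \<phi> z + \<psi> z) u = mass \<phi> u + mass \<psi> u"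
  unfolding mass_def by (rule Bochner_Integration.integral_add) (auto intro: bump_integrable)

lemma bump_mult:
  assumes \<phi>: "bump \<phi>" and b: "continuous_map (gtop G) euclideanreal b" "\<And>z. 0 \<le> b z"
  shows "bump (\<lambda>z. \<phi> z * b z)"
  using assms unfolding bump_def by (auto intro!: continuous_map_real_mult)

lemma wint_cong: "(\<And>z. z \<in> range_fiber G u \<Longrightarrow> \<phi> z = \<psi> z) \<Longrightarrow> (\<And>z. z \<in> range_fiber G u \<Longrightarrow> g z = g' z) \<Longrightarrow> wint \<phi> u g = wint \<psi> u g'"
  unfolding wint_def set_lebesgue_integral_def by (rule Bochner_Integration.integral_cong[OF refl]) (auto simp: indicator_def)

lemma shift_section:
  assumes f: "f \<in> \<F>"
  shows "(\<lambda>p. f (mul (inv (fst p)) (snd p))) \<in> csect (pullback (pairs) (\<lambda>p. src (snd p)) \<sigma>)"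
proof -
  let ?P = "pairs"
  have cs: "f \<in> dom_sections" using f by (simp add: ind_functions_iff equivariant_on_def subtopology_topspace)
  have c1: "continuous_map ?P (gtop G) fst" by (rule continuous_map_from_subtopology[OF continuous_map_fst])
  have c2: "continuous_map ?P (gtop G) snd" by (rule continuous_map_from_subtopology[OF continuous_map_snd])
  have "continuous_map ?P (gtop G) (\<lambda>p. mul (inv (fst p)) (snd p))" by (rule continuous_mul_comp[OF _ c2])
      (use continuous_map_compose[OF c1 continuous_inv'] in \<open>auto simp: o_def dom_inv\<close>)
  from S.pullback_comp[OF continuous_dom_units this cs]
  show ?thesis using S.pullback_cong[of ?P "\<lambda>p. src (mul (inv (fst p)) (snd p))" "\<lambda>p. src (snd p)"] inv_mul_in(3) by fastforce
qed

lemma shift_fiber_section: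
  assumes f: "f \<in> \<F>" and y: "y \<in> gelems G"
  shows "(\<lambda>z. f (ldiv z y)) \<in> csect (pullback (fiber_top (rng y)) (\<lambda>z. src y) \<sigma>)"
proof -
  let ?P = "pairs"
  have p: "continuous_map ?P (unit_space G) (\<lambda>p. src (snd p))"
    using continuous_map_compose[OF continuous_map_from_subtopology[OF continuous_map_snd] continuous_dom_units, of "gtop G"]
    by (simp add: o_def)
  have "continuous_map (fiber_top (rng y)) ?P (\<lambda>z. (z, y))" using y continuous_map_from_subtopology[OF continuous_id]
    by (auto simp: continuous_map_in_subtopology range_fiber_iff intro!: continuous_map_pairedI)
  from S.pullback_comp[OF p this shift_section[OF f]] show ?thesis by simp
qed

lemma shift_inner_continuous:
  assumes f: "f \<in> \<F>" and y: "y \<in> gelems G" and w: "w \<in> hcarrier (E y)"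
  shows "continuous_map (fiber_top (rng y)) euclidean (\<lambda>z. hinner (E y) (f (ldiv z y)) w)"
proof -
  have "hilbert_bundle (fiber_top (rng y)) (pullback (fiber_top (rng y)) (\<lambda>z. src y) \<sigma>)"
    by (rule S.hilbert_bundle_pullback) (simp add: topspace_unit_space dom_unit[OF y])
  from hilbert_bundle.inner_continuous[OF this shift_fiber_section[OF f y] S.pullback_const[OF _ w]]
  show ?thesis by (simp add: topspace_unit_space dom_unit[OF y])
qed

lemma shift_closed:
  assumes f: "f \<in> \<F>" and y: "y \<in> gelems G" and z: "z \<in> range_fiber G (rng y)"
  shows "f (ldiv z y) \<in> hcarrier (E y)"
proof -
  note i = inv_mul_in[of z y]
  have "f (ldiv z y) \<in> hcarrier (E (ldiv z y))"
    by (rule equivariant_closed[OF _ invariant_gelems]) (use f i y z in \<open>auto simp: ind_functions_iff range_fiber_iff\<close>)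
  then show ?thesis using i y z by (simp add: range_fiber_iff)
qed

definition nearly_constant :: "('g \<Rightarrow> 'v) \<Rightarrow> 'g \<Rightarrow> real \<Rightarrow> 'g set \<Rightarrow> bool" where
  "nearly_constant f y\<^sub>0 e U \<longleftrightarrow> (\<exists>W \<eta>. openin (gtop G) W \<and> y\<^sub>0 \<in> W \<and> \<eta> \<in> csect \<sigma> \<and>
     (\<forall>z\<in>U. \<forall>y\<in>W. rng z = rng y \<longrightarrow> hdist (E y) (f (ldiv z y)) (\<eta> (src y)) \<le> e))"

lemma nearly_constant_neighbourhood:
  assumes f: "f \<in> \<F>" and y: "y\<^sub>0 \<in> gelems G" and e: "0 < e" and z: "z\<^sub>0 \<in> gelems G"
  obtains U where "openin (gtop G) U" "z\<^sub>0 \<in> U" "nearly_constant f y\<^sub>0 e U"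
proof (cases "rng z\<^sub>0 = rng y\<^sub>0")
  case True
  let ?P = "pairs"
  have "locally_approximable ?P (\<lambda>p. fib \<sigma> (src (snd p))) ((\<lambda>\<xi> p. \<xi> (src (snd p))) ` csect \<sigma>) (\<lambda>p. f (mul (inv (fst p)) (snd p)))"
    using shift_section[OF f] by (simp add: pullback_def)
  moreover have "(z\<^sub>0, y\<^sub>0) \<in> topspace ?P" using True y z by auto
  ultimately have "\<exists>U. openin ?P U \<and> (z\<^sub>0, y\<^sub>0) \<in> U \<and> (\<exists>\<eta>\<in>(\<lambda>\<xi> p. \<xi> (src (snd p))) ` csect \<sigma>. \<forall>p\<in>U.
     hdist (fib \<sigma> (src (snd p))) (f (mul (inv (fst p)) (snd p))) (\<eta> p) < e)"
    using e unfolding locally_approximable_def by blast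
  then obtain N \<zeta> where N: "openin ?P N" "(z\<^sub>0, y\<^sub>0) \<in> N" "\<zeta> \<in> csect \<sigma>"
    "\<And>p. p \<in> N \<Longrightarrow> hdist (fib \<sigma> (src (snd p))) (f (mul (inv (fst p)) (snd p))) (\<zeta> (src (snd p))) < e"
    by auto
  obtain N' where N': "openin (prod_topology (gtop G) (gtop G)) N'" "N = N' \<inter> {p. rng (fst p) = rng (snd p)}"
    using N(1) by (auto simp: openin_subtopology)
  have "(z\<^sub>0, y\<^sub>0) \<in> N'" using N(2) N'(2) by blast
  from N'(1)[unfolded openin_prod_topology_alt, rule_format, OF this]
  obtain U W where U: "openin (gtop G) U" "openin (gtop G) W" "z\<^sub>0 \<in> U" "y\<^sub>0 \<in> W" "U \<times> W \<subseteq> N'" by auto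
  have "hdist (E y) (f (ldiv z y)) (\<zeta> (src y)) \<le> e" if "z \<in> U" "y \<in> W" "rng z = rng y" for z y
    using N(4)[of "(z, y)"] that U(5) N'(2) by auto
  then have "nearly_constant f y\<^sub>0 e U" unfolding nearly_constant_def using U N(3) by (intro exI[of _ W] exI[of _ \<zeta>]) auto
  then show ?thesis using that U by blast
next
  case False
  have "rng z\<^sub>0 \<in> gelems G" "rng y\<^sub>0 \<in> gelems G" using y z rng_closed by auto
  then obtain A B where AB: "openin (gtop G) A" "openin (gtop G) B" "rng z\<^sub>0 \<in> A" "rng y\<^sub>0 \<in> B" "disjnt A B"
    using Hausdorff False unfolding Hausdorff_space_def by blast
  define U where "U = {z \<in> gelems G. rng z \<in> A}"
  define W where "W = {z \<in> gelems G. rng z \<in> B}"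
  have o: "openin (gtop G) U" "openin (gtop G) W"
    unfolding U_def W_def using openin_continuous_map_preimage[OF continuous_rng] AB by blast+
  have "nearly_constant f y\<^sub>0 e U" unfolding nearly_constant_def by (intro exI[of _ W] exI[of _ "\<lambda>u. hzero (fib \<sigma> u)"])
      (use o y AB S.sect_zero in \<open>auto simp: U_def W_def disjnt_def\<close>)
  moreover have "z\<^sub>0 \<in> U" using z AB by (auto simp: U_def)
  ultimately show ?thesis using that o by blast
qed

abbreviation shift :: "('g \<Rightarrow> 'v) \<Rightarrow> ('g \<Rightarrow> real) \<Rightarrow> 'g \<Rightarrow> 'v \<Rightarrow> complex" where
  "shift f \<phi> y w \<equiv> wint \<phi> (rng y) (\<lambda>z. hinner (E y) (f (ldiv z y)) w)"

abbreviation "weakly_close f \<phi> y\<^sub>0 e \<equiv> \<exists>W. openin (gtop G) W \<and> y\<^sub>0 \<in> W \<and> (\<exists>k\<in>dom_sections. \<forall>y\<in>W.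
    \<forall>w\<in>hcarrier (E y). cmod (hinner (E y) (k y) w - shift f \<phi> y w) \<le> e * mass \<phi> (rng y) * hnorm (E y) w)"

abbreviation "good f y\<^sub>0 e V \<equiv> \<exists>b U. continuous_map (gtop G) euclideanreal b \<and> (\<forall>z. 0 \<le> b z \<and> b z \<le> 1) \<and>
       (\<forall>z\<in>V. b z = 1) \<and> (\<forall>z\<in>gelems G. b z \<noteq> 0 \<longrightarrow> z \<in> U) \<and> nearly_constant f y\<^sub>0 e U"

lemma shift_bound:
  assumes f: "f \<in> \<F>" and \<phi>: "bump \<phi>" and y: "y \<in> gelems G" and v: "v \<in> hcarrier (E y)" and w: "w \<in> hcarrier (E y)"
    and e: "0 < e" and near: "\<And>z. \<lbrakk>z \<in> range_fiber G (rng y); \<phi> z \<noteq> 0\<rbrakk> \<Longrightarrow> hdist (E y) (f (ldiv z y)) v \<le> e"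
  shows "cmod (complex_of_real (mass \<phi> (rng y)) * hinner (E y) v w - shift f \<phi> y w) \<le> e * mass \<phi> (rng y) * hnorm (E y) w"
proof -
  have u: "rng y \<in> units G" by (rule rng_unit[OF y])
  interpret Ey: hilbert_space "E y" by (rule E_hilbert[OF y])
  have "complex_of_real (mass \<phi> (rng y)) * hinner (E y) v w - shift f \<phi> y w
      = wint \<phi> (rng y) (\<lambda>z. hinner (E y) v w - hinner (E y) (f (ldiv z y)) w)"
    using wint_diff[OF \<phi> u _ shift_inner_continuous[OF f y w], of "\<lambda>z. hinner (E y) v w"] by (simp add: wint_const[OF \<phi> u])
  also have "cmod \<dots> \<le> (e * hnorm (E y) w) * mass \<phi> (rng y)"
  proof (rule wint_bound[OF \<phi> u])
    show "continuous_map (fiber_top (rng y)) euclidean (\<lambda>z. hinner (E y) v w - hinner (E y) (f (ldiv z y)) w)"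
      by (intro continuous_map_diff shift_inner_continuous[OF f y w]) simp
    show "0 \<le> e * hnorm (E y) w" using e Ey.norm_nonneg[OF w] by simp
    fix z assume z: "z \<in> range_fiber G (rng y)" "\<phi> z \<noteq> 0"
    have fz: "f (ldiv z y) \<in> hcarrier (E y)" by (rule shift_closed[OF f y z(1)])
    have "cmod (hinner (E y) v w - hinner (E y) (f (ldiv z y)) w) \<le> hdist (E y) v (f (ldiv z y)) * hnorm (E y) w"
      using Ey.cauchy_schwarz[OF Ey.minus_closed[OF v fz] w] v fz w by (simp add: Ey.inner_minus)
    also have "\<dots> \<le> e * hnorm (E y) w"
      using near[OF z] Ey.norm_minus_commute[OF fz v] by (intro mult_right_mono Ey.norm_nonneg[OF w]) simp
    finally show "cmod (hinner (E y) v w - hinner (E y) (f (ldiv z y)) w) \<le> e * hnorm (E y) w" .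
  qed
  finally show ?thesis by (simp add: algebra_simps)
qed

lemma approx_single:
  assumes f: "f \<in> \<F>" and y0: "y\<^sub>0 \<in> gelems G" and e: "0 < e"
    and U: "nearly_constant f y\<^sub>0 e U" and \<phi>: "bump \<phi>" "\<And>z. \<lbrakk>z \<in> gelems G; \<phi> z \<noteq> 0\<rbrakk> \<Longrightarrow> z \<in> U"
  shows "weakly_close f \<phi> y\<^sub>0 e"
proof -
  interpret P: hilbert_bundle "gtop G" "pullback (gtop G) src \<sigma>" by (rule S.hilbert_bundle_pullback[OF continuous_dom_units])
  obtain W \<eta> where W: "openin (gtop G) W" "y\<^sub>0 \<in> W" "\<eta> \<in> csect \<sigma>" "\<And>z y. \<lbrakk>z \<in> U; y \<in> W; rng z = rng y\<rbrakk> \<Longrightarrow>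
        hdist (E y) (f (ldiv z y)) (\<eta> (src y)) \<le> e"
    using U unfolding nearly_constant_def by blast
  have "continuous_map (gtop G) euclidean (\<lambda>y. complex_of_real (mass \<phi> (rng y)))"
    using continuous_map_compose[OF continuous_rng_units mass_continuous[OF \<phi>(1)]] by (simp add: o_def)
  from P.sect_mult[OF this S.pullback_sect[OF continuous_dom_units W(3)]]
  have k: "(\<lambda>y. hscale (E y) (complex_of_real (mass \<phi> (rng y))) (\<eta> (src y))) \<in> dom_sections" by simp
  have "cmod (hinner (E y) (hscale (E y) (complex_of_real (mass \<phi> (rng y))) (\<eta> (src y))) w - shift f \<phi> y w)
      \<le> e * mass \<phi> (rng y) * hnorm (E y) w" if y: "y \<in> W" and w: "w \<in> hcarrier (E y)" for y w
  proof -
    have yG: "y \<in> gelems G" using y openin_subset[OF W(1)] by blast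
    have \<eta>: "\<eta> (src y) \<in> hcarrier (E y)" by (rule S.sect_closed[OF W(3)]) (simp add: topspace_unit_space dom_unit[OF yG])
    show ?thesis using shift_bound[OF f \<phi>(1) yG \<eta> w e] W(4)[OF _ y] \<phi>(2) \<eta> w by (auto simp: range_fiber_iff E_inner[OF yG])
  qed
  then show ?thesis by (intro exI[of _ W] conjI bexI[OF _ k] ballI W(1,2))
qed

text \<open>A finite cover by sets on which the integrand is nearly constant: the bump function is split by
  multiplying with a cutoff of one set of the cover and its complement.\<close>

lemma approx_finite:
  assumes f: "f \<in> \<F>" and y0: "y\<^sub>0 \<in> gelems G" and e: "0 < e" and "finite F"
    and F: "\<And>V. V \<in> F \<Longrightarrow> good f y\<^sub>0 e V"
    and \<phi>: "bump \<phi>" "\<And>z. \<lbrakk>z \<in> gelems G; \<phi> z \<noteq> 0\<rbrakk> \<Longrightarrow> z \<in> \<Union>F"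
  shows "weakly_close f \<phi> y\<^sub>0 e"
  using \<open>finite F\<close> F \<phi>
proof (induction F arbitrary: \<phi>)
  case empty
  interpret P: hilbert_bundle "gtop G" "pullback (gtop G) src \<sigma>" by (rule S.hilbert_bundle_pullback[OF continuous_dom_units])
  show ?case
  proof (intro exI[of _ "gelems G"] conjI bexI[OF _ P.sect_zero] ballI)
    fix y w assume y: "y \<in> gelems G" and w: "w \<in> hcarrier (E y)"
    interpret Ey: hilbert_space "E y" by (rule E_hilbert[OF y])
    have "shift f \<phi> y w = wint (\<lambda>z. 0) (rng y) (\<lambda>z. 0)" unfolding wint_def set_lebesgue_integral_def
      by (rule Bochner_Integration.integral_cong[OF refl]) (use empty.prems(3) in \<open>auto simp: indicator_def range_fiber_iff\<close>)
    then have "shift f \<phi> y w = 0" by (simp add: wint_def)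
    then show "cmod (hinner (E y) (hzero (fib (pullback (gtop G) src \<sigma>) y)) w - shift f \<phi> y w)
        \<le> e * mass \<phi> (rng y) * hnorm (E y) w"
      using e mass_nonneg[OF empty.prems(2)] Ey.norm_nonneg[OF w] w by (simp add: Ey.inner_zero)
  qed (use y0 in auto)
next
  case (insert V F)
  interpret P: hilbert_bundle "gtop G" "pullback (gtop G) src \<sigma>" by (rule S.hilbert_bundle_pullback[OF continuous_dom_units])
  from insert.prems(1)[OF insertI1] obtain b U where b': "continuous_map (gtop G) euclideanreal b \<and> (\<forall>z. 0 \<le> b z \<and> b z \<le> 1) \<and>
       (\<forall>z\<in>V. b z = 1) \<and> (\<forall>z\<in>gelems G. b z \<noteq> 0 \<longrightarrow> z \<in> U) \<and> nearly_constant f y\<^sub>0 e U" by (elim exE)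
  then have b: "continuous_map (gtop G) euclideanreal b" "\<And>z. 0 \<le> b z" "\<And>z. b z \<le> 1"
    "\<And>z. z \<in> V \<Longrightarrow> b z = 1" "\<And>z. \<lbrakk>z \<in> gelems G; b z \<noteq> 0\<rbrakk> \<Longrightarrow> z \<in> U" and U: "nearly_constant f y\<^sub>0 e U" by auto
  define \<phi>1 where "\<phi>1 z = \<phi> z * b z" for z
  define \<phi>2 where "\<phi>2 z = \<phi> z * (1 - b z)" for z
  have b1: "bump \<phi>1" unfolding \<phi>1_def by (rule bump_mult[OF insert.prems(2) b(1,2)])
  have b2: "bump \<phi>2" unfolding \<phi>2_def
    by (rule bump_mult[OF insert.prems(2)]) (use b(3) in \<open>auto intro!: continuous_map_diff b(1)\<close>)
  have sum: "\<phi> = (\<lambda>z. \<phi>1 z + \<phi>2 z)" by (auto simp: \<phi>1_def \<phi>2_def algebra_simps)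
  have "weakly_close f \<phi>1 y\<^sub>0 e" by (rule approx_single[OF f y0 e U b1]) (use b(5) in \<open>auto simp: \<phi>1_def\<close>)
  then obtain W1 k1 where 1: "openin (gtop G) W1" "y\<^sub>0 \<in> W1" "k1 \<in> dom_sections"
    "\<forall>y\<in>W1. \<forall>w\<in>hcarrier (E y). cmod (hinner (E y) (k1 y) w - shift f \<phi>1 y w) \<le> e * mass \<phi>1 (rng y) * hnorm (E y) w"
    by blast
  have "weakly_close f \<phi>2 y\<^sub>0 e"
  proof (rule insert.IH[OF _ b2])
    show "\<And>V. V \<in> F \<Longrightarrow> good f y\<^sub>0 e V" using insert.prems(1) by blast
    fix z assume z: "z \<in> gelems G" "\<phi>2 z \<noteq> 0"
    then have "\<phi> z \<noteq> 0" "z \<notin> V" using b(4) by (auto simp: \<phi>2_def)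
    then show "z \<in> \<Union>F" using insert.prems(3)[OF z(1)] by blast
  qed
  then obtain W2 k2 where 2: "openin (gtop G) W2" "y\<^sub>0 \<in> W2" "k2 \<in> dom_sections"
    "\<forall>y\<in>W2. \<forall>w\<in>hcarrier (E y). cmod (hinner (E y) (k2 y) w - shift f \<phi>2 y w) \<le> e * mass \<phi>2 (rng y) * hnorm (E y) w"
    by blast
  show ?case
  proof (intro exI[of _ "W1 \<inter> W2"] conjI bexI[OF _ P.sect_add[OF 1(3) 2(3)]] ballI)
    fix y w assume y: "y \<in> W1 \<inter> W2" and w: "w \<in> hcarrier (E y)"
    have yG: "y \<in> gelems G" using y openin_subset[OF 1(1)] by blast
    have u: "rng y \<in> units G" by (rule rng_unit[OF yG])
    interpret Ey: hilbert_space "E y" by (rule E_hilbert[OF yG])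
    have c: "k1 y \<in> hcarrier (E y)" "k2 y \<in> hcarrier (E y)" using P.sect_closed[OF 1(3) yG] P.sect_closed[OF 2(3) yG] by auto
    have "shift f \<phi> y w = shift f \<phi>1 y w + shift f \<phi>2 y w"
      unfolding sum by (rule wint_add_bump[OF b1 b2 u shift_inner_continuous[OF f yG w]])
    then have "hinner (E y) (hadd (E y) (k1 y) (k2 y)) w - shift f \<phi> y w
       = (hinner (E y) (k1 y) w - shift f \<phi>1 y w) + (hinner (E y) (k2 y) w - shift f \<phi>2 y w)"
      using c w by (simp add: Ey.inner_add)
    also have "cmod \<dots> \<le> e * mass \<phi>1 (rng y) * hnorm (E y) w + e * mass \<phi>2 (rng y) * hnorm (E y) w"
      using 1(4) 2(4) y w by (intro norm_triangle_mono) auto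
    also have "\<dots> = e * mass \<phi> (rng y) * hnorm (E y) w" unfolding sum mass_add[OF b1 b2 u] by (simp add: algebra_simps)
    finally show "cmod (hinner (E y) (hadd (fib (pullback (gtop G) src \<sigma>) y) (k1 y) (k2 y)) w - shift f \<phi> y w)
        \<le> e * mass \<phi> (rng y) * hnorm (E y) w" by simp
  qed (use 1 2 in auto)
qed

lemma weak_integral:
  assumes f: "f \<in> \<F>" and \<phi>: "bump \<phi>"
  obtains k where "k \<in> dom_sections" "\<And>y w. \<lbrakk>y \<in> gelems G; w \<in> hcarrier (E y)\<rbrakk> \<Longrightarrow> hinner (E y) (k y) w = shift f \<phi> y w"
proof -
  interpret P: hilbert_bundle "gtop G" "pullback (gtop G) src \<sigma>" by (rule S.hilbert_bundle_pullback[OF continuous_dom_units])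
  have *: "\<exists>U. openin (gtop G) U \<and> y \<in> U \<and> (\<exists>k\<in>dom_sections. \<forall>v\<in>U.
      \<forall>w\<in>hcarrier (E v). cmod (hinner (E v) (k v) w - shift f \<phi> v w) \<le> e * hnorm (E v) w)"
    if y: "y \<in> gelems G" and e: "0 < e" for y and e :: real
  proof -
    obtain K where K: "compactin (gtop G) K" "closedin (gtop G) K" "\<forall>z\<in>gelems G. \<phi> z \<noteq> 0 \<longrightarrow> z \<in> K"
      using bump_compact[OF \<phi>] by blast
    have mc: "continuous_map (gtop G) euclidean (\<lambda>y. complex_of_real (mass \<phi> (rng y)))"
      using continuous_map_compose[OF continuous_rng_units mass_continuous[OF \<phi>]] by (simp add: o_def)
    obtain N where N: "openin (gtop G) N" "y \<in> N" "\<And>v. v \<in> N \<Longrightarrow> dist (complex_of_real (mass \<phi> (rng v))) (complex_of_real (mass \<phi> (rng y))) < 1"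
      by (rule continuous_map_epsE[OF mc y, of 1]) auto
    define m where "m = mass \<phi> (rng y) + 1"
    have m: "0 < m" using mass_nonneg[OF \<phi>, of "rng y"] by (simp add: m_def)
    have mN: "mass \<phi> (rng v) \<le> m" if "v \<in> N" for v
    proof -
      have "cmod (complex_of_real (mass \<phi> (rng v) - mass \<phi> (rng y))) < 1" using N(3)[OF that] by (simp add: dist_norm)
      then show ?thesis unfolding norm_of_real m_def by linarith
    qed
    define e' where "e' = e / m"
    have e': "0 < e'" using e m by (simp add: e'_def)
    let ?good = "good f y e'"
    have cover: "\<exists>V. openin (gtop G) V \<and> z \<in> V \<and> ?good V" if z: "z \<in> gelems G" for z
    proof -
      obtain U where U: "openin (gtop G) U" "z \<in> U" "nearly_constant f y e' U"
        by (rule nearly_constant_neighbourhood[OF f y e' z])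
      obtain b :: "'g \<Rightarrow> real" and V K' where b: "continuous_map (gtop G) euclideanreal b" "\<And>y. 0 \<le> b y" "\<And>y. b y \<le> 1"
        "openin (gtop G) V" "z \<in> V" "\<And>y. y \<in> V \<Longrightarrow> b y = 1" "K' \<subseteq> U" "\<And>y. y \<in> gelems G \<Longrightarrow> b y \<noteq> 0 \<Longrightarrow> y \<in> K'"
        by (rule bump_function[OF locally_compact Hausdorff U(1,2)]) auto
      show ?thesis by (intro exI[of _ V] conjI exI[of _ b] exI[of _ U]) (use b U in auto)
    qed
    have "\<forall>V\<in>{V. openin (gtop G) V \<and> ?good V}. openin (gtop G) V" by simp
    moreover have "K \<subseteq> \<Union>{V. openin (gtop G) V \<and> ?good V}"
    proof
      fix z assume "z \<in> K"
      then have "z \<in> gelems G" using compactin_subset_topspace[OF K(1)] by blast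
      from cover[OF this] show "z \<in> \<Union>{V. openin (gtop G) V \<and> ?good V}" by (elim exE conjE, intro UnionI) auto
    qed
    ultimately obtain F where F: "finite F" "F \<subseteq> {V. openin (gtop G) V \<and> ?good V}" "K \<subseteq> \<Union>F"
      using K(1) unfolding compactin_def by meson
    have "weakly_close f \<phi> y e'"
    proof (rule approx_finite[OF f y e' F(1) _ \<phi>])
      fix V assume "V \<in> F"
      then have "V \<in> {V. openin (gtop G) V \<and> ?good V}" using F(2) by (rule rev_subsetD)
      then show "?good V" by blast
    qed (use K(3) F(3) in blast)
    then obtain W k where W: "openin (gtop G) W" "y \<in> W" "k \<in> dom_sections"
      "\<And>v w. \<lbrakk>v\<in>W; w\<in>hcarrier (E v)\<rbrakk> \<Longrightarrow> cmod (hinner (E v) (k v) w - shift f \<phi> v w) \<le> e' * mass \<phi> (rng v) * hnorm (E v) w"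
      by blast
    show ?thesis
    proof (intro exI[of _ "W \<inter> N"] conjI bexI[OF _ W(3)] ballI)
      fix v w assume v: "v \<in> W \<inter> N" and w: "w \<in> hcarrier (E v)"
      have vG: "v \<in> gelems G" using v openin_subset[OF W(1)] by blast
      have n: "0 \<le> hnorm (E v) w" by (rule semi_inner_space.norm_nonneg[OF E_semi[OF vG] w])
      have "cmod (hinner (E v) (k v) w - shift f \<phi> v w) \<le> e' * mass \<phi> (rng v) * hnorm (E v) w" using W(4) v w by blast
      also have "\<dots> \<le> e' * m * hnorm (E v) w" using mN[of v] v e' n by (intro mult_right_mono mult_left_mono) auto
      also have "\<dots> = e * hnorm (E v) w" using m by (simp add: e'_def)
      finally show "cmod (hinner (E v) (k v) w - shift f \<phi> v w) \<le> e * hnorm (E v) w" .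
    qed (use W N in auto)
  qed
  show ?thesis
  proof (rule P.weak_section[of "shift f \<phi>", unfolded fib_pullback])
    fix k assume "k \<in> dom_sections" "\<And>u w. \<lbrakk>u \<in> gelems G; w \<in> hcarrier (E u)\<rbrakk> \<Longrightarrow> hinner (E u) (k u) w = shift f \<phi> u w"
    then show ?thesis by (rule that)
  qed (rule *)
qed

section \<open>Translates are limits of restrictions\<close>

lemma convolution:
  assumes f: "f \<in> \<F>" and \<phi>: "bump \<phi>"
  obtains k where "k \<in> \<F>" "\<And>y w. \<lbrakk>y \<in> gelems G; w \<in> hcarrier (E y)\<rbrakk> \<Longrightarrow> hinner (E y) (k y) w = shift f \<phi> y w"
proof -
  obtain k where k: "k \<in> dom_sections" "\<And>y w. \<lbrakk>y \<in> gelems G; w \<in> hcarrier (E y)\<rbrakk> \<Longrightarrow> hinner (E y) (k y) w = shift f \<phi> y w"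
    using weak_integral[OF f \<phi>] by metis
  interpret P: hilbert_bundle "gtop G" "pullback (gtop G) src \<sigma>" by (rule S.hilbert_bundle_pullback[OF continuous_dom_units])
  have kc: "k y \<in> hcarrier (E y)" if "y \<in> gelems G" for y using P.sect_closed[OF k(1) that] by simp
  have fe: "equivariant_on (gelems G) f" using f by (simp add: ind_functions_iff)
  obtain K where K: "compactin (gtop G) K" "closedin (gtop G) K" "\<forall>z\<in>gelems G. \<phi> z \<noteq> 0 \<longrightarrow> z \<in> K" using bump_compact[OF \<phi>] by blast
  obtain A where A: "compactin (gtop G) A" "\<forall>x\<in>gelems G. f x \<noteq> hzero (E x) \<longrightarrow> q x \<in> q ` A"
    using fe unfolding equivariant_on_def by blast
  have eq: "k (mul y h) = act \<sigma> (inv h) (k y)" if y: "y \<in> gelems G" and h: "h \<in> H" "src y = rng h" for y h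
  proof -
    have yh: "mul y h \<in> gelems G" "rng (mul y h) = rng y" "src (mul y h) = src h"
      using y h H_elem mul_closed rng_mul dom_mul by (auto simp: composable_iff)
    interpret Eh: hilbert_space "E h" by (rule E_hilbert[OF H_elem[OF h(1)]])
    let ?U = "act \<sigma> (inv h)"
    have U: "?U v \<in> hcarrier (E h)" "hinner (E h) (?U v) (?U w) = hinner (E y) v w"
      if "v \<in> hcarrier (E y)" "w \<in> hcarrier (E y)" for v w
      using act_inv_preserving[OF h(1)] that h(2) by (auto simp: inner_preserving_def)
    have c: "k (mul y h) \<in> hcarrier (E h)" using kc[OF yh(1)] yh by simp
    have "hdist (E h) (k (mul y h)) (?U (k y)) \<le> 0"
    proof (rule Eh.norm_le_if_weak[OF c U(1)[OF kc[OF y] kc[OF y]] order_refl])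
      fix w assume w: "w \<in> hcarrier (E h)"
      obtain w' where w': "w' \<in> hcarrier (E y)" "w = ?U w'"
      proof -
        have "w \<in> ?U ` hcarrier (E y)" using act_inv[OF h(1)] w h(2) by (simp add: unitary_def bij_betw_def)
        then show ?thesis using that by blast
      qed
      have "hinner (E h) (k (mul y h)) w = shift f \<phi> (mul y h) w" using k(2)[OF yh(1)] w yh by simp
      also have "\<dots> = shift f \<phi> y w'" unfolding yh(2,3)
      proof (rule wint_cong[OF refl])
        fix z assume z: "z \<in> range_fiber G (rng y)"
        then have zy: "z \<in> gelems G" "rng z = rng y" by (auto simp: range_fiber_iff)
        have "f (mul (inv z) (mul y h)) = ?U (f (ldiv z y))"
          using fe inv_mul_assoc_H[OF zy(1) y zy(2) h] inv_mul_in[OF zy(1) y zy(2)] h by (simp add: equivariant_on_def)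
        then show "hinner (E h) (f (mul (inv z) (mul y h))) w = hinner (E y) (f (ldiv z y)) w'"
          using U(2)[OF shift_closed[OF f y z] w'(1)] w'(2) by simp
      qed
      also have "\<dots> = hinner (E y) (k y) w'" using k(2)[OF y w'(1)] by simp
      also have "\<dots> = hinner (E h) (?U (k y)) w" using U(2)[OF kc[OF y] w'(1)] w'(2) by simp
      finally show "cmod (hinner (E h) (k (mul y h)) w - hinner (E h) (?U (k y)) w) \<le> 0 * hnorm (E h) w" by simp
    qed
    then show ?thesis
      using Eh.eq_if_norm_minus[OF c U(1)[OF kc[OF y] kc[OF y]]] Eh.norm_nonneg[OF Eh.minus_closed[OF c U(1)[OF kc[OF y] kc[OF y]]]]
      by simp
  qed
  let ?C = "prod_topology (gtop G) (gtop G)"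
  have KA: "compactin (gtop G) ((\<lambda>p. mul (fst p) (snd p)) ` ((K \<times> A) \<inter> {p \<in> topspace ?C. src (fst p) = rng (snd p)}))"
  proof -
    let ?D = "{p \<in> topspace ?C. src (fst p) = rng (snd p)}"
    have "closedin ?C ?D"
      using continuous_map_compose[OF continuous_map_fst continuous_dom] continuous_map_compose[OF continuous_map_snd continuous_rng]
      by (intro closedin_equal) (auto simp: o_def)
    moreover have "compactin ?C (K \<times> A)" using K(1) A(1) by (simp add: compactin_Times)
    ultimately have "compactin ?C ((K \<times> A) \<inter> ?D)" by (subst Int_commute) (rule closed_Int_compactin)
    then have "compactin (subtopology ?C ?D) ((K \<times> A) \<inter> ?D)" by (simp add: compactin_subtopology)
    moreover have "continuous_map (subtopology ?C ?D) (gtop G) (\<lambda>p. mul (fst p) (snd p))"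
      by (rule continuous_mul_comp) (auto intro: continuous_map_from_subtopology continuous_map_fst continuous_map_snd)
    ultimately show ?thesis using image_compactin by blast
  qed
  have supp: "q y \<in> q ` ((\<lambda>p. mul (fst p) (snd p)) ` ((K \<times> A) \<inter> {p \<in> topspace ?C. src (fst p) = rng (snd p)}))"
    if y: "y \<in> gelems G" and ky: "k y \<noteq> hzero (E y)" for y
  proof -
    interpret Ey: hilbert_space "E y" by (rule E_hilbert[OF y])
    have "\<exists>z\<in>range_fiber G (rng y). \<phi> z \<noteq> 0 \<and> f (ldiv z y) \<noteq> hzero (E y)"
    proof (rule ccontr)
      assume no: "\<not> ?thesis"
      have "hinner (E y) (k y) (k y) = shift f \<phi> y (k y)" using k(2)[OF y kc[OF y]] .
      also have "\<dots> = wint (\<lambda>z. 0) (rng y) (\<lambda>z. 0)" unfolding wint_def set_lebesgue_integral_def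
        by (rule Bochner_Integration.integral_cong[OF refl]) (use no kc[OF y] in \<open>auto simp: indicator_def Ey.inner_zero\<close>)
      finally have "hnorm (E y) (k y) = 0" by (simp add: hnorm_def wint_def)
      then show False using Ey.norm_eq_zero[OF kc[OF y]] ky by blast
    qed
    then obtain z where z: "z \<in> gelems G" "rng z = rng y" "\<phi> z \<noteq> 0" "f (ldiv z y) \<noteq> hzero (E y)" by (auto simp: range_fiber_iff)
    note i = inv_mul_in[OF z(1) y z(2)]
    obtain a where a: "a \<in> A" "q (ldiv z y) = q a" using A(2) i z(4) by (auto simp: i(3))
    have aG: "a \<in> gelems G" using a compactin_subset_topspace[OF A(1)] by blast
    have "src z = rng a" "q y = q (mul z a)" using q_inv_mul[OF z(1) y z(2) aG a(2)] by auto
    moreover have "z \<in> K" using K(3) z by blast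
    ultimately show ?thesis using a aG z(1) by (intro image_eqI[of _ _ "mul z a"] image_eqI[of _ _ "(z, a)"]) auto
  qed
  have "k \<in> \<F>" unfolding ind_functions_iff equivariant_on_def subtopology_topspace using k(1) eq KA supp by blast
  then show ?thesis using that k(2) by blast
qed

lemma fiber_norm_small:
  assumes u: "u \<in> units G" and A: "compactin (gtop G) A" and e: "0 < e"
  shows "\<exists>d>0. \<forall>f\<in>fiber_functions u. (\<forall>x\<in>range_fiber G u. f x \<noteq> hzero (E x) \<longrightarrow> q x \<in> q ` A) \<longrightarrow>
    (\<forall>x\<in>range_fiber G u \<inter> A. hnorm (E x) (f x) \<le> d) \<longrightarrow> hnorm (big_prefiber u) f < e"
proof -
  interpret big: semi_inner_space "big_prefiber u" by (rule semi_inner_space_big_prefiber[OF u])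
  interpret M: radon Q "\<mu> u" by (rule mu_radon[OF u])
  note D = invariant_range_fiber[OF u]
  have Am: "q ` A \<in> sets (\<mu> u)" "emeasure (\<mu> u) (q ` A) < \<infinity>"
    using M.closed_measurable[OF q_compact_closed[OF A]] M.compact_finite[OF q_compact[OF A]] by auto
  define d where "d = e / sqrt (measure (\<mu> u) (q ` A) + 1)"
  have d: "0 < d" "d\<^sup>2 * measure (\<mu> u) (q ` A) < e\<^sup>2"
    using e measure_nonneg[of "\<mu> u" "q ` A"] by (simp_all add: d_def power_divide pos_divide_less_eq add_nonneg_pos)
  have "hnorm (big_prefiber u) f < e" if f: "f \<in> fiber_functions u"
    and supp: "\<And>x. \<lbrakk>x \<in> range_fiber G u; f x \<noteq> hzero (E x)\<rbrakk> \<Longrightarrow> q x \<in> q ` A"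
    and small: "\<And>x. \<lbrakk>x \<in> range_fiber G u; x \<in> A\<rbrakk> \<Longrightarrow> hnorm (E x) (f x) \<le> d" for f
  proof -
    have fe: "equivariant_on (range_fiber G u) f" using f by (simp add: fiber_functions_def)
    have p: "Re (pairing f f (q x)) = (hnorm (E x) (f x))\<^sup>2" "0 \<le> hnorm (E x) (f x)" if "x \<in> range_fiber G u" for x
    proof -
      interpret Ex: hilbert_space "E x" by (rule E_hilbert) (use that in \<open>simp add: range_fiber_iff\<close>)
      have "f x \<in> hcarrier (E x)" by (rule equivariant_closed[OF fe D that])
      then show "Re (pairing f f (q x)) = (hnorm (E x) (f x))\<^sup>2" "0 \<le> hnorm (E x) (f x)"
        using pairing_q[OF D fe fe that] Ex.norm_sq Ex.norm_nonneg by auto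
    qed
    have "(hnorm (big_prefiber u) f)\<^sup>2 = Re (LINT \<omega>:fiber u|\<mu> u. pairing f f \<omega>)"
      using big.norm_sq[of f] f by (simp add: prefiber_simps ind_inner_pairing)
    also have "\<dots> = (LINT \<omega>|\<mu> u. Re (indicator (fiber u) \<omega> *\<^sub>R pairing f f \<omega>))" unfolding set_lebesgue_integral_def
      by (rule integral_Re[symmetric]) (use pairing_integrable[OF u fe fe] in \<open>simp add: set_integrable_def\<close>)
    also have "\<dots> \<le> (LINT \<omega>|\<mu> u. d\<^sup>2 * indicator (q ` A) \<omega>)"
    proof (rule Bochner_Integration.integral_mono)
      show "integrable (\<mu> u) (\<lambda>\<omega>. Re (indicator (fiber u) \<omega> *\<^sub>R pairing f f \<omega>))"
        by (rule integrable_Re) (use pairing_integrable[OF u fe fe] in \<open>simp add: set_integrable_def\<close>)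
      show "integrable (\<mu> u) (\<lambda>\<omega>. d\<^sup>2 * indicator (q ` A) \<omega>)" using Am by simp
      fix \<omega>
      show "Re (indicator (fiber u) \<omega> *\<^sub>R pairing f f \<omega>) \<le> d\<^sup>2 * indicator (q ` A) \<omega>"
      proof (cases "\<omega> \<in> fiber u")
        case True
        then obtain x where x: "x \<in> range_fiber G u" "\<omega> = q x" unfolding fiber_q by blast
        show ?thesis
        proof (cases "q x \<in> q ` A")
          case True
          \<comment> \<open>the norm of \<open>f\<close> is constant on cosets, so \<open>x\<close> may be moved into \<open>A\<close>\<close>
          then obtain a where a: "a \<in> A" "q x = q a" by blast
          have aR: "a \<in> range_fiber G u" by (rule invariant_q[OF D x(1) a(2)])
          have "(hnorm (E a) (f a))\<^sup>2 \<le> d\<^sup>2" by (rule power_mono[OF small[OF aR a(1)] p(2)[OF aR]])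
          then show ?thesis using a \<open>\<omega> \<in> fiber u\<close> p(1)[OF aR] x(2) by simp
        next
          case False
          then have "f x = hzero (E x)" using supp x by blast
          then show ?thesis
            using False p(1)[OF x(1)] x semi_inner_space.norm_zero[OF E_semi, of x] by (simp add: indicator_def range_fiber_iff)
        qed
      next
        case False
        then show ?thesis by (auto simp: indicator_def)
      qed
    qed
    also have "\<dots> = d\<^sup>2 * measure (\<mu> u) (q ` A)" using Am by simp
    finally have "(hnorm (big_prefiber u) f)\<^sup>2 < e\<^sup>2" using d(2) by simp
    then show ?thesis using e by (intro power2_less_imp_less[of _ e]) auto
  qed
  then show ?thesis using d(1) by (intro exI[of _ d]) blast
qed

text \<open>A left translate of an equivariant function need not extend from \<open>G\<^bsup>r(x)\<^esup>\<close> to \<open>G\<close>, but it is a limit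
  of functions that do: its averages over translations by elements close to \<open>x\<close>, taken with the
  Haar system of \<open>G\<close>.\<close>

lemma translate_approximable:
  assumes x: "x \<in> gelems G" and f: "f \<in> \<F>" and e: "0 < e"
  shows "\<exists>k\<in>\<F>. hdist (big_prefiber (rng x)) (translate x (res (src x) f)) (res (rng x) k) < e"
proof -
  define u where "u = rng x"
  let ?R = "range_fiber G u" and ?X = "fiber_top u"
  have u: "u \<in> units G" using x by (simp add: u_def rng_unit)
  have xR: "x \<in> ?R" using x by (simp add: range_fiber_iff u_def)
  have tX: "topspace ?X = ?R" by (auto simp: range_fiber_iff)
  have fe: "equivariant_on (gelems G) f" using f by (simp add: ind_functions_iff)
  interpret big: semi_inner_space "big_prefiber u" by (rule semi_inner_space_big_prefiber[OF u])
  obtain A where A: "compactin (gtop G) A" "\<forall>x\<in>gelems G. f x \<noteq> hzero (E x) \<longrightarrow> q x \<in> q ` A"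
    using fe unfolding equivariant_on_def by blast
  obtain N0 U0 where N0: "openin (gtop G) U0" "compactin (gtop G) N0" "x \<in> U0" "U0 \<subseteq> N0"
    using locally_compact x unfolding locally_compact_space_def by blast
  let ?C = "prod_topology (gtop G) (gtop G)"
  let ?D = "{p \<in> topspace ?C. src (fst p) = rng (snd p)}"
  define B where "B = (\<lambda>p. mul (fst p) (snd p)) ` ((N0 \<times> A) \<inter> ?D)"
  have B: "compactin (gtop G) B"
  proof -
    have "closedin ?C ?D"
      using continuous_map_compose[OF continuous_map_fst continuous_dom] continuous_map_compose[OF continuous_map_snd continuous_rng]
      by (intro closedin_equal) (auto simp: o_def)
    moreover have "compactin ?C (N0 \<times> A)" using N0(2) A(1) by (simp add: compactin_Times)
    ultimately have "compactin ?C ((N0 \<times> A) \<inter> ?D)" by (subst Int_commute) (rule closed_Int_compactin)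
    then have "compactin (subtopology ?C ?D) ((N0 \<times> A) \<inter> ?D)" by (simp add: compactin_subtopology)
    moreover have "continuous_map (subtopology ?C ?D) (gtop G) (\<lambda>p. mul (fst p) (snd p))"
      by (rule continuous_mul_comp) (auto intro: continuous_map_from_subtopology continuous_map_fst continuous_map_snd)
    ultimately show ?thesis unfolding B_def using image_compactin by blast
  qed
  have zB: "q y \<in> q ` B" if "z \<in> N0" "z \<in> gelems G" "y \<in> gelems G" "rng z = rng y" "f (ldiv z y) \<noteq> hzero (E y)" for z y
  proof -
    note i = inv_mul_in[OF that(2-4)] and nz = that(5)
    obtain a where a: "a \<in> A" "q (ldiv z y) = q a" using A(2) i nz by (auto simp: i(3))
    have aG: "a \<in> gelems G" using a compactin_subset_topspace[OF A(1)] by blast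
    have "src z = rng a" "q y = q (mul z a)" using q_inv_mul[OF that(2-4) aG a(2)] by auto
    then show ?thesis unfolding B_def using a aG that(1,2) by (intro image_eqI[of _ _ "mul z a"] image_eqI[of _ _ "(z, a)"]) auto
  qed
  obtain d where d: "0 < d" and d_small: "\<forall>f\<in>fiber_functions u. (\<forall>y\<in>?R. f y \<noteq> hzero (E y) \<longrightarrow> q y \<in> q ` B) \<longrightarrow>
    (\<forall>y\<in>?R \<inter> B. hnorm (E y) (f y) \<le> d) \<longrightarrow> hnorm (big_prefiber u) f < e"
    using fiber_norm_small[OF u B e] by blast
  \<comment> \<open>translates by elements of \<open>G\<^sup>u\<close> close to \<open>x\<close> are uniformly close on the compact set \<open>B \<inter> G\<^sup>u\<close>\<close>
  let ?XX = "prod_topology ?X ?X"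
  have near: "\<exists>U. openin (gtop G) U \<and> x \<in> U \<and> (\<forall>z\<in>U \<inter> ?R. \<forall>y\<in>B \<inter> ?R. hdist (E y) (f (ldiv z y)) (f (ldiv x y)) < d)"
  proof -
    let ?P = "subtopology ?C {p. rng (fst p) = rng (snd p)}"
    have cXX: "continuous_map ?XX (gtop G) fst" "continuous_map ?XX (gtop G) snd"
      using continuous_map_fst[of ?X ?X] continuous_map_snd[of ?X ?X] by (simp_all add: continuous_map_in_subtopology)
    have pP: "continuous_map ?P (unit_space G) (\<lambda>p. src (snd p))"
      using continuous_map_compose[OF continuous_map_from_subtopology[OF continuous_map_snd] continuous_dom_units, of "gtop G"]
      by (simp add: o_def)
    have pXX: "continuous_map ?XX (unit_space G) (\<lambda>p. src (snd p))"
      using continuous_map_compose[OF cXX(2) continuous_dom_units] by (simp add: o_def)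
    have j1: "continuous_map ?XX ?P (\<lambda>p. (fst p, snd p))" "continuous_map ?XX ?P (\<lambda>p. (x, snd p))"
      using cXX x continuous_map_pairedI[OF cXX] by (auto simp: continuous_map_in_subtopology range_fiber_iff u_def intro!: continuous_map_pairedI)
    interpret PX: hilbert_bundle ?XX "pullback ?XX (\<lambda>p. src (snd p)) \<sigma>" by (rule S.hilbert_bundle_pullback[OF pXX])
    have s: "(\<lambda>p. f (mul (inv (fst p)) (snd p))) \<in> csect (pullback ?XX (\<lambda>p. src (snd p)) \<sigma>)"
      "(\<lambda>p. f (mul (inv x) (snd p))) \<in> csect (pullback ?XX (\<lambda>p. src (snd p)) \<sigma>)"
      using S.pullback_comp[OF pP j1(1) shift_section[OF f]] S.pullback_comp[OF pP j1(2) shift_section[OF f]] by simp_all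
    define h where "h p = hdist (E (snd p)) (f (mul (inv (fst p)) (snd p))) (f (mul (inv x) (snd p)))" for p
    have hc: "continuous_map ?XX euclideanreal h" using PX.sect_norm[OF PX.sect_minus[OF s]] by (simp add: h_def[abs_def])
    define W where "W = {p \<in> topspace ?XX. h p \<in> {..<d}}"
    have W: "openin ?XX W" unfolding W_def by (rule openin_continuous_map_preimage[OF hc]) simp
    have "compactin (gtop G) (?R \<inter> B)" by (rule closed_Int_compactin[OF closedin_range_fiber[OF u] B])
    then have Bc: "compactin ?X (B \<inter> ?R)" by (simp add: compactin_subtopology Int_commute)
    have sub: "{x} \<times> (B \<inter> ?R) \<subseteq> W"
    proof
      fix p assume "p \<in> {x} \<times> (B \<inter> ?R)"
      then obtain y where y: "p = (x, y)" "y \<in> ?R" by auto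
      have "f (ldiv x y) \<in> hcarrier (E y)" using shift_closed[OF f, of y x] y xR by (simp add: range_fiber_iff)
      then have "h p = 0" unfolding h_def using y semi_inner_space.norm_minus_self[OF E_semi] by (simp add: range_fiber_iff)
      then show "p \<in> W" using y xR d by (simp add: W_def tX range_fiber_iff)
    qed
    obtain U V where UV: "openin ?X U" "openin ?X V" "x \<in> U" "B \<inter> ?R \<subseteq> V" "U \<times> V \<subseteq> W"
      using tube_lemma_right[OF W Bc _ sub] xR tX by auto
    obtain U' where U': "openin (gtop G) U'" "U = U' \<inter> ?R" using UV(1) by (auto simp: openin_subtopology)
    have "hdist (E y) (f (ldiv z y)) (f (ldiv x y)) < d" if "z \<in> U' \<inter> ?R" "y \<in> B \<inter> ?R" for z y
    proof -
      have "(z, y) \<in> W" using that UV U' by blast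
      then show ?thesis by (simp add: W_def h_def)
    qed
    then show ?thesis using U' UV(3) by blast
  qed
  then obtain U1 where U1: "openin (gtop G) U1" "x \<in> U1" "\<forall>z\<in>U1 \<inter> ?R. \<forall>y\<in>B \<inter> ?R.
     hdist (E y) (f (ldiv z y)) (f (ldiv x y)) < d" by blast
  obtain b :: "'g \<Rightarrow> real" and V K where b: "continuous_map (gtop G) euclideanreal b" "\<And>y. 0 \<le> b y"
    "openin (gtop G) V" "x \<in> V" "\<And>y. y \<in> V \<Longrightarrow> b y = 1" "compactin (gtop G) K" "closedin (gtop G) K" "K \<subseteq> U0 \<inter> U1"
    "\<And>y. y \<in> gelems G \<Longrightarrow> b y \<noteq> 0 \<Longrightarrow> y \<in> K"
    by (rule bump_function[OF locally_compact Hausdorff openin_Int[OF N0(1) U1(1)], of x]) (use N0 U1 in auto)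
  interpret L: radon "gtop G" "\<Lambda> u" by (rule haar_radon[OF u])
  have c: "0 < mass b u" unfolding mass_def by (rule L.pos_integral(1)[OF b(1,2,6,7,9,3,4,5)]) (use haar_support[OF u] xR in auto)
  define \<phi> where "\<phi> z = b z * (1 / mass b u)" for z
  have bb: "bump b" unfolding bump_def using b by blast
  have \<phi>: "bump \<phi>" unfolding \<phi>_def by (rule bump_mult[OF bb]) (use c in auto)
  have m1: "mass \<phi> u = 1" using c by (simp add: \<phi>_def mass_def)
  obtain k where k: "k \<in> \<F>" "\<And>y w. \<lbrakk>y \<in> gelems G; w \<in> hcarrier (E y)\<rbrakk> \<Longrightarrow> hinner (E y) (k y) w = shift f \<phi> y w"
    using convolution[OF f \<phi>] by metis
  have ke: "equivariant_on (gelems G) k" using k(1) by (simp add: ind_functions_iff)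
  define t where "t = translate x (res (src x) f)"
  define k' where "k' = restrict k ?R"
  have tf: "t \<in> fiber_functions u" "k' \<in> fiber_functions u"
    unfolding t_def k'_def u_def using translate_fiber_function[OF x ind_restrict[OF dom_unit[OF x] f]] ind_restrict[OF rng_unit[OF x] k(1)] by auto
  have ty: "t y = f (ldiv x y)" if "y \<in> ?R" for y
    using that inv_mul_in[OF x, of y] by (simp add: t_def translate_def u_def range_fiber_iff)
  let ?d = "hminus (big_prefiber u) t k'"
  have df: "?d \<in> fiber_functions u" using big.minus_closed[of t k'] tf by (simp add: prefiber_simps)
  have dy: "?d y = hminus (E y) (t y) (k y)" if "y \<in> ?R" for y using that by (simp add: hminus_def prefiber_simps k'_def)
  have kc: "k y \<in> hcarrier (E y)" and tc: "t y \<in> hcarrier (E y)" if "y \<in> ?R" for y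
    using equivariant_closed[OF ke invariant_gelems, of y] shift_closed[OF f, of y x] ty[OF that] that xR by (auto simp: range_fiber_iff)
  have small: "hnorm (E y) (?d y) \<le> d" if y: "y \<in> B \<inter> ?R" for y
  proof -
    have yG: "y \<in> gelems G" "rng y = u" "y \<in> ?R" using y by (auto simp: range_fiber_iff)
    interpret Ey: hilbert_space "E y" by (rule E_hilbert[OF yG(1)])
    show ?thesis unfolding dy[OF yG(3)]
    proof (rule Ey.norm_le_if_weak[OF tc[OF yG(3)] kc[OF yG(3)] less_imp_le[OF d]])
      fix w assume w: "w \<in> hcarrier (E y)"
      have "hdist (E y) (f (ldiv z y)) (t y) \<le> d" if z: "z \<in> range_fiber G (rng y)" "\<phi> z \<noteq> 0" for z
      proof -
        have "z \<in> U1 \<inter> ?R" using z b(8,9) yG by (auto simp: \<phi>_def range_fiber_iff)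
        then show ?thesis using U1(3) y ty[OF yG(3)] by (simp add: less_imp_le)
      qed
      from shift_bound[OF f \<phi> yG(1) tc[OF yG(3)] w d this]
      show "cmod (hinner (E y) (t y) w - hinner (E y) (k y) w) \<le> d * hnorm (E y) w" using k(2)[OF yG(1) w] yG(2) m1 by simp
    qed
  qed
  have "q y \<in> q ` B" if y: "y \<in> ?R" "?d y \<noteq> hzero (E y)" for y
  proof -
    have yG: "y \<in> gelems G" "rng y = u" using y by (auto simp: range_fiber_iff)
    interpret Ey: hilbert_space "E y" by (rule E_hilbert[OF yG(1)])
    show "q y \<in> q ` B"
    proof (rule ccontr)
      assume no: "q y \<notin> q ` B"
      have fz: "f (ldiv z y) = hzero (E y)" if "z \<in> N0" "z \<in> ?R" for z
        using zB[OF that(1) _ yG(1)] that no yG by (auto simp: range_fiber_iff)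
      have "t y = hzero (E y)" using fz[of x] ty[OF y(1)] N0 xR by auto
      moreover have "k y = hzero (E y)"
      proof (rule Ey.norm_eq_zero[OF kc[OF y(1)]])
        have "hinner (E y) (k y) (k y) = shift f \<phi> y (k y)" using k(2)[OF yG(1) kc[OF y(1)]] .
        also have "\<dots> = wint (\<lambda>z. 0) u (\<lambda>z. 0)" unfolding wint_def set_lebesgue_integral_def yG(2)
        proof (rule Bochner_Integration.integral_cong[OF refl])
          fix z
          have "\<phi> z = 0 \<or> f (ldiv z y) = hzero (E y)" if "z \<in> ?R"
            using that fz[of z] b(8,9) N0(4) by (auto simp: \<phi>_def range_fiber_iff)
          then show "indicator ?R z *\<^sub>R (complex_of_real (\<phi> z) * hinner (E y) (f (ldiv z y)) (k y))
             = indicator ?R z *\<^sub>R (complex_of_real 0 * 0)"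
            using kc[OF y(1)] by (auto simp: indicator_def Ey.inner_zero)
        qed
        finally show "hnorm (E y) (k y) = 0" by (simp add: hnorm_def wint_def)
      qed
      ultimately have "?d y = hminus (E y) (hzero (E y)) (hzero (E y))" using dy[OF y(1)] by simp
      also have "\<dots> = hzero (E y)" by (rule Ey.norm_eq_zero) (simp_all add: Ey.closed Ey.norm_minus_self)
      finally show False using y(2) by simp
    qed
  qed
  then have "hnorm (big_prefiber u) ?d < e" using d_small df small by blast
  then show ?thesis using k(1) by (auto simp: t_def k'_def u_def)
qed

section \<open>The action of the induced representation\<close>

lemma ind_act:
  assumes x: "x \<in> gelems G"
  shows "inner_preserving (ind_fiber G H \<mu> \<sigma> (src x)) (ind_fiber G H \<mu> \<sigma> (rng x)) (act (ind_rep G H \<mu> \<sigma>) x)"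
    and "\<And>f k. \<lbrakk>f \<in> \<F>; k \<in> \<F>\<rbrakk> \<Longrightarrow>
      hinner (ind_fiber G H \<mu> \<sigma> (rng x)) (act (ind_rep G H \<mu> \<sigma>) x (ind_section G H \<mu> \<sigma> f (src x))) (ind_section G H \<mu> \<sigma> k (rng x))
        = ip (rng x) (translate x (res (src x) f)) (res (rng x) k)"
proof -
  let ?u = "src x" and ?v = "rng x"
  let ?P = "hcarrier (prefiber ?v)"
  have u: "?u \<in> units G" "?v \<in> units G" using x by (auto simp: dom_unit rng_unit)
  have act: "act (ind_rep G H \<mu> \<sigma>) x = completion_map (prefiber ?v) (translate x)"
    by (simp add: ind_rep_def translate_def[abs_def])
  have ip: "inner_preserving (prefiber ?u) (big_prefiber ?v) (translate x)" unfolding inner_preserving_def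
    using translate_fiber_function[OF x ind_restrict[OF u(1)]] translate_isometry[OF x] by (auto simp: prefiber_simps)
  have dense: "\<exists>p\<in>?P. hdist (big_prefiber ?v) (translate x v) p < e"
    if v: "v \<in> hcarrier (prefiber ?u)" and e: "0 < e" for v and e :: real
  proof -
    obtain f where f: "f \<in> \<F>" "v = res ?u f" using v by (auto simp: prefiber_simps)
    show ?thesis using translate_approximable[OF x f(1) e] f(2) by (auto simp: prefiber_simps(1))
  qed
  note * = completion_map_isometry[OF semi_inner_space_prefiber[OF u(1)] semi_inner_space_big_prefiber[OF u(2)]
      semi_inner_space_prefiber[OF u(2)] prefiber_eq prefiber_subset[OF u(2)] ip]
  show "inner_preserving (ind_fiber G H \<mu> \<sigma> ?u) (ind_fiber G H \<mu> \<sigma> ?v) (act (ind_rep G H \<mu> \<sigma>) x)"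
    unfolding act ind_fiber_def by (rule *(1)) (rule dense)
  fix f k assume f: "f \<in> \<F>" and k: "k \<in> \<F>"
  have "hinner (completion (prefiber ?v)) (completion_map (prefiber ?v) (translate x) (completion_embed (prefiber ?u) (res ?u f)))
      (completion_embed (prefiber ?v) (res ?v k))
    = hinner (big_prefiber ?v) (translate x (res ?u f)) (res ?v k)"
    by (rule *(2)) (use f k dense in \<open>auto simp: prefiber_simps(1)\<close>)
  then show "hinner (ind_fiber G H \<mu> \<sigma> ?v) (act (ind_rep G H \<mu> \<sigma>) x (ind_section G H \<mu> \<sigma> f ?u)) (ind_section G H \<mu> \<sigma> k ?v)
        = ip ?v (translate x (res ?u f)) (res ?v k)"
    unfolding act ind_fiber_def ind_section_def by (simp add: prefiber_simps)
qed

end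

section \<open>Two representations and their tensor product\<close>

locale rep_pair = homogeneous_space G H \<Lambda> \<Lambda>\<^sub>H \<mu> for G :: "'g groupoid" and H \<Lambda> \<Lambda>\<^sub>H \<mu> +
  fixes \<rho> :: "('g, 'v) grep" and \<pi> :: "('g, 'w) grep"
  assumes rep_\<rho>: "unitary_rep G \<rho>" and rep_\<pi>: "unitary_rep (sub_groupoid G H) \<pi>"
begin

abbreviation "\<tau> \<equiv> tensor_rep (sub_groupoid G H) (restrict_rep \<rho> H) \<pi>"

abbreviation "R x \<equiv> fib \<rho> (src x)"
abbreviation "W x \<equiv> fib \<pi> (src x)"
abbreviation "\<T> x \<equiv> fib \<tau> (src x)"
abbreviation "moved x v \<equiv> act \<rho> (inv x) v"
abbreviation "ten x \<equiv> tensor_vec (R x) (W x)"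

lemma fib_\<tau>: "fib \<tau> = (\<lambda>u. tensor (fib \<rho> u) (fib \<pi> u))" by (simp add: tensor_rep_def restrict_rep_def)

lemma bundle_\<rho>: "hilbert_bundle (unit_space G) \<rho>" using rep_\<rho> by (simp add: unitary_rep_def)
lemma bundle_\<pi>: "hilbert_bundle (unit_space G) \<pi>" using rep_\<pi> by (simp add: unitary_rep_def unit_space_sub)

sublocale TB: tensor_bundle "unit_space G" \<rho> \<pi> \<tau>
proof -
  interpret R: hilbert_bundle "unit_space G" \<rho> by (rule bundle_\<rho>)
  interpret P: hilbert_bundle "unit_space G" \<pi> by (rule bundle_\<pi>)
  show "tensor_bundle (unit_space G) \<rho> \<pi> \<tau>" by (intro tensor_bundle.intro tensor_bundle_axioms.intro bundle_\<rho> bundle_\<pi>)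
      (simp_all add: tensor_rep_def restrict_rep_def unit_space_sub)
qed

lemma rho_unitary: "x \<in> gelems G \<Longrightarrow> unitary (R x) (fib \<rho> (rng x)) (act \<rho> x)" using rep_\<rho> by (simp add: unitary_rep_def)
lemmas rho_preserving = unitary_inner_preserving[OF rho_unitary]
lemma rho_unit: "\<lbrakk>u \<in> units G; v \<in> hcarrier (fib \<rho> u)\<rbrakk> \<Longrightarrow> act \<rho> u v = v" using rep_\<rho> by (simp add: unitary_rep_def)
lemma rho_mul: "\<lbrakk>x \<in> gelems G; y \<in> gelems G; src x = rng y; v \<in> hcarrier (R y)\<rbrakk> \<Longrightarrow> act \<rho> x (act \<rho> y v) = act \<rho> (mul x y) v"
  using rep_\<rho> unfolding unitary_rep_def by (fastforce simp: composable_iff)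
lemma rho_closed: "\<lbrakk>x \<in> gelems G; v \<in> hcarrier (R x)\<rbrakk> \<Longrightarrow> act \<rho> x v \<in> hcarrier (fib \<rho> (rng x))"
  using rho_preserving by (auto simp: inner_preserving_def)
lemma rho_inner: "\<lbrakk>x \<in> gelems G; v \<in> hcarrier (R x); w \<in> hcarrier (R x)\<rbrakk>
    \<Longrightarrow> hinner (fib \<rho> (rng x)) (act \<rho> x v) (act \<rho> x w) = hinner (R x) v w"
  using rho_preserving by (auto simp: inner_preserving_def)

lemma rho_inv_closed: "\<lbrakk>x \<in> gelems G; v \<in> hcarrier (fib \<rho> (rng x))\<rbrakk> \<Longrightarrow> moved x v \<in> hcarrier (R x)"
  using rho_closed[of "inv x" v] by (simp add: inv_closed dom_inv rng_inv)
lemma rho_inv_inner: "\<lbrakk>x \<in> gelems G; v \<in> hcarrier (fib \<rho> (rng x)); w \<in> hcarrier (fib \<rho> (rng x))\<rbrakk>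
    \<Longrightarrow> hinner (R x) (moved x v) (moved x w) = hinner (fib \<rho> (rng x)) v w"
  using rho_inner[of "inv x" v w] by (simp add: inv_closed dom_inv rng_inv)
lemma rho_inv_rho: "\<lbrakk>x \<in> gelems G; v \<in> hcarrier (R x)\<rbrakk> \<Longrightarrow> moved x (act \<rho> x v) = v"
  using rho_mul[of "inv x" x v] by (simp add: inv_closed dom_inv inv_mul rho_unit dom_unit)

lemma pi_unitary: "h \<in> H \<Longrightarrow> unitary (fib \<pi> (src h)) (fib \<pi> (rng h)) (act \<pi> h)"
  using rep_\<pi> H_elem by (simp add: unitary_rep_def sub_simps)
lemma pi_unit: "\<lbrakk>u \<in> units G; v \<in> hcarrier (fib \<pi> u)\<rbrakk> \<Longrightarrow> act \<pi> u v = v" using rep_\<pi> by (simp add: unitary_rep_def units_sub)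
lemma pi_mul: "\<lbrakk>x \<in> H; y \<in> H; src x = rng y; v \<in> hcarrier (W y)\<rbrakk> \<Longrightarrow> act \<pi> x (act \<pi> y v) = act \<pi> (mul x y) v"
  using rep_\<pi> unfolding unitary_rep_def sub_simps(3,4) by (fastforce simp: composable_def sub_simps(2,3,6) simp del: topspace_subtopology)

lemma fib_hilbert: "u \<in> units G \<Longrightarrow> hilbert_space (fib \<rho> u)" "u \<in> units G \<Longrightarrow> hilbert_space (fib \<pi> u)"
  using TB.E1.hilbert TB.E2.hilbert by (simp_all add: topspace_unit_space)

lemma fib_pair: "u \<in> units G \<Longrightarrow> hilbert_pair (fib \<rho> u) (fib \<pi> u)" using TB.pair by (simp add: topspace_unit_space)

lemma tau_act:
  assumes h: "h \<in> H"
  shows "inner_preserving (fib \<tau> (src h)) (fib \<tau> (rng h)) (act \<tau> h)"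
    and "\<And>v w. \<lbrakk>v \<in> hcarrier (fib \<rho> (src h)); w \<in> hcarrier (fib \<pi> (src h))\<rbrakk> \<Longrightarrow>
      act \<tau> h (tensor_vec (fib \<rho> (src h)) (fib \<pi> (src h)) v w)
      = tensor_vec (fib \<rho> (rng h)) (fib \<pi> (rng h)) (act \<rho> h v) (act \<pi> h w)"
proof -
  have hG: "h \<in> gelems G" by (rule H_elem[OF h])
  have a: "act \<tau> h = tensor_op (fib \<rho> (rng h)) (fib \<pi> (rng h)) (act \<rho> h) (act \<pi> h)"
    using h by (simp add: tensor_rep_def restrict_rep_def sub_simps)
  note * = tensor_op_isometry[OF fib_hilbert(1)[OF dom_unit[OF hG]] fib_hilbert(2)[OF dom_unit[OF hG]]
      fib_hilbert(1)[OF rng_unit[OF hG]] fib_hilbert(2)[OF rng_unit[OF hG]]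
      rho_preserving[OF hG] unitary_inner_preserving[OF pi_unitary[OF h]]]
  show "inner_preserving (fib \<tau> (src h)) (fib \<tau> (rng h)) (act \<tau> h)" unfolding a fib_\<tau> by (rule *(1))
  show "\<And>v w. \<lbrakk>v \<in> hcarrier (fib \<rho> (src h)); w \<in> hcarrier (fib \<pi> (src h))\<rbrakk> \<Longrightarrow>
      act \<tau> h (tensor_vec (fib \<rho> (src h)) (fib \<pi> (src h)) v w)
      = tensor_vec (fib \<rho> (rng h)) (fib \<pi> (rng h)) (act \<rho> h v) (act \<pi> h w)"
    unfolding a by (rule *(2))
qed

lemma tau_hilbert: "u \<in> units G \<Longrightarrow> hilbert_space (fib \<tau> u)"
  unfolding fib_\<tau> by (rule hilbert_pair.hilbert_space_tensor[OF fib_pair])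

lemma tau_unitary:
  assumes h: "h \<in> H"
  shows "unitary (fib \<tau> (src h)) (fib \<tau> (rng h)) (act \<tau> h)"
proof (rule unitaryI)
  let ?k = "inv h" and ?r = "rng h" and ?d = "src h"
  have hG: "h \<in> gelems G" and kH: "?k \<in> H" using h H_elem H_inv by auto
  have kd: "src ?k = ?r" "rng ?k = ?d" using hG by (simp_all add: dom_inv rng_inv)
  have u: "?r \<in> units G" "?d \<in> units G" using hG by (simp_all add: rng_unit dom_unit)
  show H1: "hilbert_space (fib \<tau> ?d)" and H2: "hilbert_space (fib \<tau> ?r)" using tau_hilbert u by auto
  show ip: "inner_preserving (fib \<tau> ?d) (fib \<tau> ?r) (act \<tau> h)" by (rule tau_act(1)[OF h])
  have ik: "inner_preserving (fib \<tau> ?r) (fib \<tau> ?d) (act \<tau> ?k)" using tau_act(1)[OF kH] by (simp add: kd)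
  interpret hp: hilbert_pair "fib \<rho> ?r" "fib \<pi> ?r" by (rule fib_pair[OF u(1)])
  fix w assume w: "w \<in> hcarrier (fib \<tau> ?r)"
  have "act \<tau> h (act \<tau> ?k w) = w"
  proof (rule inner_preserving_eq[of "fib \<tau> ?r" "fib \<tau> ?r" "\<lambda>w. act \<tau> h (act \<tau> ?k w)" "\<lambda>w. w"])
    show "semi_inner_space (fib \<tau> ?r)" by (rule hilbert_imp_semi_inner[OF H2])
    show "inner_preserving (fib \<tau> ?r) (fib \<tau> ?r) (\<lambda>w. act \<tau> h (act \<tau> ?k w))" using ip ik unfolding inner_preserving_def by metis
    show "inner_preserving (fib \<tau> ?r) (fib \<tau> ?r) (\<lambda>w. w)" by (simp add: inner_preserving_def)
    show "total (fib \<tau> ?r) {tensor_vec (fib \<rho> ?r) (fib \<pi> ?r) a b | a b. a \<in> hcarrier (fib \<rho> ?r) \<and> b \<in> hcarrier (fib \<pi> ?r)}"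
      unfolding fib_\<tau> by (rule hp.tensor_total)
    show "{tensor_vec (fib \<rho> ?r) (fib \<pi> ?r) a b | a b. a \<in> hcarrier (fib \<rho> ?r) \<and> b \<in> hcarrier (fib \<pi> ?r)} \<subseteq> hcarrier (fib \<tau> ?r)"
      unfolding fib_\<tau> by (auto simp: hp.tensor_vec_closed)
    fix s assume "s \<in> {tensor_vec (fib \<rho> ?r) (fib \<pi> ?r) a b | a b. a \<in> hcarrier (fib \<rho> ?r) \<and> b \<in> hcarrier (fib \<pi> ?r)}"
    then obtain a b where s: "s = tensor_vec (fib \<rho> ?r) (fib \<pi> ?r) a b" "a \<in> hcarrier (fib \<rho> ?r)" "b \<in> hcarrier (fib \<pi> ?r)" by blast
    have pk: "act \<pi> ?k b \<in> hcarrier (fib \<pi> ?d)"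
      using unitary_inner_preserving[OF pi_unitary[OF kH]] s(3) by (simp add: inner_preserving_def kd)
    have "act \<tau> ?k s = tensor_vec (fib \<rho> ?d) (fib \<pi> ?d) (act \<rho> ?k a) (act \<pi> ?k b)"
      using tau_act(2)[OF kH, unfolded kd, OF s(2,3)] s(1) by simp
    also have "act \<tau> h \<dots> = tensor_vec (fib \<rho> ?r) (fib \<pi> ?r) (act \<rho> h (act \<rho> ?k a)) (act \<pi> h (act \<pi> ?k b))"
      by (rule tau_act(2)[OF h rho_inv_closed[OF hG s(2)] pk])
    also have "act \<rho> h (act \<rho> ?k a) = a" using rho_mul[of h ?k a] s(2) hG u by (simp add: inv_closed kd mul_inv rho_unit)
    also have "act \<pi> h (act \<pi> ?k b) = b" using pi_mul[of h ?k b] s(3) h kH u hG by (simp add: kd mul_inv pi_unit)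
    finally show "act \<tau> h (act \<tau> ?k s) = s" using s by simp
  qed (use w H2 in auto)
  moreover have "act \<tau> ?k w \<in> hcarrier (fib \<tau> ?d)" using ik w by (simp add: inner_preserving_def)
  ultimately show "\<exists>v\<in>hcarrier (fib \<tau> ?d). act \<tau> h v = w" by blast
qed

sublocale Pi: induced G H \<Lambda> \<Lambda>\<^sub>H \<mu> \<pi> by (intro induced.intro induced_axioms.intro homogeneous_space_axioms bundle_\<pi> pi_unitary)

sublocale Tau: induced G H \<Lambda> \<Lambda>\<^sub>H \<mu> \<tau>
  by (intro induced.intro induced_axioms.intro homogeneous_space_axioms TB.hilbert_bundle_tensor tau_unitary)

section \<open>Twisting an equivariant function by a section\<close>

text \<open>Strong continuity of \<open>\<rho>\<close> follows from weak continuity because \<open>\<rho>\<close> preserves norms.\<close>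

lemma rho_inner_continuous:
  assumes \<xi>: "\<xi> \<in> csect \<rho>" and \<zeta>: "\<zeta> \<in> csect \<rho>"
  shows "continuous_map (gtop G) euclidean (\<lambda>x. hinner (R x) (moved x (\<xi> (rng x))) (\<zeta> (src x)))"
proof (rule continuous_map_locally)
  fix x assume x: "x \<in> gelems G"
  obtain \<xi>' U where U: "\<xi>' \<in> C0_sections (unit_space G) \<rho>" "openin (unit_space G) U" "rng x \<in> U" "\<And>v. v \<in> U \<Longrightarrow> \<xi>' v = \<xi> v"
    by (rule TB.E1.C0_section_local[OF unit_space_lc \<xi>, of "rng x"]) (auto simp: topspace_unit_space rng_unit x)
  obtain \<zeta>' V where V: "\<zeta>' \<in> C0_sections (unit_space G) \<rho>" "openin (unit_space G) V" "src x \<in> V" "\<And>v. v \<in> V \<Longrightarrow> \<zeta>' v = \<zeta> v"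
    by (rule TB.E1.C0_section_local[OF unit_space_lc \<zeta>, of "src x"]) (auto simp: topspace_unit_space dom_unit x)
  have "continuous_map (gtop G) euclidean (\<lambda>x. hinner (fib \<rho> (rng x)) (act \<rho> x (\<xi>' (src x))) (\<zeta>' (rng x)))"
    using rep_\<rho> U(1) V(1) by (simp add: unitary_rep_def)
  from continuous_map_compose[OF continuous_inv' this]
  have "continuous_map (gtop G) euclidean (\<lambda>x. hinner (fib \<rho> (rng (inv x))) (moved x (\<xi>' (src (inv x)))) (\<zeta>' (rng (inv x))))"
    by (simp add: o_def)
  moreover have "openin (gtop G) ({y \<in> gelems G. rng y \<in> U} \<inter> {y \<in> gelems G. src y \<in> V})"
    by (intro openin_Int openin_continuous_map_preimage[OF continuous_rng_units U(2)]
        openin_continuous_map_preimage[OF continuous_dom_units V(2)])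
  ultimately show "\<exists>W g. openin (gtop G) W \<and> x \<in> W \<and> continuous_map (gtop G) euclidean g \<and>
      (\<forall>y\<in>W. g y = hinner (R y) (moved y (\<xi> (rng y))) (\<zeta> (src y)))"
    using x U(3,4) V(3,4)
    by (intro exI[of _ "{y \<in> gelems G. rng y \<in> U} \<inter> {y \<in> gelems G. src y \<in> V}"] exI conjI) (auto simp: dom_inv rng_inv)
qed

lemma rho_section:
  assumes \<xi>: "\<xi> \<in> csect \<rho>"
  shows "(\<lambda>x. moved x (\<xi> (rng x))) \<in> csect (pullback (gtop G) src \<rho>)"
proof -
  have c: "moved x (\<xi> (rng x)) \<in> hcarrier (R x)" if "x \<in> gelems G" for x
    using rho_inv_closed[OF that] TB.E1.sect_closed[OF \<xi>, of "rng x"] that by (simp add: topspace_unit_space rng_unit)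
  have "locally_approximable (gtop G) (\<lambda>x. R x) ((\<lambda>\<xi> x. \<xi> (src x)) ` csect \<rho>) (\<lambda>x. moved x (\<xi> (rng x)))"
    unfolding locally_approximable_def
  proof (intro ballI allI impI)
    fix x and e :: real assume x: "x \<in> gelems G" and e: "0 < e"
    have ux: "src x \<in> topspace (unit_space G)" by (simp add: topspace_unit_space dom_unit[OF x])
    obtain \<zeta> where \<zeta>: "\<zeta> \<in> csect \<rho>" "hdist (R x) (\<zeta> (src x)) (moved x (\<xi> (rng x))) < e"
      using TB.E1.sect_dense[OF ux c[OF x] e] by blast
    define N where "N y = (hnorm (fib \<rho> (rng y)) (\<xi> (rng y)))\<^sup>2 - 2 * Re (hinner (R y) (moved y (\<xi> (rng y))) (\<zeta> (src y)))
      + (hnorm (R y) (\<zeta> (src y)))\<^sup>2" for y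
    have "continuous_map (gtop G) euclideanreal N" unfolding N_def
      using continuous_map_compose[OF continuous_rng_units TB.E1.sect_norm[OF \<xi>]]
        continuous_map_compose[OF continuous_dom_units TB.E1.sect_norm[OF \<zeta>(1)]]
        continuous_map_Re[OF rho_inner_continuous[OF \<xi> \<zeta>(1)]]
      by (intro continuous_map_add continuous_map_diff continuous_map_real_pow continuous_map_real_mult) (auto simp: o_def)
    then have o: "openin (gtop G) {y \<in> gelems G. N y \<in> {..<e\<^sup>2}}" by (rule openin_continuous_map_preimage) simp
    have Neq: "N y = (hdist (R y) (moved y (\<xi> (rng y))) (\<zeta> (src y)))\<^sup>2" if y: "y \<in> gelems G" for y
    proof -
      interpret Y: hilbert_space "R y" by (rule fib_hilbert(1)[OF dom_unit[OF y]])
      have z: "\<zeta> (src y) \<in> hcarrier (R y)" using TB.E1.sect_closed[OF \<zeta>(1)] y by (simp add: topspace_unit_space dom_unit)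
      have "\<xi> (rng y) \<in> hcarrier (fib \<rho> (rng y))" using TB.E1.sect_closed[OF \<xi>] y by (simp add: topspace_unit_space rng_unit)
      then have "hnorm (R y) (moved y (\<xi> (rng y))) = hnorm (fib \<rho> (rng y)) (\<xi> (rng y))"
        using rho_inv_inner[OF y] by (simp add: hnorm_def)
      then show ?thesis unfolding N_def Y.norm_minus_sq[OF c[OF y] z] by simp
    qed
    have lt: "N y < e\<^sup>2 \<longleftrightarrow> hdist (R y) (moved y (\<xi> (rng y))) (\<zeta> (src y)) < e" if y: "y \<in> gelems G" for y
    proof -
      interpret Y: hilbert_space "R y" by (rule fib_hilbert(1)[OF dom_unit[OF y]])
      have z: "\<zeta> (src y) \<in> hcarrier (R y)" using TB.E1.sect_closed[OF \<zeta>(1)] y by (simp add: topspace_unit_space dom_unit)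
      show ?thesis unfolding Neq[OF y] using e Y.norm_nonneg[OF Y.minus_closed[OF c[OF y] z]]
        by (auto intro: power_strict_mono power2_less_imp_less)
    qed
    have "x \<in> {y \<in> gelems G. N y \<in> {..<e\<^sup>2}}"
    proof -
      interpret X: hilbert_space "R x" by (rule fib_hilbert(1)[OF dom_unit[OF x]])
      show ?thesis using x lt[OF x] \<zeta>(2) X.norm_minus_commute[OF c[OF x], of "\<zeta> (src x)"] TB.E1.sect_closed[OF \<zeta>(1) ux] by simp
    qed
    then show "\<exists>U. openin (gtop G) U \<and> x \<in> U \<and> (\<exists>\<eta>\<in>(\<lambda>\<xi> x. \<xi> (src x)) ` csect \<rho>. \<forall>v\<in>U.
       hdist (fib \<rho> (src v)) (act \<rho> (inv v) (\<xi> (rng v))) (\<eta> v) < e)"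
      using o lt \<zeta>(1) by (intro exI[of _ "{y \<in> gelems G. N y \<in> {..<e\<^sup>2}}"] conjI bexI[of _ "\<lambda>x. \<zeta> (src x)"]) auto
  qed
  then show ?thesis unfolding pullback_def using c by simp
qed

definition twist :: "('g \<Rightarrow> 'v) \<Rightarrow> ('g \<Rightarrow> 'w) \<Rightarrow> 'g \<Rightarrow> (nat \<Rightarrow> ('v \<times> 'w) \<Rightarrow>\<^sub>0 complex) set" where
  "twist \<xi> f x = ten x (moved x (\<xi> (rng x))) (f x)"

lemma rho_sect_closed: "\<lbrakk>\<xi> \<in> csect \<rho>; u \<in> units G\<rbrakk> \<Longrightarrow> \<xi> u \<in> hcarrier (fib \<rho> u)"
  using TB.E1.sect_closed by (simp add: topspace_unit_space)

lemma ind_closed: "\<lbrakk>f \<in> Pi.\<F>; x \<in> gelems G\<rbrakk> \<Longrightarrow> f x \<in> hcarrier (W x)"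
  using Pi.equivariant_closed[OF _ Pi.invariant_gelems] by (simp add: Pi.ind_functions_iff)

lemma ind_closed_\<tau>: "\<lbrakk>f \<in> Tau.\<F>; x \<in> gelems G\<rbrakk> \<Longrightarrow> f x \<in> hcarrier (\<T> x)"
  using Tau.equivariant_closed[OF _ Tau.invariant_gelems] by (simp add: Tau.ind_functions_iff)

lemma dom_pair: "x \<in> gelems G \<Longrightarrow> hilbert_pair (R x) (W x)" by (rule fib_pair[OF dom_unit])

lemma twist_ind:
  assumes \<xi>: "\<xi> \<in> csect \<rho>" and f: "f \<in> Pi.\<F>"
  shows "twist \<xi> f \<in> Tau.\<F>"
proof -
  have fe: "Pi.equivariant_on (gelems G) f" using f by (simp add: Pi.ind_functions_iff)
  have fs: "f \<in> csect (pullback (gtop G) src \<pi>)" using fe by (simp add: Pi.equivariant_on_def subtopology_topspace)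
  have "twist \<xi> f \<in> csect (pullback (gtop G) src \<tau>)"
    using TB.pullback_tensor[OF continuous_dom_units rho_section[OF \<xi>] fs] by (simp add: twist_def[abs_def])
  moreover obtain A where A: "compactin (gtop G) A" "\<forall>x\<in>gelems G. f x \<noteq> hzero (W x) \<longrightarrow> q x \<in> q ` A"
    using fe unfolding Pi.equivariant_on_def by blast
  moreover have "f x \<noteq> hzero (W x)" if x: "x \<in> gelems G" and nz: "twist \<xi> f x \<noteq> hzero (\<T> x)" for x
  proof
    assume z: "f x = hzero (W x)"
    interpret hp: hilbert_pair "R x" "W x" by (rule dom_pair[OF x])
    have a: "moved x (\<xi> (rng x)) \<in> hcarrier (R x)" by (rule rho_inv_closed[OF x rho_sect_closed[OF \<xi> rng_unit[OF x]]])
    have "twist \<xi> f x = hzero (\<T> x)" unfolding fib_\<tau> twist_def z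
      by (rule hp.T.norm_eq_zero) (simp_all add: hp.tensor_vec_closed hp.tensor_norm a hp.W.zero_closed hp.W.norm_zero)
    then show False using nz by simp
  qed
  moreover have "twist \<xi> f (mul x h) = act \<tau> (inv h) (twist \<xi> f x)" if x: "x \<in> gelems G" and h: "h \<in> H" "src x = rng h" for x h
  proof -
    have hG: "h \<in> gelems G" "inv h \<in> H" "inv h \<in> gelems G" using H_elem H_inv h by auto
    have kd: "src (inv h) = src x" "rng (inv h) = src h" using hG h by (simp_all add: dom_inv rng_inv)
    have xh: "src (mul x h) = src h" "rng (mul x h) = rng x" using x h hG dom_mul rng_mul by (auto simp: composable_iff)
    have xi: "\<xi> (rng x) \<in> hcarrier (fib \<rho> (rng x))" by (rule rho_sect_closed[OF \<xi> rng_unit[OF x]])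
    have "act \<rho> (inv (mul x h)) (\<xi> (rng x)) = act \<rho> (inv h) (moved x (\<xi> (rng x)))"
      using rho_mul[of "inv h" "inv x" "\<xi> (rng x)"] inv_mul_distrib[OF x hG(1) h(2)] x hG xi kd
      by (simp add: inv_closed rng_inv dom_inv)
    moreover have "f (mul x h) = act \<pi> (inv h) (f x)" using fe x h by (simp add: Pi.equivariant_on_def)
    moreover have "act \<tau> (inv h) (twist \<xi> f x) = tensor_vec (fib \<rho> (src h)) (fib \<pi> (src h))
        (act \<rho> (inv h) (moved x (\<xi> (rng x)))) (act \<pi> (inv h) (f x))"
      unfolding twist_def using tau_act(2)[OF hG(2), unfolded kd, OF rho_inv_closed[OF x xi] ind_closed[OF f x]] .
    ultimately show ?thesis by (simp add: twist_def xh)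
  qed
  ultimately show ?thesis unfolding Tau.ind_functions_iff Tau.equivariant_on_def subtopology_topspace by blast
qed

text \<open>The contraction of an equivariant function with values in the tensor product by a section of
  \<open>\<rho>\<close>; it is adjoint to twisting.\<close>

lemma contraction:
  assumes K: "K \<in> Tau.\<F>" and \<xi>: "\<xi> \<in> csect \<rho>"
  obtains f where "f \<in> Pi.\<F>" "\<And>x w. \<lbrakk>x \<in> gelems G; w \<in> hcarrier (W x)\<rbrakk> \<Longrightarrow>
     hinner (W x) (f x) w = hinner (\<T> x) (K x) (ten x (moved x (\<xi> (rng x))) w)"
    "\<And>x. \<lbrakk>x \<in> gelems G; K x = hzero (\<T> x)\<rbrakk> \<Longrightarrow> f x = hzero (W x)"
proof -
  have Ke: "Tau.equivariant_on (gelems G) K" using K by (simp add: Tau.ind_functions_iff)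
  have Ks: "K \<in> csect (pullback (gtop G) src \<tau>)" using Ke by (simp add: Tau.equivariant_on_def subtopology_topspace)
  obtain f where f: "f \<in> csect (pullback (gtop G) src \<pi>)" "\<And>x w. \<lbrakk>x \<in> gelems G; w \<in> hcarrier (W x)\<rbrakk> \<Longrightarrow>
     hinner (W x) (f x) w = hinner (\<T> x) (K x) (ten x (moved x (\<xi> (rng x))) w)"
    using TB.pullback_contraction[OF continuous_dom_units Ks rho_section[OF \<xi>]] by metis
  interpret P: hilbert_bundle "gtop G" "pullback (gtop G) src \<pi>" by (rule TB.E2.hilbert_bundle_pullback[OF continuous_dom_units])
  have fc: "f x \<in> hcarrier (W x)" if "x \<in> gelems G" for x using P.sect_closed[OF f(1) that] by simp
  have xc: "moved x (\<xi> (rng x)) \<in> hcarrier (R x)" if "x \<in> gelems G" for x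
    by (rule rho_inv_closed[OF that rho_sect_closed[OF \<xi> rng_unit[OF that]]])
  have zero: "f x = hzero (W x)" if x: "x \<in> gelems G" and Kx: "K x = hzero (\<T> x)" for x
  proof -
    interpret hp: hilbert_pair "R x" "W x" by (rule dom_pair[OF x])
    have "hinner (W x) (f x) (f x) = 0"
      unfolding f(2)[OF x fc[OF x]] Kx fib_\<tau> by (rule hp.T.inner_zero[OF hp.tensor_vec_closed[OF xc[OF x] fc[OF x]]])
    then show ?thesis by (intro hp.W.norm_eq_zero fc x) (simp add: hnorm_def)
  qed
  obtain A where A: "compactin (gtop G) A" "\<forall>x\<in>gelems G. K x \<noteq> hzero (\<T> x) \<longrightarrow> q x \<in> q ` A"
    using Ke unfolding Tau.equivariant_on_def by blast
  have eq: "f (mul x h) = act \<pi> (inv h) (f x)" if x: "x \<in> gelems G" and h: "h \<in> H" "src x = rng h" for x h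
  proof -
    have hG: "h \<in> gelems G" "inv h \<in> H" "inv h \<in> gelems G" using H_elem H_inv h by auto
    have kd: "src (inv h) = src x" "rng (inv h) = src h" using hG h by (simp_all add: dom_inv rng_inv)
    have xh: "mul x h \<in> gelems G" "src (mul x h) = src h" "rng (mul x h) = rng x"
      using x h hG mul_closed dom_mul rng_mul by (auto simp: composable_iff)
    have xi: "\<xi> (rng x) \<in> hcarrier (fib \<rho> (rng x))" by (rule rho_sect_closed[OF \<xi> rng_unit[OF x]])
    interpret hp: hilbert_pair "fib \<rho> (src h)" "fib \<pi> (src h)" by (rule dom_pair[OF hG(1)])
    interpret hx: hilbert_pair "R x" "W x" by (rule dom_pair[OF x])
    let ?U = "act \<pi> (inv h)"
    have uU: "unitary (W x) (fib \<pi> (src h)) ?U" using pi_unitary[OF hG(2)] by (simp add: kd)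
    have U: "?U v \<in> hcarrier (fib \<pi> (src h))" "hinner (fib \<pi> (src h)) (?U v) (?U w) = hinner (W x) v w"
      if "v \<in> hcarrier (W x)" "w \<in> hcarrier (W x)" for v w
      using unitary_inner_preserving[OF uU] that by (auto simp: inner_preserving_def)
    have a1: "act \<rho> (inv (mul x h)) (\<xi> (rng x)) = act \<rho> (inv h) (moved x (\<xi> (rng x)))"
      using rho_mul[of "inv h" "inv x" "\<xi> (rng x)"] inv_mul_distrib[OF x hG(1) h(2)] x hG xi kd
      by (simp add: inv_closed rng_inv dom_inv)
    have c: "f (mul x h) \<in> hcarrier (fib \<pi> (src h))" using fc[OF xh(1)] xh by simp
    have "hdist (fib \<pi> (src h)) (f (mul x h)) (?U (f x)) \<le> 0"
    proof (rule hp.W.norm_le_if_weak[OF c U(1)[OF fc[OF x] fc[OF x]] order_refl])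
      fix w assume w: "w \<in> hcarrier (fib \<pi> (src h))"
      have "w \<in> ?U ` hcarrier (W x)" using uU w by (simp add: unitary_def bij_betw_def)
      then obtain w' where w': "w' \<in> hcarrier (W x)" "w = ?U w'" by blast
      have "hinner (fib \<pi> (src h)) (f (mul x h)) w = hinner (fib \<tau> (src h)) (K (mul x h))
         (tensor_vec (fib \<rho> (src h)) (fib \<pi> (src h)) (act \<rho> (inv h) (moved x (\<xi> (rng x)))) (?U w'))"
        using f(2)[OF xh(1)] w by (simp add: xh a1 w'(2))
      also have "\<dots> = hinner (fib \<tau> (src h)) (act \<tau> (inv h) (K x)) (act \<tau> (inv h) (ten x (moved x (\<xi> (rng x))) w'))"
        using tau_act(2)[OF hG(2), unfolded kd, OF xc[OF x] w'(1)] Ke x h by (simp add: Tau.equivariant_on_def)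
      also have "\<dots> = hinner (\<T> x) (K x) (ten x (moved x (\<xi> (rng x))) w')"
        using tau_act(1)[OF hG(2), unfolded kd] ind_closed_\<tau>[OF K x] hx.tensor_vec_closed[OF xc[OF x] w'(1)]
        by (simp add: inner_preserving_def fib_\<tau>)
      also have "\<dots> = hinner (W x) (f x) w'" using f(2)[OF x w'(1)] by simp
      also have "\<dots> = hinner (fib \<pi> (src h)) (?U (f x)) w" using U(2)[OF fc[OF x] w'(1)] w'(2) by simp
      finally show "cmod (hinner (fib \<pi> (src h)) (f (mul x h)) w - hinner (fib \<pi> (src h)) (?U (f x)) w)
          \<le> 0 * hnorm (fib \<pi> (src h)) w" by simp
    qed
    then show ?thesis using hp.W.eq_if_norm_minus[OF c U(1)[OF fc[OF x] fc[OF x]]]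
        hp.W.norm_nonneg[OF hp.W.minus_closed[OF c U(1)[OF fc[OF x] fc[OF x]]]] by simp
  qed
  have "f \<in> Pi.\<F>" unfolding Pi.ind_functions_iff Pi.equivariant_on_def subtopology_topspace using f(1) A zero eq by blast
  then show ?thesis using that f(2) zero by blast
qed

lemma twist_inner:
  assumes "\<xi> \<in> csect \<rho>" "\<eta> \<in> csect \<rho>" "f \<in> Pi.\<F>" "g \<in> Pi.\<F>" "x \<in> gelems G"
  shows "hinner (\<T> x) (twist \<xi> f x) (twist \<eta> g x) = hinner (fib \<rho> (rng x)) (\<xi> (rng x)) (\<eta> (rng x)) * hinner (W x) (f x) (g x)"
proof -
  interpret hp: hilbert_pair "R x" "W x" by (rule dom_pair[OF assms(5)])
  have c: "\<xi> (rng x) \<in> hcarrier (fib \<rho> (rng x))" "\<eta> (rng x) \<in> hcarrier (fib \<rho> (rng x))"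
    using rho_sect_closed rng_unit assms by auto
  show ?thesis unfolding twist_def fib_\<tau> using c assms by (simp add: hp.tensor_inner rho_inv_closed ind_closed rho_inv_inner)
qed

lemma ind_inner_scaled:
  assumes u: "u \<in> units G" and eq: "\<And>y. y \<in> range_fiber G u \<Longrightarrow> hinner (\<T> y) (F y) (F' y) = c * hinner (W y) (f y) (f' y)"
  shows "Tau.ip u F F' = c * Pi.ip u f f'"
proof -
  have "(LINT \<omega>:Pi.fiber u|\<mu> u. Tau.pairing F F' \<omega>) = (LINT \<omega>:Pi.fiber u|\<mu> u. c * Pi.pairing f f' \<omega>)"
  proof (rule set_lebesgue_integral_cong[OF Pi.fiber_measurable[OF u]], intro allI impI)
    fix \<omega> assume "\<omega> \<in> Pi.fiber u"
    then have "some_elem \<omega> \<in> range_fiber G u" using Q_elem[of \<omega>] by (auto simp: range_fiber_def quot_rng_def)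
    then show "Tau.pairing F F' \<omega> = c * Pi.pairing f f' \<omega>" using eq by (simp add: Tau.pairing_def Pi.pairing_def)
  qed
  then show ?thesis by (simp add: Tau.ind_inner_pairing Pi.ind_inner_pairing)
qed

lemma twist_gram:
  assumes "\<xi> \<in> csect \<rho>" "\<eta> \<in> csect \<rho>" "f \<in> Pi.\<F>" "g \<in> Pi.\<F>" "u \<in> units G"
  shows "Tau.ip u (twist \<xi> f) (twist \<eta> g) = hinner (fib \<rho> u) (\<xi> u) (\<eta> u) * Pi.ip u f g"
  by (rule ind_inner_scaled[OF assms(5)]) (use twist_inner[OF assms(1-4)] in \<open>simp add: range_fiber_def\<close>)

end

section \<open>Continuous sections of the induced bundle\<close>

lemma section_span_rel:
  assumes "\<xi> \<in> section_span F S"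
    and "\<And>s. s \<in> S \<Longrightarrow> \<exists>t\<in>section_span F' S'. R s t"
    and "R (\<lambda>u. hzero (F u)) (\<lambda>u. hzero (F' u))"
    and "\<And>s t s' t'. \<lbrakk>R s t; R s' t'\<rbrakk> \<Longrightarrow> R (\<lambda>u. hadd (F u) (s u) (s' u)) (\<lambda>u. hadd (F' u) (t u) (t' u))"
    and "\<And>s t a. R s t \<Longrightarrow> R (\<lambda>u. hscale (F u) a (s u)) (\<lambda>u. hscale (F' u) a (t u))"
  shows "\<exists>t\<in>section_span F' S'. R \<xi> t"
  using assms(1)
proof induction
  case span_zero
  show ?case using assms(3) section_span.span_zero by blast
next
  case (span_base s)
  then show ?case by (rule assms(2))
next
  case (span_add s s')
  then show ?case using assms(4) section_span.span_add by blast
next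
  case (span_scale s a)
  then show ?case using assms(5) section_span.span_scale by blast
qed

context hilbert_family
begin

lemma la_subst:
  assumes la: "locally_approximable B F S \<xi>" and sub: "\<And>s. s \<in> S \<Longrightarrow> \<exists>t\<in>T. \<forall>u\<in>topspace B. s u = t u"
  shows "locally_approximable B F T \<xi>"
  unfolding locally_approximable_def
proof (intro ballI allI impI)
  fix u and e :: real assume "u \<in> topspace B" "0 < e"
  from la[unfolded locally_approximable_def, rule_format, OF this]
  obtain U s where U: "openin B U" "u \<in> U" "s \<in> S" "\<forall>v\<in>U. hdist (F v) (\<xi> v) (s v) < e" by blast
  moreover obtain t where "t \<in> T" "\<forall>u\<in>topspace B. s u = t u" using sub[OF U(3)] by blast
  ultimately show "\<exists>U. openin B U \<and> u \<in> U \<and> (\<exists>\<eta>\<in>T. \<forall>v\<in>U. hdist (F v) (\<xi> v) (\<eta> v) < e)"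
    using openin_subset[OF U(1)] by (intro exI[of _ U] conjI bexI[of _ t]) (auto simp: subset_iff)
qed

lemma la_span:
  assumes S: "S \<subseteq> (\<Pi> u\<in>topspace B. hcarrier (F u))" and T: "T \<subseteq> (\<Pi> u\<in>topspace B. hcarrier (F u))"
    and la: "\<And>t. t \<in> T \<Longrightarrow> locally_approximable B F (section_span F S) t"
    and \<xi>: "\<xi> \<in> (\<Pi> u\<in>topspace B. hcarrier (F u))" "locally_approximable B F (section_span F T) \<xi>"
  shows "locally_approximable B F (section_span F S) \<xi>"
proof (rule la_trans[OF \<xi> section_span_closed[OF S]])
  note c = section_span_closed[OF S]
  fix t assume t: "t \<in> section_span F T"
  then have "locally_approximable B F (section_span F S) t"
  proof induction
    case span_zero
    show ?case by (rule la_self) (auto intro: section_span.span_zero fam_closed)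
  next
    case (span_base t)
    then show ?case by (rule la)
  next
    case (span_add s t)
    then show ?case using section_span_closed[OF T] by (intro la_add[OF c]) (auto intro: section_span.span_add)
  next
    case (span_scale s a)
    then show ?case using section_span_closed[OF T] by (intro la_scale[OF c]) (auto intro: section_span.span_scale)
  qed
  then show "t \<in> (\<Pi> u\<in>topspace B. hcarrier (F u)) \<and> locally_approximable B F (section_span F S) t"
    using section_span_closed[OF T] t by blast
qed

end

context induced
begin

abbreviation "fiber_space \<equiv> ind_fiber G H \<mu> \<sigma>"
abbreviation "sec \<equiv> ind_section G H \<mu> \<sigma>"

lemma fiber_space_hilbert: "u \<in> units G \<Longrightarrow> hilbert_space (fiber_space u)"
  unfolding ind_fiber_def by (rule semi_inner_space.hilbert_space_completion[OF semi_inner_space_prefiber])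

lemma sec_closed: "\<lbrakk>u \<in> units G; f \<in> \<F>\<rbrakk> \<Longrightarrow> sec f u \<in> hcarrier (fiber_space u)" unfolding ind_fiber_def ind_section_def
  by (rule semi_inner_space.embed_closed[OF semi_inner_space_prefiber]) (auto simp: prefiber_simps)

lemma sec_inner:
  assumes "u \<in> units G" "f \<in> \<F>" "g \<in> \<F>"
  shows "hinner (fiber_space u) (sec f u) (sec g u) = ip u f g"
proof -
  have "hinner (fiber_space u) (sec f u) (sec g u) = ip u (res u f) (res u g)"
    using semi_inner_space.embed_inner[OF semi_inner_space_prefiber[OF assms(1)]] assms
    unfolding ind_fiber_def ind_section_def by (auto simp: prefiber_simps)
  also have "\<dots> = ip u f g" by (rule ind_inner_cong[OF assms(1)]) simp
  finally show ?thesis .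
qed

lemma sec_ops:
  assumes "u \<in> units G"
  shows "sec (\<lambda>x. hzero (E x)) u = hzero (fiber_space u)"
    and "\<lbrakk>f \<in> \<F>; g \<in> \<F>\<rbrakk> \<Longrightarrow> sec (\<lambda>x. hadd (E x) (f x) (g x)) u = hadd (fiber_space u) (sec f u) (sec g u)"
    and "f \<in> \<F> \<Longrightarrow> sec (\<lambda>x. hscale (E x) a (f x)) u = hscale (fiber_space u) a (sec f u)"
    and "\<lbrakk>f \<in> \<F>; g \<in> \<F>\<rbrakk> \<Longrightarrow> sec (\<lambda>x. hminus (E x) (f x) (g x)) u = hminus (fiber_space u) (sec f u) (sec g u)"
proof -
  interpret P: semi_inner_space "prefiber u" by (rule semi_inner_space_prefiber[OF assms])
  have c: "f \<in> \<F> \<Longrightarrow> res u f \<in> hcarrier (prefiber u)" for f by (simp add: prefiber_simps)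
  show "sec (\<lambda>x. hzero (E x)) u = hzero (fiber_space u)"
    unfolding ind_section_def ind_fiber_def restrict_ops by (rule P.embed_zero)
  show "\<lbrakk>f \<in> \<F>; g \<in> \<F>\<rbrakk> \<Longrightarrow> sec (\<lambda>x. hadd (E x) (f x) (g x)) u = hadd (fiber_space u) (sec f u) (sec g u)"
    unfolding ind_section_def ind_fiber_def restrict_ops by (intro P.embed_add c)
  show "f \<in> \<F> \<Longrightarrow> sec (\<lambda>x. hscale (E x) a (f x)) u = hscale (fiber_space u) a (sec f u)"
    unfolding ind_section_def ind_fiber_def restrict_ops by (intro P.embed_scale c)
  show "\<lbrakk>f \<in> \<F>; g \<in> \<F>\<rbrakk> \<Longrightarrow> sec (\<lambda>x. hminus (E x) (f x) (g x)) u = hminus (fiber_space u) (sec f u) (sec g u)"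
    unfolding ind_section_def ind_fiber_def restrict_ops by (intro P.embed_minus c)
qed

lemma sec_dense:
  assumes "u \<in> units G" "v \<in> hcarrier (fiber_space u)" "0 < e"
  shows "\<exists>f\<in>\<F>. hdist (fiber_space u) v (sec f u) < e"
proof -
  interpret P: semi_inner_space "prefiber u" by (rule semi_inner_space_prefiber[OF assms(1)])
  obtain w where "w \<in> hcarrier (prefiber u)" "hdist (fiber_space u) v (completion_embed (prefiber u) w) < e"
    using P.embed_dense[of v e] assms unfolding ind_fiber_def by blast
  then show ?thesis by (auto simp: prefiber_simps ind_section_def)
qed

lemma sec_norm_continuous:
  assumes "f \<in> \<F>" "g \<in> \<F>"
  shows "continuous_map (unit_space G) euclideanreal (\<lambda>u. hdist (fiber_space u) (sec f u) (sec g u))"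
proof -
  let ?d = "\<lambda>x. hminus (E x) (f x) (g x)"
  have d: "?d \<in> \<F>" by (rule ind_minus[OF assms])
  have "continuous_map (unit_space G) euclideanreal (\<lambda>u. sqrt (Re (ip u ?d ?d)))"
    using continuous_map_compose[OF continuous_map_Re[OF ind_inner_continuous(1)[OF d d]], of euclideanreal sqrt]
    by (simp add: o_def continuous_on_real_sqrt continuous_on_id)
  then show ?thesis by (rule continuous_map_eq) (simp add: topspace_unit_space sec_ops(4)[symmetric] assms hnorm_def sec_inner d)
qed

lemma fiber_family: "hilbert_family (unit_space G) fiber_space"
  by (rule hilbert_family.intro) (simp add: topspace_unit_space fiber_space_hilbert)

lemma section_span_sec:
  assumes S: "S \<subseteq> \<F>"
  shows "\<zeta> \<in> section_span fiber_space (sec ` S) \<Longrightarrow> \<exists>f\<in>section_span E S. f \<in> \<F> \<and> (\<forall>u\<in>units G. \<zeta> u = sec f u)"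
    and "f \<in> section_span E S \<Longrightarrow> \<exists>\<zeta>\<in>section_span fiber_space (sec ` S). f \<in> \<F> \<and> (\<forall>u\<in>units G. \<zeta> u = sec f u)"
proof -
  assume "\<zeta> \<in> section_span fiber_space (sec ` S)"
  then show "\<exists>f\<in>section_span E S. f \<in> \<F> \<and> (\<forall>u\<in>units G. \<zeta> u = sec f u)"
    by (rule section_span_rel) (use S in \<open>auto intro: section_span.span_base simp: sec_ops ind_zero ind_add ind_scale\<close>)
next
  assume "f \<in> section_span E S"
  then show "\<exists>\<zeta>\<in>section_span fiber_space (sec ` S). f \<in> \<F> \<and> (\<forall>u\<in>units G. \<zeta> u = sec f u)"
    by (rule section_span_rel[where R = "\<lambda>f \<zeta>. f \<in> \<F> \<and> (\<forall>u\<in>units G. \<zeta> u = sec f u)"])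
      (use S in \<open>auto intro!: bexI[OF _ section_span.span_base] simp: sec_ops ind_zero ind_add ind_scale\<close>)
qed

lemma ind_csect_iff: "\<xi> \<in> csect (ind_rep G H \<mu> \<sigma>) \<longleftrightarrow> \<xi> \<in> (\<Pi> u\<in>units G. hcarrier (fiber_space u)) \<and>
     locally_approximable (unit_space G) fiber_space (sec ` \<F>) \<xi>"
proof -
  let ?S = "sec ` \<F>" and ?M = "ind_module G H \<mu> \<sigma>"
  interpret hilbert_family "unit_space G" fiber_space by (rule fiber_family)
  note tu = topspace_unit_space
  have Sc: "?S \<subseteq> (\<Pi> u\<in>topspace (unit_space G). hcarrier (fiber_space u))" using sec_closed by (auto simp: tu)
  have Mc: "?M \<subseteq> (\<Pi> u\<in>topspace (unit_space G). hcarrier (fiber_space u))" by (auto simp: tu ind_module_def)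
  have SM: "?S \<subseteq> section_span fiber_space ?M"
  proof
    fix s assume "s \<in> ?S"
    then obtain f where f: "f \<in> \<F>" "s = sec f" by blast
    have "s \<in> ?M" unfolding ind_module_def f(2) using f(1) sec_closed by (auto intro!: bexI[of _ f] simp: fam_norm tu)
    then show "s \<in> section_span fiber_space ?M" by (rule section_span.span_base)
  qed
  have la: "locally_approximable (unit_space G) fiber_space (section_span fiber_space ?S) m" if m: "m \<in> ?M" for m
    unfolding locally_approximable_def
  proof (intro ballI allI impI)
    fix u and e :: real assume "u \<in> topspace (unit_space G)" "0 < e"
    then obtain f where f: "f \<in> \<F>" "\<forall>u\<in>units G. hdist (fiber_space u) (m u) (sec f u) \<le> e / 2"
      using m unfolding ind_module_def by (auto dest!: spec[of _ "e / 2"])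
    have "hdist (fiber_space v) (m v) (sec f v) < e" if "v \<in> topspace (unit_space G)" for v
      using f(2)[rule_format, of v] that \<open>0 < e\<close> by (simp add: tu)
    then show "\<exists>U. openin (unit_space G) U \<and> u \<in> U \<and> (\<exists>\<eta>\<in>section_span fiber_space ?S. \<forall>v\<in>U. hdist (fiber_space v) (m v) (\<eta> v) < e)"
      using \<open>u \<in> topspace (unit_space G)\<close> f(1)
      by (intro exI[of _ "topspace (unit_space G)"] conjI bexI[of _ "sec f"]) (auto intro: section_span.span_base)
  qed
  have sec: "\<exists>t\<in>?S. \<forall>u\<in>topspace (unit_space G). s u = t u" if "s \<in> section_span fiber_space ?S" for s
    using section_span_sec(1)[OF subset_refl that] by (auto simp: tu)
  have "locally_approximable (unit_space G) fiber_space (section_span fiber_space ?M) \<xi>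
      \<longleftrightarrow> locally_approximable (unit_space G) fiber_space ?S \<xi>"
    if \<xi>: "\<xi> \<in> (\<Pi> u\<in>topspace (unit_space G). hcarrier (fiber_space u))"
  proof
    assume *: "locally_approximable (unit_space G) fiber_space (section_span fiber_space ?M) \<xi>"
    have "locally_approximable (unit_space G) fiber_space (section_span fiber_space ?S) \<xi>"
      by (rule la_span[OF Sc Mc _ \<xi> *]) (rule la)
    then show "locally_approximable (unit_space G) fiber_space ?S \<xi>" by (rule la_subst) (rule sec)
  next
    assume "locally_approximable (unit_space G) fiber_space ?S \<xi>"
    then show "locally_approximable (unit_space G) fiber_space (section_span fiber_space ?M) \<xi>"
      by (rule la_subst) (use SM in auto)
  qed
  then show ?thesis by (auto simp: ind_rep_def generated_sections_def tu)
qed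

end

lemma (in hilbert_pair) tensor_vec_add:
  assumes "v \<in> hcarrier V" "v' \<in> hcarrier V" "w \<in> hcarrier W"
  shows "tensor_vec V W (hadd V v v') w = hadd (tensor V W) (tensor_vec V W v w) (tensor_vec V W v' w)"
  by (rule T.eq_if_inner_total[OF tensor_total])
    (use assms in \<open>auto simp: tensor_vec_closed T.closed V.closed T.inner_simps tensor_inner V.inner_simps algebra_simps\<close>)

lemma (in hilbert_pair) tensor_vec_scale:
  assumes "v \<in> hcarrier V" "w \<in> hcarrier W"
  shows "tensor_vec V W (hscale V a v) w = hscale (tensor V W) a (tensor_vec V W v w)"
  by (rule T.eq_if_inner_total[OF tensor_total])
    (use assms in \<open>auto simp: tensor_vec_closed T.closed V.closed T.inner_simps tensor_inner V.inner_simps\<close>)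

lemma (in hilbert_pair) tensor_vec_zero:
  assumes "w \<in> hcarrier W"
  shows "tensor_vec V W (hzero V) w = hzero (tensor V W)"
  using assms by (intro T.norm_eq_zero) (simp_all add: tensor_vec_closed V.closed tensor_norm V.norm_zero)

context rep_pair
begin

definition slots :: "'v set \<Rightarrow> 'g \<Rightarrow> (nat \<Rightarrow> ('v \<times> 'w) \<Rightarrow>\<^sub>0 complex) set set" where
  "slots A x = {ten x (moved x v) w | v w. v \<in> A \<and> w \<in> hcarrier (W x)}"

lemma slots_closed:
  assumes "x \<in> gelems G" "A \<subseteq> hcarrier (fib \<rho> (rng x))"
  shows "slots A x \<subseteq> hcarrier (\<T> x)"
  using assms unfolding slots_def fib_\<tau> by (auto intro!: hilbert_pair.tensor_vec_closed[OF dom_pair] rho_inv_closed)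

lemma slots_hspan:
  assumes x: "x \<in> gelems G" and E: "E \<subseteq> hcarrier (fib \<rho> (rng x))" and A: "A \<subseteq> hspan (fib \<rho> (rng x)) E"
  shows "slots A x \<subseteq> hspan (\<T> x) (slots E x)"
proof -
  interpret hp: hilbert_pair "R x" "W x" by (rule dom_pair[OF x])
  interpret R: hilbert_space "fib \<rho> (rng x)" by (rule fib_hilbert(1)[OF rng_unit[OF x]])
  have lin: "moved x (hadd (fib \<rho> (rng x)) v w) = hadd (R x) (moved x v) (moved x w)"
    "moved x (hscale (fib \<rho> (rng x)) a v) = hscale (R x) a (moved x v)"
    "moved x (hzero (fib \<rho> (rng x))) = hzero (R x)"
    if "v \<in> hcarrier (fib \<rho> (rng x))" "w \<in> hcarrier (fib \<rho> (rng x))" for v w a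
    using inner_preserving_linear[OF hilbert_imp_semi_inner[OF fib_hilbert(1)[OF rng_unit[OF x]]] fib_hilbert(1)[OF dom_unit[OF x]], of "moved x"]
      rho_preserving[OF inv_closed[OF x]] that by (auto simp: dom_inv[OF x] rng_inv[OF x])
  have "ten x (moved x v) w \<in> hspan (\<T> x) (slots E x)" if w: "w \<in> hcarrier (W x)" and v: "v \<in> hspan (fib \<rho> (rng x)) E" for v w
    using v
  proof induction
    case zero
    then show ?case using w lin R.zero_closed by (simp add: hp.tensor_vec_zero fib_\<tau> hspan.zero)
  next
    case (base s)
    then show ?case using w by (intro hspan.base) (auto simp: slots_def)
  next
    case (add v v')
    then show ?case using w lin rho_inv_closed[OF x] R.hspan_closed[OF E] by (simp add: hp.tensor_vec_add fib_\<tau> hspan.add)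
  next
    case (scale v a)
    then show ?case using w lin(2)[OF _ R.zero_closed] rho_inv_closed[OF x] R.hspan_closed[OF E]
      by (simp add: hp.tensor_vec_scale fib_\<tau> hspan.scale)
  qed
  then show ?thesis using A by (auto simp: slots_def)
qed

abbreviation "target \<equiv> Tau.fiber_space"
abbreviation "sect_values A u \<equiv> (\<lambda>\<xi>. \<xi> u) ` A"

lemma moved_sections_dense:
  assumes x: "x \<in> gelems G" and v: "v \<in> hcarrier (R x)" and e: "0 < e"
  shows "\<exists>\<xi>\<in>csect \<rho>. hdist (R x) v (moved x (\<xi> (rng x))) < e"
proof -
  interpret R: hilbert_space "fib \<rho> (rng x)" by (rule fib_hilbert(1)[OF rng_unit[OF x]])
  obtain \<xi> where \<xi>: "\<xi> \<in> csect \<rho>" "hdist (fib \<rho> (rng x)) (\<xi> (rng x)) (act \<rho> x v) < e"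
    using TB.E1.sect_dense[of "rng x" "act \<rho> x v" e] rho_closed[OF x v] e rng_unit[OF x] by (auto simp: topspace_unit_space)
  note c = rho_sect_closed[OF \<xi>(1) rng_unit[OF x]] rho_closed[OF x v]
  have "inner_preserving (fib \<rho> (rng x)) (R x) (moved x)"
    using rho_preserving[OF inv_closed[OF x]] by (simp add: dom_inv rng_inv x)
  from inner_preserving_norm[OF hilbert_imp_semi_inner[OF fib_hilbert(1)[OF rng_unit[OF x]]] hilbert_imp_semi_inner[OF fib_hilbert(1)[OF dom_unit[OF x]]] this c(2,1)]
  show ?thesis using \<xi> R.norm_minus_commute[OF c] rho_inv_rho[OF x v] by (intro bexI[OF _ \<xi>(1)]) simp
qed

text \<open>Near every point, \<open>K\<close> is approximated by finite sums of products of moved sections of \<open>\<rho>\<close>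
  with vectors of \<open>\<pi>\<close>, because such products are total in the fiber.\<close>

lemma local_slots:
  assumes K: "K \<in> Tau.\<F>" and x: "x \<in> gelems G" and e: "0 < e"
  shows "\<exists>A U. finite A \<and> A \<subseteq> csect \<rho> \<and> openin (gtop G) U \<and> x \<in> U \<and>
    (\<forall>y\<in>U. \<exists>t\<in>hspan (\<T> y) (slots (sect_values A (rng y)) y). hdist (\<T> y) (K y) t < e)"
proof -
  let ?A = "{moved x (\<xi> (rng x)) | \<xi>. \<xi> \<in> csect \<rho>}" and ?B = "sect_values (csect \<pi>) (src x)"
  define gens where "gens = {(\<lambda>y. ten y (moved y (\<xi> (rng y))) (\<eta> (src y))) | \<xi> \<eta>. \<xi> \<in> csect \<rho> \<and> \<eta> \<in> csect \<pi>}"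
  interpret hp: hilbert_pair "R x" "W x" by (rule dom_pair[OF x])
  interpret P: hilbert_bundle "gtop G" "pullback (gtop G) src \<tau>" by (rule TB.T.hilbert_bundle_pullback[OF continuous_dom_units])
  have ux: "src x \<in> topspace (unit_space G)" by (simp add: topspace_unit_space dom_unit x)
  have Ks: "K \<in> csect (pullback (gtop G) src \<tau>)" using K by (simp add: Tau.ind_functions_iff Tau.equivariant_on_def subtopology_topspace)
  have "total (tensor (R x) (W x)) {ten x a b | a b. a \<in> ?A \<and> b \<in> ?B}"
  proof (rule hp.tensor_total_dense)
    show "?A \<subseteq> hcarrier (R x)" using rho_inv_closed[OF x rho_sect_closed[OF _ rng_unit[OF x]]] by blast
    show "?B \<subseteq> hcarrier (W x)" using TB.E2.sect_closed[OF _ ux] by blast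
    show "\<exists>a\<in>?A. hdist (R x) v a < e" if "v \<in> hcarrier (R x)" "0 < e" for v e using moved_sections_dense[OF x that] by blast
    show "\<exists>b\<in>?B. hdist (W x) w b < e" if "w \<in> hcarrier (W x)" "0 < e" for w e by (rule TB.E2.values_dense[OF ux that])
  qed
  then obtain s where s: "s \<in> hspan (\<T> x) {ten x a b | a b. a \<in> ?A \<and> b \<in> ?B}" "hdist (\<T> x) (K x) s < e"
    using ind_closed_\<tau>[OF K x] e unfolding total_def fib_\<tau> by blast
  have "{ten x a b | a b. a \<in> ?A \<and> b \<in> ?B} \<subseteq> {s x | s. s \<in> gens}"
  proof clarify
    fix \<xi> \<eta> assume "\<xi> \<in> csect \<rho>" "\<eta> \<in> csect \<pi>"
    then have "(\<lambda>y. ten y (moved y (\<xi> (rng y))) (\<eta> (src y))) \<in> gens" unfolding gens_def by blast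
    then show "\<exists>s. ten x (moved x (\<xi> (rng x))) (\<eta> (src x)) = s x \<and> s \<in> gens" by (intro exI conjI) auto
  qed
  from hspan_mono[OF this] have "s \<in> hspan (\<T> x) {s x | s. s \<in> gens}" using s(1) by (rule subsetD)
  from P.section_span_hspan[unfolded fib_pullback', of s x gens, OF this] obtain \<zeta> where \<zeta>: "\<zeta> \<in> section_span \<T> gens" "\<zeta> x = s" by blast
  have "\<zeta> \<in> csect (pullback (gtop G) src \<tau>)" using \<zeta>(1)
  proof induction
    case (span_base \<xi>)
    then obtain \<xi>' \<eta> where "\<xi>' \<in> csect \<rho>" "\<eta> \<in> csect \<pi>" "\<xi> = (\<lambda>y. ten y (moved y (\<xi>' (rng y))) (\<eta> (src y)))"
      unfolding gens_def by blast
    then show ?case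
      using TB.pullback_tensor[OF continuous_dom_units rho_section[of \<xi>'] TB.E2.pullback_sect[OF continuous_dom_units, of \<eta>]] by simp
  next
    case span_zero
    show ?case using P.sect_zero by simp
  next
    case (span_add s t)
    then show ?case using P.sect_add[of s t] by simp
  next
    case (span_scale s a)
    then show ?case using P.sect_scale[of s a] by simp
  qed
  then have "continuous_map (gtop G) euclideanreal (\<lambda>y. hdist (\<T> y) (K y) (\<zeta> y))"
    using P.sect_norm[OF P.sect_minus[OF Ks]] by simp
  then have o: "openin (gtop G) {y \<in> gelems G. hdist (\<T> y) (K y) (\<zeta> y) \<in> {..<e}}" by (rule openin_continuous_map_preimage) simp
  have "\<exists>A. finite A \<and> A \<subseteq> csect \<rho> \<and> (\<forall>y\<in>gelems G. \<zeta> y \<in> hspan (\<T> y) (slots (sect_values A (rng y)) y))" using \<zeta>(1)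
  proof induction
    case span_zero
    show ?case by (rule exI[of _ "{}"]) (auto intro: hspan.zero)
  next
    case (span_base s)
    then obtain \<xi> \<eta> where "\<xi> \<in> csect \<rho>" "\<eta> \<in> csect \<pi>" "s = (\<lambda>y. ten y (moved y (\<xi> (rng y))) (\<eta> (src y)))"
      unfolding gens_def by blast
    then show ?case using TB.E2.sect_closed dom_unit
      by (intro exI[of _ "{\<xi>}"]) (auto intro!: hspan.base simp: slots_def topspace_unit_space)
  next
    case (span_add s t)
    then obtain A A' where *: "finite A" "A \<subseteq> csect \<rho>" "\<forall>y\<in>gelems G. s y \<in> hspan (\<T> y) (slots (sect_values A (rng y)) y)"
      "finite A'" "A' \<subseteq> csect \<rho>" "\<forall>y\<in>gelems G. t y \<in> hspan (\<T> y) (slots (sect_values A' (rng y)) y)" by auto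
    have "slots (sect_values A (rng y)) y \<subseteq> slots (sect_values (A \<union> A') (rng y)) y"
      "slots (sect_values A' (rng y)) y \<subseteq> slots (sect_values (A \<union> A') (rng y)) y" for y by (auto simp: slots_def)
    then show ?case using * hspan_mono by (intro exI[of _ "A \<union> A'"] conjI ballI hspan.add) (simp, simp, blast, blast)
  next
    case (span_scale s a)
    then obtain A where "finite A" "A \<subseteq> csect \<rho>" "\<forall>y\<in>gelems G. s y \<in> hspan (\<T> y) (slots (sect_values A (rng y)) y)" by auto
    then show ?case by (intro exI[of _ A]) (simp add: hspan.scale)
  qed
  then obtain A where "finite A" "A \<subseteq> csect \<rho>" "\<forall>y\<in>gelems G. \<zeta> y \<in> hspan (\<T> y) (slots (sect_values A (rng y)) y)" by blast
  then show ?thesis using o s(2) \<zeta>(2) x by (intro exI[of _ A] exI[of _ "{y \<in> gelems G. hdist (\<T> y) (K y) (\<zeta> y) \<in> {..<e}}"]) auto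
qed

lemma compact_slots:
  assumes K: "K \<in> Tau.\<F>" and C: "compactin (gtop G) C" and e: "0 < e"
  shows "\<exists>A. finite A \<and> A \<subseteq> csect \<rho> \<and> (\<forall>y\<in>C. \<exists>t\<in>hspan (\<T> y) (slots (sect_values A (rng y)) y). hdist (\<T> y) (K y) t < e)"
proof -
  define good where "good A y \<longleftrightarrow> (\<exists>t\<in>hspan (\<T> y) (slots (sect_values A (rng y)) y). hdist (\<T> y) (K y) t < e)" for A y
  have mono: "good A' y" if "good A y" "A \<subseteq> A'" for A A' y
  proof -
    have "slots (sect_values A (rng y)) y \<subseteq> slots (sect_values A' (rng y)) y" using that(2) by (auto simp: slots_def)
    from hspan_mono[OF this] show ?thesis using that(1) unfolding good_def by blast
  qed
  have "\<forall>x\<in>C. \<exists>A U. finite A \<and> A \<subseteq> csect \<rho> \<and> openin (gtop G) U \<and> x \<in> U \<and> (\<forall>y\<in>U. good A y)"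
    using local_slots[OF K _ e] compactin_subset_topspace[OF C] unfolding good_def by blast
  then obtain A U where AU: "\<And>x. x \<in> C \<Longrightarrow> finite (A x)" "\<And>x. x \<in> C \<Longrightarrow> A x \<subseteq> csect \<rho>" "\<And>x. x \<in> C \<Longrightarrow> openin (gtop G) (U x)"
    "\<And>x. x \<in> C \<Longrightarrow> x \<in> U x" "\<And>x y. \<lbrakk>x \<in> C; y \<in> U x\<rbrakk> \<Longrightarrow> good (A x) y" by metis
  have "C \<subseteq> \<Union>(U ` C)" using AU(4) by blast
  then obtain \<U> where "finite \<U>" "\<U> \<subseteq> U ` C" "C \<subseteq> \<Union>\<U>" using C AU(3) unfolding compactin_def by (auto dest!: spec[of _ "U ` C"])
  then obtain D where D: "D \<subseteq> C" "finite D" "C \<subseteq> \<Union>(U ` D)" using finite_subset_image[of \<U> U C] by blast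
  have "good (\<Union>(A ` D)) y" if y: "y \<in> C" for y
  proof -
    obtain x where x: "x \<in> D" "y \<in> U x" using D(3) y by blast
    have "x \<in> C" using x D(1) by blast
    then show ?thesis using x by (intro mono[OF AU(5)[of x y]]) auto
  qed
  moreover have "finite (\<Union>(A ` D))" "\<Union>(A ` D) \<subseteq> csect \<rho>" using D AU(1,2) by (blast, blast)
  ultimately show ?thesis unfolding good_def by blast
qed

lemma section_span_ind: "\<lbrakk>S \<subseteq> Tau.\<F>; f \<in> section_span \<T> S\<rbrakk> \<Longrightarrow> f \<in> Tau.\<F>"
  by (rotate_tac 1, erule section_span.induct) (use Tau.ind_zero Tau.ind_add Tau.ind_scale in auto)

definition twists :: "('g \<Rightarrow> (nat \<Rightarrow> ('v \<times> 'w) \<Rightarrow>\<^sub>0 complex) set) set" where "twists = {twist \<xi> f | \<xi> f. \<xi> \<in> csect \<rho> \<and> f \<in> Pi.\<F>}"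

lemma twists_ind: "twists \<subseteq> Tau.\<F>" using twist_ind by (auto simp: twists_def)

text \<open>Projection of \<open>K\<close>, over \<open>G\<^sup>u\<close>, onto the slots of a finite orthonormal set of values at \<open>u\<close>:
  the component along \<open>e = \<xi> u\<close> is the twist by \<open>\<xi>\<close> of the contraction of \<open>K\<close> by \<open>\<xi>\<close>.\<close>

lemma slot_projection:
  assumes K: "K \<in> Tau.\<F>" and u: "u \<in> units G"
    and E: "finite E" "E \<subseteq> sect_values (csect \<rho>) u" "orthonormal (fib \<rho> u) E"
  shows "\<exists>K'\<in>section_span \<T> twists. (\<forall>x\<in>range_fiber G u. K' x \<in> hspan (\<T> x) (slots E x) \<and>
       (\<forall>s\<in>slots E x. hinner (\<T> x) (hminus (\<T> x) (K x) (K' x)) s = 0)) \<and>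
    (\<forall>x\<in>gelems G. K x = hzero (\<T> x) \<longrightarrow> K' x = hzero (\<T> x))"
  using E
proof (induction E)
  case empty
  show ?case by (rule bexI[OF _ section_span.span_zero]) (auto simp: slots_def intro: hspan.zero)
next
  case (insert b E)
  have on: "orthonormal (fib \<rho> u) E" using insert.prems(2) by (simp add: orthonormal_def)
  with insert obtain K' where K': "K' \<in> section_span \<T> twists" "\<And>x. x \<in> range_fiber G u \<Longrightarrow> K' x \<in> hspan (\<T> x) (slots E x)"
    "\<And>x s. \<lbrakk>x \<in> range_fiber G u; s \<in> slots E x\<rbrakk> \<Longrightarrow> hinner (\<T> x) (hminus (\<T> x) (K x) (K' x)) s = 0"
    "\<And>x. \<lbrakk>x \<in> gelems G; K x = hzero (\<T> x)\<rbrakk> \<Longrightarrow> K' x = hzero (\<T> x)" by auto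
  obtain \<xi> where \<xi>: "\<xi> \<in> csect \<rho>" "\<xi> u = b" using insert.prems(1) by auto
  obtain f where f: "f \<in> Pi.\<F>" "\<And>x w. \<lbrakk>x \<in> gelems G; w \<in> hcarrier (W x)\<rbrakk> \<Longrightarrow>
     hinner (W x) (f x) w = hinner (\<T> x) (K x) (ten x (moved x (\<xi> (rng x))) w)"
    "\<And>x. \<lbrakk>x \<in> gelems G; K x = hzero (\<T> x)\<rbrakk> \<Longrightarrow> f x = hzero (W x)"
    using contraction[OF K \<xi>(1)] by blast
  let ?t = "twist \<xi> f"
  have t: "?t \<in> twists" using \<xi>(1) f(1) by (auto simp: twists_def)
  have Ec: "E \<subseteq> hcarrier (fib \<rho> u)" "b \<in> hcarrier (fib \<rho> u)" using insert.prems(1) rho_sect_closed u by auto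
  have K'i: "K' \<in> Tau.\<F>" by (rule section_span_ind[OF twists_ind K'(1)])
  show ?case
  proof (intro bexI[of _ "\<lambda>x. hadd (\<T> x) (K' x) (?t x)"] conjI ballI impI)
    show "(\<lambda>x. hadd (\<T> x) (K' x) (?t x)) \<in> section_span \<T> twists" by (intro section_span.span_add section_span.span_base K' t)
  next
    fix x assume x: "x \<in> gelems G" and z: "K x = hzero (\<T> x)"
    interpret hp: hilbert_pair "R x" "W x" by (rule dom_pair[OF x])
    have "?t x = hzero (\<T> x)" unfolding twist_def f(3)[OF x z] fib_\<tau> by (rule hp.T.norm_eq_zero)
        (simp_all add: hp.tensor_vec_closed hp.tensor_norm rho_inv_closed[OF x rho_sect_closed[OF \<xi>(1) rng_unit[OF x]]] hp.W.zero_closed hp.W.norm_zero)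
    then show "hadd (\<T> x) (K' x) (?t x) = hzero (\<T> x)" using K'(4)[OF x z] hp.T.add_zero[OF hp.T.zero_closed] by (simp add: fib_\<tau>)
  next
    fix x assume xR: "x \<in> range_fiber G u"
    then have x: "x \<in> gelems G" "rng x = u" by (auto simp: range_fiber_def)
    interpret hp: hilbert_pair "R x" "W x" by (rule dom_pair[OF x(1)])
    have tx: "?t x = ten x (moved x b) (f x)" by (simp add: twist_def x \<xi>(2))
    have fx: "f x \<in> hcarrier (W x)" by (rule ind_closed[OF f(1) x(1)])
    have mc: "moved x v \<in> hcarrier (R x)" if "v \<in> hcarrier (fib \<rho> u)" for v using rho_inv_closed[OF x(1)] that x(2) by simp
    have mi: "hinner (R x) (moved x v) (moved x w) = hinner (fib \<rho> u) v w"
      if "v \<in> hcarrier (fib \<rho> u)" "w \<in> hcarrier (fib \<rho> u)" for v w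
      using rho_inv_inner[OF x(1)] that x(2) by simp
    have c: "K x \<in> hcarrier (\<T> x)" "K' x \<in> hcarrier (\<T> x)" "?t x \<in> hcarrier (\<T> x)"
      using ind_closed_\<tau>[OF _ x(1)] K K'i twist_ind[OF \<xi>(1) f(1)] by auto
    have "slots (insert b E) x = slots {b} x \<union> slots E x" by (auto simp: slots_def)
    moreover have "?t x \<in> slots {b} x" using fx by (auto simp: slots_def tx)
    moreover have "K' x \<in> hspan (\<T> x) (slots (insert b E) x)" by (rule subsetD[OF hspan_mono K'(2)[OF xR]]) (auto simp: slots_def)
    ultimately show "hadd (\<T> x) (K' x) (?t x) \<in> hspan (\<T> x) (slots (insert b E) x)" by (intro hspan.add[OF _ hspan.base]) simp_all
    fix s assume "s \<in> slots (insert b E) x"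
    then obtain v w where s: "s = ten x (moved x v) w" "v = b \<or> v \<in> E" "w \<in> hcarrier (W x)" by (auto simp: slots_def)
    have vc: "v \<in> hcarrier (fib \<rho> u)" using s(2) Ec by auto
    have sc: "s \<in> hcarrier (\<T> x)" unfolding s(1) fib_\<tau> by (rule hp.tensor_vec_closed[OF mc[OF vc] s(3)])
    have ts: "hinner (\<T> x) (?t x) s = hinner (fib \<rho> u) b v * hinner (W x) (f x) w"
      unfolding tx s(1) fib_\<tau> using mc Ec(2) vc fx s(3) by (simp add: hp.tensor_inner mi)
    have "hinner (\<T> x) (K x) s - hinner (\<T> x) (K' x) s - hinner (\<T> x) (?t x) s = 0"
    proof (cases "v = b")
      case True
      have "hinner (\<T> x) (K' x) s = cnj (hinner (\<T> x) s (K' x))" using hp.T.inner_commute[of "K' x" s] c sc by (simp add: fib_\<tau>)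
      also have "hinner (\<T> x) s (K' x) = 0" unfolding fib_\<tau>
      proof (rule hp.T.hspan_orthogonal)
        show "slots E x \<subseteq> hcarrier (tensor (R x) (W x))" using slots_closed[OF x(1), of E] Ec x(2) by (simp add: fib_\<tau>)
        show "s \<in> hcarrier (tensor (R x) (W x))" using sc by (simp add: fib_\<tau>)
        show "K' x \<in> hspan (tensor (R x) (W x)) (slots E x)" using K'(2)[OF xR] by (simp add: fib_\<tau>)
        fix s' assume "s' \<in> slots E x"
        then obtain v' w' where s': "s' = ten x (moved x v') w'" "v' \<in> E" "w' \<in> hcarrier (W x)" by (auto simp: slots_def)
        have "hinner (fib \<rho> u) b v' = 0" using insert.prems(2) insert.hyps(2) s'(2) by (auto simp: orthonormal_def)
        then show "hinner (tensor (R x) (W x)) s s' = 0"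
          unfolding s(1) s'(1) True using mc mi Ec s'(2,3) s(3) by (auto simp: hp.tensor_inner subset_iff)
      qed
      finally have "hinner (\<T> x) (K' x) s = 0" by simp
      moreover have "hinner (fib \<rho> u) b b = 1" using insert.prems(2) by (simp add: orthonormal_def)
      moreover have "hinner (W x) (f x) w = hinner (\<T> x) (K x) s"
        unfolding s(1) True using f(2)[OF x(1) s(3)] by (simp add: x(2) \<xi>(2))
      ultimately show ?thesis using ts True by simp
    next
      case False
      then have "s \<in> slots E x" using s by (auto simp: slots_def)
      from K'(3)[OF xR this] have "hinner (\<T> x) (K x) s - hinner (\<T> x) (K' x) s = 0"
        using c sc by (simp add: fib_\<tau> hp.T.inner_simps)
      moreover have "hinner (fib \<rho> u) b v = 0" using insert.prems(2) False s(2) by (auto simp: orthonormal_def)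
      ultimately show ?thesis unfolding ts by simp
    qed
    then show "hinner (\<T> x) (hminus (\<T> x) (K x) (hadd (\<T> x) (K' x) (?t x))) s = 0"
      using c sc by (simp add: fib_\<tau> hp.T.inner_simps hp.T.closed algebra_simps)
  qed
qed

text \<open>The projection is at least as close to \<open>K\<close>, pointwise over \<open>G\<^sup>u\<close>, as the local approximants,
  all of which take their values in the span of the slots.\<close>

lemma twists_dense:
  assumes K: "K \<in> Tau.\<F>" and u: "u \<in> units G" and e: "0 < e"
  shows "\<exists>K'\<in>section_span \<T> twists. hdist (target u) (Tau.sec K u) (Tau.sec K' u) < e"
proof -
  let ?R = "range_fiber G u"
  interpret R: hilbert_space "fib \<rho> u" by (rule fib_hilbert(1)[OF u])
  have Ke: "Tau.equivariant_on (gelems G) K" using K by (simp add: Tau.ind_functions_iff)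
  obtain C where C: "compactin (gtop G) C" "\<forall>x\<in>gelems G. K x \<noteq> hzero (\<T> x) \<longrightarrow> q x \<in> q ` C"
    using Ke unfolding Tau.equivariant_on_def by blast
  have CG: "C \<subseteq> gelems G" by (rule compactin_subset_topspace[OF C(1)])
  obtain d where d: "0 < d" and d_small: "\<forall>f\<in>Tau.fiber_functions u. (\<forall>x\<in>?R. f x \<noteq> hzero (\<T> x) \<longrightarrow> q x \<in> q ` C) \<longrightarrow>
    (\<forall>x\<in>?R \<inter> C. hnorm (\<T> x) (f x) \<le> d) \<longrightarrow> hnorm (Tau.big_prefiber u) f < e"
    using Tau.fiber_norm_small[OF u C(1) e] by blast
  obtain A where A: "finite A" "A \<subseteq> csect \<rho>" "\<And>y. y \<in> C \<Longrightarrow> \<exists>t\<in>hspan (\<T> y) (slots (sect_values A (rng y)) y).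
       hdist (\<T> y) (K y) t < d"
    using compact_slots[OF K C(1) d] by auto
  have "\<exists>E. finite E \<and> E \<subseteq> sect_values (csect \<rho>) u \<and> orthonormal (fib \<rho> u) E \<and> sect_values A u \<subseteq> hspan (fib \<rho> u) E"
  proof (rule R.gram_schmidt)
    show "finite (sect_values A u)" "sect_values A u \<subseteq> sect_values (csect \<rho>) u" using A by auto
    show "sect_values (csect \<rho>) u \<subseteq> hcarrier (fib \<rho> u)" using rho_sect_closed u by auto
    show "hzero (fib \<rho> u) \<in> sect_values (csect \<rho>) u" by (rule image_eqI[OF _ TB.E1.sect_zero]) simp
    fix v w a assume "v \<in> sect_values (csect \<rho>) u" "w \<in> sect_values (csect \<rho>) u"
    then obtain \<xi> \<eta> where "\<xi> \<in> csect \<rho>" "v = \<xi> u" "\<eta> \<in> csect \<rho>" "w = \<eta> u" by blast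
    then show "hadd (fib \<rho> u) v w \<in> sect_values (csect \<rho>) u" "hscale (fib \<rho> u) a v \<in> sect_values (csect \<rho>) u"
      by (auto intro: image_eqI[OF _ TB.E1.sect_add] image_eqI[OF _ TB.E1.sect_scale])
  qed
  then obtain E where E: "finite E" "E \<subseteq> sect_values (csect \<rho>) u" "orthonormal (fib \<rho> u) E" "sect_values A u \<subseteq> hspan (fib \<rho> u) E"
    by blast
  have Ec: "E \<subseteq> hcarrier (fib \<rho> u)" using E(2) rho_sect_closed u by auto
  obtain K' where K': "K' \<in> section_span \<T> twists" "\<And>x. x \<in> ?R \<Longrightarrow> K' x \<in> hspan (\<T> x) (slots E x)"
    "\<And>x s. \<lbrakk>x \<in> ?R; s \<in> slots E x\<rbrakk> \<Longrightarrow> hinner (\<T> x) (hminus (\<T> x) (K x) (K' x)) s = 0"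
    "\<And>x. \<lbrakk>x \<in> gelems G; K x = hzero (\<T> x)\<rbrakk> \<Longrightarrow> K' x = hzero (\<T> x)"
    using slot_projection[OF K u E(1-3)] by auto
  have K'i: "K' \<in> Tau.\<F>" by (rule section_span_ind[OF twists_ind K'(1)])
  define D where "D x = hminus (\<T> x) (K x) (K' x)" for x
  have Di: "D \<in> Tau.\<F>" unfolding D_def[abs_def] by (rule Tau.ind_minus[OF K K'i])
  have small: "hnorm (\<T> y) (D y) \<le> d" if y: "y \<in> C" "rng y = u" for y
  proof -
    have yG: "y \<in> gelems G" using y CG by blast
    then have yR: "y \<in> ?R" using y by (simp add: range_fiber_def)
    interpret T: hilbert_space "\<T> y" by (rule tau_hilbert[OF dom_unit[OF yG]])
    have sc: "slots E y \<subseteq> hcarrier (\<T> y)" using slots_closed[OF yG, of E] Ec y(2) by simp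
    obtain t where t: "t \<in> hspan (\<T> y) (slots (sect_values A u) y)" "hdist (\<T> y) (K y) t < d" using A(3)[OF y(1)] y(2) by auto
    have "slots (sect_values A u) y \<subseteq> hspan (\<T> y) (slots E y)" using slots_hspan[OF yG, of E] Ec E(4) y(2) by simp
    from hspan_minimal[OF this] have t': "t \<in> hspan (\<T> y) (slots E y)" using t(1) by blast
    let ?p = "hminus (\<T> y) t (K' y)"
    have p: "?p \<in> hspan (\<T> y) (slots E y)" by (rule T.hspan_minus[OF t' K'(2)[OF yR]])
    have c: "K y \<in> hcarrier (\<T> y)" "K' y \<in> hcarrier (\<T> y)" "t \<in> hcarrier (\<T> y)" "?p \<in> hcarrier (\<T> y)" "D y \<in> hcarrier (\<T> y)"
      using ind_closed_\<tau>[OF _ yG] K K'i Di T.hspan_closed[OF sc] t' p by auto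
    have "hinner (\<T> y) (D y) ?p = 0" using T.hspan_orthogonal[OF sc c(5) _ p] K'(3)[OF yR] by (simp add: D_def)
    then have "(hdist (\<T> y) (D y) ?p)\<^sup>2 = (hnorm (\<T> y) (D y))\<^sup>2 + (hnorm (\<T> y) ?p)\<^sup>2" using T.norm_minus_sq[OF c(5,4)] by simp
    moreover have "hdist (\<T> y) (D y) ?p = hdist (\<T> y) (K y) t"
      unfolding D_def by (rule T.norm_eqI) (use c(1-3) in \<open>simp add: T.inner_simps T.closed\<close>)
    ultimately have "(hnorm (\<T> y) (D y))\<^sup>2 \<le> (hdist (\<T> y) (K y) t)\<^sup>2" by simp
    then have "hnorm (\<T> y) (D y) \<le> hdist (\<T> y) (K y) t" using T.norm_nonneg c by (auto intro: power2_le_imp_le simp: T.closed)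
    then show ?thesis using t(2) by simp
  qed
  have Df: "restrict D ?R \<in> Tau.fiber_functions u" by (rule Tau.ind_restrict[OF u Di])
  have "q x \<in> q ` C" if x: "x \<in> ?R" "restrict D ?R x \<noteq> hzero (\<T> x)" for x
  proof (rule ccontr)
    have xG: "x \<in> gelems G" using x by (simp add: range_fiber_def)
    assume "q x \<notin> q ` C"
    then have "K x = hzero (\<T> x)" using C(2) xG by blast
    interpret T: hilbert_space "\<T> x" by (rule tau_hilbert[OF dom_unit[OF xG]])
    have "D x = hzero (\<T> x)" using K'(4)[OF xG \<open>K x = _\<close>] \<open>K x = _\<close> T.add_uminus[OF T.zero_closed] by (simp add: D_def hminus_def)
    then show False using x by simp
  qed
  moreover have "hnorm (\<T> x) (restrict D ?R x) \<le> d" if "x \<in> ?R \<inter> C" for x using small[of x] that by (simp add: range_fiber_def)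
  ultimately have "hnorm (Tau.big_prefiber u) (restrict D ?R) < e" using d_small Df by blast
  moreover have "hdist (target u) (Tau.sec K u) (Tau.sec K' u) = hnorm (Tau.big_prefiber u) (restrict D ?R)"
  proof -
    have "hminus (target u) (Tau.sec K u) (Tau.sec K' u) = Tau.sec D u"
      unfolding D_def[abs_def] by (rule Tau.sec_ops(4)[OF u K K'i, symmetric])
    moreover have "Tau.ip u (restrict D ?R) (restrict D ?R) = Tau.ip u D D" by (rule Tau.ind_inner_cong[OF u]) simp
    ultimately show ?thesis by (simp add: hnorm_def Tau.sec_inner[OF u Di Di] Tau.prefiber_simps)
  qed
  ultimately show ?thesis by (intro bexI[OF _ K'(1)]) simp
qed

end

lemma section_span_value: "\<zeta> \<in> section_span F S \<Longrightarrow> \<zeta> u \<in> hspan (F u) {s u | s. s \<in> S}"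
  by (induction rule: section_span.induct) (auto intro: hspan.intros)

lemma la_transport:
  assumes F: "hilbert_family B F" and F': "hilbert_family B F'"
    and T: "\<And>u. u \<in> topspace B \<Longrightarrow> inner_preserving (F u) (F' u) (T u)"
    and S: "S \<subseteq> (\<Pi> u\<in>topspace B. hcarrier (F u))" and \<xi>: "\<xi> \<in> (\<Pi> u\<in>topspace B. hcarrier (F u))"
    and 1: "\<And>s. s \<in> S \<Longrightarrow> \<exists>t\<in>S'. \<forall>u\<in>topspace B. t u = T u (s u)"
    and 2: "\<And>t. t \<in> S' \<Longrightarrow> \<exists>s\<in>S. \<forall>u\<in>topspace B. t u = T u (s u)"
  shows "locally_approximable B F S \<xi> \<longleftrightarrow> locally_approximable B F' S' (\<lambda>u. T u (\<xi> u))"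
proof -
  have n: "hdist (F' v) (T v (\<xi> v)) (t v) = hdist (F v) (\<xi> v) (s v)"
    if "s \<in> S" "\<forall>u\<in>topspace B. t u = T u (s u)" "openin B U" "v \<in> U" for s t U v
  proof -
    have v: "v \<in> topspace B" using that openin_subset by blast
    have "\<xi> v \<in> hcarrier (F v)" "s v \<in> hcarrier (F v)" using \<xi> S v that(1) by (auto simp: Pi_iff)
    from inner_preserving_norm[OF hilbert_family.semi[OF F v] hilbert_family.semi[OF F' v] T[OF v] this]
    show ?thesis using that(2) v by simp
  qed
  have eq: "(\<exists>\<eta>\<in>S. \<forall>v\<in>U. hdist (F v) (\<xi> v) (\<eta> v) < e)
    \<longleftrightarrow> (\<exists>\<eta>\<in>S'. \<forall>v\<in>U. hdist (F' v) (T v (\<xi> v)) (\<eta> v) < e)" if U: "openin B U" for U e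
  proof
    assume "\<exists>\<eta>\<in>S. \<forall>v\<in>U. hdist (F v) (\<xi> v) (\<eta> v) < e"
    then obtain s where s: "s \<in> S" "\<forall>v\<in>U. hdist (F v) (\<xi> v) (s v) < e" by blast
    obtain t where "t \<in> S'" "\<forall>u\<in>topspace B. t u = T u (s u)" using 1[OF s(1)] by blast
    then show "\<exists>\<eta>\<in>S'. \<forall>v\<in>U. hdist (F' v) (T v (\<xi> v)) (\<eta> v) < e" using n[OF s(1) _ U, of t] s(2) by (intro bexI[of _ t]) auto
  next
    assume "\<exists>\<eta>\<in>S'. \<forall>v\<in>U. hdist (F' v) (T v (\<xi> v)) (\<eta> v) < e"
    then obtain t where t: "t \<in> S'" "\<forall>v\<in>U. hdist (F' v) (T v (\<xi> v)) (t v) < e" by blast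
    obtain s where "s \<in> S" "\<forall>u\<in>topspace B. t u = T u (s u)" using 2[OF t(1)] by blast
    then show "\<exists>\<eta>\<in>S. \<forall>v\<in>U. hdist (F v) (\<xi> v) (\<eta> v) < e" using n[OF _ _ U, of s t] t(2) by (intro bexI[of _ s]) auto
  qed
  show ?thesis unfolding locally_approximable_def by (intro ball_cong all_cong imp_cong ex_cong1 conj_cong refl eq) assumption
qed

context rep_pair
begin

abbreviation "ind_\<pi> \<equiv> ind_rep G H \<mu> \<pi>"
abbreviation "ind_\<tau> \<equiv> ind_rep G H \<mu> \<tau>"
abbreviation "source_rep \<equiv> tensor_rep G \<rho> ind_\<pi>"
abbreviation "source u \<equiv> tensor (fib \<rho> u) (Pi.fiber_space u)"
abbreviation "elem u \<equiv> tensor_vec (fib \<rho> u) (Pi.fiber_space u)"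
abbreviation "indices \<equiv> csect \<rho> \<times> Pi.\<F>"
abbreviation "source_gen u \<equiv> (\<lambda>(\<xi>, f). elem u (\<xi> u) (Pi.sec f u))"
abbreviation "target_gen u \<equiv> (\<lambda>(\<xi>, f). Tau.sec (twist \<xi> f) u)"

lemma source_pair: "u \<in> units G \<Longrightarrow> hilbert_pair (fib \<rho> u) (Pi.fiber_space u)"
  by (simp add: hilbert_pair_def fib_hilbert Pi.fiber_space_hilbert)

lemma source_gen_closed: "\<lbrakk>u \<in> units G; i \<in> indices\<rbrakk> \<Longrightarrow> source_gen u i \<in> hcarrier (source u)"
  by (auto intro!: hilbert_pair.tensor_vec_closed[OF source_pair] rho_sect_closed Pi.sec_closed)

lemma target_gen_closed: "\<lbrakk>u \<in> units G; i \<in> indices\<rbrakk> \<Longrightarrow> target_gen u i \<in> hcarrier (target u)"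
  by (auto intro!: Tau.sec_closed twist_ind)

lemma source_total:
  assumes u: "u \<in> units G"
  shows "total (source u) (source_gen u ` indices)"
proof -
  interpret hp: hilbert_pair "fib \<rho> u" "Pi.fiber_space u" by (rule source_pair[OF u])
  have tu: "u \<in> topspace (unit_space G)" using u by (simp add: topspace_unit_space)
  have "total (source u) {elem u v w | v w. v \<in> sect_values (csect \<rho>) u \<and> w \<in> (\<lambda>f. Pi.sec f u) ` Pi.\<F>}"
  proof (rule hp.tensor_total_dense)
    show "sect_values (csect \<rho>) u \<subseteq> hcarrier (fib \<rho> u)" using rho_sect_closed u by auto
    show "(\<lambda>f. Pi.sec f u) ` Pi.\<F> \<subseteq> hcarrier (Pi.fiber_space u)" using Pi.sec_closed[OF u] by auto
    show "\<exists>a\<in>sect_values (csect \<rho>) u. hdist (fib \<rho> u) v a < e" if "v \<in> hcarrier (fib \<rho> u)" "0 < e" for v e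
      by (rule TB.E1.values_dense[OF tu that])
    show "\<exists>b\<in>(\<lambda>f. Pi.sec f u) ` Pi.\<F>. hdist (Pi.fiber_space u) w b < e" if w: "w \<in> hcarrier (Pi.fiber_space u)" "0 < e" for w e
      using Pi.sec_dense[OF u w] by auto
  qed
  then show ?thesis by (rule total_mono) force
qed

lemma target_total:
  assumes u: "u \<in> units G"
  shows "total (target u) (target_gen u ` indices)"
  unfolding total_def
proof (intro ballI allI impI)
  fix v and e :: real assume v: "v \<in> hcarrier (target u)" and e: "0 < e"
  interpret Z: hilbert_space "target u" by (rule Tau.fiber_space_hilbert[OF u])
  obtain K where K: "K \<in> Tau.\<F>" "hdist (target u) v (Tau.sec K u) < e / 2" using Tau.sec_dense[OF u v, of "e / 2"] e by auto
  obtain K' where K': "K' \<in> section_span \<T> twists" "hdist (target u) (Tau.sec K u) (Tau.sec K' u) < e / 2"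
    using twists_dense[OF K(1) u, of "e / 2"] e by auto
  obtain \<zeta> where \<zeta>: "\<zeta> \<in> section_span target (Tau.sec ` twists)" "\<zeta> u = Tau.sec K' u"
    using Tau.section_span_sec(2)[OF twists_ind K'(1)] u by blast
  have "Tau.sec K' u \<in> hspan (target u) {s u | s. s \<in> Tau.sec ` twists}" using section_span_value[OF \<zeta>(1), of u] \<zeta>(2) by simp
  moreover have "{s u | s. s \<in> Tau.sec ` twists} = target_gen u ` indices" by (force simp: twists_def)
  moreover have "hdist (target u) v (Tau.sec K' u) < e"
    using Z.norm_triangle[OF v, of "Tau.sec K' u" "Tau.sec K u"] Tau.sec_closed[OF u] K section_span_ind[OF twists_ind K'(1)] K'(2) by simp
  ultimately show "\<exists>s\<in>hspan (target u) (target_gen u ` indices). hdist (target u) v s < e" by auto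
qed

lemma fiber_unitary:
  assumes u: "u \<in> units G"
  shows "\<exists>T. unitary (source u) (target u) T \<and> (\<forall>\<xi>\<in>csect \<rho>. \<forall>f\<in>Pi.\<F>. T (elem u (\<xi> u) (Pi.sec f u)) = Tau.sec (twist \<xi> f) u)"
proof -
  interpret hp: hilbert_pair "fib \<rho> u" "Pi.fiber_space u" by (rule source_pair[OF u])
  have "hinner (source u) (source_gen u i) (source_gen u j) = hinner (target u) (target_gen u i) (target_gen u j)"
    if "i \<in> indices" "j \<in> indices" for i j
    using that u by (auto simp: hp.tensor_inner rho_sect_closed Pi.sec_closed Pi.sec_inner Tau.sec_inner twist_ind twist_gram)
  from unitary_of_gram[OF hp.hilbert_space_tensor Tau.fiber_space_hilbert[OF u] source_gen_closed[OF u] target_gen_closed[OF u] this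
      source_total[OF u] target_total[OF u]]
  obtain T where T: "unitary (source u) (target u) T" "\<And>i. i \<in> indices \<Longrightarrow> T (source_gen u i) = target_gen u i" by blast
  show ?thesis using T(1) T(2)[of "(\<xi>, f)" for \<xi> f] by (intro exI[of _ T]) auto
qed

lemma source_family: "hilbert_family (unit_space G) source"
  by (rule hilbert_family.intro) (simp add: topspace_unit_space hilbert_pair.hilbert_space_tensor[OF source_pair])

abbreviation "source_sections \<equiv> {(\<lambda>u. elem u (\<xi> u) (Pi.sec f u)) | \<xi> f. \<xi> \<in> csect \<rho> \<and> f \<in> Pi.\<F>}"

lemma source_csect_iff:
  assumes \<zeta>: "\<zeta> \<in> (\<Pi> u\<in>units G. hcarrier (source u))"
  shows "\<zeta> \<in> csect source_rep \<longleftrightarrow> locally_approximable (unit_space G) source (section_span source source_sections) \<zeta>"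
proof -
  let ?B = "unit_space G"
  interpret Y: hilbert_family ?B source by (rule source_family)
  note tu = topspace_unit_space
  define S where "S = {(\<lambda>u. elem u (\<xi> u) (\<eta> u)) | \<xi> \<eta>. \<xi> \<in> csect \<rho> \<and> \<eta> \<in> csect ind_\<pi>}"
  have csect: "\<zeta> \<in> csect source_rep \<longleftrightarrow> locally_approximable ?B source (section_span source S) \<zeta>"
    using \<zeta> by (simp add: tensor_rep_def generated_sections_def S_def ind_rep_def tu)
  have Sc: "S \<subseteq> (\<Pi> u\<in>topspace ?B. hcarrier (source u))" using rho_sect_closed unfolding S_def
    by (auto intro!: hilbert_pair.tensor_vec_closed[OF source_pair] simp: Pi.ind_csect_iff tu)
  have S0c: "source_sections \<subseteq> (\<Pi> u\<in>topspace ?B. hcarrier (source u))"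
    by (auto intro!: hilbert_pair.tensor_vec_closed[OF source_pair] rho_sect_closed Pi.sec_closed simp: tu)
  have \<zeta>': "\<zeta> \<in> (\<Pi> u\<in>topspace ?B. hcarrier (source u))" using \<zeta> by (simp add: tu)
  have sec: "Pi.sec f \<in> csect ind_\<pi>" if "f \<in> Pi.\<F>" for f unfolding Pi.ind_csect_iff
    using hilbert_family.la_self[OF Pi.fiber_family, of "Pi.sec f"] that Pi.sec_closed by (auto simp: tu)
  have S0S: "source_sections \<subseteq> S" using sec unfolding S_def by blast
  have "locally_approximable ?B source (section_span source source_sections) s" if s: "s \<in> S" for s
    unfolding locally_approximable_def
  proof (intro ballI allI impI)
    fix u and e :: real assume u: "u \<in> topspace ?B" and e: "0 < e"
    obtain \<xi> \<eta> where s: "s = (\<lambda>u. elem u (\<xi> u) (\<eta> u))" "\<xi> \<in> csect \<rho>" "\<eta> \<in> csect ind_\<pi>" using s unfolding S_def by blast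
    define M where "M = hnorm (fib \<rho> u) (\<xi> u) + 1"
    have M: "0 < M" unfolding M_def using semi_inner_space.norm_nonneg[OF TB.E1.semi[OF u] TB.E1.sect_closed[OF s(2) u]] by simp
    obtain U1 where U1: "openin ?B U1" "u \<in> U1" "\<And>v. v \<in> U1 \<Longrightarrow> dist (hnorm (fib \<rho> v) (\<xi> v)) (hnorm (fib \<rho> u) (\<xi> u)) < 1"
      using continuous_map_epsE[OF TB.E1.sect_norm[OF s(2)] u zero_less_one] by metis
    have la: "\<eta> \<in> (\<Pi> u\<in>units G. hcarrier (Pi.fiber_space u))" "locally_approximable ?B Pi.fiber_space (Pi.sec ` Pi.\<F>) \<eta>"
      using s(3) by (simp_all add: Pi.ind_csect_iff)
    have "0 < e / M" using e M by simp
    from la(2)[unfolded locally_approximable_def, rule_format, OF u this]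
    obtain U2 f where U2: "openin ?B U2" "u \<in> U2" "f \<in> Pi.\<F>" "\<forall>v\<in>U2. hdist (Pi.fiber_space v) (\<eta> v) (Pi.sec f v) < e / M" by blast
    have "hdist (source v) (s v) (elem v (\<xi> v) (Pi.sec f v)) < e" if v: "v \<in> U1 \<inter> U2" for v
    proof -
      have vu: "v \<in> units G" using openin_subset[OF U1(1)] v by (auto simp: tu)
      interpret hp: hilbert_pair "fib \<rho> v" "Pi.fiber_space v" by (rule source_pair[OF vu])
      note c = rho_sect_closed[OF s(2) vu] Pi.sec_closed[OF vu U2(3)]
      have \<eta>c: "\<eta> v \<in> hcarrier (Pi.fiber_space v)" using la(1) vu by auto
      have "hdist (source v) (s v) (elem v (\<xi> v) (Pi.sec f v))
          \<le> hnorm (fib \<rho> v) (\<xi> v) * hdist (Pi.fiber_space v) (\<eta> v) (Pi.sec f v)"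
        using hp.tensor_norm_diff[OF c(1) \<eta>c c] hp.V.norm_minus_self[OF c(1)] by (simp add: s(1))
      also have "\<dots> \<le> M * hdist (Pi.fiber_space v) (\<eta> v) (Pi.sec f v)"
        using U1(3)[of v] v hp.W.norm_nonneg[OF hp.W.minus_closed[OF \<eta>c c(2)]]
        by (intro mult_right_mono) (auto simp: M_def dist_real_def)
      also have "\<dots> < e" using U2(4) v M by (simp add: pos_less_divide_eq mult.commute)
      finally show ?thesis .
    qed
    then show "\<exists>U. openin ?B U \<and> u \<in> U \<and> (\<exists>\<eta>\<in>section_span source source_sections. \<forall>v\<in>U. hdist (source v) (s v) (\<eta> v) < e)"
      using U1 U2 s(2) by (intro exI[of _ "U1 \<inter> U2"] conjI bexI[of _ "\<lambda>u. elem u (\<xi> u) (Pi.sec f u)"] section_span.span_base) auto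
  qed
  moreover have "locally_approximable ?B source (section_span source S) s" if "s \<in> source_sections" for s
    by (rule Y.la_self[OF section_span.span_base]) (use that S0S S0c in blast)+
  ultimately show ?thesis unfolding csect using Y.la_span[OF S0c Sc _ \<zeta>'] Y.la_span[OF Sc S0c _ \<zeta>'] by blast
qed

lemma target_csect_iff:
  assumes \<eta>: "\<eta> \<in> (\<Pi> u\<in>units G. hcarrier (target u))"
  shows "\<eta> \<in> csect ind_\<tau> \<longleftrightarrow> locally_approximable (unit_space G) target (section_span target (Tau.sec ` twists)) \<eta>"
proof -
  let ?B = "unit_space G" and ?Z = target
  interpret Z: hilbert_family ?B ?Z by (rule Tau.fiber_family)
  note tu = topspace_unit_space
  have \<eta>': "\<eta> \<in> (\<Pi> u\<in>topspace ?B. hcarrier (?Z u))" using \<eta> by (simp add: tu)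
  have tc: "Tau.sec ` twists \<subseteq> (\<Pi> u\<in>topspace ?B. hcarrier (?Z u))" using twists_ind Tau.sec_closed by (auto simp: tu)
  have la: "locally_approximable ?B ?Z (section_span ?Z (Tau.sec ` twists)) (Tau.sec K)" if K: "K \<in> Tau.\<F>" for K
    unfolding locally_approximable_def
  proof (intro ballI allI impI)
    fix u and e :: real assume u: "u \<in> topspace ?B" and e: "0 < e"
    obtain K' where K': "K' \<in> section_span \<T> twists" "hdist (?Z u) (Tau.sec K u) (Tau.sec K' u) < e"
      using twists_dense[OF K _ e, of u] u by (auto simp: tu)
    obtain \<zeta> where \<zeta>: "\<zeta> \<in> section_span ?Z (Tau.sec ` twists)" "\<forall>u\<in>units G. \<zeta> u = Tau.sec K' u"
      using Tau.section_span_sec(2)[OF twists_ind K'(1)] by blast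
    have "openin ?B {v \<in> topspace ?B. hdist (?Z v) (Tau.sec K v) (Tau.sec K' v) \<in> {..<e}}"
      by (rule openin_continuous_map_preimage[OF Tau.sec_norm_continuous[OF K section_span_ind[OF twists_ind K'(1)]]]) simp
    then show "\<exists>U. openin ?B U \<and> u \<in> U \<and> (\<exists>\<eta>\<in>section_span ?Z (Tau.sec ` twists). \<forall>v\<in>U. hdist (?Z v) (Tau.sec K v) (\<eta> v) < e)"
      using u K'(2) \<zeta>
      by (intro exI[of _ "{v \<in> topspace ?B. hdist (?Z v) (Tau.sec K v) (Tau.sec K' v) \<in> {..<e}}"] conjI bexI[of _ \<zeta>]) (auto simp: tu)
  qed
  have "locally_approximable ?B ?Z (Tau.sec ` Tau.\<F>) \<eta> \<longleftrightarrow> locally_approximable ?B ?Z (section_span ?Z (Tau.sec ` twists)) \<eta>"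
  proof
    assume "locally_approximable ?B ?Z (Tau.sec ` Tau.\<F>) \<eta>"
    then show "locally_approximable ?B ?Z (section_span ?Z (Tau.sec ` twists)) \<eta>"
      by (rule Z.la_trans[OF \<eta>' _ Z.section_span_closed[OF tc]]) (use la Tau.sec_closed in \<open>auto simp: tu\<close>)
  next
    assume "locally_approximable ?B ?Z (section_span ?Z (Tau.sec ` twists)) \<eta>"
    then show "locally_approximable ?B ?Z (Tau.sec ` Tau.\<F>) \<eta>"
      by (rule Z.la_subst) (use Tau.section_span_sec(1)[OF twists_ind] in \<open>fastforce simp: tu\<close>)
  qed
  then show ?thesis using \<eta> by (simp add: Tau.ind_csect_iff)
qed

lemma moved_translate:
  assumes x: "x \<in> gelems G" and y: "y \<in> gelems G" "rng y = rng x" and v: "v \<in> hcarrier (R x)"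
  shows "moved (ldiv x y) v = moved y (act \<rho> x v)"
proof -
  have "inv (ldiv x y) = ldiv y x" using inv_mul_distrib[OF inv_closed[OF x] y(1)] x y by (simp add: dom_inv inv_inv)
  then show ?thesis using rho_mul[of "inv y" x v] x y v by (simp add: inv_closed dom_inv)
qed

lemma twist_translate:
  assumes \<xi>: "\<xi> \<in> csect \<rho>" "\<eta> \<in> csect \<rho>" and f: "f \<in> Pi.\<F>" "g \<in> Pi.\<F>" and x: "x \<in> gelems G"
  shows "Tau.ip (rng x) (Tau.translate x (res (src x) (twist \<xi> f))) (res (rng x) (twist \<eta> g))
    = hinner (fib \<rho> (rng x)) (act \<rho> x (\<xi> (src x))) (\<eta> (rng x)) * Pi.ip (rng x) (Pi.translate x (res (src x) f)) (res (rng x) g)"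
proof (rule ind_inner_scaled[OF rng_unit[OF x]])
  fix y assume yR: "y \<in> range_fiber G (rng x)"
  then have y: "y \<in> gelems G" "rng y = rng x" by (auto simp: range_fiber_def)
  let ?z = "ldiv x y"
  note z = Pi.inv_mul_in[OF x y(1) y(2)[symmetric]]
  interpret hp: hilbert_pair "R y" "W y" by (rule dom_pair[OF y(1)])
  have xi: "\<xi> (src x) \<in> hcarrier (R x)" "\<eta> (rng x) \<in> hcarrier (fib \<rho> (rng x))" using rho_sect_closed \<xi> dom_unit rng_unit x by auto
  have "twist \<xi> f ?z = ten y (moved y (act \<rho> x (\<xi> (src x)))) (f ?z)" by (simp add: twist_def z moved_translate[OF x y xi(1)])
  moreover have "twist \<eta> g y = ten y (moved y (\<eta> (rng x))) (g y)" by (simp add: twist_def y)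
  moreover have "f ?z \<in> hcarrier (W y)" "g y \<in> hcarrier (W y)" using ind_closed f z y by (metis, metis)
  moreover have "moved y (act \<rho> x (\<xi> (src x))) \<in> hcarrier (R y)" "moved y (\<eta> (rng x)) \<in> hcarrier (R y)"
    "hinner (R y) (moved y (act \<rho> x (\<xi> (src x)))) (moved y (\<eta> (rng x)))
      = hinner (fib \<rho> (rng x)) (act \<rho> x (\<xi> (src x))) (\<eta> (rng x))"
    using rho_inv_closed[OF y(1)] rho_inv_inner[OF y(1)] rho_closed[OF x xi(1)] xi(2) y(2) by simp_all
  ultimately have "hinner (\<T> y) (twist \<xi> f ?z) (twist \<eta> g y)
      = hinner (fib \<rho> (rng x)) (act \<rho> x (\<xi> (src x))) (\<eta> (rng x)) * hinner (W y) (f ?z) (g y)"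
    by (simp add: fib_\<tau> hp.tensor_inner)
  then show "hinner (\<T> y) (Tau.translate x (res (src x) (twist \<xi> f)) y) (res (rng x) (twist \<eta> g) y)
    = hinner (fib \<rho> (rng x)) (act \<rho> x (\<xi> (src x))) (\<eta> (rng x))
      * hinner (W y) (Pi.translate x (res (src x) f) y) (res (rng x) g y)"
    using yR z by (simp add: Tau.translate_def Pi.translate_def range_fiber_def)
qed

lemma unitary_intertwines:
  assumes T: "\<And>u. u \<in> units G \<Longrightarrow> unitary (source u) (target u) (T u)"
    and gen: "\<And>u \<xi> f. \<lbrakk>u \<in> units G; \<xi> \<in> csect \<rho>; f \<in> Pi.\<F>\<rbrakk> \<Longrightarrow> T u (elem u (\<xi> u) (Pi.sec f u)) = Tau.sec (twist \<xi> f) u"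
    and x: "x \<in> gelems G" and v: "v \<in> hcarrier (source (src x))"
  shows "T (rng x) (act source_rep x v) = act ind_\<tau> x (T (src x) v)"
proof -
  let ?d = "src x" and ?r = "rng x"
  have u: "?d \<in> units G" "?r \<in> units G" using x by (auto simp: dom_unit rng_unit)
  interpret d: hilbert_pair "fib \<rho> ?d" "Pi.fiber_space ?d" by (rule source_pair[OF u(1)])
  interpret r: hilbert_pair "fib \<rho> ?r" "Pi.fiber_space ?r" by (rule source_pair[OF u(2)])
  interpret Z: hilbert_space "target ?r" by (rule Tau.fiber_space_hilbert[OF u(2)])
  note top = tensor_op_isometry[OF d.V.hilbert_space_axioms d.W.hilbert_space_axioms r.V.hilbert_space_axioms r.W.hilbert_space_axioms
      rho_preserving[OF x] Pi.ind_act(1)[OF x]]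
  have act: "act source_rep x = tensor_op (fib \<rho> ?r) (Pi.fiber_space ?r) (act \<rho> x) (act ind_\<pi> x)"
    by (simp add: tensor_rep_def ind_rep_def)
  have ipT: "inner_preserving (source u) (target u) (T u)" if "u \<in> units G" for u
    by (rule unitary_inner_preserving[OF T[OF that]])
  have L: "inner_preserving (source ?d) (target ?r) (\<lambda>v. T ?r (act source_rep x v))"
    using top(1) ipT[OF u(2)] unfolding inner_preserving_def act by auto
  have R: "inner_preserving (source ?d) (target ?r) (\<lambda>v. act ind_\<tau> x (T ?d v))"
    using Tau.ind_act(1)[OF x] ipT[OF u(1)] unfolding inner_preserving_def by auto
  show ?thesis
  proof (rule inner_preserving_eq[OF hilbert_imp_semi_inner[OF d.hilbert_space_tensor] Z.hilbert_space_axioms L R source_total[OF u(1)] _ _ v])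
    show "source_gen ?d ` indices \<subseteq> hcarrier (source ?d)" using source_gen_closed[OF u(1)] by blast
    fix s assume "s \<in> source_gen ?d ` indices"
    then obtain \<xi> f where s: "\<xi> \<in> csect \<rho>" "f \<in> Pi.\<F>" "s = elem ?d (\<xi> ?d) (Pi.sec f ?d)" by auto
    have sc: "s \<in> hcarrier (source ?d)" using source_gen_closed[OF u(1), of "(\<xi>, f)"] s by simp
    note cl = rho_sect_closed[OF s(1) u(1)] Pi.sec_closed[OF u(1) s(2)]
    have ac: "act ind_\<pi> x (Pi.sec f ?d) \<in> hcarrier (Pi.fiber_space ?r)"
      using Pi.ind_act(1)[OF x] cl(2) by (simp add: inner_preserving_def)
    have as: "act source_rep x s = elem ?r (act \<rho> x (\<xi> ?d)) (act ind_\<pi> x (Pi.sec f ?d))"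
      unfolding act s(3) by (rule top(2)[OF cl])
    have asc: "act source_rep x s \<in> hcarrier (source ?r)" unfolding as by (rule r.tensor_vec_closed[OF rho_closed[OF x cl(1)] ac])
    show "T ?r (act source_rep x s) = act ind_\<tau> x (T ?d s)"
    proof (rule Z.eq_if_inner_total[OF target_total[OF u(2)]])
      show "target_gen ?r ` indices \<subseteq> hcarrier (target ?r)" using target_gen_closed[OF u(2)] by blast
      show "T ?r (act source_rep x s) \<in> hcarrier (target ?r)" "act ind_\<tau> x (T ?d s) \<in> hcarrier (target ?r)"
        using L R sc by (simp_all add: inner_preserving_def)
      fix t assume "t \<in> target_gen ?r ` indices"
      then obtain \<eta> g where t: "\<eta> \<in> csect \<rho>" "g \<in> Pi.\<F>" "t = Tau.sec (twist \<eta> g) ?r" by auto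
      note cr = rho_sect_closed[OF t(1) u(2)] Pi.sec_closed[OF u(2) t(2)]
      have "hinner (target ?r) (T ?r (act source_rep x s)) t
          = hinner (source ?r) (act source_rep x s) (elem ?r (\<eta> ?r) (Pi.sec g ?r))"
        unfolding t(3) gen[OF u(2) t(1,2), symmetric]
        using ipT[OF u(2)] asc r.tensor_vec_closed[OF cr] by (simp add: inner_preserving_def)
      also have "\<dots> = hinner (fib \<rho> ?r) (act \<rho> x (\<xi> ?d)) (\<eta> ?r)
          * hinner (Pi.fiber_space ?r) (act ind_\<pi> x (Pi.sec f ?d)) (Pi.sec g ?r)"
        unfolding as by (rule r.tensor_inner[OF rho_closed[OF x cl(1)] ac cr])
      also have "\<dots> = hinner (target ?r) (act ind_\<tau> x (T ?d s)) t" using gen[OF u(1) s(1,2)] s(3) t(3)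
        by (simp add: Pi.ind_act(2)[OF x s(2) t(2)] Tau.ind_act(2)[OF x twist_ind[OF s(1,2)] twist_ind[OF t(1,2)]] twist_translate[OF s(1) t(1) s(2) t(2) x])
      finally show "hinner (target ?r) (T ?r (act source_rep x s)) t = hinner (target ?r) (act ind_\<tau> x (T ?d s)) t" .
    qed
  qed
qed

lemma equivalent: "unitarily_equivalent G source_rep ind_\<tau>"
proof -
  have "\<forall>u\<in>units G. \<exists>T. unitary (source u) (target u) T \<and>
    (\<forall>\<xi>\<in>csect \<rho>. \<forall>f\<in>Pi.\<F>. T (elem u (\<xi> u) (Pi.sec f u)) = Tau.sec (twist \<xi> f) u)"
    using fiber_unitary by blast
  from bchoice[OF this] obtain T where T: "\<And>u. u \<in> units G \<Longrightarrow> unitary (source u) (target u) (T u)"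
    and gen: "\<And>u \<xi> f. \<lbrakk>u \<in> units G; \<xi> \<in> csect \<rho>; f \<in> Pi.\<F>\<rbrakk> \<Longrightarrow> T u (elem u (\<xi> u) (Pi.sec f u)) = Tau.sec (twist \<xi> f) u"
    by blast
  note tu = topspace_unit_space
  have fibs: "fib source_rep = source" "fib ind_\<tau> = target" by (simp_all add: tensor_rep_def[of G] ind_rep_def)
  have ip: "inner_preserving (source u) (target u) (T u)" if "u \<in> units G" for u by (rule unitary_inner_preserving[OF T[OF that]])
  note lin = inner_preserving_linear[OF hilbert_imp_semi_inner[OF hilbert_pair.hilbert_space_tensor[OF source_pair]] Tau.fiber_space_hilbert ip]
  have S0c: "source_sections \<subseteq> (\<Pi> u\<in>topspace (unit_space G). hcarrier (source u))"
    by (auto intro!: hilbert_pair.tensor_vec_closed[OF source_pair] rho_sect_closed Pi.sec_closed simp: tu)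
  interpret Y: hilbert_family "unit_space G" source by (rule source_family)
  note Sc = Y.section_span_closed[OF S0c]
  let ?R = "\<lambda>s t. \<forall>u\<in>units G. s u \<in> hcarrier (source u) \<and> t u = T u (s u)"
  have R: "?R (\<lambda>u. hzero (source u)) (\<lambda>u. hzero (target u))"
    "\<lbrakk>?R s t; ?R s' t'\<rbrakk> \<Longrightarrow> ?R (\<lambda>u. hadd (source u) (s u) (s' u)) (\<lambda>u. hadd (target u) (t u) (t' u))"
    "?R s t \<Longrightarrow> ?R (\<lambda>u. hscale (source u) a (s u)) (\<lambda>u. hscale (target u) a (t u))" for s t s' t' a
    using Y.fam_closed by (simp_all add: lin tu)
  have base: "?R (\<lambda>u. elem u (\<xi> u) (Pi.sec f u)) (Tau.sec (twist \<xi> f))" if "\<xi> \<in> csect \<rho>" "f \<in> Pi.\<F>" for \<xi> f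
    using that gen source_gen_closed[of _ "(\<xi>, f)"] by simp
  have 1: "\<exists>t\<in>section_span target (Tau.sec ` twists). ?R s t" if "s \<in> section_span source source_sections" for s using that
  proof (rule section_span_rel[where R = ?R])
    fix s assume "s \<in> source_sections"
    then obtain \<xi> f where s: "\<xi> \<in> csect \<rho>" "f \<in> Pi.\<F>" "s = (\<lambda>u. elem u (\<xi> u) (Pi.sec f u))" by blast
    show "\<exists>t\<in>section_span target (Tau.sec ` twists). ?R s t"
      by (rule bexI[of _ "Tau.sec (twist \<xi> f)"]) (use base s in \<open>auto simp: twists_def intro!: section_span.span_base imageI\<close>)
  qed (rule R; assumption)+
  have 2: "\<exists>s\<in>section_span source source_sections. ?R s t" if "t \<in> section_span target (Tau.sec ` twists)" for t using that
  proof (rule section_span_rel[where R = "\<lambda>t s. ?R s t"])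
    fix t assume "t \<in> Tau.sec ` twists"
    then obtain \<xi> f where t: "\<xi> \<in> csect \<rho>" "f \<in> Pi.\<F>" "t = Tau.sec (twist \<xi> f)" by (auto simp: twists_def)
    show "\<exists>s\<in>section_span source source_sections. ?R s t"
      by (rule bexI[of _ "\<lambda>u. elem u (\<xi> u) (Pi.sec f u)"]) (use base t in \<open>auto intro!: section_span.span_base\<close>)
  qed (rule R; assumption)+
  have one: "\<exists>t\<in>section_span target (Tau.sec ` twists). \<forall>u\<in>topspace (unit_space G). t u = T u (s u)"
    if "s \<in> section_span source source_sections" for s using 1[OF that] unfolding tu by blast
  have two: "\<exists>s\<in>section_span source source_sections. \<forall>u\<in>topspace (unit_space G). t u = T u (s u)"
    if "t \<in> section_span target (Tau.sec ` twists)" for t using 2[OF that] unfolding tu by blast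
  have sect: "\<zeta> \<in> csect source_rep \<longleftrightarrow> (\<lambda>u. T u (\<zeta> u)) \<in> csect ind_\<tau>" if \<zeta>: "\<zeta> \<in> (\<Pi> u\<in>units G. hcarrier (source u))" for \<zeta>
  proof -
    have T\<zeta>: "(\<lambda>u. T u (\<zeta> u)) \<in> (\<Pi> u\<in>units G. hcarrier (target u))" using \<zeta> ip by (auto simp: inner_preserving_def)
    show ?thesis unfolding source_csect_iff[OF \<zeta>] target_csect_iff[OF T\<zeta>]
      by (rule la_transport[OF source_family Tau.fiber_family _ Sc _ one two]) (use \<zeta> ip in \<open>simp_all add: tu\<close>)
  qed
  show ?thesis unfolding unitarily_equivalent_def fibs using T sect unitary_intertwines[OF T gen] by (intro exI[of _ T]) blast
qed

end

theorem theorem3p1: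
  fixes G :: "'g groupoid" and H :: "'g set"
    and \<Lambda> \<Lambda>\<^sub>H :: "'g \<Rightarrow> 'g measure" and \<mu> :: "'g \<Rightarrow> 'g set measure"
    and \<rho> :: "('g, 'v) grep" and \<pi> :: "('g, 'w) grep"
  assumes "lc_groupoid G" and "haar_system G \<Lambda>"
    and "closed_wide_subgroupoid G H" and "haar_system (sub_groupoid G H) \<Lambda>\<^sub>H"
    and "quot_measure_system G H \<mu>"
    and "unitary_rep G \<rho>" and "unitary_rep (sub_groupoid G H) \<pi>"
  shows "unitarily_equivalent G (tensor_rep G \<rho> (ind_rep G H \<mu> \<pi>))
    (ind_rep G H \<mu> (tensor_rep (sub_groupoid G H) (restrict_rep \<rho> H) \<pi>))"
proof -
  interpret rep_pair G H \<Lambda> \<Lambda>\<^sub>H \<mu> \<rho> \<pi>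
    using assms by (intro rep_pair.intro homogeneous_space.intro homogeneous_space_axioms.intro rep_pair_axioms.intro)
  show ?thesis by (rule equivalent)
qed

end
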